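(* Let $\Sigma \overset{q}{\rightarrow} G$ be a twist with $G$ a (locally compact) étale, Hausdorff, amenable groupoid. Let $H$ be an open subgroupoid of $G$. Then $$A_H = \{ f\in C_r^*(\Sigma;G) \colon \gamma(f) = 0 \text{ for all } \gamma \in \Sigma\setminus\Sigma_H \}$$ is equal to the canonical copy of $C_r^*(\Sigma_H;H)$ within $C_r^*(\Sigma;G)$.
   Context: **Twists.** A twist $\Sigma\overset{q}\to G$ over a locally compact Hausdorff étale groupoid $G$ is a central (topologically locally trivial) extension of topological groupoids $\mathbb T\times G^{(0)}\hookrightarrow\Sigma\overset{q}\twoheadrightarrow G$; $\mathbb T$ acts on $\Sigma$ with $\Sigma/\mathbb T=G$. Let $L=(\mathbb C\times\Sigma)/\!\sim$, where $(z_1,\gamma_1)\sim(z_2,\gamma_2)$ if $(z_1,\gamma_1)=(\overline\lambda z_2,\lambda\cdot\gamma_2)$ for some $\lambda\in\mathbb T$; this is a Fell line bundle over $G$ via $[z,\gamma]\mapsto q(\gamma)$. $C_c(\Sigma;G)$ is the $*$-algebra of compactly supported continuous sections of $L$ with $f*g(\gamma)=\sum_{\gamma=\alpha\beta}f(\alpha)g(\beta)$ and $f^*(\gamma)=\overline{f(\gamma^{-1})}$. $C_r^*(\Sigma;G)$ is the unique C$^*$-completion for which restriction $C_c(\Sigma;G)\to C_c(G^{(0)})$ extends to a faithful conditional expectation onto $C_0(G^{(0)})$. **Elements as functions.** Elements of $C_r^*(\Sigma;G)$ are viewed as continuous sections of $L$ over $G$ vanishing at infinity (the inclusion of $C_c(\Sigma;G)$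 into such sections extends injectively to $C_r^*(\Sigma;G)$). Each $\gamma\in\Sigma$ acts as a linear functional on $C_r^*(\Sigma;G)$: $\gamma(f)$ is the scalar $z$ with $f(q(\gamma))=[z,\gamma]$. So $f\in A_H$ means that the section $f$ vanishes off $H$. **Subtwists.** For $H\subseteq G$, $\Sigma_H=q^{-1}(H)$. For an open subgroupoid $H$, $\Sigma_H\to H$ is a twist and extension by zero $C_c(\Sigma_H;H)\hookrightarrow C_c(\Sigma;G)$ induces an embedding of $C_r^*(\Sigma_H;H)$ into $C_r^*(\Sigma;G)$; its image is the canonical copy of $C_r^*(\Sigma_H;H)$. **Amenability.** A function $h\colon G\to\mathbb C$ is of positive type if for all $x\in G^{(0)}$ and finite $F\subseteq G_x$ (elements of $G$ with source $x$), the matrix $[h(\eta\gamma^{-1})]_{\eta,\gamma\in F}$ is positive. $G$ is amenable if and only if there is a net of uniformly sup-bounded positive-type functions in $C_c(G)$ converging to $1$ uniformly on compact subsets of $G$. *)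

theory Defs
  imports "HOL-Analysis.Analysis"
begin

subsection \<open>Topological groupoids\<close>

text \<open>
  The arrows form the topological space \<open>gtop G\<close>, and the unit space is a subset of the arrows.
  The values of the operations outside \<open>arrows G\<close>, and of \<open>gmul\<close> on non-composable pairs, are
  irrelevant; a pair \<open>(\<gamma>, \<eta>)\<close> is composable if the source of \<open>\<gamma>\<close> is the range of \<open>\<eta>\<close>.
\<close>

record 'g grpd =
  gtop :: "'g topology"
  gsrc :: "'g \<Rightarrow> 'g"
  grng :: "'g \<Rightarrow> 'g"
  gmul :: "'g \<Rightarrow> 'g \<Rightarrow> 'g"
  ginv :: "'g \<Rightarrow> 'g"

definition arrows :: "'g grpd \<Rightarrow> 'g set" where
  "arrows G = topspace (gtop G)"

definition units :: "'g grpd \<Rightarrow> 'g set" where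
  "units G = gsrc G ` arrows G"

definition composable :: "'g grpd \<Rightarrow> ('g \<times> 'g) set" where
  "composable G = {(\<gamma>, \<eta>). \<gamma> \<in> arrows G \<and> \<eta> \<in> arrows G \<and> gsrc G \<gamma> = grng G \<eta>}"

locale groupoid =
  fixes G :: "'g grpd"
  assumes src_closed: "\<gamma> \<in> arrows G \<Longrightarrow> gsrc G \<gamma> \<in> arrows G"
    and rng_closed: "\<gamma> \<in> arrows G \<Longrightarrow> grng G \<gamma> \<in> arrows G"
    and src_src: "\<gamma> \<in> arrows G \<Longrightarrow> gsrc G (gsrc G \<gamma>) = gsrc G \<gamma>"
    and rng_src: "\<gamma> \<in> arrows G \<Longrightarrow> grng G (gsrc G \<gamma>) = gsrc G \<gamma>"
    and src_rng: "\<gamma> \<in> arrows G \<Longrightarrow> gsrc G (grng G \<gamma>) = grng G \<gamma>"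
    and rng_rng: "\<gamma> \<in> arrows G \<Longrightarrow> grng G (grng G \<gamma>) = grng G \<gamma>"
    and mul_closed: "(\<gamma>, \<eta>) \<in> composable G \<Longrightarrow> gmul G \<gamma> \<eta> \<in> arrows G"
    and src_mul: "(\<gamma>, \<eta>) \<in> composable G \<Longrightarrow> gsrc G (gmul G \<gamma> \<eta>) = gsrc G \<eta>"
    and rng_mul: "(\<gamma>, \<eta>) \<in> composable G \<Longrightarrow> grng G (gmul G \<gamma> \<eta>) = grng G \<gamma>"
    and mul_assoc: "(\<gamma>, \<eta>) \<in> composable G \<Longrightarrow> (\<eta>, \<theta>) \<in> composable G \<Longrightarrow>
          gmul G (gmul G \<gamma> \<eta>) \<theta> = gmul G \<gamma> (gmul G \<eta> \<theta>)"
    and mul_src: "\<gamma> \<in> arrows G \<Longrightarrow> gmul G \<gamma> (gsrc G \<gamma>) = \<gamma>"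
    and mul_rng: "\<gamma> \<in> arrows G \<Longrightarrow> gmul G (grng G \<gamma>) \<gamma> = \<gamma>"
    and inv_closed: "\<gamma> \<in> arrows G \<Longrightarrow> ginv G \<gamma> \<in> arrows G"
    and src_inv: "\<gamma> \<in> arrows G \<Longrightarrow> gsrc G (ginv G \<gamma>) = grng G \<gamma>"
    and rng_inv: "\<gamma> \<in> arrows G \<Longrightarrow> grng G (ginv G \<gamma>) = gsrc G \<gamma>"
    and inv_mul: "\<gamma> \<in> arrows G \<Longrightarrow> gmul G (ginv G \<gamma>) \<gamma> = gsrc G \<gamma>"
    and mul_inv: "\<gamma> \<in> arrows G \<Longrightarrow> gmul G \<gamma> (ginv G \<gamma>) = grng G \<gamma>"

locale topological_groupoid = groupoid +
  assumes continuous_src: "continuous_map (gtop G) (gtop G) (gsrc G)"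
    and continuous_rng: "continuous_map (gtop G) (gtop G) (grng G)"
    and continuous_inv: "continuous_map (gtop G) (gtop G) (ginv G)"
    and continuous_mul:
      "continuous_map (subtopology (prod_topology (gtop G) (gtop G)) (composable G)) (gtop G)
         (\<lambda>(\<gamma>, \<eta>). gmul G \<gamma> \<eta>)"

definition local_homeomorphism :: "'a topology \<Rightarrow> 'b topology \<Rightarrow> ('a \<Rightarrow> 'b) \<Rightarrow> bool" where
  "local_homeomorphism X Y f \<longleftrightarrow>
     (\<forall>x \<in> topspace X. \<exists>U. openin X U \<and> x \<in> U \<and> openin Y (f ` U) \<and>
        homeomorphic_map (subtopology X U) (subtopology Y (f ` U)) f)"

locale lch_etale_groupoid = topological_groupoid +
  assumes locally_compact: "locally_compact_space (gtop G)"
    and Hausdorff: "Hausdorff_space (gtop G)"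
    and etale_src: "local_homeomorphism (gtop G) (subtopology (gtop G) (units G)) (gsrc G)"
    and etale_rng: "local_homeomorphism (gtop G) (subtopology (gtop G) (units G)) (grng G)"

definition open_subgroupoid :: "'g grpd \<Rightarrow> 'g set \<Rightarrow> bool" where
  "open_subgroupoid G H \<longleftrightarrow> openin (gtop G) H \<and> (\<forall>\<gamma> \<in> H. ginv G \<gamma> \<in> H) \<and>
     (\<forall>\<gamma> \<in> H. \<forall>\<eta> \<in> H. (\<gamma>, \<eta>) \<in> composable G \<longrightarrow> gmul G \<gamma> \<eta> \<in> H)"

definition restrict_grpd :: "'g grpd \<Rightarrow> 'g set \<Rightarrow> 'g grpd" where
  "restrict_grpd G X = G\<lparr>gtop := subtopology (gtop G) X\<rparr>"


subsection \<open>Amenability\<close>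

text \<open>A matrix is positive if it is positive semidefinite.\<close>

definition positive_type :: "'g grpd \<Rightarrow> ('g \<Rightarrow> complex) \<Rightarrow> bool" where
  "positive_type G h \<longleftrightarrow>
     (\<forall>x \<in> units G. \<forall>F. finite F \<and> F \<subseteq> {\<gamma> \<in> arrows G. gsrc G \<gamma> = x} \<longrightarrow>
        (\<forall>c :: 'g \<Rightarrow> complex.
           (\<Sum>\<eta>\<in>F. \<Sum>\<gamma>\<in>F. cnj (c \<eta>) * h (gmul G \<eta> (ginv G \<gamma>)) * c \<gamma>) \<in> \<real>\<^sub>\<ge>\<^sub>0))"

definition compactly_supported_functions :: "'g grpd \<Rightarrow> ('g \<Rightarrow> complex) set" where
  "compactly_supported_functions G =
     {h. continuous_map (gtop G) euclidean h \<and>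
         compactin (gtop G) (gtop G closure_of {\<gamma> \<in> arrows G. h \<gamma> \<noteq> 0})}"

text \<open>
  A net of functions is rendered by a proper filter on the set of functions (the image of the
  filter of tails of the index set); every proper filter arises from a net in this way.
\<close>

definition amenable :: "'g grpd \<Rightarrow> bool" where
  "amenable G \<longleftrightarrow>
     (\<exists>(F :: ('g \<Rightarrow> complex) filter) C. F \<noteq> bot \<and>
        (\<forall>\<^sub>F h in F. h \<in> compactly_supported_functions G \<and> positive_type G h \<and>
           (\<forall>\<gamma> \<in> arrows G. cmod (h \<gamma>) \<le> C)) \<and>
        (\<forall>K. compactin (gtop G) K \<longrightarrow> uniform_limit K (\<lambda>h. h) (\<lambda>_. 1) F))"


subsection \<open>Twists\<close>

text \<open>
  A twist consists of the groupoids \<open>base_grpd\<close> (\<open>G\<close>) and \<open>total_grpd\<close> (\<open>\<Sigma>\<close>), the inclusion \<open>inc\<close>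
  of the trivial circle bundle over the units of \<open>G\<close> into \<open>\<Sigma>\<close>, and the quotient map \<open>proj\<close> (\<open>q\<close>).
  The unit spaces of \<open>G\<close> and \<open>\<Sigma>\<close> are identified through \<open>\<lambda>x. inc E (1, x)\<close>.
\<close>

record ('g, 's) twist_data =
  base_grpd :: "'g grpd"
  total_grpd :: "'s grpd"
  inc :: "complex \<times> 'g \<Rightarrow> 's"
  proj :: "'s \<Rightarrow> 'g"

abbreviation circle :: "complex set" where
  "circle \<equiv> sphere 0 1"

locale twist =
  fixes E :: "('g, 's) twist_data"
  assumes base: "lch_etale_groupoid (base_grpd E)"
    and total: "topological_groupoid (total_grpd E)"
    and inc_continuous: "continuous_map
          (prod_topology (top_of_set circle) (subtopology (gtop (base_grpd E)) (units (base_grpd E))))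
          (gtop (total_grpd E)) (inc E)"
    and inc_inj: "inj_on (inc E) (circle \<times> units (base_grpd E))"
    and inc_src: "z \<in> circle \<Longrightarrow> x \<in> units (base_grpd E) \<Longrightarrow>
          gsrc (total_grpd E) (inc E (z, x)) = inc E (1, x)"
    and inc_rng: "z \<in> circle \<Longrightarrow> x \<in> units (base_grpd E) \<Longrightarrow>
          grng (total_grpd E) (inc E (z, x)) = inc E (1, x)"
    and inc_mul: "z \<in> circle \<Longrightarrow> w \<in> circle \<Longrightarrow> x \<in> units (base_grpd E) \<Longrightarrow>
          inc E (z * w, x) = gmul (total_grpd E) (inc E (z, x)) (inc E (w, x))"
    and proj_continuous: "continuous_map (gtop (total_grpd E)) (gtop (base_grpd E)) (proj E)"
    and proj_surj: "proj E ` arrows (total_grpd E) = arrows (base_grpd E)"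
    and proj_src: "\<sigma> \<in> arrows (total_grpd E) \<Longrightarrow>
          proj E (gsrc (total_grpd E) \<sigma>) = gsrc (base_grpd E) (proj E \<sigma>)"
    and proj_rng: "\<sigma> \<in> arrows (total_grpd E) \<Longrightarrow>
          proj E (grng (total_grpd E) \<sigma>) = grng (base_grpd E) (proj E \<sigma>)"
    and proj_mul: "(\<sigma>, \<tau>) \<in> composable (total_grpd E) \<Longrightarrow>
          proj E (gmul (total_grpd E) \<sigma> \<tau>) = gmul (base_grpd E) (proj E \<sigma>) (proj E \<tau>)"
    and proj_inc: "z \<in> circle \<Longrightarrow> x \<in> units (base_grpd E) \<Longrightarrow> proj E (inc E (z, x)) = x"
    and exact: "inc E ` (circle \<times> units (base_grpd E)) =
          {\<sigma> \<in> arrows (total_grpd E). proj E \<sigma> \<in> units (base_grpd E)}"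
    and central: "z \<in> circle \<Longrightarrow> \<sigma> \<in> arrows (total_grpd E) \<Longrightarrow>
          gmul (total_grpd E) (inc E (z, grng (base_grpd E) (proj E \<sigma>))) \<sigma> =
          gmul (total_grpd E) \<sigma> (inc E (z, gsrc (base_grpd E) (proj E \<sigma>)))"
    and locally_trivial: "\<alpha> \<in> arrows (base_grpd E) \<Longrightarrow>
          \<exists>U \<phi>. openin (gtop (base_grpd E)) U \<and> \<alpha> \<in> U \<and>
            continuous_map (subtopology (gtop (base_grpd E)) U) (gtop (total_grpd E)) \<phi> \<and>
            (\<forall>\<beta> \<in> U. proj E (\<phi> \<beta>) = \<beta>) \<and>
            homeomorphic_map
              (prod_topology (top_of_set circle) (subtopology (gtop (base_grpd E)) U))
              (subtopology (gtop (total_grpd E)) {\<sigma> \<in> arrows (total_grpd E). proj E \<sigma> \<in> U})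
              (\<lambda>(z, \<beta>). gmul (total_grpd E) (inc E (z, grng (base_grpd E) \<beta>)) (\<phi> \<beta>))"

definition circle_act :: "('g, 's) twist_data \<Rightarrow> complex \<Rightarrow> 's \<Rightarrow> 's" where
  "circle_act E z \<sigma> = gmul (total_grpd E) (inc E (z, grng (base_grpd E) (proj E \<sigma>))) \<sigma>"

definition preimage_arrows :: "('g, 's) twist_data \<Rightarrow> 'g set \<Rightarrow> 's set" where
  "preimage_arrows E H = {\<sigma> \<in> arrows (total_grpd E). proj E \<sigma> \<in> H}"

definition subtwist :: "('g, 's) twist_data \<Rightarrow> 'g set \<Rightarrow> ('g, 's) twist_data" where
  "subtwist E H = E\<lparr>base_grpd := restrict_grpd (base_grpd E) H,
                    total_grpd := restrict_grpd (total_grpd E) (preimage_arrows E H)\<rparr>"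


subsection \<open>The line bundle of a twist\<close>

definition line_rel :: "('g, 's) twist_data \<Rightarrow> ((complex \<times> 's) \<times> (complex \<times> 's)) set" where
  "line_rel E = {((z1, \<sigma>1), (z2, \<sigma>2)). \<sigma>1 \<in> arrows (total_grpd E) \<and> \<sigma>2 \<in> arrows (total_grpd E) \<and>
     (\<exists>\<mu> \<in> circle. z1 = cnj \<mu> * z2 \<and> \<sigma>1 = circle_act E \<mu> \<sigma>2)}"

definition line_class :: "('g, 's) twist_data \<Rightarrow> complex \<Rightarrow> 's \<Rightarrow> (complex \<times> 's) set" where
  "line_class E z \<sigma> = line_rel E `` {(z, \<sigma>)}"

definition line_bundle :: "('g, 's) twist_data \<Rightarrow> (complex \<times> 's) set set" where
  "line_bundle E = (UNIV \<times> arrows (total_grpd E)) // line_rel E"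

definition line_topology :: "('g, 's) twist_data \<Rightarrow> (complex \<times> 's) set topology" where
  "line_topology E = topology (\<lambda>W. W \<subseteq> line_bundle E \<and>
     openin (prod_topology euclidean (gtop (total_grpd E)))
       {(z, \<sigma>). \<sigma> \<in> arrows (total_grpd E) \<and> line_class E z \<sigma> \<in> W})"

lemma openin_line_topology:
  "openin (line_topology E) W \<longleftrightarrow> W \<subseteq> line_bundle E \<and>
     openin (prod_topology euclidean (gtop (total_grpd E)))
       {(z, \<sigma>). \<sigma> \<in> arrows (total_grpd E) \<and> line_class E z \<sigma> \<in> W}"
proof -
  let ?X = "prod_topology (euclidean :: complex topology) (gtop (total_grpd E))"
  let ?pre = "\<lambda>W. {(z, \<sigma>). \<sigma> \<in> arrows (total_grpd E) \<and> line_class E z \<sigma> \<in> W}"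
  have Int: "?pre (S \<inter> T) = ?pre S \<inter> ?pre T" for S T by auto
  have Un: "?pre (\<Union>K) = (\<Union>S\<in>K. ?pre S)" for K by auto
  have "istopology (\<lambda>W. W \<subseteq> line_bundle E \<and> openin ?X (?pre W))"
    unfolding istopology_def Int Un by (auto intro!: openin_Union)
  then show ?thesis
    unfolding line_topology_def by (simp add: topology_inverse')
qed

definition line_fibre :: "('g, 's) twist_data \<Rightarrow> 'g \<Rightarrow> (complex \<times> 's) set set" where
  "line_fibre E \<gamma> = {line_class E z \<sigma> | z \<sigma>. \<sigma> \<in> arrows (total_grpd E) \<and> proj E \<sigma> = \<gamma>}"

text \<open>The coordinate of a point of the fibre over \<open>q(\<sigma>)\<close> with respect to \<open>\<sigma>\<close>.\<close>

definition line_coord :: "('g, 's) twist_data \<Rightarrow> 's \<Rightarrow> (complex \<times> 's) set \<Rightarrow> complex" where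
  "line_coord E \<sigma> l = (THE z. l = line_class E z \<sigma>)"

text \<open>
  The Fell bundle operations are defined on representatives; for instance
  \<open>[z, \<sigma>] [w, \<tau>] = [z w, \<sigma>\<tau>]\<close> and \<open>[z, \<sigma>]\<^sup>* = [cnj z, \<sigma>\<^sup>-\<^sup>1]\<close>.
\<close>

definition line_zero :: "('g, 's) twist_data \<Rightarrow> 'g \<Rightarrow> (complex \<times> 's) set" where
  "line_zero E \<gamma> = (THE n. \<exists>\<sigma> \<in> arrows (total_grpd E). proj E \<sigma> = \<gamma> \<and> n = line_class E 0 \<sigma>)"

definition line_add ::
  "('g, 's) twist_data \<Rightarrow> (complex \<times> 's) set \<Rightarrow> (complex \<times> 's) set \<Rightarrow> (complex \<times> 's) set" where
  "line_add E l m = (THE n. \<exists>\<sigma> \<in> arrows (total_grpd E). \<exists>z w.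
     l = line_class E z \<sigma> \<and> m = line_class E w \<sigma> \<and> n = line_class E (z + w) \<sigma>)"

definition line_scale ::
  "('g, 's) twist_data \<Rightarrow> complex \<Rightarrow> (complex \<times> 's) set \<Rightarrow> (complex \<times> 's) set" where
  "line_scale E c l = (THE n. \<exists>\<sigma> \<in> arrows (total_grpd E). \<exists>z.
     l = line_class E z \<sigma> \<and> n = line_class E (c * z) \<sigma>)"

definition line_mul ::
  "('g, 's) twist_data \<Rightarrow> (complex \<times> 's) set \<Rightarrow> (complex \<times> 's) set \<Rightarrow> (complex \<times> 's) set" where
  "line_mul E l m = (THE n. \<exists>(\<sigma>, \<tau>) \<in> composable (total_grpd E). \<exists>z w.
     l = line_class E z \<sigma> \<and> m = line_class E w \<tau> \<and>
     n = line_class E (z * w) (gmul (total_grpd E) \<sigma> \<tau>))"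

definition line_star :: "('g, 's) twist_data \<Rightarrow> (complex \<times> 's) set \<Rightarrow> (complex \<times> 's) set" where
  "line_star E l = (THE n. \<exists>\<sigma> \<in> arrows (total_grpd E). \<exists>z.
     l = line_class E z \<sigma> \<and> n = line_class E (cnj z) (ginv (total_grpd E) \<sigma>))"

definition line_norm :: "('g, 's) twist_data \<Rightarrow> (complex \<times> 's) set \<Rightarrow> real" where
  "line_norm E l = (THE r. \<exists>\<sigma> \<in> arrows (total_grpd E). \<exists>z. l = line_class E z \<sigma> \<and> r = cmod z)"


subsection \<open>Sections and the convolution algebra\<close>

type_synonym ('g, 's) line_section = "'g \<Rightarrow> (complex \<times> 's) set"

definition continuous_sections :: "('g, 's) twist_data \<Rightarrow> ('g, 's) line_section set" where
  "continuous_sections E = {f \<in> (\<Pi>\<^sub>E \<gamma> \<in> arrows (base_grpd E). line_fibre E \<gamma>).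
     continuous_map (gtop (base_grpd E)) (line_topology E) f}"

definition Cc_sections :: "('g, 's) twist_data \<Rightarrow> ('g, 's) line_section set" where
  "Cc_sections E = {f \<in> continuous_sections E.
     compactin (gtop (base_grpd E))
       (gtop (base_grpd E) closure_of {\<gamma> \<in> arrows (base_grpd E). f \<gamma> \<noteq> line_zero E \<gamma>})}"

definition C0_sections :: "('g, 's) twist_data \<Rightarrow> ('g, 's) line_section set" where
  "C0_sections E = {f \<in> continuous_sections E.
     \<forall>\<epsilon> > 0. compactin (gtop (base_grpd E)) {\<gamma> \<in> arrows (base_grpd E). line_norm E (f \<gamma>) \<ge> \<epsilon>}}"

definition section_eval :: "('g, 's) twist_data \<Rightarrow> 's \<Rightarrow> ('g, 's) line_section \<Rightarrow> complex" where
  "section_eval E \<sigma> f = line_coord E \<sigma> (f (proj E \<sigma>))"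

definition section_add ::
  "('g, 's) twist_data \<Rightarrow> ('g, 's) line_section \<Rightarrow> ('g, 's) line_section \<Rightarrow> ('g, 's) line_section"
where
  "section_add E f g = (\<lambda>\<gamma> \<in> arrows (base_grpd E). line_add E (f \<gamma>) (g \<gamma>))"

definition section_scale ::
  "('g, 's) twist_data \<Rightarrow> complex \<Rightarrow> ('g, 's) line_section \<Rightarrow> ('g, 's) line_section" where
  "section_scale E c f = (\<lambda>\<gamma> \<in> arrows (base_grpd E). line_scale E c (f \<gamma>))"

definition section_star ::
  "('g, 's) twist_data \<Rightarrow> ('g, 's) line_section \<Rightarrow> ('g, 's) line_section" where
  "section_star E f = (\<lambda>\<gamma> \<in> arrows (base_grpd E). line_star E (f (ginv (base_grpd E) \<gamma>)))"

text \<open>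
  The sum of the products \<open>f(\<alpha>) g(\<beta>)\<close> over all factorisations \<open>\<gamma> = \<alpha>\<beta>\<close> is taken in the fibre over
  \<open>\<gamma>\<close>, computed in the coordinate of any \<open>\<sigma>\<close> above \<open>\<gamma>\<close>. For compactly supported sections only
  finitely many terms are nonzero, so that the \<open>infsum\<close> is a finite sum.
\<close>

definition section_conv ::
  "('g, 's) twist_data \<Rightarrow> ('g, 's) line_section \<Rightarrow> ('g, 's) line_section \<Rightarrow> ('g, 's) line_section"
where
  "section_conv E f g = (\<lambda>\<gamma> \<in> arrows (base_grpd E).
     THE n. \<exists>\<sigma> \<in> arrows (total_grpd E). proj E \<sigma> = \<gamma> \<and>
       n = line_class E
         (\<Sum>\<^sub>\<infinity>(\<alpha>, \<beta>) \<in> {(\<alpha>, \<beta>) \<in> composable (base_grpd E). gmul (base_grpd E) \<alpha> \<beta> = \<gamma>}.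
            line_coord E \<sigma> (line_mul E (f \<alpha>) (g \<beta>))) \<sigma>)"

text \<open>
  Agreeing with \<open>f\<close> on \<open>X\<close> and zero elsewhere. With \<open>X\<close> the unit space this is restriction to the
  unit space (viewed again as a section over \<open>G\<close>); for a section \<open>f\<close> of the subtwist over \<open>X\<close> it is
  extension by zero, because for \<open>\<sigma>\<close> above \<open>X\<close> the classes \<open>[z, \<sigma>]\<close> formed in the subtwist and in
  the twist are the same set.
\<close>

definition section_on ::
  "('g, 's) twist_data \<Rightarrow> 'g set \<Rightarrow> ('g, 's) line_section \<Rightarrow> ('g, 's) line_section" where
  "section_on E X f = (\<lambda>\<gamma> \<in> arrows (base_grpd E). if \<gamma> \<in> X then f \<gamma> else line_zero E \<gamma>)"


subsection \<open>C*-algebras and conditional expectations\<close>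

text \<open>C*-algebras need not be unital.\<close>

class cstar_algebra = real_normed_algebra + banach +
  fixes scaleC :: "complex \<Rightarrow> 'a \<Rightarrow> 'a"
    and star :: "'a \<Rightarrow> 'a"
  assumes scaleC_add_right: "scaleC c (x + y) = scaleC c x + scaleC c y"
    and scaleC_add_left: "scaleC (c + d) x = scaleC c x + scaleC d x"
    and scaleC_scaleC: "scaleC c (scaleC d x) = scaleC (c * d) x"
    and scaleC_of_real: "scaleC (complex_of_real r) x = r *\<^sub>R x"
    and norm_scaleC: "norm (scaleC c x) = cmod c * norm x"
    and mult_scaleC_left: "scaleC c x * y = scaleC c (x * y)"
    and mult_scaleC_right: "x * scaleC c y = scaleC c (x * y)"
    and star_star: "star (star x) = x"
    and star_add: "star (x + y) = star x + star y"
    and star_scaleC: "star (scaleC c x) = scaleC (cnj c) (star x)"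
    and star_mult: "star (x * y) = star y * star x"
    and cstar_identity: "norm (star x * x) = (norm x)\<^sup>2"

definition cstar_subalgebra :: "'a::cstar_algebra set \<Rightarrow> bool" where
  "cstar_subalgebra D \<longleftrightarrow> closed D \<and> 0 \<in> D \<and> (\<forall>x \<in> D. \<forall>y \<in> D. x + y \<in> D \<and> x * y \<in> D) \<and>
     (\<forall>c. \<forall>x \<in> D. scaleC c x \<in> D) \<and> (\<forall>x \<in> D. star x \<in> D)"

text \<open>The positive elements of a C*-algebra are those of the form \<open>star a * a\<close>.\<close>

definition conditional_expectation :: "'a::cstar_algebra set \<Rightarrow> ('a \<Rightarrow> 'a) \<Rightarrow> bool" where
  "conditional_expectation D P \<longleftrightarrow> cstar_subalgebra D \<and>
     (\<forall>a b. P (a + b) = P a + P b) \<and> (\<forall>c a. P (scaleC c a) = scaleC c (P a)) \<and>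
     range P = D \<and> (\<forall>d \<in> D. P d = d) \<and>
     (\<forall>a. norm (P a) \<le> norm a) \<and>
     (\<forall>a. \<exists>d \<in> D. P (star a * a) = star d * d) \<and>
     (\<forall>d \<in> D. \<forall>a. P (d * a) = d * P a \<and> P (a * d) = P a * d)"

definition faithful :: "('a::cstar_algebra \<Rightarrow> 'a) \<Rightarrow> bool" where
  "faithful P \<longleftrightarrow> (\<forall>a. P (star a * a) = 0 \<longrightarrow> a = 0)"


subsection \<open>The reduced C*-algebra of a twist\<close>

text \<open>
  A C*-completion of the convolution algebra is a C*-algebra (the type \<open>'a\<close>) together with an
  injective *-homomorphism of the convolution algebra onto a dense subalgebra.
\<close>

definition cstar_completion ::
  "('g, 's) twist_data \<Rightarrow> (('g, 's) line_section \<Rightarrow> 'a::cstar_algebra) \<Rightarrow> bool" where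
  "cstar_completion E j \<longleftrightarrow> inj_on j (Cc_sections E) \<and> closure (j ` Cc_sections E) = UNIV \<and>
     (\<forall>f \<in> Cc_sections E. \<forall>g \<in> Cc_sections E.
        j (section_add E f g) = j f + j g \<and> j (section_conv E f g) = j f * j g) \<and>
     (\<forall>c. \<forall>f \<in> Cc_sections E. j (section_scale E c f) = scaleC c (j f)) \<and>
     (\<forall>f \<in> Cc_sections E. j (section_star E f) = star (j f))"

text \<open>
  Compactly supported functions on the unit space are the sections in \<open>Cc_sections E\<close> vanishing off
  the units, \<open>h\<close> corresponding to \<open>x \<mapsto> [h(x), inc E (1, x)]\<close>. In any C*-completion their closure is
  the algebra of continuous functions on the unit space vanishing at infinity, because every C*-norm
  on the compactly supported continuous functions is the supremum norm.
\<close>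

definition unit_Cc_sections :: "('g, 's) twist_data \<Rightarrow> ('g, 's) line_section set" where
  "unit_Cc_sections E =
     {f \<in> Cc_sections E. \<forall>\<gamma> \<in> arrows (base_grpd E) - units (base_grpd E). f \<gamma> = line_zero E \<gamma>}"

text \<open>
  The reduced C*-algebra is determined, up to an isomorphism that is the identity on the convolution
  algebra, by the following property.
\<close>

definition reduced_completion ::
  "('g, 's) twist_data \<Rightarrow> (('g, 's) line_section \<Rightarrow> 'a::cstar_algebra) \<Rightarrow> bool" where
  "reduced_completion E j \<longleftrightarrow> cstar_completion E j \<and>
     (\<exists>P. conditional_expectation (closure (j ` unit_Cc_sections E)) P \<and> faithful P \<and>
        (\<forall>f \<in> Cc_sections E. P (j f) = j (section_on E (units (base_grpd E)) f)))"

text \<open>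
  Elements of the reduced C*-algebra as sections vanishing at infinity: the continuous extension of
  the inclusion of the compactly supported sections. Since \<open>|\<sigma>(f)|\<close> is the norm of \<open>f(q(\<sigma>))\<close>,
  uniform convergence of sections is uniform convergence of the functions \<open>\<sigma> \<mapsto> \<sigma>(f)\<close>.
\<close>

definition completion_section ::
  "('g, 's) twist_data \<Rightarrow> (('g, 's) line_section \<Rightarrow> 'a::cstar_algebra) \<Rightarrow> 'a \<Rightarrow>
     ('g, 's) line_section" where
  "completion_section E j a = (THE F. F \<in> C0_sections E \<and>
     (\<forall>u. (\<forall>n. u n \<in> Cc_sections E) \<and> (\<lambda>n. j (u n)) \<longlonglongrightarrow> a \<longrightarrow>
        uniform_limit (arrows (total_grpd E)) (\<lambda>n \<sigma>. section_eval E \<sigma> (u n))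
          (\<lambda>\<sigma>. section_eval E \<sigma> F) sequentially))"

definition completion_eval ::
  "('g, 's) twist_data \<Rightarrow> (('g, 's) line_section \<Rightarrow> 'a::cstar_algebra) \<Rightarrow> 's \<Rightarrow> 'a \<Rightarrow> complex"
where
  "completion_eval E j \<sigma> a = section_eval E \<sigma> (completion_section E j a)"

text \<open>
  The embedding of the reduced C*-algebra of the subtwist over \<open>H\<close> induced by extension by zero,
  that is, its continuous extension to the completions.
\<close>

definition canonical_embedding ::
  "('g, 's) twist_data \<Rightarrow> 'g set \<Rightarrow> (('g, 's) line_section \<Rightarrow> 'a::cstar_algebra) \<Rightarrow>
     (('g, 's) line_section \<Rightarrow> 'b::cstar_algebra) \<Rightarrow> 'b \<Rightarrow> 'a" where
  "canonical_embedding E H j jH b = (THE a.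
     \<forall>u. (\<forall>n. u n \<in> Cc_sections (subtwist E H)) \<and> (\<lambda>n. jH (u n)) \<longlonglongrightarrow> b \<longrightarrow>
       (\<lambda>n. j (section_on E H (u n))) \<longlonglongrightarrow> a)"

end

theory Submission
  imports Defs
begin

text \<open>
  An element \<open>a\<close> of the reduced algebra whose section vanishes off \<open>H\<close> is to be approximated by
  compactly supported sections over \<open>H\<close>. If \<open>a\<close> has compact support, a continuous cut-off does
  this: the section changes little in the supremum norm, the changes live in a fixed compact set
  \<open>K\<close>, and for sections with support in \<open>K\<close> the reduced norm is at most a constant \<open>m\<^sub>K\<close> times the
  supremum norm (\<open>norm_le_sup_on_compact\<close>, \<open>Cc_vanishing_in_subalgebra_H\<close>). Amenability reduces the
  general case to this one. Multiplication by a compactly supported function \<open>h\<close> of positive type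
  with \<open>\<bar>h\<bar> \<le> C\<close> is a Schur multiplier on the matrices of the regular representations, so it has
  norm at most \<open>C\<close> for the reduced norm, whatever its support (\<open>norm_positive_type_mult\<close>). It maps
  the whole algebra to compactly supported sections and preserves vanishing off \<open>H\<close>. As the
  functions \<open>h\<close> tend to \<open>1\<close> uniformly on compact sets, \<open>h a\<close> tends to \<open>a\<close>
  (\<open>vanishing_in_subalgebra_H\<close>).

  The reduced algebra is given only by its faithful expectation, so its norm has to be identified
  with that of the regular representations. The value of the expectation at a unit \<open>x\<close> is a
  positive functional \<open>\<phi>\<^sub>x\<close>, whose Gelfand-Naimark-Segal space consists of the square summable
  functions on the arrows with source \<open>x\<close>. The supremum over \<open>x\<close> of the operator norms there is a
  C*-norm dominated by the given norm, and on a complete C*-algebra such a norm equals the given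
  one (\<open>gns_bound_norm\<close>, \<open>norm_le_gns_bound\<close>). The argument for the equality is a substitute for
  functional calculus: square roots of \<open>1 - W\<close> for contractions \<open>W\<close> produce a nonzero vector that
  can be divided by the powers of a self-adjoint element with explicit bounds
  (\<open>ex_divisible_by_powers\<close>).

  The same norm formula, applied to the closure of the sections over \<open>H\<close> with only the units of
  \<open>H\<close>, shows that extension by zero is isometric (\<open>norm_J\<close>), so that the canonical copy of the
  algebra of \<open>H\<close> is this closure. For elements of the algebra to be sections at all, the reduced
  norm must dominate the supremum norm; this follows from the expectation once the norm of a
  function on the unit space is known to be its supremum, which is elementary (\<open>norm_unit_le\<close>,
  \<open>unit_value_le_norm\<close>, \<open>cmod_ev_le_norm\<close>).

  Sections are treated throughout as equivariant functions on \<open>\<Sigma>\<close>.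
\<close>

section \<open>Elementary facts on C*-algebras\<close>

lemma scaleC_one [simp]: "scaleC 1 x = (x :: 'a::cstar_algebra)"
  using scaleC_of_real[of 1 x] by simp

lemma scaleC_minus1: "scaleC (-1) x = - (x :: 'a::cstar_algebra)"
  using scaleC_of_real[of "-1" x] by simp

lemma scaleC_zero_left [simp]: "scaleC 0 x = (0 :: 'a::cstar_algebra)"
  using scaleC_of_real[of 0 x] by simp

lemma scaleC_zero_right [simp]: "scaleC c 0 = (0 :: 'a::cstar_algebra)"
  using scaleC_add_right[of c 0 0] by simp

lemma scaleC_minus_right: "scaleC c (- x) = - scaleC c (x :: 'a::cstar_algebra)"
  using scaleC_add_right[of c x "-x"] by (simp add: eq_neg_iff_add_eq_0 add.commute)

lemma scaleC_diff_right: "scaleC c (x - y) = scaleC c x - scaleC c (y :: 'a::cstar_algebra)"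
  using scaleC_add_right[of c x "-y"] by (simp add: scaleC_minus_right)

lemma star_zero [simp]: "star (0 :: 'a::cstar_algebra) = 0"
  using star_add[of 0 "0::'a"] by simp

lemma star_minus: "star (- x) = - star (x :: 'a::cstar_algebra)"
  using star_add[of x "-x"] by (simp add: eq_neg_iff_add_eq_0 add.commute)

lemma star_diff: "star (x - y) = star x - star (y :: 'a::cstar_algebra)"
  using star_add[of x "-y"] by (simp add: star_minus)

lemma star_scaleR: "star (r *\<^sub>R x) = r *\<^sub>R star (x :: 'a::cstar_algebra)"
  using star_scaleC[of "complex_of_real r" x] by (simp add: scaleC_of_real)

lemma norm_star: "norm (star x) = norm (x :: 'a::cstar_algebra)"
proof -
  have le: "norm y \<le> norm (star y)" for y :: 'a
  proof (cases "y = 0")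
    case False
    have "norm y * norm y = norm (star y * y)"
      by (simp add: cstar_identity power2_eq_square)
    also have "\<dots> \<le> norm (star y) * norm y" by (rule norm_mult_ineq)
    finally show ?thesis using False by simp
  qed simp
  from le[of x] le[of "star x"] show ?thesis by (simp add: star_star)
qed

lemma bounded_linear_star: "bounded_linear (star :: 'a \<Rightarrow> 'a::cstar_algebra)"
  by (rule bounded_linear_intro[of _ 1]) (simp_all add: star_add star_scaleR norm_star)

lemma bounded_linear_scaleC: "bounded_linear (scaleC c :: 'a \<Rightarrow> 'a::cstar_algebra)"
proof (rule bounded_linear_intro[of _ "cmod c"])
  show "scaleC c (r *\<^sub>R x) = r *\<^sub>R scaleC c x" for r :: real and x :: 'a
    by (simp add: scaleC_of_real[symmetric] scaleC_scaleC mult.commute)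
qed (simp_all add: scaleC_add_right norm_scaleC mult.commute)

lemmas tendsto_star = bounded_linear.tendsto[OF bounded_linear_star]
  and tendsto_scaleC = bounded_linear.tendsto[OF bounded_linear_scaleC]

section \<open>Square roots of self-adjoint multipliers\<close>

text \<open>
  The algebra may lack a unit, but it acts on itself by left multiplication, and the operators on it
  contain the identity. An operator is symmetric if it is self-adjoint for the algebra-valued inner
  product \<open>a\<^sup>* b\<close>.
\<close>

definition symmetric_op :: "('a \<Rightarrow>\<^sub>L 'a::cstar_algebra) \<Rightarrow> bool" where
  "symmetric_op T \<longleftrightarrow> (\<forall>a b. star (T a) * b = star a * T b)"

definition commuting :: "('a \<Rightarrow>\<^sub>L 'a::real_normed_vector) \<Rightarrow> ('a \<Rightarrow>\<^sub>L 'a) \<Rightarrow> bool" where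
  "commuting S T \<longleftrightarrow> S o\<^sub>L T = T o\<^sub>L S"

definition stabilises :: "'a set \<Rightarrow> ('a \<Rightarrow>\<^sub>L 'a::real_normed_vector) \<Rightarrow> bool" where
  "stabilises D T \<longleftrightarrow> (\<forall>a \<in> D. T a \<in> D)"

definition left_mult :: "'a::cstar_algebra \<Rightarrow> ('a \<Rightarrow>\<^sub>L 'a)" where
  "left_mult c = Blinfun (\<lambda>a. c * a)"

lemma left_mult_apply [simp]: "left_mult c a = c * a"
  unfolding left_mult_def by (simp add: bounded_linear_Blinfun_apply bounded_linear_mult_right)

lemma norm_left_mult: "norm (left_mult c) \<le> norm c"
  by (rule norm_blinfun_bound) (simp_all add: norm_mult_ineq)

lemma symmetric_op_left_mult: "star c = c \<Longrightarrow> symmetric_op (left_mult c)"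
  by (simp add: symmetric_op_def star_mult mult.assoc)

lemma commutingD: "commuting S T \<Longrightarrow> S (T a) = T (S a)"
  unfolding commuting_def by (metis blinfun_apply_blinfun_compose)

lemma commutingI: "(\<And>a. blinfun_apply S (blinfun_apply T a) = blinfun_apply T (blinfun_apply S a)) \<Longrightarrow>
    commuting S T"
  unfolding commuting_def by (rule blinfun_eqI) simp

lemma commuting_sym: "commuting S T \<Longrightarrow> commuting T S"
  by (simp add: commuting_def)

lemma commuting_compose: "commuting S T \<Longrightarrow> commuting S T' \<Longrightarrow> commuting S (T o\<^sub>L T')"
  using commutingD[of S T] commutingD[of S T'] by (intro commutingI) (simp add: blinfun.bilinear_simps)

lemma commuting_add: "commuting S T \<Longrightarrow> commuting S T' \<Longrightarrow> commuting S (T + T')"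
  using commutingD[of S T] commutingD[of S T'] by (intro commutingI) (simp add: blinfun.bilinear_simps)

lemma commuting_diff: "commuting S T \<Longrightarrow> commuting S T' \<Longrightarrow> commuting S (T - T')"
  using commutingD[of S T] commutingD[of S T'] by (intro commutingI) (simp add: blinfun.bilinear_simps)

lemma commuting_scaleR: "commuting S T \<Longrightarrow> commuting S (r *\<^sub>R T)"
  using commutingD[of S T] by (intro commutingI) (simp add: blinfun.bilinear_simps)

lemma commuting_id: "commuting S id_blinfun"
  by (rule commutingI) simp

lemma commuting_refl: "commuting S S"
  by (simp add: commuting_def)

lemma commuting_zero: "commuting S 0"
  by (rule commutingI) (simp add: blinfun.bilinear_simps)

lemmas commuting_intros = commuting_zero commuting_compose commuting_add commuting_diff commuting_scaleR
  commuting_id commuting_refl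

lemma symmetric_op_id: "symmetric_op id_blinfun"
  by (simp add: symmetric_op_def)

lemma symmetric_op_add: "symmetric_op S \<Longrightarrow> symmetric_op T \<Longrightarrow> symmetric_op (S + T)"
  by (simp add: symmetric_op_def blinfun.bilinear_simps star_add algebra_simps)

lemma symmetric_op_diff: "symmetric_op S \<Longrightarrow> symmetric_op T \<Longrightarrow> symmetric_op (S - T)"
  by (simp add: symmetric_op_def blinfun.bilinear_simps star_diff algebra_simps)

lemma symmetric_op_scaleR: "symmetric_op T \<Longrightarrow> symmetric_op (r *\<^sub>R T)"
  by (simp add: symmetric_op_def blinfun.bilinear_simps star_scaleR)

lemma symmetric_op_square: "symmetric_op T \<Longrightarrow> symmetric_op (T o\<^sub>L T)"
  by (simp add: symmetric_op_def)

lemmas symmetric_op_intros = symmetric_op_id symmetric_op_add symmetric_op_diff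
  symmetric_op_scaleR symmetric_op_square

lemma tendsto_blinfun_apply: "S \<longlonglongrightarrow> T \<Longrightarrow> (\<lambda>n. blinfun_apply (S n) a) \<longlonglongrightarrow> T a"
  by (intro blinfun.tendsto tendsto_const)

lemma closed_symmetric_op: "closed (Collect symmetric_op)"
  unfolding closed_sequential_limits
proof (intro allI impI, elim conjE)
  fix S and T :: "'a \<Rightarrow>\<^sub>L 'a" assume S: "\<forall>n. S n \<in> Collect symmetric_op" and lim: "S \<longlonglongrightarrow> T"
  have "star (T a) * b = star a * T b" for a b
  proof (rule LIMSEQ_unique)
    show "(\<lambda>n. star (S n a) * b) \<longlonglongrightarrow> star (T a) * b"
      by (intro tendsto_mult tendsto_star tendsto_blinfun_apply lim tendsto_const)
    have "star (S n a) * b = star a * S n b" for n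
      using S by (simp add: symmetric_op_def)
    then show "(\<lambda>n. star (S n a) * b) \<longlonglongrightarrow> star a * T b"
      by (simp, intro tendsto_mult tendsto_blinfun_apply lim tendsto_const)
  qed
  then show "T \<in> Collect symmetric_op" by (simp add: symmetric_op_def)
qed

lemma closed_commuting: "closed {T. commuting S T}"
  unfolding closed_sequential_limits
proof (intro allI impI, elim conjE)
  fix U and T :: "'a \<Rightarrow>\<^sub>L 'a" assume U: "\<forall>n. U n \<in> {T. commuting S T}" and lim: "U \<longlonglongrightarrow> T"
  have "S (T a) = T (S a)" for a
  proof (rule LIMSEQ_unique)
    show "(\<lambda>n. S (U n a)) \<longlonglongrightarrow> S (T a)"
      by (intro blinfun.tendsto tendsto_blinfun_apply lim tendsto_const)
    have "S (U n a) = U n (S a)" for n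
      using U by (auto dest: commutingD)
    then show "(\<lambda>n. S (U n a)) \<longlonglongrightarrow> T (S a)"
      by (simp, intro tendsto_blinfun_apply lim)
  qed
  then show "T \<in> {T. commuting S T}" by (simp add: commutingI)
qed

lemma closed_stabilises:
  assumes "closed D" shows "closed {T. stabilises D T}"
  unfolding closed_sequential_limits
proof (intro allI impI, elim conjE)
  fix U and T :: "'a \<Rightarrow>\<^sub>L 'a" assume U: "\<forall>n. U n \<in> {T. stabilises D T}" and lim: "U \<longlonglongrightarrow> T"
  show "T \<in> {T. stabilises D T}"
    using closed_sequentially[OF assms _ tendsto_blinfun_apply[OF lim]] U
    by (auto simp: stabilises_def)
qed

text \<open>
  The square root of \<open>1 - W\<close> for a contraction \<open>W\<close> is \<open>1 - S\<close>, where \<open>S\<close> is the limit of the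
  iteration \<open>S \<mapsto> (W + S\<^sup>2) / 2\<close> started at \<open>0\<close>. The increments of the iteration are polynomials
  in \<open>W\<close> with nonnegative coefficients, so their norms are at most their values at the scalar \<open>1\<close>,
  which have a finite sum. The closed sets \<open>\<A>\<close> stable under the iteration carry properties of \<open>W\<close>
  over to \<open>S\<close>.
\<close>

lemma ex_one_minus_sqrt:
  fixes W :: "'a \<Rightarrow>\<^sub>L 'a::banach"
  assumes W: "norm W \<le> 1"
  shows "\<exists>S. norm S \<le> 1 \<and> (id_blinfun - S) o\<^sub>L (id_blinfun - S) = id_blinfun - W \<and>
           (\<forall>\<A>. closed \<A> \<longrightarrow> 0 \<in> \<A> \<longrightarrow> (\<forall>T \<in> \<A>. (1/2) *\<^sub>R (W + (T o\<^sub>L T)) \<in> \<A>) \<longrightarrow> S \<in> \<A>)"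
proof -
  \<comment> \<open>The same iteration at the scalar \<open>1\<close>; it increases to \<open>1\<close>.\<close>
  define s where "s = rec_nat (0::real) (\<lambda>_ t. (1/2) * (1 + t * t))"
  define S where "S = rec_nat (0::'a \<Rightarrow>\<^sub>L 'a) (\<lambda>_ T. (1/2) *\<^sub>R (W + (T o\<^sub>L T)))"
  have s_simps: "s 0 = 0" "s (Suc n) = (1/2) * (1 + s n * s n)" for n
    by (simp_all add: s_def)
  have S_simps: "S 0 = 0" "S (Suc n) = (1/2) *\<^sub>R (W + (S n o\<^sub>L S n))" for n
    by (simp_all add: S_def)
  have s01: "0 \<le> s n \<and> s n \<le> 1" for n
  proof (induction n)
    case (Suc n)
    then have "s n * s n \<le> 1" "0 \<le> s n * s n" by (simp_all add: mult_le_one)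
    then show ?case by (simp add: s_simps)
  qed (simp add: s_simps)
  have s_mono: "s n \<le> s (Suc n)" for n
    using zero_le_square[of "s n - 1"] by (simp add: s_simps algebra_simps)
  have "convergent s"
    using s01 s_mono by (intro Bseq_mono_convergent BseqI'[of _ 1])
      (auto intro: lift_Suc_mono_le)
  then obtain l where "s \<longlonglongrightarrow> l" by (auto simp: convergent_def)
  then have d_summable: "summable (\<lambda>n. s (Suc n) - s n)"
    using telescope_sums sums_summable by blast
  have inv: "S n \<in> \<A>" if "0 \<in> \<A>" "\<forall>T \<in> \<A>. (1/2) *\<^sub>R (W + (T o\<^sub>L T)) \<in> \<A>" for \<A> n
    using that by (induction n) (auto simp: S_simps)
  have comm_W: "commuting W (S n)" for n
    using inv[of "{T. commuting W T}" n] by (simp add: commuting_intros)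
  have comm: "commuting (S m) (S n)" for m n
    using inv[of "{T. commuting (S m) T}" n] commuting_sym[OF comm_W]
    by (simp add: commuting_intros)
  have S_le: "norm (S n) \<le> s n" for n
  proof (induction n)
    case (Suc n)
    have "norm (S n o\<^sub>L S n) \<le> s n * s n"
      using Suc s01 by (intro order_trans[OF norm_blinfun_compose] mult_mono) auto
    then have "norm (W + (S n o\<^sub>L S n)) \<le> 1 + s n * s n"
      using W by (intro order_trans[OF norm_triangle_ineq]) auto
    then show ?case by (simp add: S_simps s_simps)
  qed (simp add: S_simps s_simps)
  have D_le: "norm (S (Suc n) - S n) \<le> s (Suc n) - s n" for n
  proof (induction n)
    case 0
    then show ?case using W by (simp add: S_simps s_simps)
  next
    case (Suc n)
    have eq: "S (Suc (Suc n)) - S (Suc n) = (1/2) *\<^sub>R ((S (Suc n) + S n) o\<^sub>L (S (Suc n) - S n))"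
      by (rule blinfun_eqI)
        (simp add: S_simps(2)[of "Suc n"] blinfun.bilinear_simps
          commutingD[OF comm_W] S_simps(2)[of n] algebra_simps)
    have "norm ((S (Suc n) + S n) o\<^sub>L (S (Suc n) - S n)) \<le> (s (Suc n) + s n) * (s (Suc n) - s n)"
      using Suc S_le s01
      by (intro order_trans[OF norm_blinfun_compose] mult_mono order_trans[OF norm_triangle_ineq] add_mono)
        (auto intro: add_nonneg_nonneg)
    moreover have "s (Suc (Suc n)) - s (Suc n) = (1/2) * ((s (Suc n) + s n) * (s (Suc n) - s n))"
      by (simp add: s_simps(2)[of "Suc n"] s_simps(2)[of n] field_simps)
    ultimately show ?case by (simp add: eq)
  qed
  have "summable (\<lambda>n. S (Suc n) - S n)"
    using D_le by (intro summable_comparison_test'[OF d_summable]) auto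
  then have "(\<lambda>n. S n - S 0) \<longlonglongrightarrow> (\<Sum>n. S (Suc n) - S n)"
    using summable_LIMSEQ[of "\<lambda>n. S (Suc n) - S n"] by (simp add: sum_lessThan_telescope)
  then obtain L where L: "S \<longlonglongrightarrow> L" by (auto simp: S_simps)
  have "norm L \<le> 1"
    using S_le s01 by (intro LIMSEQ_le_const2[OF tendsto_norm[OF L]]) (meson order_trans)
  moreover have "(id_blinfun - L) o\<^sub>L (id_blinfun - L) = id_blinfun - W"
  proof -
    have "(\<lambda>n. (1/2) *\<^sub>R (W + (S n o\<^sub>L S n))) \<longlonglongrightarrow> (1/2) *\<^sub>R (W + (L o\<^sub>L L))"
      by (intro tendsto_intros L bounded_bilinear.tendsto[OF bounded_bilinear_blinfun_compose])
    moreover have "(\<lambda>n. (1/2) *\<^sub>R (W + (S n o\<^sub>L S n))) \<longlonglongrightarrow> L"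
      using LIMSEQ_Suc[OF L] by (simp add: S_simps)
    ultimately have eq: "L = (1/2) *\<^sub>R (W + (L o\<^sub>L L))" by (rule LIMSEQ_unique[symmetric])
    have "2 *\<^sub>R L a = W a + L (L a)" for a
      using arg_cong[OF eq, of "\<lambda>T. 2 *\<^sub>R blinfun_apply T a"] by (simp add: blinfun.bilinear_simps)
    then show ?thesis
      by (intro blinfun_eqI) (simp add: blinfun.bilinear_simps algebra_simps scaleR_2)
  qed
  moreover have "L \<in> \<A>" if "closed \<A>" "0 \<in> \<A>" "\<forall>T \<in> \<A>. (1/2) *\<^sub>R (W + (T o\<^sub>L T)) \<in> \<A>" for \<A>
    using closed_sequentially[OF that(1) _ L] inv[OF that(2,3)] by blast
  ultimately show ?thesis by blast
qed

text \<open>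
  If \<open>p\<close> and \<open>q\<close> are commuting self-adjoint multipliers with \<open>p\<^sup>2 + q\<^sup>2 = r\<close>, then \<open>q + i p\<close>
  is \<open>r\<^sup>1\<^sup>/\<^sup>2\<close> times an isometry, and so is \<open>q - i p\<close>; hence their half sum \<open>q\<close> and, up to a
  factor \<open>i\<close>, their half difference \<open>p\<close> have norm at most \<open>r\<^sup>1\<^sup>/\<^sup>2\<close>. With the square roots above,
  this estimate serves in place of spectral theory.
\<close>

lemma norm_of_sum_of_squares_le:
  fixes p q :: "'a \<Rightarrow>\<^sub>L 'a::cstar_algebra"
  assumes "symmetric_op p" "symmetric_op q" and comm: "commuting p q"
    and eq: "p (p a) + q (q a) = r *\<^sub>R a" and r: "0 \<le> r"
  shows "norm (p a) \<le> sqrt r * norm a" and "norm (q a) \<le> sqrt r * norm a"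
proof -
  have iso: "norm (q a + scaleC c (p a)) = sqrt r * norm a" if c: "c = \<i> \<or> c = - \<i>" for c
  proof -
    have [simp]: "c * c = -1" "cnj c = - c" using c by auto
    have q: "star (q x) * y = star x * q y" and p: "star (p x) * y = star x * p y" for x y
      using assms by (auto simp: symmetric_op_def)
    have q_scaleC: "star x * q (scaleC c y) = star x * scaleC c (q y)" for x y
      using q[of x "scaleC c y"] q[of x y] by (simp add: mult_scaleC_right)
    have p_scaleC: "star x * p (scaleC c y) = star x * scaleC c (p y)" for x y
      using p[of x "scaleC c y"] p[of x y] by (simp add: mult_scaleC_right)
    have minus: "scaleC (- c) y = - scaleC c y" for y :: 'a
      by (metis scaleC_minus1 scaleC_scaleC mult_minus1)
    let ?v = "q a + scaleC c (p a)"
    have "star ?v * ?v = star a * (q (q a) + p (p a))"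
      using commutingD[OF comm, of a]
      by (simp add: star_add star_scaleC distrib_left distrib_right left_diff_distrib right_diff_distrib
          q p mult_scaleC_left
          mult_scaleC_right scaleC_scaleC blinfun.bilinear_simps q_scaleC p_scaleC minus
          scaleC_minus_right scaleC_add_right scaleC_diff_right scaleC_minus1)
    also have "\<dots> = r *\<^sub>R (star a * a)"
      using eq by (simp add: add.commute)
    finally have "(norm ?v)\<^sup>2 = r * (norm a)\<^sup>2"
      using r by (simp add: cstar_identity[symmetric])
    then show ?thesis
      by (metis norm_ge_zero real_sqrt_mult real_sqrt_unique)
  qed
  have "2 *\<^sub>R q a = (q a + scaleC \<i> (p a)) + (q a + scaleC (- \<i>) (p a))"
    using scaleC_add_left[of \<i> "-\<i>" "p a"] by (simp add: scaleR_2 algebra_simps)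
  then have "norm (2 *\<^sub>R q a) \<le> sqrt r * norm a + sqrt r * norm a"
    by (metis iso norm_triangle_ineq)
  then show "norm (q a) \<le> sqrt r * norm a" by simp
  have "scaleC (2 * \<i>) (p a) = (q a + scaleC \<i> (p a)) - (q a + scaleC (- \<i>) (p a))"
    using scaleC_add_left[of "2*\<i>" "-\<i>" "p a"] by (simp add: algebra_simps)
  then have "norm (scaleC (2 * \<i>) (p a)) \<le> sqrt r * norm a + sqrt r * norm a"
    by (metis iso norm_triangle_ineq4)
  then show "norm (p a) \<le> sqrt r * norm a" by (simp add: norm_scaleC norm_mult)
qed

text \<open>
  The stable closed sets that matter are the symmetric operators, the operators that commute with a
  given one, and the operators that leave a closed subspace invariant.
\<close>

lemma one_minus_sqrt:
  fixes W :: "'a \<Rightarrow>\<^sub>L 'a::cstar_algebra"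
  assumes "norm W \<le> 1" "symmetric_op W"
  obtains S :: "'a \<Rightarrow>\<^sub>L 'a" where "norm S \<le> 1" "\<And>a. a - S a - S (a - S a) = a - W a" "symmetric_op S"
    "\<And>T. commuting W T \<Longrightarrow> commuting S T"
    "\<And>D. closed D \<Longrightarrow> subspace D \<Longrightarrow> stabilises D W \<Longrightarrow> stabilises D S"
proof -
  obtain S where S: "norm S \<le> 1" "(id_blinfun - S) o\<^sub>L (id_blinfun - S) = id_blinfun - W"
    and ind: "\<And>\<A>. closed \<A> \<Longrightarrow> 0 \<in> \<A> \<Longrightarrow>
      (\<forall>T \<in> \<A>. (1/2) *\<^sub>R (W + (T o\<^sub>L T)) \<in> \<A>) \<Longrightarrow> S \<in> \<A>"
    using ex_one_minus_sqrt[OF assms(1)] by blast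
  show thesis
  proof
    show "norm S \<le> 1" by (fact S(1))
    show "a - S a - S (a - S a) = a - W a" for a
      using arg_cong[OF S(2), of "\<lambda>T. blinfun_apply T a"]
      by (simp add: blinfun.bilinear_simps algebra_simps)
    have "symmetric_op (0 :: 'a \<Rightarrow>\<^sub>L 'a)" by (simp add: symmetric_op_def)
    then show "symmetric_op S"
      using ind[OF closed_symmetric_op] assms(2) by (simp add: symmetric_op_intros)
    show "commuting S T" if "commuting W T" for T
      using ind[OF closed_commuting[of T]] commuting_sym[OF that] commuting_sym[of T S]
      by (simp add: commuting_intros)
    show "stabilises D S" if "closed D" "subspace D" "stabilises D W" for D
      using ind[OF closed_stabilises[OF that(1)]] that(2,3)
      by (simp add: stabilises_def blinfun.bilinear_simps subspace_0 subspace_add subspace_scale)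
  qed
qed


section \<open>The norm of a C*-algebra with a faithful family of positive functionals\<close>

lemma cstar_subalgebra_subspace: "cstar_subalgebra D \<Longrightarrow> subspace (D :: 'a::cstar_algebra set)"
  unfolding cstar_subalgebra_def subspace_def by (metis scaleC_of_real)

text \<open>
  A surrogate for the vectors in the spectral subspace of \<open>c\<^sup>2\<close> over \<open>{r<..}\<close>. Let \<open>m\<close> be the
  absolute value of \<open>y = (c\<^sup>2 - r) / 2\<close>, and \<open>V = (m + y) / 2\<close> its positive part. Then
  \<open>V c\<^sup>2 = V (r + 2 m)\<close>, and \<open>r + 2 m\<close> has an inverse of norm at most \<open>1 / r\<close>; so every
  \<open>e = V a\<close> can be divided by \<open>c\<^sup>2\<close> arbitrarily often, at the price of a factor \<open>1 / r\<close> each time.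
  If \<open>V\<close> vanished, then \<open>r - c\<^sup>2 = 2 m\<close> would be a square, contradicting \<open>r < 1 = \<parallel>c\<^sup>2\<parallel>\<close>.
\<close>

lemma ex_divisible_by_powers:
  fixes c :: "'a::cstar_algebra"
  assumes D: "cstar_subalgebra D" and c: "c \<in> D" "star c = c" "norm c = 1" and r: "0 < r" "r < 1"
  obtains e B where "e \<in> D" "e \<noteq> 0"
    "\<And>n. \<exists>u \<in> D. e = ((\<lambda>v. c * (c * v)) ^^ n) u \<and> norm u \<le> B / r ^ n"
proof -
  have Dsub: "subspace D" and Dcl: "closed D"
    using D cstar_subalgebra_subspace by (auto simp: cstar_subalgebra_def)
  let ?C = "left_mult c"
  define y where "y = (1/2) *\<^sub>R ((?C o\<^sub>L ?C) - r *\<^sub>R id_blinfun)"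
  have y_apply: "y a = (1/2) *\<^sub>R (c * (c * a) - r *\<^sub>R a)" for a
    by (simp add: y_def blinfun.bilinear_simps)
  have C_sym: "symmetric_op ?C" by (rule symmetric_op_left_mult[OF c(2)])
  have y_sym: "symmetric_op y"
    unfolding y_def by (intro symmetric_op_intros C_sym)
  have CDs: "stabilises D ?C"
    using D c(1) by (simp add: stabilises_def cstar_subalgebra_def)
  have yDs: "stabilises D y"
    using CDs Dsub
    by (simp add: stabilises_def y_apply subspace_diff subspace_scale)
  have C1: "norm ?C \<le> 1" using norm_left_mult[of c] c(3) by simp
  have "norm (?C o\<^sub>L ?C) \<le> 1"
    using C1 by (intro order_trans[OF norm_blinfun_compose] mult_le_one) auto
  moreover have "norm (r *\<^sub>R (id_blinfun :: 'a \<Rightarrow>\<^sub>L 'a)) \<le> 1"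
    using r by (intro norm_blinfun_bound) (auto simp: mult_left_le_one_le blinfun.bilinear_simps)
  ultimately have "norm ((?C o\<^sub>L ?C) - r *\<^sub>R id_blinfun) \<le> 2"
    by (intro order_trans[OF norm_triangle_ineq4]) simp
  then have y1: "norm y \<le> 1" by (simp add: y_def)
  have yC: "commuting y ?C"
    unfolding y_def by (rule commuting_sym, intro commuting_intros)
  have "norm (y o\<^sub>L y) \<le> 1"
    using y1 by (intro order_trans[OF norm_blinfun_compose] mult_le_one) auto
  moreover have "symmetric_op (y o\<^sub>L y)" by (intro symmetric_op_intros y_sym)
  ultimately obtain S1 :: "'a \<Rightarrow>\<^sub>L 'a" where S1: "\<And>a. a - S1 a - S1 (a - S1 a) = a - y (y a)"
      "symmetric_op S1"
      "\<And>T. commuting (y o\<^sub>L y) T \<Longrightarrow> commuting S1 T" "stabilises D (y o\<^sub>L y) \<Longrightarrow> stabilises D S1"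
    using one_minus_sqrt[of "y o\<^sub>L y"] Dsub Dcl by (metis blinfun_apply_blinfun_compose)
  \<comment> \<open>\<open>d = (1 - y\<^sup>2)\<^sup>1\<^sup>/\<^sup>2\<close>, and below \<open>m = (1 - d\<^sup>2)\<^sup>1\<^sup>/\<^sup>2 = \<bar>y\<bar>\<close>.\<close>
  define d where "d = id_blinfun - S1"
  have dd: "d (d a) = a - y (y a)" for a using S1(1)[of a] by (simp add: d_def blinfun.bilinear_simps)
  have d_sym: "symmetric_op d" unfolding d_def by (intro symmetric_op_intros S1)
  have d_comm: "commuting d T" if "commuting y T" for T
    using that unfolding d_def
    by (intro commuting_sym[of T] commuting_intros commuting_sym[OF S1(3)]) (auto intro: commuting_sym
        commuting_intros)
  have dDs: "stabilises D d"
    using S1(4) yDs Dsub by (auto simp: d_def stabilises_def blinfun.bilinear_simps subspace_diff)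
  have d1: "norm d \<le> 1"
  proof (rule norm_blinfun_bound)
    show "norm (d a) \<le> 1 * norm a" for a
      using norm_of_sum_of_squares_le(2)[OF y_sym d_sym, of a 1] dd[of a]
        commuting_sym[OF d_comm[OF commuting_refl]] by simp
  qed simp
  have "norm (d o\<^sub>L d) \<le> 1"
    using d1 by (intro order_trans[OF norm_blinfun_compose] mult_le_one) auto
  moreover have "symmetric_op (d o\<^sub>L d)" by (intro symmetric_op_intros d_sym)
  ultimately obtain S2 :: "'a \<Rightarrow>\<^sub>L 'a" where S2: "norm S2 \<le> 1"
      "\<And>a. a - S2 a - S2 (a - S2 a) = a - d (d a)" "symmetric_op S2"
      "\<And>T. commuting (d o\<^sub>L d) T \<Longrightarrow> commuting S2 T" "stabilises D (d o\<^sub>L d) \<Longrightarrow> stabilises D S2"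
    using one_minus_sqrt[of "d o\<^sub>L d"] Dsub Dcl by (metis blinfun_apply_blinfun_compose)
  define m where "m = id_blinfun - S2"
  have m_apply: "m a = a - S2 a" for a by (simp add: m_def blinfun.bilinear_simps)
  have mm: "m (m a) = y (y a)" for a
    using S2(2)[of a] dd[of a] by (simp add: m_def blinfun.bilinear_simps)
  have S2_comm: "commuting S2 T" if "commuting y T" for T
    using d_comm[OF that] by (intro S2(4)) (auto intro: commuting_sym commuting_intros)
  have S2Ds: "stabilises D S2" using S2(5) dDs by (simp add: stabilises_def)
  have my: "m (y a) = y (m a)" for a
    using commutingD[OF S2_comm[OF commuting_refl], of a] by (simp add: m_apply blinfun.bilinear_simps)
  have mC: "m (c * a) = c * m a" for a
    using commutingD[OF S2_comm[OF yC], of a] by (simp add: m_apply algebra_simps)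
  \<comment> \<open>\<open>1 - S3\<close> is a square root of \<open>m\<close>.\<close>
  obtain S3 :: "'a \<Rightarrow>\<^sub>L 'a" where S3: "\<And>a. a - S3 a - S3 (a - S3 a) = a - S2 a" "symmetric_op S3"
      "\<And>T. commuting S2 T \<Longrightarrow> commuting S3 T"
    using one_minus_sqrt[OF S2(1,3)] by metis
  define V where "V = (1/2) *\<^sub>R (m + y)"
  have V_apply: "V a = (1/2) *\<^sub>R (m a + y a)" for a by (simp add: V_def blinfun.bilinear_simps)
  have VD: "V a \<in> D" if "a \<in> D" for a
    using that S2Ds yDs Dsub
    by (auto simp: V_apply m_apply stabilises_def subspace_diff subspace_scale subspace_add)
  have VC: "V (c * (c * a)) = c * (c * V a)" for a
    by (simp add: V_apply mC y_apply algebra_simps)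
  have V_eq: "V (r *\<^sub>R a + 2 *\<^sub>R m a) = c * (c * V a)" for a
  proof -
    have "V (m a) = V (y a)" by (simp add: V_apply mm my)
    then have "V (r *\<^sub>R a + 2 *\<^sub>R m a) = V (r *\<^sub>R a + 2 *\<^sub>R y a)"
      by (simp add: blinfun.bilinear_simps)
    also have "r *\<^sub>R a + 2 *\<^sub>R y a = c * (c * a)" by (simp add: y_apply)
    finally show ?thesis by (simp add: VC)
  qed
  have inverse: "\<exists>b \<in> D. r *\<^sub>R b + 2 *\<^sub>R m b = a \<and> norm b \<le> norm a / r" if a: "a \<in> D" for a
  proof -
    \<comment> \<open>\<open>r + 2 m = (r + 2) - 2 S2\<close> with \<open>S2\<close> a contraction, so the equation is a fixed point problem\<close>
    \<comment> \<open>for a contraction of \<open>D\<close>.\<close>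
    let ?f = "\<lambda>b. (1 / (r + 2)) *\<^sub>R (a + 2 *\<^sub>R S2 b)"
    have S2_le: "norm (S2 b) \<le> norm b" for b
      using norm_blinfun[of S2 b] S2(1) mult_left_le_one_le[of "norm b" "norm S2"] by simp
    have "\<exists>!b. b \<in> D \<and> ?f b = b"
    proof (rule Banach_fix[of D "2 / (r + 2)" ?f])
      show "complete D" using Dcl by (simp add: complete_eq_closed)
      show "?f ` D \<subseteq> D"
        using S2Ds Dsub a by (auto simp: stabilises_def subspace_add subspace_scale)
      have "dist (?f x) (?f y) = 2 / (r + 2) * norm (S2 (x - y))" for x y
        using r by (simp add: dist_norm scaleR_diff_right[symmetric] blinfun.diff_right)
      then show "dist (?f x) (?f y) \<le> 2 / (r + 2) * dist x y" for x y
        using r S2_le by (simp add: dist_norm divide_right_mono mult_left_mono)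
    qed (use a r in auto)
    then obtain b where b: "b \<in> D" "?f b = b" by blast
    then have "(r + 2) *\<^sub>R b = (r + 2) *\<^sub>R ?f b" by simp
    also have "\<dots> = a + 2 *\<^sub>R S2 b" using r by simp
    finally have eq: "r *\<^sub>R b + 2 *\<^sub>R m b = a" "(r + 2) *\<^sub>R b = a + 2 *\<^sub>R S2 b"
      by (simp_all add: m_apply algebra_simps)
    have "(r + 2) * norm b = norm (a + 2 *\<^sub>R S2 b)"
      using arg_cong[OF eq(2), of norm] r by simp
    also have "\<dots> \<le> norm a + 2 * norm b"
      using S2_le[of b] by (intro order_trans[OF norm_triangle_ineq]) simp
    finally have "norm b \<le> norm a / r" using r by (simp add: field_simps)
    with b(1) eq(1) show ?thesis by blast
  qed
  have "\<exists>a \<in> D. V a \<noteq> 0"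
  proof (rule ccontr)
    assume "\<not> ?thesis"
    then have V0: "V a = 0" if "a \<in> D" for a using that by blast
    define q where "q = sqrt 2 *\<^sub>R (id_blinfun - S3)"
    have q_sym: "symmetric_op q" unfolding q_def by (intro symmetric_op_intros S3)
    have "commuting S3 ?C" by (intro S3(3) S2_comm yC)
    then have Cq: "commuting ?C q"
      unfolding q_def by (intro commuting_intros commuting_sym[of S3])
    have q_apply: "q b = sqrt 2 *\<^sub>R (b - S3 b)" for b
      by (simp add: q_def blinfun.bilinear_simps)
    have "q (q c) = (sqrt 2 * sqrt 2) *\<^sub>R (c - S3 c - S3 (c - S3 c))"
      by (simp only: q_apply blinfun.scaleR_right scaleR_diff_right[symmetric] scaleR_scaleR)
    then have "q (q c) = 2 *\<^sub>R m c" by (simp only: S3(1) m_apply) simp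
    moreover have "m c = - y c"
      using V0[OF c(1)] by (simp add: V_apply add_eq_0_iff2)
    ultimately have "?C (?C c) + q (q c) = r *\<^sub>R c" by (simp add: y_apply)
    from norm_of_sum_of_squares_le(1)[OF C_sym q_sym Cq this] r c
    have "norm (c * c) \<le> sqrt r" by simp
    moreover have "norm (c * c) = 1" using cstar_identity[of c] c by simp
    ultimately show False using r by simp
  qed
  then obtain a where a: "a \<in> D" "V a \<noteq> 0" by blast
  have "\<exists>u \<in> D. V a = ((\<lambda>v. c * (c * v)) ^^ n) (V u) \<and> norm u \<le> norm a / r ^ n" for n
  proof (induction n)
    case 0
    show ?case using a by auto
  next
    case (Suc n)
    then obtain u where u: "u \<in> D" "V a = ((\<lambda>v. c * (c * v)) ^^ n) (V u)" "norm u \<le> norm a / r ^ n" by blast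
    obtain b where b: "b \<in> D" "r *\<^sub>R b + 2 *\<^sub>R m b = u" "norm b \<le> norm u / r"
      using inverse[OF u(1)] by blast
    have "V u = c * (c * V b)" using V_eq[of b] b(2) by simp
    then have "V a = ((\<lambda>v. c * (c * v)) ^^ Suc n) (V b)"
      using u(2) by (simp add: funpow_Suc_right del: funpow.simps)
    moreover have "norm b \<le> norm a / r ^ Suc n"
      using order_trans[OF b(3) divide_right_mono[OF u(3)]] r by (simp add: mult.commute)
    ultimately show ?case using b(1) by blast
  qed
  then have "\<exists>u \<in> D. V a = ((\<lambda>v. c * (c * v)) ^^ n) u \<and> norm u \<le> (norm V * norm a) / r ^ n" for n
    using VD order_trans[OF norm_blinfun mult_left_mono[of _ _ "norm V"]]
    by (metis norm_ge_zero times_divide_eq_right)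
  with VD a show thesis using that by blast
qed


text \<open>
  The functionals live on a closed *-subalgebra \<open>D\<close>, so that the same results apply to a whole
  C*-algebra and to the image of the algebra of a subgroupoid, with its smaller family of functionals.
\<close>

locale positive_functionals =
  fixes D :: "'a::cstar_algebra set" and X :: "'i set" and \<phi> :: "'i \<Rightarrow> 'a \<Rightarrow> complex"
  assumes subalgebra: "cstar_subalgebra D"
    and additive: "x \<in> X \<Longrightarrow> a \<in> D \<Longrightarrow> b \<in> D \<Longrightarrow> \<phi> x (a + b) = \<phi> x a + \<phi> x b"
    and homogeneous: "x \<in> X \<Longrightarrow> a \<in> D \<Longrightarrow> \<phi> x (scaleC c a) = c * \<phi> x a"
    and contractive: "x \<in> X \<Longrightarrow> a \<in> D \<Longrightarrow> cmod (\<phi> x a) \<le> norm a"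
    and positive: "x \<in> X \<Longrightarrow> a \<in> D \<Longrightarrow> \<phi> x (star a * a) \<in> \<real>\<^sub>\<ge>\<^sub>0"
begin

definition seminorm_at :: "'i \<Rightarrow> 'a \<Rightarrow> real" where
  "seminorm_at x a = sqrt (Re (\<phi> x (star a * a)))"

text \<open>
  A bound for the norm of left multiplication by \<open>a\<close> in the Gelfand-Naimark-Segal spaces of all the
  functionals. The bilinear form is convenient because it is symmetric under the adjoint.
\<close>

definition gns_bound :: "'a \<Rightarrow> real \<Rightarrow> bool" where
  "gns_bound a M \<longleftrightarrow> (\<forall>x \<in> X. \<forall>k \<in> D. \<forall>b \<in> D.
     cmod (\<phi> x (star k * (a * b))) \<le> M * seminorm_at x k * seminorm_at x b)"

lemma in_D: "a \<in> D \<Longrightarrow> b \<in> D \<Longrightarrow> a + b \<in> D" "a \<in> D \<Longrightarrow> b \<in> D \<Longrightarrow> a * b \<in> D"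
    "a \<in> D \<Longrightarrow> scaleC c a \<in> D" "a \<in> D \<Longrightarrow> star a \<in> D" "a \<in> D \<Longrightarrow> r *\<^sub>R a \<in> D" "a \<in> D \<Longrightarrow> - a \<in> D"
    "a \<in> D \<Longrightarrow> b \<in> D \<Longrightarrow> a - b \<in> D"
  using subalgebra cstar_subalgebra_subspace[OF subalgebra]
  by (auto simp: cstar_subalgebra_def subspace_scale subspace_neg subspace_diff)

lemma diff: "x \<in> X \<Longrightarrow> a \<in> D \<Longrightarrow> b \<in> D \<Longrightarrow> \<phi> x (a - b) = \<phi> x a - \<phi> x b"
  using additive[of x "a - b" b] by (simp add: in_D)

context
  fixes x assumes x: "x \<in> X"
begin

lemma seminorm_at_nonneg: "a \<in> D \<Longrightarrow> 0 \<le> seminorm_at x a"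
  using positive[OF x, of a] by (simp add: seminorm_at_def complex_nonneg_Reals_iff)

lemma seminorm_at_square: "a \<in> D \<Longrightarrow> \<phi> x (star a * a) = of_real ((seminorm_at x a)\<^sup>2)"
  using positive[OF x, of a] by (simp add: seminorm_at_def complex_nonneg_Reals_iff complex_eq_iff)

lemma seminorm_at_le: assumes "a \<in> D" shows "seminorm_at x a \<le> norm a"
proof -
  have "cmod (\<phi> x (star a * a)) \<le> norm (star a * a)"
    using assms by (intro contractive x in_D)
  then have "(seminorm_at x a)\<^sup>2 \<le> (norm a)\<^sup>2"
    by (simp add: seminorm_at_square[OF assms] cstar_identity norm_power)
  then show ?thesis by (rule power2_le_imp_le) simp
qed

lemma expand_square:
  assumes "a \<in> D" "b \<in> D"
  shows "\<phi> x (star (a + scaleC t b) * (a + scaleC t b)) =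
    \<phi> x (star a * a) + t * \<phi> x (star a * b) + cnj t * \<phi> x (star b * a) + cnj t * t * \<phi> x (star b * b)"
  using assms x
  by (simp add: star_add star_scaleC distrib_left distrib_right mult_scaleC_left mult_scaleC_right
      scaleC_scaleC additive homogeneous in_D mult.commute)

lemma hermitian:
  assumes "a \<in> D" "b \<in> D"
  shows "\<phi> x (star b * a) = cnj (\<phi> x (star a * b))"
proof -
  have im0: "Im (\<phi> x (star v * v)) = 0" if "v \<in> D" for v
    using positive[OF x that] by (simp add: complex_nonneg_Reals_iff)
  have "Im (\<phi> x (star (a + scaleC t b) * (a + scaleC t b))) = 0" for t
    using assms by (intro im0 in_D)
  from this[of 1] this[of \<i>] show ?thesis
    using im0 assms unfolding expand_square[OF assms] by (simp add: complex_eq_iff)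
qed

lemma Cauchy_Schwarz:
  assumes ab: "a \<in> D" "b \<in> D"
  shows "cmod (\<phi> x (star a * b)) \<le> seminorm_at x a * seminorm_at x b"
proof -
  define z where "z = \<phi> x (star a * b)"
  define p q where "p = (seminorm_at x a)\<^sup>2" and "q = (seminorm_at x b)\<^sup>2"
  have ineq: "0 \<le> p - 2 * s * (cmod z)\<^sup>2 + s\<^sup>2 * (cmod z)\<^sup>2 * q" for s :: real
  proof -
    \<comment> \<open>The scalars in the direction of \<open>- cnj z\<close> are the ones that decrease the form fastest.\<close>
    let ?t = "- (of_real s * cnj z)"
    have "a + scaleC ?t b \<in> D" using ab by (intro in_D)
    then have "0 \<le> Re (\<phi> x (star (a + scaleC ?t b) * (a + scaleC ?t b)))"
      using positive[OF x] by (simp add: complex_nonneg_Reals_iff)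
    also have "\<phi> x (star (a + scaleC ?t b) * (a + scaleC ?t b)) =
        of_real p + ?t * z + cnj ?t * cnj z + cnj ?t * ?t * of_real q"
      unfolding expand_square[OF ab] hermitian[OF ab] z_def
      by (simp add: seminorm_at_square ab p_def q_def)
    also have "?t * z = - of_real (s * (cmod z)\<^sup>2)"
      by (simp only: of_real_mult complex_norm_square) (simp add: algebra_simps)
    also have "cnj ?t * cnj z = - of_real (s * (cmod z)\<^sup>2)"
      by (simp only: of_real_mult complex_norm_square) (simp add: algebra_simps)
    also have "cnj ?t * ?t = of_real (s\<^sup>2 * (cmod z)\<^sup>2)"
      by (simp only: of_real_mult complex_norm_square) (simp add: algebra_simps power2_eq_square)
    finally show ?thesis by (simp only: plus_complex.sel uminus_complex.sel Re_complex_of_real flip: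
        of_real_mult)
  qed
  have "(cmod z)\<^sup>2 \<le> p * q"
  proof (cases "q = 0")
    case True
    have "cmod z = 0"
    proof (rule ccontr)
      assume "cmod z \<noteq> 0"
      then show False using ineq[of "(p + 1) / (2 * (cmod z)\<^sup>2)"] True by simp
    qed
    then show ?thesis using True by simp
  next
    case False
    then have "q > 0" by (simp add: q_def)
    then show ?thesis using ineq[of "1 / q"] by (simp add: power2_eq_square field_simps)
  qed
  then have "(cmod z)\<^sup>2 \<le> (seminorm_at x a * seminorm_at x b)\<^sup>2"
    by (simp add: p_def q_def power_mult_distrib)
  then show ?thesis
    unfolding z_def by (rule power2_le_imp_le) (simp add: seminorm_at_nonneg ab)
qed

text \<open>
  \<open>\<parallel>a\<parallel>\<^sup>2 - a\<^sup>* a\<close> is the square of a self-adjoint multiplier \<open>R\<close>, so its compression by \<open>b\<close> is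
  \<open>(R b)\<^sup>* (R b)\<close>.
\<close>

lemma seminorm_at_mult:
  assumes a: "a \<in> D" and b: "b \<in> D"
  shows "seminorm_at x (a * b) \<le> norm a * seminorm_at x b"
proof (cases "a = 0")
  case True
  have "seminorm_at x 0 = 0"
    using homogeneous[OF x b, of 0] by (simp add: seminorm_at_def)
  then show ?thesis using True by simp
next
  case False
  define v where "v = (1 / norm a) *\<^sub>R a"
  have v: "v \<in> D" "norm v = 1" using False a by (simp_all add: v_def in_D)
  have "norm (left_mult (star v * v)) \<le> 1"
    using norm_left_mult[of "star v * v"] v by (simp add: cstar_identity)
  moreover have "symmetric_op (left_mult (star v * v))"
    by (rule symmetric_op_left_mult) (simp add: star_mult star_star)
  moreover have "stabilises D (left_mult (star v * v))"
    using v by (simp add: stabilises_def in_D)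
  ultimately obtain S :: "'a \<Rightarrow>\<^sub>L 'a" where S: "\<And>a. a - S a - S (a - S a) = a - star v * v * a"
      "symmetric_op S" "stabilises D S"
    using one_minus_sqrt[of "left_mult (star v * v)"] subalgebra cstar_subalgebra_subspace[OF subalgebra]
    unfolding cstar_subalgebra_def left_mult_apply by metis
  let ?R = "id_blinfun - S"
  have "?R b \<in> D" using S(3) b by (simp add: stabilises_def blinfun.bilinear_simps in_D)
  then have "0 \<le> Re (\<phi> x (star (?R b) * ?R b))"
    using positive[OF x] by (simp add: complex_nonneg_Reals_iff)
  also have "star (?R b) * ?R b = star b * ?R (?R b)"
    using symmetric_op_diff[OF symmetric_op_id S(2)] by (simp add: symmetric_op_def)
  also have "?R (?R b) = b - star v * v * b"
    using S(1)[of b] by (simp add: blinfun.bilinear_simps)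
  also have "star b * \<dots> = star b * b - star (v * b) * (v * b)"
    by (simp add: right_diff_distrib star_mult mult.assoc)
  also have "\<phi> x \<dots> = \<phi> x (star b * b) - \<phi> x (star (v * b) * (v * b))"
    using v b by (intro diff x in_D)
  finally have "(seminorm_at x (v * b))\<^sup>2 \<le> (seminorm_at x b)\<^sup>2"
    using v b by (simp add: seminorm_at_square in_D)
  then have le: "seminorm_at x (v * b) \<le> seminorm_at x b"
    by (rule power2_le_imp_le) (simp add: seminorm_at_nonneg b)
  have "a * b = scaleC (of_real (norm a)) (v * b)"
    using False by (simp add: scaleC_of_real v_def)
  then have "\<phi> x (star (a * b) * (a * b)) = of_real ((norm a)\<^sup>2) * \<phi> x (star (v * b) * (v * b))"
    using x v b by (simp add: star_scaleC mult_scaleC_left mult_scaleC_right scaleC_scaleC homogeneous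
        in_D power2_eq_square)
  then have "seminorm_at x (a * b) = norm a * seminorm_at x (v * b)"
    by (simp only: seminorm_at_def) (simp add: real_sqrt_mult)
  then show ?thesis using le by (simp add: mult_left_mono)
qed

end

lemma gns_bound_norm:
  assumes a: "a \<in> D" shows "gns_bound a (norm a)"
  unfolding gns_bound_def
proof (intro ballI)
  fix x k b assume x: "x \<in> X" and kb: "k \<in> D" "b \<in> D"
  have "cmod (\<phi> x (star k * (a * b))) \<le> seminorm_at x k * seminorm_at x (a * b)"
    using a kb by (intro Cauchy_Schwarz x in_D)
  also have "\<dots> \<le> seminorm_at x k * (norm a * seminorm_at x b)"
    by (intro mult_left_mono seminorm_at_mult seminorm_at_nonneg x a kb)
  finally show "cmod (\<phi> x (star k * (a * b))) \<le> norm a * seminorm_at x k * seminorm_at x b"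
    by (simp add: mult_ac)
qed

lemma gns_boundD:
  assumes "gns_bound a M" "0 \<le> M" "x \<in> X" and ab: "a \<in> D" "b \<in> D"
  shows "seminorm_at x (a * b) \<le> M * seminorm_at x b"
proof (cases "seminorm_at x (a * b) = 0")
  case False
  then have pos: "0 < seminorm_at x (a * b)"
    using seminorm_at_nonneg[OF assms(3) in_D(2)[OF ab]] by linarith
  have "cmod (\<phi> x (star (a * b) * (a * b))) \<le> M * seminorm_at x (a * b) * seminorm_at x b"
    using assms in_D(2)[OF ab] by (auto simp: gns_bound_def)
  then have "seminorm_at x (a * b) * seminorm_at x (a * b) \<le> M * seminorm_at x (a * b) * seminorm_at x b"
    using assms in_D(2)[OF ab] by (simp add: seminorm_at_square norm_power norm_mult power2_eq_square)
  then show ?thesis using pos by (simp add: mult_ac)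
qed (use assms seminorm_at_nonneg in auto)

lemma gns_bound_star:
  assumes "gns_bound a M" and a: "a \<in> D" shows "gns_bound (star a) M"
  unfolding gns_bound_def
proof (intro ballI)
  fix x k b assume x: "x \<in> X" and kb: "k \<in> D" "b \<in> D"
  have "\<phi> x (star k * (star a * b)) = cnj (\<phi> x (star b * (a * k)))"
    using hermitian[OF x, of b "a * k"] a kb by (simp add: in_D star_mult mult.assoc)
  then show "cmod (\<phi> x (star k * (star a * b))) \<le> M * seminorm_at x k * seminorm_at x b"
    using assms(1) x kb by (auto simp: gns_bound_def mult_ac)
qed

text \<open>
  A C*-norm dominated by the norm of a C*-algebra equals it, here for the norm that comes from the
  functionals. Suppose \<open>M < \<parallel>a\<parallel>\<close>, and put \<open>c = a\<^sup>* a / \<parallel>a\<parallel>\<^sup>2\<close>. A nonzero vector that can be divided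
  by \<open>c\<^sup>2\<close> arbitrarily often at a moderate price has seminorms bounded by a null sequence, which
  contradicts faithfulness.
\<close>

lemma norm_le_gns_bound:
  assumes faithful: "\<And>e. e \<in> D \<Longrightarrow> (\<And>x. x \<in> X \<Longrightarrow> \<phi> x (star e * e) = 0) \<Longrightarrow> e = 0"
    and a: "a \<in> D" and M: "gns_bound a M" "0 \<le> M"
  shows "norm a \<le> M"
proof (rule ccontr)
  assume less: "\<not> norm a \<le> M"
  then have na: "norm a > 0" using M(2) by linarith
  define c where "c = (1 / (norm a)\<^sup>2) *\<^sub>R (star a * a)"
  define \<rho> where "\<rho> = (M / norm a)\<^sup>2"
  have \<rho>: "0 \<le> \<rho>" "\<rho> < 1"
    using less M na by (auto simp: \<rho>_def power_less_one_iff)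
  have cD: "c \<in> D" and c_star: "star c = c" and c1: "norm c = 1"
    using a na by (simp_all add: c_def in_D star_scaleR star_mult star_star cstar_identity)
  define r where "r = (1 + \<rho>\<^sup>2) / 2"
  have "\<rho>\<^sup>2 < 1" using \<rho> by (simp add: power_less_one_iff)
  then have r: "0 < r" "r < 1" "\<rho>\<^sup>2 < r" by (simp_all add: r_def add_pos_nonneg)
  obtain e B where e: "e \<in> D" "e \<noteq> 0"
    and div: "\<And>n. \<exists>u \<in> D. e = ((\<lambda>v. c * (c * v)) ^^ n) u \<and> norm u \<le> B / r ^ n"
    using ex_divisible_by_powers[OF subalgebra cD c_star c1 r(1,2)] by metis
  have "e = 0"
  proof (rule faithful[OF e(1)])
    fix x assume x: "x \<in> X"
    have c_le: "seminorm_at x (c * b) \<le> \<rho> * seminorm_at x b" if b: "b \<in> D" for b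
    proof -
      have "seminorm_at x (star a * (a * b)) \<le> M * seminorm_at x (a * b)"
        by (rule gns_boundD[OF gns_bound_star[OF M(1) a] M(2) x]) (use a b in \<open>auto simp: in_D\<close>)
      also have "\<dots> \<le> M * (M * seminorm_at x b)"
        by (intro mult_left_mono gns_boundD[OF M x a b] M)
      finally have le: "seminorm_at x (star a * (a * b)) \<le> M\<^sup>2 * seminorm_at x b"
        by (simp add: power2_eq_square)
      have "c * b = scaleC (of_real (1 / (norm a)\<^sup>2)) (star a * (a * b))"
        unfolding scaleC_of_real by (simp add: c_def mult.assoc)
      moreover define w where "w = star a * (a * b)"
      moreover have "w \<in> D" using a b by (simp add: w_def in_D)
      ultimately have "\<phi> x (star (c * b) * (c * b)) = of_real ((1 / (norm a)\<^sup>2)\<^sup>2) * \<phi> x (star w * w)"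
        using x by (simp add: star_scaleC mult_scaleC_left mult_scaleC_right scaleC_scaleC homogeneous
            in_D power2_eq_square)
      then have "seminorm_at x (c * b) = (1 / (norm a)\<^sup>2) * seminorm_at x w"
        by (simp only: seminorm_at_def) (simp add: real_sqrt_mult real_sqrt_divide)
      also have "\<dots> \<le> (1 / (norm a)\<^sup>2) * (M\<^sup>2 * seminorm_at x b)"
        using le by (intro mult_left_mono) (auto simp: w_def)
      finally show ?thesis by (simp add: \<rho>_def power_divide)
    qed
    have pow: "u \<in> D \<Longrightarrow> ((\<lambda>v. c * (c * v)) ^^ n) u \<in> D \<and>
        seminorm_at x (((\<lambda>v. c * (c * v)) ^^ n) u) \<le> (\<rho>\<^sup>2) ^ n * seminorm_at x u" for u n
    proof (induction n)
      case (Suc n)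
      let ?v = "((\<lambda>v. c * (c * v)) ^^ n) u"
      have v: "?v \<in> D" "seminorm_at x ?v \<le> (\<rho>\<^sup>2) ^ n * seminorm_at x u" using Suc by auto
      have "seminorm_at x (c * (c * ?v)) \<le> \<rho> * (\<rho> * seminorm_at x ?v)"
        using c_le[of "c * ?v"] mult_left_mono[OF c_le[of ?v] \<rho>(1)] v cD by (auto simp: in_D)
      also have "\<dots> \<le> \<rho> * (\<rho> * ((\<rho>\<^sup>2) ^ n * seminorm_at x u))"
        by (intro mult_left_mono v \<rho>)
      finally show ?case using v cD by (simp add: in_D power2_eq_square mult_ac)
    qed simp
    have le: "seminorm_at x e \<le> B * (\<rho>\<^sup>2 / r) ^ n" for n
    proof -
      obtain u where u: "u \<in> D" "e = ((\<lambda>v. c * (c * v)) ^^ n) u" "norm u \<le> B / r ^ n" using div by blast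
      have "seminorm_at x e \<le> (\<rho>\<^sup>2) ^ n * seminorm_at x u" using pow[OF u(1)] u(2) by auto
      also have "\<dots> \<le> (\<rho>\<^sup>2) ^ n * (B / r ^ n)"
        using seminorm_at_le[OF x u(1)] u(3) by (intro mult_left_mono) auto
      finally show ?thesis by (simp add: power_divide mult_ac)
    qed
    have "(\<lambda>n. B * (\<rho>\<^sup>2 / r) ^ n) \<longlonglongrightarrow> B * 0"
      using r by (intro tendsto_mult tendsto_const LIMSEQ_power_zero) (auto simp: abs_of_nonneg)
    then have "seminorm_at x e \<le> 0"
      using le by (intro LIMSEQ_le_const) auto
    then have "seminorm_at x e = 0" using seminorm_at_nonneg[OF x e(1)] by simp
    then show "\<phi> x (star e * e) = 0" by (simp add: seminorm_at_square[OF x e(1)])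
  qed
  with e(2) show False by simp
qed

lemma tendsto_functional:
  assumes x: "x \<in> X" and a: "\<And>n. a n \<in> D" "b \<in> D" "a \<longlonglongrightarrow> b"
  shows "(\<lambda>n. \<phi> x (a n)) \<longlonglongrightarrow> \<phi> x b"
proof (rule LIM_zero_cancel, rule Lim_null_comparison)
  show "\<forall>\<^sub>F n in sequentially. norm (\<phi> x (a n) - \<phi> x b) \<le> norm (a n - b)"
    using contractive[OF x] a by (simp add: diff[OF x, symmetric] in_D)
  show "(\<lambda>n. norm (a n - b)) \<longlonglongrightarrow> 0"
    using a(3) by (intro tendsto_norm_zero LIM_zero)
qed

lemma gns_bound_on_dense:
  assumes D0: "D0 \<subseteq> D" "D \<subseteq> closure D0" and a: "a \<in> D"
    and bound: "\<And>x k b. x \<in> X \<Longrightarrow> k \<in> D0 \<Longrightarrow> b \<in> D0 \<Longrightarrow>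
      cmod (\<phi> x (star k * (a * b))) \<le> M * seminorm_at x k * seminorm_at x b"
  shows "gns_bound a M"
  unfolding gns_bound_def
proof (intro ballI)
  fix x k b assume x: "x \<in> X" and kb: "k \<in> D" "b \<in> D"
  obtain k' where k': "\<And>n. k' n \<in> D0" "k' \<longlonglongrightarrow> k" using kb(1) D0(2) by (meson closure_sequential subsetD)
  obtain b' where b': "\<And>n. b' n \<in> D0" "b' \<longlonglongrightarrow> b" using kb(2) D0(2) by (meson closure_sequential subsetD)
  have D: "k' n \<in> D" "b' n \<in> D" for n using k' b' D0 by blast+
  have seminorm: "(\<lambda>n. seminorm_at x (c n)) \<longlonglongrightarrow> seminorm_at x d"
    if "\<And>n. c n \<in> D" "d \<in> D" "c \<longlonglongrightarrow> d" for c d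
    unfolding seminorm_at_def using that
    by (intro tendsto_real_sqrt tendsto_Re tendsto_functional x tendsto_mult tendsto_star in_D)
  have "(\<lambda>n. cmod (\<phi> x (star (k' n) * (a * b' n)))) \<longlonglongrightarrow> cmod (\<phi> x (star k * (a * b)))"
    by (intro tendsto_norm tendsto_functional x tendsto_mult tendsto_star tendsto_const k' b' in_D D kb a)
  moreover have "(\<lambda>n. M * seminorm_at x (k' n) * seminorm_at x (b' n)) \<longlonglongrightarrow> M * seminorm_at x k *
      seminorm_at x b"
    by (intro tendsto_mult tendsto_const seminorm k' b' D kb)
  ultimately show "cmod (\<phi> x (star k * (a * b))) \<le> M * seminorm_at x k * seminorm_at x b"
    by (rule LIMSEQ_le) (use bound x k' b' in auto)
qed

end

section \<open>Groupoids and twists\<close>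

context groupoid
begin

lemma composable_iff:
  "(\<gamma>, \<eta>) \<in> composable G \<longleftrightarrow> \<gamma> \<in> arrows G \<and> \<eta> \<in> arrows G \<and> gsrc G \<gamma> = grng G \<eta>"
  by (simp add: composable_def)

lemma units_iff: "x \<in> units G \<longleftrightarrow> x \<in> arrows G \<and> gsrc G x = x"
  unfolding units_def using src_closed src_src by (auto intro: rev_image_eqI)

lemma src_in_units [simp]: "\<gamma> \<in> arrows G \<Longrightarrow> gsrc G \<gamma> \<in> units G"
  by (simp add: units_iff src_closed src_src)

lemma rng_in_units [simp]: "\<gamma> \<in> arrows G \<Longrightarrow> grng G \<gamma> \<in> units G"
  by (simp add: units_iff rng_closed src_rng)

lemma units_arrows: "x \<in> units G \<Longrightarrow> x \<in> arrows G"
  by (simp add: units_iff)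

lemma rng_unit: "x \<in> units G \<Longrightarrow> grng G x = x"
  using rng_src[of x] by (simp add: units_iff)

lemma inv_mul_cancel: "(\<gamma>, \<eta>) \<in> composable G \<Longrightarrow> gmul G (ginv G \<gamma>) (gmul G \<gamma> \<eta>) = \<eta>"
  using mul_assoc[of "ginv G \<gamma>" \<gamma> \<eta>]
  by (simp add: composable_iff src_inv inv_closed inv_mul mul_rng)

lemma mul_inv_cancel: "(\<gamma>, \<eta>) \<in> composable G \<Longrightarrow> gmul G (gmul G \<gamma> \<eta>) (ginv G \<eta>) = \<gamma>"
  using mul_assoc[of \<gamma> \<eta> "ginv G \<eta>"]
  by (simp add: composable_iff rng_inv inv_closed mul_inv) (metis mul_src)

lemma inv_unique: "(\<gamma>, \<eta>) \<in> composable G \<Longrightarrow> gmul G \<gamma> \<eta> = grng G \<gamma> \<Longrightarrow> \<eta> = ginv G \<gamma>"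
  using inv_mul_cancel[of \<gamma> \<eta>] mul_src[of "ginv G \<gamma>"]
  by (simp add: composable_iff inv_closed src_inv)

lemma inv_inv: "\<gamma> \<in> arrows G \<Longrightarrow> ginv G (ginv G \<gamma>) = \<gamma>"
  by (rule inv_unique[symmetric]) (simp_all add: composable_iff inv_closed src_inv rng_inv inv_mul)

lemma mul_inv_mul:
  assumes "\<gamma> \<in> arrows G" "\<eta> \<in> arrows G" "gsrc G \<gamma> = gsrc G \<eta>"
  shows "gmul G (gmul G \<gamma> (ginv G \<eta>)) \<eta> = \<gamma>"
  using mul_assoc[of \<gamma> "ginv G \<eta>" \<eta>] assms
  by (simp add: composable_iff inv_closed rng_inv src_inv inv_mul) (metis mul_src)

end

context twist
begin

sublocale B: lch_etale_groupoid "base_grpd E" by (rule base)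
sublocale T: topological_groupoid "total_grpd E" by (rule total)

abbreviation "G \<equiv> base_grpd E"
abbreviation "\<Sigma> \<equiv> total_grpd E"
abbreviation "q \<equiv> proj E"
abbreviation "act \<equiv> circle_act E"
abbreviation "ev \<equiv> section_eval E"

lemma proj_closed [simp]: "\<sigma> \<in> arrows \<Sigma> \<Longrightarrow> q \<sigma> \<in> arrows G"
  using proj_surj by blast

lemma unit_fibre:
  assumes "\<sigma> \<in> arrows \<Sigma>" "q \<sigma> \<in> units G"
  obtains z where "z \<in> circle" "\<sigma> = inc E (z, q \<sigma>)"
proof -
  have "\<sigma> \<in> inc E ` (circle \<times> units G)" using exact assms by auto
  then obtain z x where "z \<in> circle" "x \<in> units G" "\<sigma> = inc E (z, x)" by auto
  then show thesis using that proj_inc by auto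
qed

lemma inc_closed [simp]: "z \<in> circle \<Longrightarrow> x \<in> units G \<Longrightarrow> inc E (z, x) \<in> arrows \<Sigma>"
  using exact by blast

lemma one_circle [simp]: "(1::complex) \<in> circle" by simp

lemma rng_total: assumes "\<sigma> \<in> arrows \<Sigma>" shows "grng \<Sigma> \<sigma> = inc E (1, grng G (q \<sigma>))"
proof -
  have r: "grng \<Sigma> \<sigma> \<in> arrows \<Sigma>" "q (grng \<Sigma> \<sigma>) = grng G (q \<sigma>)"
    using assms by (auto simp: T.rng_closed proj_rng)
  then obtain z where z: "z \<in> circle" "grng \<Sigma> \<sigma> = inc E (z, grng G (q \<sigma>))"
    using unit_fibre[of "grng \<Sigma> \<sigma>"] assms by auto
  then have "grng \<Sigma> (grng \<Sigma> \<sigma>) = inc E (1, grng G (q \<sigma>))"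
    using inc_rng[of z "grng G (q \<sigma>)"] assms by simp
  then show ?thesis using T.rng_rng[OF assms] by simp
qed

lemma src_total: assumes "\<sigma> \<in> arrows \<Sigma>" shows "gsrc \<Sigma> \<sigma> = inc E (1, gsrc G (q \<sigma>))"
proof -
  have r: "gsrc \<Sigma> \<sigma> \<in> arrows \<Sigma>" "q (gsrc \<Sigma> \<sigma>) = gsrc G (q \<sigma>)"
    using assms by (auto simp: T.src_closed proj_src)
  then obtain z where z: "z \<in> circle" "gsrc \<Sigma> \<sigma> = inc E (z, gsrc G (q \<sigma>))"
    using unit_fibre[of "gsrc \<Sigma> \<sigma>"] assms by auto
  then have "gsrc \<Sigma> (gsrc \<Sigma> \<sigma>) = inc E (1, gsrc G (q \<sigma>))"
    using inc_src[of z "gsrc G (q \<sigma>)"] assms by simp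
  then show ?thesis using T.src_src[OF assms] by simp
qed

lemma inc_one_eq_iff: "x \<in> units G \<Longrightarrow> y \<in> units G \<Longrightarrow> inc E (1, x) = inc E (1, y) \<longleftrightarrow> x = y"
  by (metis proj_inc one_circle)

lemma composable_total:
  "(\<sigma>, \<tau>) \<in> composable \<Sigma> \<longleftrightarrow> \<sigma> \<in> arrows \<Sigma> \<and> \<tau> \<in> arrows \<Sigma> \<and> gsrc G (q \<sigma>) = grng G (q \<tau>)"
  unfolding T.composable_iff by (auto simp: src_total rng_total inc_one_eq_iff)

lemma proj_inv: assumes "\<sigma> \<in> arrows \<Sigma>" shows "q (ginv \<Sigma> \<sigma>) = ginv G (q \<sigma>)"
proof (rule B.inv_unique)
  have comp: "(\<sigma>, ginv \<Sigma> \<sigma>) \<in> composable \<Sigma>"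
    using assms by (simp add: T.composable_iff T.inv_closed T.rng_inv)
  then show "(q \<sigma>, q (ginv \<Sigma> \<sigma>)) \<in> composable G"
    using assms by (simp add: composable_total B.composable_iff)
  show "gmul G (q \<sigma>) (q (ginv \<Sigma> \<sigma>)) = grng G (q \<sigma>)"
    using proj_mul[OF comp] assms by (simp add: T.mul_inv proj_rng)
qed

subsection \<open>The circle action\<close>

lemma circle_mult [simp]: "z \<in> circle \<Longrightarrow> w \<in> circle \<Longrightarrow> z * w \<in> circle"
  by (simp add: norm_mult)

lemma circle_cnj [simp]: "z \<in> circle \<Longrightarrow> cnj z \<in> circle"
  by simp

lemma circle_cnj_mult: "z \<in> circle \<Longrightarrow> cnj z * z = 1" "z \<in> circle \<Longrightarrow> z * cnj z = 1"
  by (simp_all add: complex_norm_square[symmetric] mult.commute[of "cnj z"])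

lemma act_composable:
  assumes "z \<in> circle" "\<sigma> \<in> arrows \<Sigma>"
  shows "(inc E (z, grng G (q \<sigma>)), \<sigma>) \<in> composable \<Sigma>"
  using assms proj_inc[of z "grng G (q \<sigma>)"] by (simp add: composable_total B.src_rng)

lemma act_closed [simp]: "z \<in> circle \<Longrightarrow> \<sigma> \<in> arrows \<Sigma> \<Longrightarrow> act z \<sigma> \<in> arrows \<Sigma>"
  unfolding circle_act_def by (intro T.mul_closed act_composable)

lemma proj_act [simp]: "z \<in> circle \<Longrightarrow> \<sigma> \<in> arrows \<Sigma> \<Longrightarrow> q (act z \<sigma>) = q \<sigma>"
  unfolding circle_act_def by (simp add: proj_mul act_composable proj_inc B.mul_rng)

lemma act_one [simp]: "\<sigma> \<in> arrows \<Sigma> \<Longrightarrow> act 1 \<sigma> = \<sigma>"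
  unfolding circle_act_def by (simp add: rng_total[symmetric] T.mul_rng)

lemma act_mult:
  assumes "z \<in> circle" "(\<sigma>, \<tau>) \<in> composable \<Sigma>"
  shows "gmul \<Sigma> (act z \<sigma>) \<tau> = act z (gmul \<Sigma> \<sigma> \<tau>)"
    and "gmul \<Sigma> \<sigma> (act z \<tau>) = act z (gmul \<Sigma> \<sigma> \<tau>)"
proof -
  have st: "\<sigma> \<in> arrows \<Sigma>" "\<tau> \<in> arrows \<Sigma>" "gsrc G (q \<sigma>) = grng G (q \<tau>)"
    using assms by (auto simp: composable_total)
  have "q (gmul \<Sigma> \<sigma> \<tau>) = gmul G (q \<sigma>) (q \<tau>)" using assms proj_mul by blast
  moreover have "grng G (gmul G (q \<sigma>) (q \<tau>)) = grng G (q \<sigma>)"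
    using st by (intro B.rng_mul) (simp add: B.composable_iff)
  ultimately have eq: "act z (gmul \<Sigma> \<sigma> \<tau>) = gmul \<Sigma> (inc E (z, grng G (q \<sigma>))) (gmul \<Sigma> \<sigma> \<tau>)"
    by (simp add: circle_act_def)
  also have "\<dots> = gmul \<Sigma> (act z \<sigma>) \<tau>"
    using T.mul_assoc[OF act_composable[OF assms(1) st(1)] assms(2)] by (simp add: circle_act_def)
  finally show 1: "gmul \<Sigma> (act z \<sigma>) \<tau> = act z (gmul \<Sigma> \<sigma> \<tau>)" by simp
  have c: "(\<sigma>, inc E (z, gsrc G (q \<sigma>))) \<in> composable \<Sigma>"
    using st(1,2) assms(1) by (simp add: composable_total proj_inc B.rng_src)
  have "gmul \<Sigma> (act z \<sigma>) \<tau> = gmul \<Sigma> (gmul \<Sigma> \<sigma> (inc E (z, gsrc G (q \<sigma>)))) \<tau>"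
    using central[OF assms(1) st(1)] by (simp add: circle_act_def)
  also have "\<dots> = gmul \<Sigma> \<sigma> (act z \<tau>)"
    using T.mul_assoc[OF c, of \<tau>] act_composable[OF assms(1) st(2)] st(3) by (simp add: circle_act_def)
  finally show "gmul \<Sigma> \<sigma> (act z \<tau>) = act z (gmul \<Sigma> \<sigma> \<tau>)" using 1 by simp
qed

lemma act_act:
  assumes "z \<in> circle" "w \<in> circle" "\<sigma> \<in> arrows \<Sigma>"
  shows "act z (act w \<sigma>) = act (z * w) \<sigma>"
proof -
  let ?x = "grng G (q \<sigma>)"
  have x: "?x \<in> units G" using assms by simp
  have "act z (act w \<sigma>) = gmul \<Sigma> (inc E (z, ?x)) (gmul \<Sigma> (inc E (w, ?x)) \<sigma>)"
    using proj_act[OF assms(2,3)] by (simp add: circle_act_def)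
  also have "\<dots> = gmul \<Sigma> (gmul \<Sigma> (inc E (z, ?x)) (inc E (w, ?x))) \<sigma>"
    using T.mul_assoc[of "inc E (z, ?x)" "inc E (w, ?x)" \<sigma>] act_composable[OF assms(2,3)] assms x
    by (simp add: composable_total proj_inc B.rng_unit B.src_rng)
  finally show ?thesis using inc_mul[OF assms(1,2) x] by (simp add: circle_act_def)
qed

lemma act_cnj [simp]:
  assumes "z \<in> circle" "\<sigma> \<in> arrows \<Sigma>"
  shows "act (cnj z) (act z \<sigma>) = \<sigma>" "act z (act (cnj z) \<sigma>) = \<sigma>"
  using act_act[of "cnj z" z \<sigma>] act_act[of z "cnj z" \<sigma>] circle_cnj[of z] assms by (simp_all add:
      circle_cnj_mult)

lemma act_free:
  assumes "z \<in> circle" "w \<in> circle" "\<sigma> \<in> arrows \<Sigma>" "act z \<sigma> = act w \<sigma>"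
  shows "z = w"
proof -
  let ?x = "grng G (q \<sigma>)"
  have "inc E (z, ?x) = gmul \<Sigma> (act z \<sigma>) (ginv \<Sigma> \<sigma>)"
    using T.mul_inv_cancel[OF act_composable[OF assms(1,3)]] by (simp add: circle_act_def)
  also have "\<dots> = inc E (w, ?x)"
    unfolding assms(4) using T.mul_inv_cancel[OF act_composable[OF assms(2,3)]] by (simp add:
        circle_act_def)
  finally have "(z, ?x) = (w, ?x)"
    by (rule inj_onD[OF inc_inj]) (use assms in simp_all)
  then show ?thesis by simp
qed

lemma act_transitive:
  assumes "\<sigma> \<in> arrows \<Sigma>" "\<tau> \<in> arrows \<Sigma>" "q \<sigma> = q \<tau>"
  obtains z where "z \<in> circle" "\<sigma> = act z \<tau>"
proof -
  let ?u = "gmul \<Sigma> \<sigma> (ginv \<Sigma> \<tau>)"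
  have c: "(\<sigma>, ginv \<Sigma> \<tau>) \<in> composable \<Sigma>"
    using assms by (simp add: composable_total T.inv_closed proj_inv B.rng_inv)
  have u: "?u \<in> arrows \<Sigma>" "q ?u = grng G (q \<tau>)"
    using assms c by (auto simp: T.mul_closed proj_mul proj_inv B.mul_inv)
  then obtain z where z: "z \<in> circle" "?u = inc E (z, grng G (q \<tau>))"
    using unit_fibre[of ?u] assms by auto
  have "gmul \<Sigma> ?u \<tau> = \<sigma>"
    using assms by (intro T.mul_inv_mul) (auto simp: src_total)
  then have "\<sigma> = act z \<tau>" using z by (simp add: circle_act_def)
  with z show thesis using that by blast
qed

lemma act_inv:
  assumes "z \<in> circle" "\<sigma> \<in> arrows \<Sigma>"
  shows "ginv \<Sigma> (act z \<sigma>) = act (cnj z) (ginv \<Sigma> \<sigma>)"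
proof (rule T.inv_unique[symmetric])
  have s: "cnj z \<in> circle" "ginv \<Sigma> \<sigma> \<in> arrows \<Sigma>" using assms by (simp_all add: T.inv_closed)
  have c: "(\<sigma>, ginv \<Sigma> \<sigma>) \<in> composable \<Sigma>"
    using assms by (simp add: T.composable_iff T.inv_closed T.rng_inv)
  show c': "(act z \<sigma>, act (cnj z) (ginv \<Sigma> \<sigma>)) \<in> composable \<Sigma>"
    using c assms s by (simp add: composable_total)
  have "gmul \<Sigma> (act z \<sigma>) (act (cnj z) (ginv \<Sigma> \<sigma>)) = act z (gmul \<Sigma> \<sigma> (act (cnj z) (ginv \<Sigma> \<sigma>)))"
    using c' assms by (intro act_mult) (simp_all add: composable_total)
  also have "\<dots> = grng \<Sigma> \<sigma>"
    using act_mult(2)[OF s(1) c] assms by (simp add: T.mul_inv T.rng_closed)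
  finally show "gmul \<Sigma> (act z \<sigma>) (act (cnj z) (ginv \<Sigma> \<sigma>)) = grng \<Sigma> (act z \<sigma>)"
    using assms by (simp add: rng_total)
qed

end

section \<open>Sections of the line bundle in coordinates\<close>

text \<open>
  A section \<open>f\<close> is handled through its coordinates \<open>ev \<sigma> f\<close>, a function on \<open>\<Sigma>\<close> that satisfies
  \<open>ev (\<mu> \<sigma>) f = cnj \<mu> ev \<sigma> f\<close> on the circle orbits. All operations on sections become
  pointwise operations or convolution sums of such functions.
\<close>

context twist
begin

lemma line_rel_iff: "((z, \<sigma>), (w, \<tau>)) \<in> line_rel E \<longleftrightarrow>
    \<sigma> \<in> arrows \<Sigma> \<and> \<tau> \<in> arrows \<Sigma> \<and> (\<exists>\<mu> \<in> circle. z = cnj \<mu> * w \<and> \<sigma> = act \<mu> \<tau>)"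
  by (simp add: line_rel_def)

lemma equiv_line_rel: "equiv (UNIV \<times> arrows \<Sigma>) (line_rel E)"
proof (rule equivI)
  show "line_rel E \<subseteq> (UNIV \<times> arrows \<Sigma>) \<times> UNIV \<times> arrows \<Sigma>"
    by (auto simp: line_rel_def)
  show "refl_on (UNIV \<times> arrows \<Sigma>) (line_rel E)"
    by (rule refl_onI) (auto simp: line_rel_iff intro!: bexI[of _ 1])
  show "sym (line_rel E)"
  proof (rule symI)
    fix p p' assume "(p, p') \<in> line_rel E"
    moreover obtain z \<sigma> w \<tau> where p: "p = (z, \<sigma>)" "p' = (w, \<tau>)" by (metis prod.exhaust)
    ultimately obtain \<mu> where \<mu>: "\<mu> \<in> circle" "z = cnj \<mu> * w" "\<sigma> = act \<mu> \<tau>" "\<tau> \<in> arrows \<Sigma>"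
      by (auto simp: line_rel_iff)
    have "w = cnj (cnj \<mu>) * z" using \<mu>(2) circle_cnj_mult(2)[OF \<mu>(1)]
      by (simp add: mult.assoc[symmetric])
    moreover have "\<tau> = act (cnj \<mu>) \<sigma>" using \<mu> by (simp only: act_cnj)
    ultimately show "(p', p) \<in> line_rel E"
      unfolding p line_rel_iff using \<mu> circle_cnj by (metis act_closed)
  qed
  show "trans (line_rel E)"
  proof (rule transI)
    fix p p' p'' assume rel: "(p, p') \<in> line_rel E" "(p', p'') \<in> line_rel E"
    obtain z \<sigma> w \<tau> v \<rho> where p: "p = (z, \<sigma>)" "p' = (w, \<tau>)" "p'' = (v, \<rho>)" by (metis prod.exhaust)
    obtain \<mu> \<nu> where m: "\<mu> \<in> circle" "z = cnj \<mu> * w" "\<sigma> = act \<mu> \<tau>" "\<nu> \<in> circle" "w = cnj \<nu> * v"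
        "\<tau> = act \<nu> \<rho>"
      "\<rho> \<in> arrows \<Sigma>" using rel unfolding p line_rel_iff by blast
    have "z = cnj (\<mu> * \<nu>) * v" "\<sigma> = act (\<mu> * \<nu>) \<rho>"
      using m by (simp_all only: act_act complex_cnj_mult mult.assoc)
    then show "(p, p'') \<in> line_rel E"
      unfolding p line_rel_iff using m circle_mult act_closed by metis
  qed
qed

lemma line_class_eq_iff:
  assumes "\<sigma> \<in> arrows \<Sigma>" "\<tau> \<in> arrows \<Sigma>"
  shows "line_class E z \<sigma> = line_class E w \<tau> \<longleftrightarrow> (\<exists>\<mu> \<in> circle. z = cnj \<mu> * w \<and> \<sigma> = act \<mu> \<tau>)"
  using eq_equiv_class_iff[OF equiv_line_rel, of "(z, \<sigma>)" "(w, \<tau>)"] assms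
  by (simp add: line_class_def line_rel_iff)

lemma line_class_inject:
  assumes "\<sigma> \<in> arrows \<Sigma>"
  shows "line_class E z \<sigma> = line_class E w \<sigma> \<longleftrightarrow> z = w"
proof
  assume "line_class E z \<sigma> = line_class E w \<sigma>"
  then obtain \<mu> where \<mu>: "\<mu> \<in> circle" "z = cnj \<mu> * w" "\<sigma> = act \<mu> \<sigma>"
    unfolding line_class_eq_iff[OF assms assms] by blast
  then have "act \<mu> \<sigma> = act 1 \<sigma>" using assms by simp
  then have "\<mu> = 1" by (rule act_free[OF \<mu>(1) one_circle assms])
  then show "z = w" using \<mu> by simp
qed simp

lemma line_class_act:
  assumes "\<mu> \<in> circle" "\<sigma> \<in> arrows \<Sigma>"
  shows "line_class E z (act \<mu> \<sigma>) = line_class E (\<mu> * z) \<sigma>"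
proof -
  have "z = cnj \<mu> * (\<mu> * z)" using circle_cnj_mult(1)[OF assms(1)] by (simp add: mult.assoc[symmetric])
  then show ?thesis using assms line_class_eq_iff[of "act \<mu> \<sigma>" \<sigma>] act_closed by blast
qed

lemma line_coord_class [simp]: "\<sigma> \<in> arrows \<Sigma> \<Longrightarrow> line_coord E \<sigma> (line_class E z \<sigma>) = z"
  unfolding line_coord_def by (rule the_equality) (auto simp: line_class_inject)

lemma line_class_cases:
  assumes "l \<in> line_fibre E (q \<sigma>)" "\<sigma> \<in> arrows \<Sigma>"
  obtains z where "l = line_class E z \<sigma>"
proof -
  obtain z \<tau> where l: "l = line_class E z \<tau>" "\<tau> \<in> arrows \<Sigma>" "q \<tau> = q \<sigma>"
    using assms by (auto simp: line_fibre_def)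
  obtain \<mu> where "\<mu> \<in> circle" "\<tau> = act \<mu> \<sigma>" using act_transitive[OF l(2) assms(2) l(3)] .
  then show thesis using that l line_class_act assms by metis
qed

lemma line_class_in_fibre: "\<sigma> \<in> arrows \<Sigma> \<Longrightarrow> line_class E z \<sigma> \<in> line_fibre E (q \<sigma>)"
  by (auto simp: line_fibre_def)

lemma line_zero_class: "\<sigma> \<in> arrows \<Sigma> \<Longrightarrow> line_zero E (q \<sigma>) = line_class E 0 \<sigma>"
  unfolding line_zero_def
proof (rule the_equality)
  fix n assume s: "\<sigma> \<in> arrows \<Sigma>" and "\<exists>\<tau>\<in>arrows \<Sigma>. q \<tau> = q \<sigma> \<and> n = line_class E 0 \<tau>"
  then obtain \<tau> where t: "\<tau> \<in> arrows \<Sigma>" "q \<tau> = q \<sigma>" "n = line_class E 0 \<tau>" by blast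
  obtain \<mu> where "\<mu> \<in> circle" "\<tau> = act \<mu> \<sigma>" using act_transitive[OF t(1) s t(2)] .
  then show "n = line_class E 0 \<sigma>" using t s line_class_act[of \<mu> \<sigma> 0] by simp
qed blast

text \<open>
  The action is free, so the factor that compares two representatives of one point compares all the
  coordinates over that arrow; hence the fibrewise operations do not depend on representatives.
\<close>

lemma line_class_change:
  assumes "\<sigma> \<in> arrows \<Sigma>" "\<tau> \<in> arrows \<Sigma>" "line_class E z \<sigma> = line_class E z' \<tau>"
  obtains \<mu> where "\<mu> \<in> circle" "\<sigma> = act \<mu> \<tau>"
    "\<And>w w'. line_class E w \<sigma> = line_class E w' \<tau> \<longleftrightarrow> w = cnj \<mu> * w'"
proof -
  obtain \<mu> where \<mu>: "\<mu> \<in> circle" "\<sigma> = act \<mu> \<tau>"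
    using assms line_class_eq_iff by blast
  have "line_class E w \<sigma> = line_class E w' \<tau> \<longleftrightarrow> w = cnj \<mu> * w'" for w w'
    unfolding line_class_eq_iff[OF assms(1,2)]
    using \<mu> act_free[OF \<mu>(1) _ assms(2)] by metis
  with \<mu> show thesis using that by blast
qed

lemma line_norm_class: "\<sigma> \<in> arrows \<Sigma> \<Longrightarrow> line_norm E (line_class E z \<sigma>) = cmod z"
  unfolding line_norm_def
proof (rule the_equality)
  fix r assume s: "\<sigma> \<in> arrows \<Sigma>" and
    "\<exists>\<tau>\<in>arrows \<Sigma>. \<exists>w. line_class E z \<sigma> = line_class E w \<tau> \<and> r = cmod w"
  then obtain \<tau> w where t: "\<tau> \<in> arrows \<Sigma>" "line_class E z \<sigma> = line_class E w \<tau>" "r = cmod w" by blast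
  obtain \<mu> where "\<mu> \<in> circle" "z = cnj \<mu> * w"
    using t(2) line_class_eq_iff[OF s t(1)] by blast
  then show "r = cmod z" using t(3) by (simp add: norm_mult)
qed blast

lemma line_add_class: "\<sigma> \<in> arrows \<Sigma> \<Longrightarrow> line_add E (line_class E z \<sigma>) (line_class E w \<sigma>) = line_class E (z
    + w) \<sigma>"
  unfolding line_add_def
proof (rule the_equality)
  fix n assume s: "\<sigma> \<in> arrows \<Sigma>" and "\<exists>\<tau>\<in>arrows \<Sigma>. \<exists>z' w'. line_class E z \<sigma> = line_class E z' \<tau> \<and>
    line_class E w \<sigma> = line_class E w' \<tau> \<and> n = line_class E (z' + w') \<tau>"
  then obtain \<tau> z' w' where t: "\<tau> \<in> arrows \<Sigma>" "line_class E z \<sigma> = line_class E z' \<tau>"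
    "line_class E w \<sigma> = line_class E w' \<tau>" "n = line_class E (z' + w') \<tau>" by blast
  show "n = line_class E (z + w) \<sigma>"
    using line_class_change[OF s t(1,2)] t by (metis distrib_left)
qed blast

lemma line_scale_class: "\<sigma> \<in> arrows \<Sigma> \<Longrightarrow> line_scale E c (line_class E z \<sigma>) = line_class E (c * z) \<sigma>"
  unfolding line_scale_def
proof (rule the_equality)
  fix n assume s: "\<sigma> \<in> arrows \<Sigma>" and
    "\<exists>\<tau>\<in>arrows \<Sigma>. \<exists>z'. line_class E z \<sigma> = line_class E z' \<tau> \<and> n = line_class E (c * z') \<tau>"
  then obtain \<tau> z' where t: "\<tau> \<in> arrows \<Sigma>" "line_class E z \<sigma> = line_class E z' \<tau>"
    "n = line_class E (c * z') \<tau>" by blast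
  show "n = line_class E (c * z) \<sigma>"
    using line_class_change[OF s t(1,2)] t by (metis mult.left_commute)
qed blast

lemma line_star_class:
  "\<sigma> \<in> arrows \<Sigma> \<Longrightarrow> line_star E (line_class E z \<sigma>) = line_class E (cnj z) (ginv \<Sigma> \<sigma>)"
  unfolding line_star_def
proof (rule the_equality)
  fix n assume s: "\<sigma> \<in> arrows \<Sigma>" and
    "\<exists>\<tau>\<in>arrows \<Sigma>. \<exists>z'. line_class E z \<sigma> = line_class E z' \<tau> \<and> n = line_class E (cnj z') (ginv \<Sigma> \<tau>)"
  then obtain \<tau> z' where t: "\<tau> \<in> arrows \<Sigma>" "line_class E z \<sigma> = line_class E z' \<tau>"
    "n = line_class E (cnj z') (ginv \<Sigma> \<tau>)" by blast
  obtain \<mu> where m: "\<mu> \<in> circle" "\<sigma> = act \<mu> \<tau>" "z = cnj \<mu> * z'"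
    using line_class_change[OF s t(1,2)] t(2) by metis
  have "line_class E (cnj z) (ginv \<Sigma> \<sigma>) = line_class E (cnj \<mu> * (\<mu> * cnj z')) (ginv \<Sigma> \<tau>)"
    using m t(1) line_class_act[OF circle_cnj[OF m(1)] T.inv_closed[OF t(1)]]
    by (simp add: act_inv)
  also have "cnj \<mu> * (\<mu> * cnj z') = cnj z'"
    using circle_cnj_mult(1)[OF m(1)] by (simp add: mult.assoc[symmetric])
  finally show "n = line_class E (cnj z) (ginv \<Sigma> \<sigma>)" using t(3) by simp
qed blast

lemma line_mul_class:
  assumes "(\<sigma>, \<tau>) \<in> composable \<Sigma>"
  shows "line_mul E (line_class E z \<sigma>) (line_class E w \<tau>) = line_class E (z * w) (gmul \<Sigma> \<sigma> \<tau>)"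
  unfolding line_mul_def
proof (rule the_equality)
  show "\<exists>(\<sigma>', \<tau>')\<in>composable \<Sigma>. \<exists>z' w'. line_class E z \<sigma> = line_class E z' \<sigma>' \<and>
      line_class E w \<tau> = line_class E w' \<tau>' \<and>
      line_class E (z * w) (gmul \<Sigma> \<sigma> \<tau>) = line_class E (z' * w') (gmul \<Sigma> \<sigma>' \<tau>')"
    using assms by blast
  fix n assume "\<exists>(\<sigma>', \<tau>')\<in>composable \<Sigma>. \<exists>z' w'. line_class E z \<sigma> = line_class E z' \<sigma>' \<and>
      line_class E w \<tau> = line_class E w' \<tau>' \<and> n = line_class E (z' * w') (gmul \<Sigma> \<sigma>' \<tau>')"
  then obtain \<sigma>' \<tau>' z' w' where t: "(\<sigma>', \<tau>') \<in> composable \<Sigma>" "line_class E z \<sigma> = line_class E z' \<sigma>'"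
      "line_class E w \<tau> = line_class E w' \<tau>'" "n = line_class E (z' * w') (gmul \<Sigma> \<sigma>' \<tau>')" by blast
  have arr: "\<sigma> \<in> arrows \<Sigma>" "\<tau> \<in> arrows \<Sigma>" "\<sigma>' \<in> arrows \<Sigma>" "\<tau>' \<in> arrows \<Sigma>"
    using assms t by (auto simp: composable_total)
  obtain \<mu> where m: "\<mu> \<in> circle" "\<sigma> = act \<mu> \<sigma>'" "z = cnj \<mu> * z'"
    using line_class_change[OF arr(1,3) t(2)] t(2) by metis
  obtain \<nu> where n: "\<nu> \<in> circle" "\<tau> = act \<nu> \<tau>'" "w = cnj \<nu> * w'"
    using line_class_change[OF arr(2,4) t(3)] t(3) by metis
  have c: "(\<sigma>', act \<nu> \<tau>') \<in> composable \<Sigma>" using t(1) n by (simp add: composable_total)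
  have p: "gmul \<Sigma> \<sigma>' \<tau>' \<in> arrows \<Sigma>" using t(1) by (rule T.mul_closed)
  have "gmul \<Sigma> \<sigma> \<tau> = act (\<mu> * \<nu>) (gmul \<Sigma> \<sigma>' \<tau>')"
    unfolding m n using act_mult(1)[OF m(1) c] act_mult(2)[OF n(1) t(1)] act_act[OF m(1) n(1) p] by simp
  then have "line_class E (z * w) (gmul \<Sigma> \<sigma> \<tau>) = line_class E (\<mu> * \<nu> * (z * w)) (gmul \<Sigma> \<sigma>' \<tau>')"
    using line_class_act[OF circle_mult[OF m(1) n(1)] p] by simp
  also have "\<mu> * \<nu> * (z * w) = (cnj \<mu> * \<mu>) * (cnj \<nu> * \<nu>) * (z' * w')"
    unfolding m(3) n(3) by (simp add: mult_ac)
  finally show "n = line_class E (z * w) (gmul \<Sigma> \<sigma> \<tau>)"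
    using t(4) circle_cnj_mult(1)[OF m(1)] circle_cnj_mult(1)[OF n(1)] by simp
qed

subsection \<open>Sections\<close>

text \<open>Sections that need not be continuous.\<close>

abbreviation "sections \<equiv> (\<Pi>\<^sub>E \<gamma> \<in> arrows G. line_fibre E \<gamma>)"

definition lift :: "'g \<Rightarrow> 's" where
  "lift \<gamma> = (SOME \<sigma>. \<sigma> \<in> arrows \<Sigma> \<and> q \<sigma> = \<gamma>)"

lemma lift: assumes "\<gamma> \<in> arrows G" shows lift_closed: "lift \<gamma> \<in> arrows \<Sigma>" and proj_lift: "q (lift \<gamma>) = \<gamma>"
proof -
  have "\<exists>\<sigma>. \<sigma> \<in> arrows \<Sigma> \<and> q \<sigma> = \<gamma>" using proj_surj assms by (metis imageE)
  from someI_ex[OF this] show "lift \<gamma> \<in> arrows \<Sigma>" "q (lift \<gamma>) = \<gamma>" unfolding lift_def by auto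
qed

lemma section_value:
  assumes "f \<in> sections" "\<sigma> \<in> arrows \<Sigma>"
  shows "f (q \<sigma>) = line_class E (ev \<sigma> f) \<sigma>"
proof -
  have "f (q \<sigma>) \<in> line_fibre E (q \<sigma>)" using assms by (auto simp: PiE_def)
  then obtain z where "f (q \<sigma>) = line_class E z \<sigma>" using line_class_cases assms(2) by metis
  then show ?thesis using assms(2) by (simp add: section_eval_def)
qed

lemma ev_act:
  assumes "f \<in> sections" "\<sigma> \<in> arrows \<Sigma>" "\<mu> \<in> circle"
  shows "ev (act \<mu> \<sigma>) f = cnj \<mu> * ev \<sigma> f"
proof -
  have "line_class E (ev (act \<mu> \<sigma>) f) (act \<mu> \<sigma>) = line_class E (ev \<sigma> f) \<sigma>"
    using section_value[OF assms(1,2)] section_value[OF assms(1) act_closed[OF assms(3,2)]] assms by simp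
  then have "\<mu> * ev (act \<mu> \<sigma>) f = ev \<sigma> f"
    using assms by (simp add: line_class_act line_class_inject)
  then show ?thesis using circle_cnj_mult(1)[OF assms(3)] by (metis mult.assoc mult_1)
qed

lemma section_eqI:
  assumes "f \<in> sections" "g \<in> sections" "\<And>\<sigma>. \<sigma> \<in> arrows \<Sigma> \<Longrightarrow> ev \<sigma> f = ev \<sigma> g"
  shows "f = g"
proof (rule PiE_ext[OF assms(1,2)])
  fix \<gamma> assume "\<gamma> \<in> arrows G"
  then show "f \<gamma> = g \<gamma>"
    using section_value[OF assms(1), of "lift \<gamma>"] section_value[OF assms(2), of "lift \<gamma>"] assms(3)
    by (simp add: lift)
qed

definition equivariant :: "('s \<Rightarrow> complex) \<Rightarrow> bool" where
  "equivariant F \<longleftrightarrow> (\<forall>\<sigma> \<in> arrows \<Sigma>. \<forall>\<mu> \<in> circle. F (act \<mu> \<sigma>) = cnj \<mu> * F \<sigma>)"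

definition section_of :: "('s \<Rightarrow> complex) \<Rightarrow> ('g, 's) line_section" where
  "section_of F = (\<lambda>\<gamma> \<in> arrows G. line_class E (F (lift \<gamma>)) (lift \<gamma>))"

lemma section_of_in_sections: "section_of F \<in> sections"
proof -
  have "line_class E (F (lift \<gamma>)) (lift \<gamma>) \<in> line_fibre E \<gamma>" if "\<gamma> \<in> arrows G" for \<gamma>
    using line_class_in_fibre[OF lift_closed[OF that]] proj_lift[OF that] by simp
  then show ?thesis by (auto simp: section_of_def)
qed

lemma ev_section_of:
  assumes "equivariant F" "\<sigma> \<in> arrows \<Sigma>" shows "ev \<sigma> (section_of F) = F \<sigma>"
proof -
  have \<gamma>: "q \<sigma> \<in> arrows G" using assms by simp
  obtain \<mu> where \<mu>: "\<mu> \<in> circle" "lift (q \<sigma>) = act \<mu> \<sigma>"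
    using act_transitive[OF lift_closed[OF \<gamma>] assms(2) proj_lift[OF \<gamma>]] .
  have "line_class E (F (lift (q \<sigma>))) (lift (q \<sigma>)) = line_class E (\<mu> * (cnj \<mu> * F \<sigma>)) \<sigma>"
    unfolding \<mu>(2) using assms \<mu>(1) by (simp add: line_class_act equivariant_def)
  also have "\<mu> * (cnj \<mu> * F \<sigma>) = F \<sigma>"
    using circle_cnj_mult(2)[OF \<mu>(1)] by (simp add: mult.assoc[symmetric])
  finally show ?thesis using assms \<gamma> by (simp add: section_eval_def section_of_def)
qed

lemma section_eq_zero_iff:
  assumes "f \<in> sections" "\<sigma> \<in> arrows \<Sigma>" shows "f (q \<sigma>) = line_zero E (q \<sigma>) \<longleftrightarrow> ev \<sigma> f = 0"
  using assms by (simp add: section_value line_zero_class line_class_inject)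

lemma cmod_ev_eq:
  assumes "f \<in> sections" "\<sigma> \<in> arrows \<Sigma>" "\<tau> \<in> arrows \<Sigma>" "q \<sigma> = q \<tau>"
  shows "cmod (ev \<sigma> f) = cmod (ev \<tau> f)"
  using line_norm_class[OF assms(2)] line_norm_class[OF assms(3)]
    section_value[OF assms(1,2)] section_value[OF assms(1,3)] assms(4) by metis

lemma line_norm_section: "f \<in> sections \<Longrightarrow> \<sigma> \<in> arrows \<Sigma> \<Longrightarrow> line_norm E (f (q \<sigma>)) = cmod (ev \<sigma> f)"
  by (simp add: section_value line_norm_class)

text \<open>
  Each operation on sections is given fibrewise by representatives; a formula for a representative
  over every \<open>\<sigma>\<close> amounts to a formula for the coordinates.
\<close>

lemma section_by_coordinates:
  assumes "\<And>\<sigma>. \<sigma> \<in> arrows \<Sigma> \<Longrightarrow> F (q \<sigma>) = line_class E (c \<sigma>) \<sigma>"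
  shows "restrict F (arrows G) \<in> sections"
    and "\<sigma> \<in> arrows \<Sigma> \<Longrightarrow> ev \<sigma> (restrict F (arrows G)) = c \<sigma>"
proof -
  show "restrict F (arrows G) \<in> sections"
  proof (intro PiE_I)
    fix \<gamma> assume "\<gamma> \<in> arrows G"
    then show "restrict F (arrows G) \<gamma> \<in> line_fibre E \<gamma>"
      using assms[of "lift \<gamma>"] line_class_in_fibre[of "lift \<gamma>"] by (simp add: lift)
  qed simp
  show "\<sigma> \<in> arrows \<Sigma> \<Longrightarrow> ev \<sigma> (restrict F (arrows G)) = c \<sigma>"
    using assms by (simp add: section_eval_def)
qed

lemma
  assumes "f \<in> sections" "g \<in> sections"
  shows section_add_in_sections: "section_add E f g \<in> sections"
    and ev_add: "\<sigma> \<in> arrows \<Sigma> \<Longrightarrow> ev \<sigma> (section_add E f g) = ev \<sigma> f + ev \<sigma> g"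
  using section_by_coordinates[of "\<lambda>\<gamma>. line_add E (f \<gamma>) (g \<gamma>)" "\<lambda>\<sigma>. ev \<sigma> f + ev \<sigma> g"] assms
  by (simp_all add: section_add_def section_value line_add_class)

lemma
  assumes "f \<in> sections"
  shows section_scale_in_sections: "section_scale E c f \<in> sections"
    and ev_scale: "\<sigma> \<in> arrows \<Sigma> \<Longrightarrow> ev \<sigma> (section_scale E c f) = c * ev \<sigma> f"
  using section_by_coordinates[of "\<lambda>\<gamma>. line_scale E c (f \<gamma>)" "\<lambda>\<sigma>. c * ev \<sigma> f"] assms
  by (simp_all add: section_scale_def section_value line_scale_class)

lemma
  assumes "f \<in> sections"
  shows section_star_in_sections: "section_star E f \<in> sections"
    and ev_star: "\<sigma> \<in> arrows \<Sigma> \<Longrightarrow> ev \<sigma> (section_star E f) = cnj (ev (ginv \<Sigma> \<sigma>) f)"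
proof -
  have "line_star E (f (ginv G (q \<sigma>))) = line_class E (cnj (ev (ginv \<Sigma> \<sigma>) f)) \<sigma>" if "\<sigma> \<in> arrows \<Sigma>" for \<sigma>
    using that section_value[OF assms, of "ginv \<Sigma> \<sigma>"]
    by (simp add: T.inv_closed proj_inv line_star_class T.inv_inv)
  from section_by_coordinates[of "\<lambda>\<gamma>. line_star E (f (ginv G \<gamma>))", OF this]
  show "section_star E f \<in> sections" "\<sigma> \<in> arrows \<Sigma> \<Longrightarrow> ev \<sigma> (section_star E f) = cnj (ev (ginv \<Sigma> \<sigma>) f)"
    by (simp_all add: section_star_def)
qed

lemma
  assumes "\<And>\<sigma>. \<sigma> \<in> arrows \<Sigma> \<Longrightarrow> q \<sigma> \<in> Y \<Longrightarrow> f (q \<sigma>) = line_class E (c \<sigma>) \<sigma>"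
  shows section_on_in_sections: "section_on E Y f \<in> sections"
    and ev_section_on: "\<sigma> \<in> arrows \<Sigma> \<Longrightarrow> ev \<sigma> (section_on E Y f) = (if q \<sigma> \<in> Y then c \<sigma> else 0)"
  using section_by_coordinates[of "\<lambda>\<gamma>. if \<gamma> \<in> Y then f \<gamma> else line_zero E \<gamma>"
      "\<lambda>\<sigma>. if q \<sigma> \<in> Y then c \<sigma> else 0"] assms
  by (simp_all add: section_on_def line_zero_class)

subsection \<open>Convolution\<close>

abbreviation source_fibre :: "'g \<Rightarrow> 'g set" where
  "source_fibre x \<equiv> {\<beta> \<in> arrows G. gsrc G \<beta> = x}"

definition fibre_support :: "('g, 's) line_section \<Rightarrow> 'g \<Rightarrow> 'g set" where
  "fibre_support g x = {\<beta> \<in> source_fibre x. ev (lift \<beta>) g \<noteq> 0}"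

lemma
  assumes "\<sigma> \<in> arrows \<Sigma>" "\<tau> \<in> arrows \<Sigma>" "gsrc G (q \<tau>) = gsrc G (q \<sigma>)"
  shows quotient_closed: "gmul \<Sigma> \<sigma> (ginv \<Sigma> \<tau>) \<in> arrows \<Sigma>"
    and quotient_composable: "(\<sigma>, ginv \<Sigma> \<tau>) \<in> composable \<Sigma>" "(gmul \<Sigma> \<sigma> (ginv \<Sigma> \<tau>), \<tau>) \<in> composable \<Sigma>"
    and proj_quotient: "q (gmul \<Sigma> \<sigma> (ginv \<Sigma> \<tau>)) = gmul G (q \<sigma>) (ginv G (q \<tau>))"
    and quotient_mult: "gmul \<Sigma> (gmul \<Sigma> \<sigma> (ginv \<Sigma> \<tau>)) \<tau> = \<sigma>"
proof -
  show c: "(\<sigma>, ginv \<Sigma> \<tau>) \<in> composable \<Sigma>"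
    using assms by (simp add: composable_total T.inv_closed proj_inv B.rng_inv)
  show a: "gmul \<Sigma> \<sigma> (ginv \<Sigma> \<tau>) \<in> arrows \<Sigma>" using c by (rule T.mul_closed)
  show "q (gmul \<Sigma> \<sigma> (ginv \<Sigma> \<tau>)) = gmul G (q \<sigma>) (ginv G (q \<tau>))"
    using proj_mul[OF c] assms by (simp add: proj_inv)
  show "(gmul \<Sigma> \<sigma> (ginv \<Sigma> \<tau>), \<tau>) \<in> composable \<Sigma>"
    using a assms T.src_mul[OF c] by (simp add: T.composable_iff T.src_inv)
  show "gmul \<Sigma> (gmul \<Sigma> \<sigma> (ginv \<Sigma> \<tau>)) \<tau> = \<sigma>"
    using assms by (intro T.mul_inv_mul) (auto simp: src_total)
qed

text \<open>
  The factorisations \<open>\<gamma> = \<alpha> \<beta>\<close> are parametrised by the arrows \<open>\<beta>\<close> with the same source as \<open>\<gamma>\<close>,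
  namely \<open>\<alpha> = \<gamma> \<beta>\<^sup>-\<^sup>1\<close>; so convolution by \<open>f\<close> acts on the functions on a source fibre as the matrix
  with the entries \<open>f(\<gamma> \<beta>\<^sup>-\<^sup>1)\<close>.
\<close>

lemma
  assumes f: "f \<in> sections" and g: "g \<in> sections"
    and fin: "\<And>x. x \<in> units G \<Longrightarrow> finite (fibre_support g x)"
  shows section_conv_in_sections: "section_conv E f g \<in> sections"
    and ev_conv: "\<sigma> \<in> arrows \<Sigma> \<Longrightarrow> finite S \<Longrightarrow> fibre_support g (gsrc G (q \<sigma>)) \<subseteq> S \<Longrightarrow>
      S \<subseteq> source_fibre (gsrc G (q \<sigma>)) \<Longrightarrow>
      ev \<sigma> (section_conv E f g) = (\<Sum>\<beta>\<in>S. ev (gmul \<Sigma> \<sigma> (ginv \<Sigma> (lift \<beta>))) f * ev (lift \<beta>) g)"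
proof -
  define c where "c = (\<lambda>\<sigma>. \<Sum>\<beta>\<in>fibre_support g (gsrc G (q \<sigma>)).
    ev (gmul \<Sigma> \<sigma> (ginv \<Sigma> (lift \<beta>))) f * ev (lift \<beta>) g)"
  have c_act: "c (act \<mu> \<sigma>) = cnj \<mu> * c \<sigma>" if s: "\<sigma> \<in> arrows \<Sigma>" and \<mu>: "\<mu> \<in> circle" for \<sigma> \<mu>
  proof -
    have "ev (gmul \<Sigma> (act \<mu> \<sigma>) (ginv \<Sigma> (lift \<beta>))) f = cnj \<mu> * ev (gmul \<Sigma> \<sigma> (ginv \<Sigma> (lift \<beta>))) f"
      if "\<beta> \<in> fibre_support g (gsrc G (q \<sigma>))" for \<beta>
      using that s \<mu> f quotient_composable(1)[of \<sigma> "lift \<beta>"]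
      by (simp add: fibre_support_def lift act_mult ev_act T.mul_closed)
    then show ?thesis using s \<mu> by (simp add: c_def sum_distrib_left mult.assoc)
  qed
  \<comment> \<open>\<open>c\<close> is equivariant, so the choice of \<open>\<sigma>\<close> above an arrow does not affect the class \<open>[c \<sigma>, \<sigma>]\<close>.\<close>
  define P where "P = (\<lambda>\<gamma>. {(\<alpha>, \<beta>) \<in> composable G. gmul G \<alpha> \<beta> = \<gamma>})"
  have infsum: "(\<Sum>\<^sub>\<infinity>(\<alpha>, \<beta>)\<in>P (q \<sigma>). line_coord E \<sigma> (line_mul E (f \<alpha>) (g \<beta>))) = c \<sigma>"
    if s: "\<sigma> \<in> arrows \<Sigma>" for \<sigma>
  proof -
    let ?x = "gsrc G (q \<sigma>)" and ?h = "\<lambda>\<beta>. (gmul G (q \<sigma>) (ginv G \<beta>), \<beta>)"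
    have P: "P (q \<sigma>) = ?h ` source_fibre ?x"
    proof (intro equalityI subsetI)
      fix p assume "p \<in> P (q \<sigma>)"
      then obtain \<alpha> \<beta> where p: "p = (\<alpha>, \<beta>)" "(\<alpha>, \<beta>) \<in> composable G" "gmul G \<alpha> \<beta> = q \<sigma>" by (auto simp: P_def)
      then show "p \<in> ?h ` source_fibre ?x"
        using B.mul_inv_cancel[OF p(2)] B.src_mul[OF p(2)]
        by (intro image_eqI[of _ _ \<beta>]) (auto simp: B.composable_iff)
    next
      fix p assume "p \<in> ?h ` source_fibre ?x"
      then obtain \<beta> where b: "p = ?h \<beta>" "\<beta> \<in> arrows G" "gsrc G \<beta> = ?x" by auto
      have "(q \<sigma>, ginv G \<beta>) \<in> composable G" using b s by (simp add: B.composable_iff B.inv_closed B.rng_inv)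
      then show "p \<in> P (q \<sigma>)"
        using b s B.mul_inv_mul[of "q \<sigma>" \<beta>] B.src_mul[of "q \<sigma>" "ginv G \<beta>"]
        by (simp add: P_def B.composable_iff B.mul_closed B.src_inv)
    qed
    have val: "line_coord E \<sigma> (line_mul E (f (gmul G (q \<sigma>) (ginv G \<beta>))) (g \<beta>)) =
        ev (gmul \<Sigma> \<sigma> (ginv \<Sigma> (lift \<beta>))) f * ev (lift \<beta>) g" if b: "\<beta> \<in> source_fibre ?x" for \<beta>
    proof -
      have l: "lift \<beta> \<in> arrows \<Sigma>" "q (lift \<beta>) = \<beta>" "gsrc G (q (lift \<beta>)) = ?x" using b by (auto simp: lift)
      have "f (gmul G (q \<sigma>) (ginv G \<beta>)) =
          line_class E (ev (gmul \<Sigma> \<sigma> (ginv \<Sigma> (lift \<beta>))) f) (gmul \<Sigma> \<sigma> (ginv \<Sigma> (lift \<beta>)))"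
        using section_value[OF f quotient_closed[OF s l(1,3)]] proj_quotient[OF s l(1,3)] l(2) by simp
      moreover have "g \<beta> = line_class E (ev (lift \<beta>) g) (lift \<beta>)"
        using section_value[OF g l(1)] l(2) by simp
      ultimately show ?thesis
        using s by (simp add: line_mul_class quotient_composable(2)[OF s l(1,3)] quotient_mult[OF s l(1,3)])
    qed
    have "inj_on ?h (source_fibre ?x)" by (rule inj_onI) simp
    then have "(\<Sum>\<^sub>\<infinity>(\<alpha>, \<beta>)\<in>P (q \<sigma>). line_coord E \<sigma> (line_mul E (f \<alpha>) (g \<beta>))) =
        (\<Sum>\<^sub>\<infinity>\<beta>\<in>source_fibre ?x. ev (gmul \<Sigma> \<sigma> (ginv \<Sigma> (lift \<beta>))) f * ev (lift \<beta>) g)"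
      unfolding P using val by (subst infsum_reindex) (auto intro!: infsum_cong simp: o_def)
    also have "\<dots> = (\<Sum>\<^sub>\<infinity>\<beta>\<in>fibre_support g ?x. ev (gmul \<Sigma> \<sigma> (ginv \<Sigma> (lift \<beta>))) f * ev (lift \<beta>) g)"
      by (rule infsum_cong_neutral) (auto simp: fibre_support_def)
    also have "\<dots> = c \<sigma>"
      using fin s by (simp add: c_def)
    finally show ?thesis .
  qed
  have the: "(THE n. \<exists>\<sigma>' \<in> arrows \<Sigma>. q \<sigma>' = q \<sigma> \<and> n = line_class E
      (\<Sum>\<^sub>\<infinity>(\<alpha>, \<beta>)\<in>P (q \<sigma>). line_coord E \<sigma>' (line_mul E (f \<alpha>) (g \<beta>))) \<sigma>') = line_class E (c \<sigma>) \<sigma>"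
    if s: "\<sigma> \<in> arrows \<Sigma>" for \<sigma>
  proof (rule the_equality)
    show "\<exists>\<sigma>' \<in> arrows \<Sigma>. q \<sigma>' = q \<sigma> \<and> line_class E (c \<sigma>) \<sigma> = line_class E
      (\<Sum>\<^sub>\<infinity>(\<alpha>, \<beta>)\<in>P (q \<sigma>). line_coord E \<sigma>' (line_mul E (f \<alpha>) (g \<beta>))) \<sigma>'"
      using s infsum by metis
    fix n assume "\<exists>\<sigma>' \<in> arrows \<Sigma>. q \<sigma>' = q \<sigma> \<and> n = line_class E
      (\<Sum>\<^sub>\<infinity>(\<alpha>, \<beta>)\<in>P (q \<sigma>). line_coord E \<sigma>' (line_mul E (f \<alpha>) (g \<beta>))) \<sigma>'"
    then obtain \<sigma>' where s': "\<sigma>' \<in> arrows \<Sigma>" "q \<sigma>' = q \<sigma>" "n = line_class E (c \<sigma>') \<sigma>'"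
      using infsum by metis
    obtain \<mu> where "\<mu> \<in> circle" "\<sigma> = act \<mu> \<sigma>'" using act_transitive[OF s s'(1)] s'(2) by metis
    then show "n = line_class E (c \<sigma>) \<sigma>"
      using s' s c_act line_class_eq_iff by metis
  qed
  have main: "section_conv E f g \<in> sections" "\<And>\<sigma>. \<sigma> \<in> arrows \<Sigma> \<Longrightarrow> ev \<sigma> (section_conv E f g) = c \<sigma>"
    using section_by_coordinates[OF the] unfolding section_conv_def P_def by auto
  show "section_conv E f g \<in> sections" by (fact main)
  show "ev \<sigma> (section_conv E f g) = (\<Sum>\<beta>\<in>S. ev (gmul \<Sigma> \<sigma> (ginv \<Sigma> (lift \<beta>))) f * ev (lift \<beta>) g)"
    if "\<sigma> \<in> arrows \<Sigma>" "finite S" "fibre_support g (gsrc G (q \<sigma>)) \<subseteq> S"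
      "S \<subseteq> source_fibre (gsrc G (q \<sigma>))"
    unfolding main(2)[OF that(1)] c_def
    by (rule sum.mono_neutral_left[OF that(2,3)]) (use that(4) in \<open>auto simp: fibre_support_def\<close>)
qed

end

section \<open>Topology of the line bundle\<close>

lemma continuous_map_locally:
  assumes "\<And>x. x \<in> topspace X \<Longrightarrow> \<exists>N. openin X N \<and> x \<in> N \<and> continuous_map (subtopology X N) Y f"
  shows "continuous_map X Y f"
  unfolding continuous_map_def
proof (intro conjI allI impI)
  show "f \<in> topspace X \<rightarrow> topspace Y"
  proof
    fix x assume x: "x \<in> topspace X"
    from assms[OF this] obtain N where "x \<in> N" "continuous_map (subtopology X N) Y f" by blast
    then show "f x \<in> topspace Y" using x by (auto simp: continuous_map_def)
  qed
  fix V assume V: "openin Y V"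
  show "openin X {x \<in> topspace X. f x \<in> V}"
  proof (subst openin_subopen, intro ballI)
    fix x assume x: "x \<in> {x \<in> topspace X. f x \<in> V}"
    then obtain N where N: "openin X N" "x \<in> N" "continuous_map (subtopology X N) Y f"
      using assms by blast
    have "openin (subtopology X N) {y \<in> topspace (subtopology X N). f y \<in> V}"
      using N(3) V by (rule openin_continuous_map_preimage)
    then have "openin X {y \<in> topspace (subtopology X N). f y \<in> V}"
      using N(1) by (simp add: openin_open_subtopology)
    then show "\<exists>W. openin X W \<and> x \<in> W \<and> W \<subseteq> {x \<in> topspace X. f x \<in> V}"
      using x N(2) by (intro exI[of _ "{y \<in> topspace (subtopology X N). f y \<in> V}"]) auto
  qed
qed

lemma continuous_map_complex_mult:
  fixes f g :: "'a \<Rightarrow> complex"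
  shows "continuous_map X euclidean f \<Longrightarrow> continuous_map X euclidean g \<Longrightarrow>
    continuous_map X euclidean (\<lambda>x. f x * g x)"
  by (simp add: continuous_map_atin tendsto_mult)

lemma continuous_map_cnj:
  "continuous_map X euclidean f \<Longrightarrow> continuous_map X euclidean (\<lambda>x. cnj (f x))"
  by (simp add: continuous_map_atin tendsto_cnj)

lemma continuous_map_compose_on:
  assumes "continuous_map X euclidean f" "continuous_on S h" "\<And>x. x \<in> topspace X \<Longrightarrow> f x \<in> S"
  shows "continuous_map X euclidean (\<lambda>x. h (f x))"
proof -
  have "continuous_map X (top_of_set S) f"
    using assms by (auto simp: continuous_map_in_subtopology)
  moreover have "continuous_map (top_of_set S) euclidean h"
    using assms(2) by simp
  ultimately show ?thesis using continuous_map_compose[of X _ f euclidean h] by (simp add: o_def)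
qed

lemma continuous_map_clopen_cases:
  assumes U: "openin X U" "closedin X U"
    and f: "continuous_map (subtopology X U) Y f" and g: "continuous_map X Y g"
  shows "continuous_map X Y (\<lambda>x. if x \<in> U then f x else g x)"
proof (rule continuous_map_locally)
  fix x assume x: "x \<in> topspace X"
  show "\<exists>N. openin X N \<and> x \<in> N \<and> continuous_map (subtopology X N) Y (\<lambda>x. if x \<in> U then f x else g x)"
  proof (cases "x \<in> U")
    case True
    have "continuous_map (subtopology X U) Y (\<lambda>x. if x \<in> U then f x else g x)"
      by (rule continuous_map_eq[OF f]) auto
    then show ?thesis using True U by blast
  next
    case False
    have "continuous_map (subtopology X (topspace X - U)) Y (\<lambda>x. if x \<in> U then f x else g x)"
      by (rule continuous_map_eq[OF continuous_map_from_subtopology[OF g]]) auto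
    moreover have "openin X (topspace X - U)" using U(2) by (simp add: closedin_def)
    ultimately show ?thesis using False x by blast
  qed
qed

context topological_groupoid
begin

lemma topspace_gtop [simp]: "topspace (gtop G) = arrows G"
  by (simp add: arrows_def)

lemma continuous_map_gmul:
  assumes "continuous_map X (gtop G) f" "continuous_map X (gtop G) g"
    and "\<And>x. x \<in> topspace X \<Longrightarrow> (f x, g x) \<in> composable G"
  shows "continuous_map X (gtop G) (\<lambda>x. gmul G (f x) (g x))"
proof -
  have "continuous_map X (subtopology (prod_topology (gtop G) (gtop G)) (composable G)) (\<lambda>x. (f x, g x))"
    using assms by (auto simp: continuous_map_in_subtopology intro: continuous_map_pairedI)
  from continuous_map_compose[OF this continuous_mul] show ?thesis by (simp add: o_def)
qed

lemma continuous_map_ginv: "continuous_map X (gtop G) f \<Longrightarrow> continuous_map X (gtop G) (\<lambda>x. ginv G (f x))"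
  using continuous_map_compose[OF _ continuous_inv, of X f] by (simp add: o_def)

lemma continuous_map_gsrc: "continuous_map X (gtop G) f \<Longrightarrow> continuous_map X (gtop G) (\<lambda>x. gsrc G (f x))"
  using continuous_map_compose[OF _ continuous_src, of X f] by (simp add: o_def)

end

context lch_etale_groupoid
begin

lemma compactin_imp_closed: "compactin (gtop G) K \<Longrightarrow> closedin (gtop G) K"
  using Hausdorff compactin_imp_closedin by blast

lemma local_homeomorphism_section:
  assumes lh: "local_homeomorphism (gtop G) (subtopology (gtop G) (units G)) p" and \<gamma>: "\<gamma> \<in> arrows G"
  shows "\<exists>U b. openin (gtop G) U \<and> \<gamma> \<in> U \<and> openin (subtopology (gtop G) (units G)) (p ` U) \<and>
    continuous_map (subtopology (gtop G) (p ` U)) (gtop G) b \<and> (\<forall>\<beta> \<in> U. b (p \<beta>) = \<beta>)"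
proof -
  obtain U where U: "openin (gtop G) U" "\<gamma> \<in> U" "openin (subtopology (gtop G) (units G)) (p ` U)"
    and hom: "homeomorphic_map (subtopology (gtop G) U) (subtopology (subtopology (gtop G) (units G)) (p
        ` U)) p"
    using lh \<gamma> unfolding local_homeomorphism_def by auto
  obtain b where b: "homeomorphic_maps (subtopology (gtop G) U)
      (subtopology (subtopology (gtop G) (units G)) (p ` U)) p b"
    using hom homeomorphic_map_maps by blast
  have "p ` U \<subseteq> units G" using openin_subset[OF U(3)] by auto
  then have "subtopology (subtopology (gtop G) (units G)) (p ` U) = subtopology (gtop G) (p ` U)"
    by (simp add: subtopology_subtopology inf.absorb2)
  then have "continuous_map (subtopology (gtop G) (p ` U)) (gtop G) b"
    using b by (auto simp: homeomorphic_maps_def continuous_map_in_subtopology)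
  moreover have "\<forall>\<beta> \<in> U. b (p \<beta>) = \<beta>"
    using b openin_subset[OF U(1)] by (auto simp: homeomorphic_maps_def)
  ultimately show ?thesis using U by blast
qed

text \<open>
  Near a unit \<open>x\<close>, an arrow \<open>\<beta>\<close> and its source both lie in a neighbourhood of \<open>x\<close> on which the source
  map is injective, and they have the same source; so they are equal.
\<close>

lemma openin_units: "openin (gtop G) (units G)"
proof (subst openin_subopen, intro ballI)
  fix x assume x: "x \<in> units G"
  then obtain U b where U: "openin (gtop G) U" "x \<in> U" "\<forall>\<beta> \<in> U. b (gsrc G \<beta>) = \<beta>"
    using local_homeomorphism_section[OF etale_src units_arrows] by metis
  have "openin (gtop G) {\<beta> \<in> U. gsrc G \<beta> \<in> U}"
    by (rule openin_continuous_map_preimage_gen[OF continuous_src U(1,1)])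
  moreover have "{\<beta> \<in> U. gsrc G \<beta> \<in> U} \<subseteq> units G"
  proof clarify
    fix \<beta> assume b: "\<beta> \<in> U" "gsrc G \<beta> \<in> U"
    then have "\<beta> \<in> arrows G" using openin_subset[OF U(1)] by auto
    then show "\<beta> \<in> units G" using U(3) b src_src units_iff by metis
  qed
  ultimately show "\<exists>T. openin (gtop G) T \<and> x \<in> T \<and> T \<subseteq> units G"
    using x U(2) by (intro exI[of _ "{\<beta> \<in> U. gsrc G \<beta> \<in> U}"]) (simp add: units_iff)
qed

lemma closedin_units: "closedin (gtop G) (units G)"
proof -
  have "units G = {x \<in> topspace (gtop G). gsrc G x = x}" by (auto simp: units_iff)
  then show ?thesis
    using closedin_continuous_maps_eq[OF Hausdorff continuous_src continuous_map_id] by simp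
qed

lemma etale_section:
  assumes "\<gamma> \<in> arrows G"
  shows "\<exists>U b. openin (gtop G) U \<and> \<gamma> \<in> U \<and> openin (gtop G) (gsrc G ` U) \<and>
    continuous_map (subtopology (gtop G) (gsrc G ` U)) (gtop G) b \<and> (\<forall>\<beta> \<in> U. b (gsrc G \<beta>) = \<beta>)"
  using local_homeomorphism_section[OF etale_src assms] openin_trans_full[OF _ openin_units] by blast

text \<open>
  Finitely many open sets on which \<open>p\<close> is injective cover \<open>K\<close>, and each of them meets a fibre of \<open>p\<close>
  in at most one point.
\<close>

lemma local_homeomorphism_finite_fibres:
  assumes lh: "local_homeomorphism (gtop G) (subtopology (gtop G) (units G)) p"
    and K: "compactin (gtop G) K"
  shows "\<exists>m. \<forall>x. finite {\<gamma> \<in> K. p \<gamma> = x} \<and> card {\<gamma> \<in> K. p \<gamma> = x} \<le> m"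
proof -
  let ?\<U> = "{U. openin (gtop G) U \<and> inj_on p U}"
  have "\<exists>U \<in> ?\<U>. \<gamma> \<in> U" if "\<gamma> \<in> K" for \<gamma>
  proof -
    have "\<gamma> \<in> arrows G" using that compactin_subset_topspace[OF K] by auto
    then obtain U b where "openin (gtop G) U" "\<gamma> \<in> U" "\<forall>\<beta> \<in> U. b (p \<beta>) = \<beta>"
      using local_homeomorphism_section[OF lh] by metis
    then show ?thesis by (intro bexI[of _ U]) (auto intro: inj_on_inverseI)
  qed
  then have "K \<subseteq> \<Union>?\<U>" by (meson UnionI subsetI)
  then have "\<exists>\<F>. finite \<F> \<and> \<F> \<subseteq> ?\<U> \<and> K \<subseteq> \<Union>\<F>"
    by (intro compactinD[OF K]) simp_all
  then obtain \<F> where F: "finite \<F>" "\<F> \<subseteq> ?\<U>" "K \<subseteq> \<Union>\<F>" by (elim exE conjE)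
  have one: "finite {\<gamma> \<in> U. p \<gamma> = x} \<and> card {\<gamma> \<in> U. p \<gamma> = x} \<le> 1" if "U \<in> \<F>" for U x
  proof (cases "{\<gamma> \<in> U. p \<gamma> = x} = {}")
    case False
    then obtain \<gamma> where "\<gamma> \<in> U" "p \<gamma> = x" by blast
    then have "{\<gamma> \<in> U. p \<gamma> = x} = {\<gamma>}"
      using that F(2) by (auto dest: inj_onD)
    then show ?thesis by simp
  qed (simp only:, simp)
  have "finite {\<gamma> \<in> K. p \<gamma> = x} \<and> card {\<gamma> \<in> K. p \<gamma> = x} \<le> card \<F>" for x
  proof -
    have sub: "{\<gamma> \<in> K. p \<gamma> = x} \<subseteq> (\<Union>U\<in>\<F>. {\<gamma> \<in> U. p \<gamma> = x})" using F(3) by blast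
    have fin: "finite (\<Union>U\<in>\<F>. {\<gamma> \<in> U. p \<gamma> = x})" using F(1) one by blast
    have "card {\<gamma> \<in> K. p \<gamma> = x} \<le> card (\<Union>U\<in>\<F>. {\<gamma> \<in> U. p \<gamma> = x})"
      by (rule card_mono[OF fin sub])
    also have "\<dots> \<le> (\<Sum>U\<in>\<F>. card {\<gamma> \<in> U. p \<gamma> = x})" by (rule card_UN_le[OF F(1)])
    also have "\<dots> \<le> (\<Sum>U\<in>\<F>. 1)" by (rule sum_mono) (use one in blast)
    finally show ?thesis using finite_subset[OF sub fin] by simp
  qed
  then show ?thesis by blast
qed

lemma finite_source_fibre:
  "compactin (gtop G) K \<Longrightarrow> finite {\<gamma> \<in> K. gsrc G \<gamma> = x}"
  using local_homeomorphism_finite_fibres[OF etale_src] by blast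

lemma compactin_product_set:
  assumes "compactin (gtop G) K" "compactin (gtop G) L"
  shows "compactin (gtop G) {gmul G \<alpha> \<beta> | \<alpha> \<beta>. \<alpha> \<in> K \<and> \<beta> \<in> L \<and> (\<alpha>, \<beta>) \<in> composable G}"
proof -
  let ?X = "prod_topology (gtop G) (gtop G)"
  have "closedin ?X {p \<in> topspace ?X. gsrc G (fst p) = grng G (snd p)}"
    using continuous_map_compose[OF continuous_map_fst continuous_src]
      continuous_map_compose[OF continuous_map_snd continuous_rng]
    by (intro closedin_continuous_maps_eq[OF Hausdorff]) (auto simp: o_def)
  also have "{p \<in> topspace ?X. gsrc G (fst p) = grng G (snd p)} = composable G"
    by (auto simp: composable_iff)
  finally have "compactin ?X ((K \<times> L) \<inter> composable G)"
    using assms by (intro compact_Int_closedin) (auto simp: compactin_Times)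
  then have "compactin (subtopology ?X (composable G)) ((K \<times> L) \<inter> composable G)"
    by (simp add: compactin_subtopology)
  from image_compactin[OF this continuous_mul]
  show ?thesis by (rule back_subst[of "compactin _"]) force
qed

end

context twist
begin

text \<open>
  The first component of the inverse of a local trivialisation: every \<open>\<sigma>\<close> above \<open>U\<close> is
  \<open>l(\<sigma>) \<phi>(q(\<sigma>))\<close> with \<open>l(\<sigma>)\<close> in the circle and depending continuously on \<open>\<sigma>\<close>.
\<close>

lemma local_trivialisation:
  assumes "\<gamma> \<in> arrows G"
  shows "\<exists>U \<phi> l. openin (gtop G) U \<and> \<gamma> \<in> U \<and>
    (\<forall>\<beta> \<in> U. \<phi> \<beta> \<in> arrows \<Sigma> \<and> q (\<phi> \<beta>) = \<beta>) \<and>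
    (\<forall>z \<in> circle. continuous_map (subtopology (gtop G) U) (gtop \<Sigma>) (\<lambda>\<beta>. act z (\<phi> \<beta>))) \<and>
    continuous_map (subtopology (gtop \<Sigma>) {\<sigma> \<in> arrows \<Sigma>. q \<sigma> \<in> U}) euclidean l \<and>
    (\<forall>\<sigma> \<in> arrows \<Sigma>. q \<sigma> \<in> U \<longrightarrow> l \<sigma> \<in> circle \<and> \<sigma> = act (l \<sigma>) (\<phi> (q \<sigma>)))"
proof -
  obtain U \<phi> where U: "openin (gtop G) U" "\<gamma> \<in> U"
    and \<phi>: "continuous_map (subtopology (gtop G) U) (gtop \<Sigma>) \<phi>" "\<forall>\<beta> \<in> U. q (\<phi> \<beta>) = \<beta>"
    and hom: "homeomorphic_map (prod_topology (top_of_set circle) (subtopology (gtop G) U))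
        (subtopology (gtop \<Sigma>) {\<sigma> \<in> arrows \<Sigma>. q \<sigma> \<in> U}) (\<lambda>(z, \<beta>). gmul \<Sigma> (inc E (z, grng G \<beta>)) (\<phi> \<beta>))"
    using locally_trivial[OF assms] by blast
  let ?\<Theta> = "\<lambda>(z, \<beta>). gmul \<Sigma> (inc E (z, grng G \<beta>)) (\<phi> \<beta>)"
  have UG: "U \<subseteq> arrows G" using openin_subset[OF U(1)] by simp
  have \<phi>': "\<phi> \<beta> \<in> arrows \<Sigma> \<and> q (\<phi> \<beta>) = \<beta>" if "\<beta> \<in> U" for \<beta>
    using that \<phi> UG by (auto simp: continuous_map_def)
  have \<Theta>: "?\<Theta> (z, \<beta>) = act z (\<phi> \<beta>)" if "\<beta> \<in> U" for z \<beta>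
    using \<phi>'[OF that] by (simp add: circle_act_def)
  obtain g where g: "homeomorphic_maps (prod_topology (top_of_set circle) (subtopology (gtop G) U))
        (subtopology (gtop \<Sigma>) {\<sigma> \<in> arrows \<Sigma>. q \<sigma> \<in> U}) ?\<Theta> g"
    using hom homeomorphic_map_maps by blast
  let ?l = "\<lambda>\<sigma>. fst (g \<sigma>)"
  have cont: "continuous_map (subtopology (gtop G) U) (gtop \<Sigma>) (\<lambda>\<beta>. act z (\<phi> \<beta>))" if z: "z \<in> circle" for z
  proof -
    have "continuous_map (subtopology (gtop G) U)
        (prod_topology (top_of_set circle) (subtopology (gtop G) U)) (\<lambda>\<beta>. (z, \<beta>))"
      using z by (intro continuous_map_pairedI) (simp_all add: continuous_map_in_subtopology)
    moreover have "continuous_map (prod_topology (top_of_set circle) (subtopology (gtop G) U)) (gtop \<Sigma>) ?\<Theta>"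
      using g by (auto simp: homeomorphic_maps_def continuous_map_in_subtopology)
    ultimately have "continuous_map (subtopology (gtop G) U) (gtop \<Sigma>) (?\<Theta> \<circ> (\<lambda>\<beta>. (z, \<beta>)))"
      by (rule continuous_map_compose)
    then show ?thesis by (rule continuous_map_eq) (use \<Theta> in auto)
  qed
  have "continuous_map (subtopology (gtop \<Sigma>) {\<sigma> \<in> arrows \<Sigma>. q \<sigma> \<in> U}) (top_of_set circle) (fst \<circ> g)"
    using g by (intro continuous_map_compose[OF _ continuous_map_fst]) (auto simp: homeomorphic_maps_def)
  then have l: "continuous_map (subtopology (gtop \<Sigma>) {\<sigma> \<in> arrows \<Sigma>. q \<sigma> \<in> U}) euclidean ?l"
    by (auto simp: continuous_map_in_subtopology o_def)
  have "?l \<sigma> \<in> circle \<and> \<sigma> = act (?l \<sigma>) (\<phi> (q \<sigma>))" if s: "\<sigma> \<in> arrows \<Sigma>" "q \<sigma> \<in> U" for \<sigma>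
  proof -
    have "continuous_map (subtopology (gtop \<Sigma>) {\<sigma> \<in> arrows \<Sigma>. q \<sigma> \<in> U})
       (prod_topology (top_of_set circle) (subtopology (gtop G) U)) g"
      using g by (simp add: homeomorphic_maps_def)
    from funcset_mem[OF continuous_map_funspace[OF this], of \<sigma>]
    have "g \<sigma> \<in> circle \<times> U" using s by auto
    then obtain z \<beta> where zb: "g \<sigma> = (z, \<beta>)" "z \<in> circle" "\<beta> \<in> U" by blast
    have "?\<Theta> (g \<sigma>) = \<sigma>" using g s by (auto simp: homeomorphic_maps_def)
    then have "\<sigma> = act z (\<phi> \<beta>)" using zb \<Theta> by simp
    moreover from this have "q \<sigma> = \<beta>" using zb \<phi>' by simp
    ultimately show ?thesis using zb by simp
  qed
  with U \<phi>' cont l show ?thesis by blast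
qed

lemma openin_preimage: "openin (gtop G) U \<Longrightarrow> openin (gtop \<Sigma>) {\<sigma> \<in> arrows \<Sigma>. q \<sigma> \<in> U}"
  using openin_continuous_map_preimage[OF proj_continuous] by simp

text \<open>Every \<open>\<sigma>\<close> lies in the image of a continuous local section \<open>z \<phi>\<close> of \<open>q\<close>.\<close>

lemma openin_proj_image:
  assumes V: "openin (gtop \<Sigma>) V" shows "openin (gtop G) (q ` V)"
proof (subst openin_subopen, intro ballI)
  fix \<gamma> assume "\<gamma> \<in> q ` V"
  then obtain \<sigma> where s: "\<sigma> \<in> V" "\<sigma> \<in> arrows \<Sigma>" "q \<sigma> = \<gamma>" using openin_subset[OF V] by auto
  obtain U \<phi> l where U: "openin (gtop G) U" "\<gamma> \<in> U" "\<forall>\<beta> \<in> U. \<phi> \<beta> \<in> arrows \<Sigma> \<and> q (\<phi> \<beta>) = \<beta>"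
    and cont: "\<forall>z \<in> circle. continuous_map (subtopology (gtop G) U) (gtop \<Sigma>) (\<lambda>\<beta>. act z (\<phi> \<beta>))"
    and l: "\<forall>\<sigma> \<in> arrows \<Sigma>. q \<sigma> \<in> U \<longrightarrow> l \<sigma> \<in> circle \<and> \<sigma> = act (l \<sigma>) (\<phi> (q \<sigma>))"
    using local_trivialisation[OF proj_closed[OF s(2)]] unfolding s(3) by (elim exE conjE) (rule that)
  have ls: "l \<sigma> \<in> circle" "\<sigma> = act (l \<sigma>) (\<phi> \<gamma>)" using l s U(2) by auto
  let ?W = "{\<beta> \<in> topspace (subtopology (gtop G) U). act (l \<sigma>) (\<phi> \<beta>) \<in> V}"
  have "openin (subtopology (gtop G) U) ?W"
    using cont ls(1) V by (intro openin_continuous_map_preimage) auto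
  then have "openin (gtop G) ?W" using U(1) by (simp add: openin_open_subtopology)
  moreover have "\<gamma> \<in> ?W" using s ls U by auto
  moreover have "?W \<subseteq> q ` V" using U(3) ls(1) by (force intro: image_eqI[of _ _ "act (l \<sigma>) (\<phi> _)"])
  ultimately show "\<exists>W. openin (gtop G) W \<and> \<gamma> \<in> W \<and> W \<subseteq> q ` V" by blast
qed

lemma continuous_map_on_base:
  assumes "continuous_map (gtop \<Sigma>) Y F" "\<And>\<sigma>. \<sigma> \<in> arrows \<Sigma> \<Longrightarrow> F \<sigma> = k (q \<sigma>)"
  shows "continuous_map (gtop G) Y k"
  unfolding continuous_map_def
proof (intro conjI allI impI)
  have k: "k \<gamma> = F (lift \<gamma>)" if "\<gamma> \<in> arrows G" for \<gamma>
    using assms(2)[of "lift \<gamma>"] that by (simp add: lift)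
  show "k \<in> topspace (gtop G) \<rightarrow> topspace Y"
  proof
    fix \<gamma> assume "\<gamma> \<in> topspace (gtop G)"
    then have "\<gamma> \<in> arrows G" by simp
    then show "k \<gamma> \<in> topspace Y"
      using funcset_mem[OF continuous_map_funspace[OF assms(1)], of "lift \<gamma>"] by (simp add: k lift)
  qed
  fix V assume "openin Y V"
  then have "openin (gtop G) (q ` {\<sigma> \<in> topspace (gtop \<Sigma>). F \<sigma> \<in> V})"
    by (intro openin_proj_image openin_continuous_map_preimage[OF assms(1)])
  also have "q ` {\<sigma> \<in> topspace (gtop \<Sigma>). F \<sigma> \<in> V} = {\<gamma> \<in> topspace (gtop G). k \<gamma> \<in> V}"
  proof (intro equalityI subsetI)
    fix \<gamma> assume "\<gamma> \<in> {\<gamma> \<in> topspace (gtop G). k \<gamma> \<in> V}"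
    then show "\<gamma> \<in> q ` {\<sigma> \<in> topspace (gtop \<Sigma>). F \<sigma> \<in> V}"
      using k by (intro image_eqI[of _ _ "lift \<gamma>"]) (auto simp: lift)
  qed (use assms(2) in auto)
  finally show "openin (gtop G) {\<gamma> \<in> topspace (gtop G). k \<gamma> \<in> V}" .
qed

lemma topspace_line_topology: "topspace (line_topology E) = line_bundle E"
proof -
  have "{(z, \<sigma>). \<sigma> \<in> arrows \<Sigma> \<and> line_class E z \<sigma> \<in> line_bundle E} = topspace (prod_topology euclidean
      (gtop \<Sigma>))"
    by (auto simp: line_bundle_def line_class_def quotientI)
  then have "openin (line_topology E) (line_bundle E)"
    unfolding openin_line_topology by (metis openin_topspace order_refl)
  then show ?thesis
    using openin_subset openin_line_topology[of E "topspace (line_topology E)"] openin_topspace by blast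
qed

text \<open>
  The line bundle carries the quotient topology, \<open>q\<close> is open, and over a trivialising open set the
  bundle has a continuous coordinate; so continuity can be tested on the coordinates, as functions on
  \<open>\<Sigma>\<close>.
\<close>

lemma continuous_sections_iff:
  "f \<in> continuous_sections E \<longleftrightarrow> f \<in> sections \<and> continuous_map (gtop \<Sigma>) euclidean (\<lambda>\<sigma>. ev \<sigma> f)"
proof (cases "f \<in> sections")
  case f: True
  have "continuous_map (gtop G) (line_topology E) f" if cont:
      "continuous_map (gtop \<Sigma>) euclidean (\<lambda>\<sigma>. ev \<sigma> f)"
  proof (rule continuous_map_on_base)
    show "line_class E (ev \<sigma> f) \<sigma> = f (q \<sigma>)" if "\<sigma> \<in> arrows \<Sigma>" for \<sigma>
      using section_value[OF f that] by simp
    have pair: "continuous_map (gtop \<Sigma>) (prod_topology euclidean (gtop \<Sigma>)) (\<lambda>\<sigma>. (ev \<sigma> f, \<sigma>))"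
      using cont by (intro continuous_map_pairedI) simp_all
    show "continuous_map (gtop \<Sigma>) (line_topology E) (\<lambda>\<sigma>. line_class E (ev \<sigma> f) \<sigma>)"
      unfolding continuous_map_def
    proof (intro conjI allI impI)
      show "(\<lambda>\<sigma>. line_class E (ev \<sigma> f) \<sigma>) \<in> topspace (gtop \<Sigma>) \<rightarrow> topspace (line_topology E)"
        by (auto simp: topspace_line_topology line_bundle_def line_class_def quotientI)
      fix W assume "openin (line_topology E) W"
      then have "openin (prod_topology euclidean (gtop \<Sigma>)) {(z, \<sigma>). \<sigma> \<in> arrows \<Sigma> \<and> line_class E z \<sigma> \<in> W}"
        by (simp add: openin_line_topology)
      from openin_continuous_map_preimage[OF pair this]
      show "openin (gtop \<Sigma>) {\<sigma> \<in> topspace (gtop \<Sigma>). line_class E (ev \<sigma> f) \<sigma> \<in> W}"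
        by (rule back_subst[of "openin _"]) auto
    qed
  qed
  moreover have "continuous_map (gtop \<Sigma>) euclidean (\<lambda>\<sigma>. ev \<sigma> f)"
    if cont: "continuous_map (gtop G) (line_topology E) f"
  proof (rule continuous_map_locally)
    fix \<sigma>0 assume "\<sigma>0 \<in> topspace (gtop \<Sigma>)"
    then have s0: "\<sigma>0 \<in> arrows \<Sigma>" by simp
    obtain U \<phi> l where U: "openin (gtop G) U" "q \<sigma>0 \<in> U" "\<forall>\<beta> \<in> U. \<phi> \<beta> \<in> arrows \<Sigma> \<and> q (\<phi> \<beta>) = \<beta>"
      and lcont: "continuous_map (subtopology (gtop \<Sigma>) {\<sigma> \<in> arrows \<Sigma>. q \<sigma> \<in> U}) euclidean l"
      and l: "\<forall>\<sigma> \<in> arrows \<Sigma>. q \<sigma> \<in> U \<longrightarrow> l \<sigma> \<in> circle \<and> \<sigma> = act (l \<sigma>) (\<phi> (q \<sigma>))"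
      using local_trivialisation[OF proj_closed[OF s0]] by (elim exE conjE) (rule that)
    let ?\<Sigma>U = "{\<sigma> \<in> arrows \<Sigma>. q \<sigma> \<in> U}"
    have UG: "U \<subseteq> arrows G" using openin_subset[OF U(1)] by simp
    have coord: "line_class E z \<sigma> = line_class E (l \<sigma> * z) (\<phi> (q \<sigma>))" if "\<sigma> \<in> ?\<Sigma>U" for z \<sigma>
      using that l U(3) line_class_act[of "l \<sigma>" "\<phi> (q \<sigma>)" z] by simp
    have "continuous_map (subtopology (gtop G) U) euclidean (\<lambda>\<beta>. ev (\<phi> \<beta>) f)"
      unfolding continuous_map_def
    proof (intro conjI allI impI)
      fix O' :: "complex set" assume O': "openin euclidean O'"
      define W where "W = {line_class E w (\<phi> \<beta>) | w \<beta>. w \<in> O' \<and> \<beta> \<in> U}"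
      have in_W: "line_class E z \<sigma> \<in> W \<longleftrightarrow> \<sigma> \<in> ?\<Sigma>U \<and> l \<sigma> * z \<in> O'" if s: "\<sigma> \<in> arrows \<Sigma>" for z \<sigma>
      proof
        assume "line_class E z \<sigma> \<in> W"
        then obtain w \<beta> where w: "line_class E z \<sigma> = line_class E w (\<phi> \<beta>)" "w \<in> O'" "\<beta> \<in> U" by (auto
            simp: W_def)
        then obtain \<mu> where "\<mu> \<in> circle" "\<sigma> = act \<mu> (\<phi> \<beta>)" using line_class_eq_iff s U(3) by blast
        then have b: "q \<sigma> = \<beta>" using w U(3) by simp
        then have "\<sigma> \<in> ?\<Sigma>U" using s w by simp
        moreover from coord[OF this, of z] have "l \<sigma> * z = w"
          using w b U(3) line_class_inject by metis
        ultimately show "\<sigma> \<in> ?\<Sigma>U \<and> l \<sigma> * z \<in> O'" using w by simp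
      next
        assume "\<sigma> \<in> ?\<Sigma>U \<and> l \<sigma> * z \<in> O'"
        then show "line_class E z \<sigma> \<in> W" unfolding W_def using coord by blast
      qed
      have "continuous_map (prod_topology euclidean (subtopology (gtop \<Sigma>) ?\<Sigma>U)) euclidean (\<lambda>p. l (snd p)
          * fst p)"
        using continuous_map_compose[OF continuous_map_snd lcont] continuous_map_fst
        by (intro continuous_map_complex_mult) (auto simp: o_def)
      from openin_continuous_map_preimage[OF this O']
      have "openin (prod_topology euclidean (subtopology (gtop \<Sigma>) ?\<Sigma>U))
          {p \<in> UNIV \<times> ?\<Sigma>U. l (snd p) * fst p \<in> O'}" by (simp add: Int_absorb1 subset_eq)
      moreover have "openin (prod_topology euclidean (gtop \<Sigma>)) (UNIV \<times> ?\<Sigma>U)"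
        using openin_preimage[OF U(1)] by (simp add: openin_prod_Times_iff)
      ultimately have "openin (prod_topology euclidean (gtop \<Sigma>)) {p \<in> UNIV \<times> ?\<Sigma>U. l (snd p) * fst p \<in> O'}"
        unfolding prod_topology_subtopology(2) topspace_euclidean by (rule openin_trans_full)
      also have "{p \<in> UNIV \<times> ?\<Sigma>U. l (snd p) * fst p \<in> O'} = {(z, \<sigma>). \<sigma> \<in> arrows \<Sigma> \<and> line_class E z \<sigma> \<in> W}"
        using in_W by auto
      finally have "openin (line_topology E) W"
        using U(3) by (auto simp: openin_line_topology W_def line_bundle_def line_class_def quotientI)
      then have "openin (gtop G) {\<beta> \<in> topspace (gtop G). f \<beta> \<in> W}"
        by (rule openin_continuous_map_preimage[OF cont])
      then have "openin (subtopology (gtop G) U) (U \<inter> {\<beta> \<in> topspace (gtop G). f \<beta> \<in> W})"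
        by (rule openin_subtopology_Int2)
      moreover have "f \<beta> \<in> W \<longleftrightarrow> ev (\<phi> \<beta>) f \<in> O'" if b: "\<beta> \<in> U" for \<beta>
      proof -
        have p: "\<phi> \<beta> \<in> arrows \<Sigma>" "q (\<phi> \<beta>) = \<beta>" using U(3) b by auto
        then have "act (l (\<phi> \<beta>)) (\<phi> \<beta>) = act 1 (\<phi> \<beta>)" and "l (\<phi> \<beta>) \<in> circle" using l b by auto
        then have "l (\<phi> \<beta>) = 1" using act_free one_circle p(1) by blast
        then show ?thesis
          using in_W[OF p(1), of "ev (\<phi> \<beta>) f"] section_value[OF f p(1)] p b by simp
      qed
      ultimately show "openin (subtopology (gtop G) U) {\<beta> \<in> topspace (subtopology (gtop G) U). ev (\<phi> \<beta>)
          f \<in> O'}"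
        using UG by (elim back_subst[of "openin _"]) auto
    qed simp
    moreover have "continuous_map (subtopology (gtop \<Sigma>) ?\<Sigma>U) (subtopology (gtop G) U) q"
      using proj_continuous by (auto simp: continuous_map_in_subtopology continuous_map_from_subtopology)
    ultimately have "continuous_map (subtopology (gtop \<Sigma>) ?\<Sigma>U) euclidean (\<lambda>\<sigma>. ev (\<phi> (q \<sigma>)) f)"
      using continuous_map_compose[of _ _ q _ "\<lambda>\<beta>. ev (\<phi> \<beta>) f"] by (simp add: o_def)
    then have "continuous_map (subtopology (gtop \<Sigma>) ?\<Sigma>U) euclidean (\<lambda>\<sigma>. cnj (l \<sigma>) * ev (\<phi> (q \<sigma>)) f)"
      by (intro continuous_map_complex_mult continuous_map_cnj lcont)
    moreover have "cnj (l \<sigma>) * ev (\<phi> (q \<sigma>)) f = ev \<sigma> f" if "\<sigma> \<in> ?\<Sigma>U" for \<sigma>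
      using that l U(3) ev_act[OF f, of "\<phi> (q \<sigma>)" "l \<sigma>"] by simp
    ultimately have "continuous_map (subtopology (gtop \<Sigma>) ?\<Sigma>U) euclidean (\<lambda>\<sigma>. ev \<sigma> f)"
      by (rule continuous_map_eq) auto
    then show "\<exists>N. openin (gtop \<Sigma>) N \<and> \<sigma>0 \<in> N \<and> continuous_map (subtopology (gtop \<Sigma>) N) euclidean (\<lambda>\<sigma>.
        ev \<sigma> f)"
      using openin_preimage[OF U(1)] s0 U(2) by blast
  qed
  ultimately show ?thesis using f by (auto simp: continuous_sections_def)
qed (simp add: continuous_sections_def)

end

section \<open>The convolution algebra\<close>

context twist
begin

lemma Cc_sections_iff:
  "f \<in> Cc_sections E \<longleftrightarrow> f \<in> sections \<and> continuous_map (gtop \<Sigma>) euclidean (\<lambda>\<sigma>. ev \<sigma> f) \<and>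
     (\<exists>K. compactin (gtop G) K \<and> (\<forall>\<sigma> \<in> arrows \<Sigma>. q \<sigma> \<notin> K \<longrightarrow> ev \<sigma> f = 0))"
proof -
  have "compactin (gtop G) (gtop G closure_of {\<gamma> \<in> arrows G. f \<gamma> \<noteq> line_zero E \<gamma>}) \<longleftrightarrow>
      (\<exists>K. compactin (gtop G) K \<and> (\<forall>\<sigma> \<in> arrows \<Sigma>. q \<sigma> \<notin> K \<longrightarrow> ev \<sigma> f = 0))" (is "?l \<longleftrightarrow> ?r")
    if f: "f \<in> sections"
  proof
    assume ?l
    moreover have "{\<gamma> \<in> arrows G. f \<gamma> \<noteq> line_zero E \<gamma>} \<subseteq> gtop G closure_of {\<gamma> \<in> arrows G. f \<gamma> \<noteq>
        line_zero E \<gamma>}"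
      by (rule closure_of_subset) auto
    then have "ev \<sigma> f = 0" if "\<sigma> \<in> arrows \<Sigma>"
      "q \<sigma> \<notin> gtop G closure_of {\<gamma> \<in> arrows G. f \<gamma> \<noteq> line_zero E \<gamma>}" for \<sigma>
      using that section_eq_zero_iff[OF f that(1)] proj_closed[OF that(1)] by blast
    ultimately show ?r by blast
  next
    assume ?r
    then obtain K where K: "compactin (gtop G) K" "\<And>\<sigma>. \<sigma> \<in> arrows \<Sigma> \<Longrightarrow> q \<sigma> \<notin> K \<Longrightarrow> ev \<sigma> f = 0" by blast
    have "{\<gamma> \<in> arrows G. f \<gamma> \<noteq> line_zero E \<gamma>} \<subseteq> K"
    proof clarify
      fix \<gamma> assume g: "\<gamma> \<in> arrows G" "f \<gamma> \<noteq> line_zero E \<gamma>"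
      show "\<gamma> \<in> K"
      proof (rule ccontr)
        assume "\<gamma> \<notin> K"
        then have "ev (lift \<gamma>) f = 0" using g lift[OF g(1)] by (intro K(2)) auto
        then show False using section_eq_zero_iff[OF f lift_closed[OF g(1)]] g by (simp add: lift)
      qed
    qed
    then have "gtop G closure_of {\<gamma> \<in> arrows G. f \<gamma> \<noteq> line_zero E \<gamma>} \<subseteq> K"
      by (rule closure_of_minimal[OF _ B.compactin_imp_closed[OF K(1)]])
    then show ?l by (rule closed_compactin[OF K(1)]) simp
  qed
  then show ?thesis unfolding Cc_sections_def continuous_sections_iff by blast
qed

lemma CcE:
  assumes "f \<in> Cc_sections E"
  obtains K where "f \<in> sections" "continuous_map (gtop \<Sigma>) euclidean (\<lambda>\<sigma>. ev \<sigma> f)"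
    "compactin (gtop G) K" "\<And>\<sigma>. \<sigma> \<in> arrows \<Sigma> \<Longrightarrow> q \<sigma> \<notin> K \<Longrightarrow> ev \<sigma> f = 0"
  using assms unfolding Cc_sections_iff by blast

lemma Cc_support:
  assumes "f \<in> Cc_sections E"
  obtains K where "compactin (gtop G) K" "\<And>\<sigma>. \<sigma> \<in> arrows \<Sigma> \<Longrightarrow> q \<sigma> \<notin> K \<Longrightarrow> ev \<sigma> f = 0"
  using assms by (rule CcE) (rule that)

lemma CcI:
  assumes "f \<in> sections" "continuous_map (gtop \<Sigma>) euclidean (\<lambda>\<sigma>. ev \<sigma> f)"
    "compactin (gtop G) K" "\<And>\<sigma>. \<sigma> \<in> arrows \<Sigma> \<Longrightarrow> q \<sigma> \<notin> K \<Longrightarrow> ev \<sigma> f = 0"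
  shows "f \<in> Cc_sections E"
  using assms unfolding Cc_sections_iff by blast

lemma Cc_in_sections: "f \<in> Cc_sections E \<Longrightarrow> f \<in> sections"
  by (erule CcE)

lemma Cc_continuous: "f \<in> Cc_sections E \<Longrightarrow> continuous_map (gtop \<Sigma>) euclidean (\<lambda>\<sigma>. ev \<sigma> f)"
  by (erule CcE)

lemma continuous_map_eq_on_arrows:
  "continuous_map (gtop \<Sigma>) Y F \<Longrightarrow> (\<And>\<sigma>. \<sigma> \<in> arrows \<Sigma> \<Longrightarrow> F \<sigma> = F' \<sigma>) \<Longrightarrow> continuous_map (gtop \<Sigma>) Y F'"
  by (erule continuous_map_eq) simp

lemma section_of_in_Cc:
  assumes "equivariant F" "continuous_map (gtop \<Sigma>) euclidean F"
    "compactin (gtop G) K" "\<And>\<sigma>. \<sigma> \<in> arrows \<Sigma> \<Longrightarrow> q \<sigma> \<notin> K \<Longrightarrow> F \<sigma> = 0"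
  shows "section_of F \<in> Cc_sections E"
  using assms by (intro CcI[of _ K] section_of_in_sections continuous_map_eq_on_arrows[OF assms(2)])
    (simp_all add: ev_section_of)

lemma section_add_in_Cc:
  assumes f: "f \<in> Cc_sections E" and g: "g \<in> Cc_sections E" shows "section_add E f g \<in> Cc_sections E"
proof -
  obtain K where K: "compactin (gtop G) K" "\<And>\<sigma>. \<sigma> \<in> arrows \<Sigma> \<Longrightarrow> q \<sigma> \<notin> K \<Longrightarrow> ev \<sigma> f = 0"
    using f by (rule Cc_support) (rule that)
  obtain L where L: "compactin (gtop G) L" "\<And>\<sigma>. \<sigma> \<in> arrows \<Sigma> \<Longrightarrow> q \<sigma> \<notin> L \<Longrightarrow> ev \<sigma> g = 0"
    using g by (rule Cc_support) (rule that)
  have fg: "f \<in> sections" "g \<in> sections" by (rule Cc_in_sections[OF f], rule Cc_in_sections[OF g])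
  show ?thesis
  proof (rule CcI[OF section_add_in_sections[OF fg] _ compactin_Un[OF K(1) L(1)]])
    show "continuous_map (gtop \<Sigma>) euclidean (\<lambda>\<sigma>. ev \<sigma> (section_add E f g))"
      by (rule continuous_map_eq_on_arrows[OF continuous_map_add[OF Cc_continuous[OF f] Cc_continuous[OF
          g]]])
        (simp add: ev_add[OF fg])
  qed (use K(2) L(2) in \<open>auto simp: ev_add[OF fg]\<close>)
qed

lemma section_scale_in_Cc:
  assumes f: "f \<in> Cc_sections E" shows "section_scale E c f \<in> Cc_sections E"
proof -
  obtain K where K: "compactin (gtop G) K" "\<And>\<sigma>. \<sigma> \<in> arrows \<Sigma> \<Longrightarrow> q \<sigma> \<notin> K \<Longrightarrow> ev \<sigma> f = 0"
    using f by (rule Cc_support) (rule that)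
  have fs: "f \<in> sections" using f by (rule Cc_in_sections)
  show ?thesis
  proof (rule CcI[OF section_scale_in_sections[OF fs] _ K(1)])
    show "continuous_map (gtop \<Sigma>) euclidean (\<lambda>\<sigma>. ev \<sigma> (section_scale E c f))"
      by (rule continuous_map_eq_on_arrows[OF continuous_map_complex_mult[of _ "\<lambda>_. c", OF _
          Cc_continuous[OF f]]])
        (simp_all add: ev_scale[OF fs])
  qed (use K(2) in \<open>auto simp: ev_scale[OF fs]\<close>)
qed

lemma section_star_in_Cc:
  assumes f: "f \<in> Cc_sections E" shows "section_star E f \<in> Cc_sections E"
proof -
  obtain K where K: "compactin (gtop G) K" "\<And>\<sigma>. \<sigma> \<in> arrows \<Sigma> \<Longrightarrow> q \<sigma> \<notin> K \<Longrightarrow> ev \<sigma> f = 0"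
    using f by (rule Cc_support) (rule that)
  have fs: "f \<in> sections" using f by (rule Cc_in_sections)
  show ?thesis
  proof (rule CcI[OF section_star_in_sections[OF fs] _ image_compactin[OF K(1) B.continuous_inv]])
    have "continuous_map (gtop \<Sigma>) euclidean (\<lambda>\<sigma>. cnj (ev (ginv \<Sigma> \<sigma>) f))"
      using continuous_map_compose[OF T.continuous_inv Cc_continuous[OF f]]
      by (intro continuous_map_cnj) (simp add: o_def)
    then show "continuous_map (gtop \<Sigma>) euclidean (\<lambda>\<sigma>. ev \<sigma> (section_star E f))"
      by (rule continuous_map_eq_on_arrows) (simp add: ev_star[OF fs])
    fix \<sigma> assume s: "\<sigma> \<in> arrows \<Sigma>" "q \<sigma> \<notin> ginv G ` K"
    have "q (ginv \<Sigma> \<sigma>) \<notin> K"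
    proof
      assume "q (ginv \<Sigma> \<sigma>) \<in> K"
      then have "ginv G (ginv G (q \<sigma>)) \<in> ginv G ` K" using s(1) by (simp add: proj_inv)
      then show False using s by (simp add: B.inv_inv)
    qed
    then show "ev \<sigma> (section_star E f) = 0"
      using s K(2)[of "ginv \<Sigma> \<sigma>"] by (simp add: ev_star[OF fs] T.inv_closed)
  qed
qed

lemma fibre_support_subset:
  assumes "\<And>\<sigma>. \<sigma> \<in> arrows \<Sigma> \<Longrightarrow> q \<sigma> \<notin> K \<Longrightarrow> ev \<sigma> g = 0"
  shows "fibre_support g x \<subseteq> {\<beta> \<in> K. gsrc G \<beta> = x}"
proof
  fix \<beta> assume "\<beta> \<in> fibre_support g x"
  then show "\<beta> \<in> {\<beta> \<in> K. gsrc G \<beta> = x}"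
    using assms[of "lift \<beta>"] by (auto simp: fibre_support_def lift)
qed

lemma finite_fibre_support:
  assumes "g \<in> Cc_sections E" shows "finite (fibre_support g x)"
proof -
  obtain K where K: "compactin (gtop G) K" "\<And>\<sigma>. \<sigma> \<in> arrows \<Sigma> \<Longrightarrow> q \<sigma> \<notin> K \<Longrightarrow> ev \<sigma> g = 0"
    using assms by (rule Cc_support) (rule that)
  show ?thesis
    by (rule finite_subset[OF fibre_support_subset[OF K(2)] B.finite_source_fibre[OF K(1)]])
qed

text \<open>
  A local inverse of the source map followed by a local section of \<open>q\<close>: the arrows near \<open>\<beta>\<close>, lifted to
  \<open>\<Sigma>\<close>, become continuous functions of their source.
\<close>

lemma lifting_section:
  assumes "\<beta> \<in> arrows G"
  shows "\<exists>U p. openin (gtop G) U \<and> \<beta> \<in> U \<and> openin (gtop G) (gsrc G ` U) \<and>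
    continuous_map (subtopology (gtop G) (gsrc G ` U)) (gtop \<Sigma>) p \<and>
    (\<forall>\<gamma> \<in> U. p (gsrc G \<gamma>) \<in> arrows \<Sigma> \<and> q (p (gsrc G \<gamma>)) = \<gamma>)"
proof -
  obtain U1 b where U1: "openin (gtop G) U1" "\<beta> \<in> U1" "openin (gtop G) (gsrc G ` U1)"
      and b: "continuous_map (subtopology (gtop G) (gsrc G ` U1)) (gtop G) b" "\<forall>\<beta> \<in> U1. b (gsrc G \<beta>) = \<beta>"
    using B.etale_section[OF assms] by (elim exE conjE) (rule that)
  obtain U2 \<phi> l where U2: "openin (gtop G) U2" "\<beta> \<in> U2" "\<forall>\<beta> \<in> U2. \<phi> \<beta> \<in> arrows \<Sigma> \<and> q (\<phi> \<beta>) = \<beta>"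
    and cont: "\<forall>z \<in> circle. continuous_map (subtopology (gtop G) U2) (gtop \<Sigma>) (\<lambda>\<beta>. act z (\<phi> \<beta>))"
    and "\<forall>\<sigma> \<in> arrows \<Sigma>. q \<sigma> \<in> U2 \<longrightarrow> l \<sigma> \<in> circle \<and> \<sigma> = act (l \<sigma>) (\<phi> (q \<sigma>))"
    using local_trivialisation[OF assms] by (elim exE conjE) (rule that)
  let ?U = "U1 \<inter> U2"
  have U1G: "U1 \<subseteq> arrows G" using openin_subset[OF U1(1)] by simp
  have img: "gsrc G ` ?U = {x \<in> topspace (subtopology (gtop G) (gsrc G ` U1)). b x \<in> U2}"
    using b(2) U1G B.src_closed by auto
  have "openin (subtopology (gtop G) (gsrc G ` U1)) (gsrc G ` ?U)"
    unfolding img by (rule openin_continuous_map_preimage[OF b(1) U2(1)])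
  then have op: "openin (gtop G) (gsrc G ` ?U)"
    using U1(3) by (rule openin_trans_full)
  have "continuous_map (subtopology (gtop G) (gsrc G ` ?U)) (subtopology (gtop G) U2) b"
    using continuous_map_from_subtopology_mono[OF b(1), of "gsrc G ` ?U"] b(2)
    by (auto simp: continuous_map_in_subtopology)
  moreover have "continuous_map (subtopology (gtop G) U2) (gtop \<Sigma>) (\<lambda>\<beta>. act 1 (\<phi> \<beta>))"
    using cont one_circle by blast
  ultimately have "continuous_map (subtopology (gtop G) (gsrc G ` ?U)) (gtop \<Sigma>) ((\<lambda>\<beta>. act 1 (\<phi> \<beta>)) \<circ> b)"
    by (rule continuous_map_compose)
  moreover have "\<forall>\<gamma> \<in> ?U. ((\<lambda>\<beta>. act 1 (\<phi> \<beta>)) \<circ> b) (gsrc G \<gamma>) \<in> arrows \<Sigma> \<and>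
      q (((\<lambda>\<beta>. act 1 (\<phi> \<beta>)) \<circ> b) (gsrc G \<gamma>)) = \<gamma>"
    using b(2) U2(3) by simp
  ultimately show ?thesis
    using op U1(1,2) U2(1,2) by (intro exI[of _ ?U] exI[of _ "(\<lambda>\<beta>. act 1 (\<phi> \<beta>)) \<circ> b"]) auto
qed

text \<open>A circle factor of \<open>\<tau>\<close> cancels between the two factors of a term of the convolution sum.\<close>

lemma conv_term_lift:
  assumes f: "f \<in> sections" and g: "g \<in> sections" and s: "\<sigma> \<in> arrows \<Sigma>" "\<tau> \<in> arrows \<Sigma>" "\<tau>' \<in> arrows \<Sigma>"
    and eq: "q \<tau> = q \<tau>'" "gsrc G (q \<tau>') = gsrc G (q \<sigma>)"
  shows "ev (gmul \<Sigma> \<sigma> (ginv \<Sigma> \<tau>)) f * ev \<tau> g = ev (gmul \<Sigma> \<sigma> (ginv \<Sigma> \<tau>')) f * ev \<tau>' g"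
proof -
  obtain \<mu> where \<mu>: "\<mu> \<in> circle" "\<tau> = act \<mu> \<tau>'" using act_transitive[OF s(2,3) eq(1)] .
  have c: "(\<sigma>, ginv \<Sigma> \<tau>') \<in> composable \<Sigma>" using quotient_composable(1)[OF s(1,3) eq(2)] .
  have "gmul \<Sigma> \<sigma> (ginv \<Sigma> \<tau>) = act (cnj \<mu>) (gmul \<Sigma> \<sigma> (ginv \<Sigma> \<tau>'))"
    using act_inv[OF \<mu>(1) s(3)] act_mult(2)[OF circle_cnj[OF \<mu>(1)] c] \<mu>(2) by simp
  then have "ev (gmul \<Sigma> \<sigma> (ginv \<Sigma> \<tau>)) f = \<mu> * ev (gmul \<Sigma> \<sigma> (ginv \<Sigma> \<tau>')) f"
    using ev_act[OF f T.mul_closed[OF c] circle_cnj[OF \<mu>(1)]] by simp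
  moreover have "ev \<tau> g = cnj \<mu> * ev \<tau>' g" using ev_act[OF g s(3) \<mu>(1)] \<mu>(2) by simp
  ultimately show ?thesis using circle_cnj_mult(2)[OF \<mu>(1)] by (simp add: mult_ac)
qed

text \<open>
  Near \<open>\<sigma>\<^sub>0\<close> the arrows in the compact support of \<open>g\<close> with the same source as \<open>\<sigma>\<close> are the values of
  finitely many continuous functions with pairwise different values, one for each such arrow at
  \<open>\<sigma>\<^sub>0\<close>: no further arrows appear because the source map sends the rest of the support to a closed
  set.
\<close>

lemma continuous_conv:
  assumes f: "f \<in> Cc_sections E" and g: "g \<in> Cc_sections E"
  shows "continuous_map (gtop \<Sigma>) euclidean (\<lambda>\<sigma>. ev \<sigma> (section_conv E f g))"
proof (rule continuous_map_locally)
  have fg: "f \<in> sections" "g \<in> sections" by (rule Cc_in_sections[OF f], rule Cc_in_sections[OF g])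
  obtain K where K: "compactin (gtop G) K" "\<And>\<sigma>. \<sigma> \<in> arrows \<Sigma> \<Longrightarrow> q \<sigma> \<notin> K \<Longrightarrow> ev \<sigma> g = 0"
    using g by (rule Cc_support) (rule that)
  have KG: "K \<subseteq> arrows G" using compactin_subset_topspace[OF K(1)] by simp
  fix \<sigma>0 assume "\<sigma>0 \<in> topspace (gtop \<Sigma>)"
  then have s0: "\<sigma>0 \<in> arrows \<Sigma>" by simp
  define x0 where "x0 = gsrc G (q \<sigma>0)"
  define T0 where "T0 = {\<beta> \<in> K. gsrc G \<beta> = x0}"
  have T0: "finite T0" "T0 \<subseteq> arrows G" using B.finite_source_fibre[OF K(1)] KG by (auto simp: T0_def)
  define good where "good = (\<lambda>\<beta> U p. openin (gtop G) U \<and> \<beta> \<in> U \<and> openin (gtop G) (gsrc G ` U) \<and>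
    continuous_map (subtopology (gtop G) (gsrc G ` U)) (gtop \<Sigma>) p \<and>
    (\<forall>\<gamma> \<in> U. p (gsrc G \<gamma>) \<in> arrows \<Sigma> \<and> q (p (gsrc G \<gamma>)) = \<gamma>))"
  have "\<exists>U p. good \<beta> U p" if "\<beta> \<in> T0" for \<beta>
    using lifting_section[of \<beta>] that T0(2) unfolding good_def by blast
  then obtain U p where Up: "\<And>\<beta>. \<beta> \<in> T0 \<Longrightarrow> good \<beta> (U \<beta>) (p \<beta>)" by metis
  have U: "openin (gtop G) (U \<beta>)" "\<beta> \<in> U \<beta>" "openin (gtop G) (gsrc G ` U \<beta>)"
    and p: "continuous_map (subtopology (gtop G) (gsrc G ` U \<beta>)) (gtop \<Sigma>) (p \<beta>)"
    and pU: "\<And>\<gamma>. \<gamma> \<in> U \<beta> \<Longrightarrow> p \<beta> (gsrc G \<gamma>) \<in> arrows \<Sigma> \<and> q (p \<beta> (gsrc G \<gamma>)) = \<gamma>"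
    if "\<beta> \<in> T0" for \<beta> using Up[OF that] unfolding good_def by blast+
  have UG: "U \<beta> \<subseteq> arrows G" if "\<beta> \<in> T0" for \<beta> using openin_subset[OF U(1)[OF that]] by simp
  \<comment> \<open>The sources at which the branches through \<open>\<beta>\<close> and \<open>\<beta>'\<close> have different values.\<close>
  define D where "D = (\<lambda>\<beta> \<beta>'. {x \<in> gsrc G ` U \<beta> \<inter> gsrc G ` U \<beta>'. q (p \<beta> x) \<noteq> q (p \<beta>' x)})"
  have D_open: "openin (gtop G) (D \<beta> \<beta>')" if b: "\<beta> \<in> T0" "\<beta>' \<in> T0" for \<beta> \<beta>'
  proof -
    let ?W = "gsrc G ` U \<beta> \<inter> gsrc G ` U \<beta>'"
    have W: "openin (gtop G) ?W" using U(3) b by blast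
    have c: "continuous_map (subtopology (gtop G) ?W) (gtop G) (\<lambda>x. q (p \<delta> x))" if "\<delta> \<in> {\<beta>, \<beta>'}" for \<delta>
    proof -
      have "continuous_map (subtopology (gtop G) ?W) (gtop \<Sigma>) (p \<delta>)"
        using that b by (auto intro: continuous_map_from_subtopology_mono[OF p])
      from continuous_map_compose[OF this proj_continuous] show ?thesis by (simp add: o_def)
    qed
    have "closedin (subtopology (gtop G) ?W) {x \<in> topspace (subtopology (gtop G) ?W). q (p \<beta> x) = q (p
        \<beta>' x)}"
      by (intro closedin_continuous_maps_eq[OF B.Hausdorff] c) auto
    then have "openin (subtopology (gtop G) ?W) (topspace (subtopology (gtop G) ?W) -
        {x \<in> topspace (subtopology (gtop G) ?W). q (p \<beta> x) = q (p \<beta>' x)})" by (simp add: closedin_def)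
    also have "topspace (subtopology (gtop G) ?W) -
        {x \<in> topspace (subtopology (gtop G) ?W). q (p \<beta> x) = q (p \<beta>' x)} = D \<beta> \<beta>'"
      using openin_subset[OF W] by (auto simp: D_def)
    finally show ?thesis using W by (rule openin_trans_full)
  qed
  define \<A> where "\<A> = (\<lambda>\<beta>. gsrc G ` U \<beta>) ` T0 \<union> (\<lambda>(\<beta>, \<beta>'). D \<beta> \<beta>') ` {(\<beta>, \<beta>') \<in> T0 \<times> T0. \<beta> \<noteq> \<beta>'}"
  have "finite {(\<beta>, \<beta>') \<in> T0 \<times> T0. \<beta> \<noteq> \<beta>'}"
    by (rule finite_subset[of _ "T0 \<times> T0"]) (use T0(1) in auto)
  then have "finite \<A>" using T0(1) by (simp add: \<A>_def)
  moreover have "openin (gtop G) X" if "X \<in> \<A>" for X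
    using that U(3) D_open by (auto simp: \<A>_def)
  ultimately have N1: "openin (gtop G) (units G \<inter> \<Inter>\<A>)"
    by (intro openin_Int_Inter B.openin_units) auto
  have "openin (gtop G) (\<Union>\<beta>\<in>T0. U \<beta>)" using U(1) by blast
  then have "closedin (gtop G) (K - (\<Union>\<beta>\<in>T0. U \<beta>))"
    by (rule closedin_diff[OF B.compactin_imp_closed[OF K(1)]])
  then have "compactin (gtop G) (K - (\<Union>\<beta>\<in>T0. U \<beta>))"
    by (rule closed_compactin[OF K(1) Diff_subset])
  then have "closedin (gtop G) (gsrc G ` (K - (\<Union>\<beta>\<in>T0. U \<beta>)))"
    by (intro B.compactin_imp_closed image_compactin[OF _ B.continuous_src])
  then have O: "openin (gtop G) (units G \<inter> \<Inter>\<A> - gsrc G ` (K - (\<Union>\<beta>\<in>T0. U \<beta>)))" (is "openin _ ?O")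
    by (rule openin_diff[OF N1])
  have p_x0: "q (p \<beta> x0) = \<beta>" if "\<beta> \<in> T0" for \<beta>
    using pU[OF that U(2)[OF that]] that by (auto simp: T0_def)
  have x0_in: "x0 \<in> gsrc G ` U \<beta>" if "\<beta> \<in> T0" for \<beta>
    using U(2)[OF that] that by (auto simp: T0_def)
  have "x0 \<in> \<Inter>\<A>" using x0_in p_x0 by (auto simp: \<A>_def D_def)
  moreover have "x0 \<notin> gsrc G ` (K - (\<Union>\<beta>\<in>T0. U \<beta>))" using U(2) by (auto simp: T0_def)
  ultimately have x0: "x0 \<in> ?O" using s0 by (simp add: x0_def)
  let ?N = "{\<sigma> \<in> arrows \<Sigma>. gsrc G (q \<sigma>) \<in> ?O}"
  have srcq: "continuous_map (gtop \<Sigma>) (gtop G) (\<lambda>\<sigma>. gsrc G (q \<sigma>))"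
    by (rule B.continuous_map_gsrc[OF proj_continuous])
  have N: "openin (gtop \<Sigma>) ?N"
    using openin_continuous_map_preimage[OF srcq O] by simp
  have val: "ev \<sigma> (section_conv E f g) =
      (\<Sum>\<beta>\<in>T0. ev (gmul \<Sigma> \<sigma> (ginv \<Sigma> (p \<beta> (gsrc G (q \<sigma>))))) f * ev (p \<beta> (gsrc G (q \<sigma>))) g)"
    and p_arr: "\<And>\<beta>. \<beta> \<in> T0 \<Longrightarrow> p \<beta> (gsrc G (q \<sigma>)) \<in> arrows \<Sigma> \<and>
      gsrc G (q (p \<beta> (gsrc G (q \<sigma>)))) = gsrc G (q \<sigma>)"
    if "\<sigma> \<in> ?N" for \<sigma>
  proof -
    let ?x = "gsrc G (q \<sigma>)"
    have s: "\<sigma> \<in> arrows \<Sigma>" and x: "?x \<in> ?O" using that by auto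
    have xU: "?x \<in> gsrc G ` U \<beta>" if "\<beta> \<in> T0" for \<beta> using x that by (auto simp: \<A>_def)
    have p: "p \<beta> ?x \<in> arrows \<Sigma> \<and> gsrc G (q (p \<beta> ?x)) = ?x" if b: "\<beta> \<in> T0" for \<beta>
    proof -
      obtain \<gamma> where \<gamma>: "\<gamma> \<in> U \<beta>" "gsrc G \<gamma> = ?x" using xU[OF b] by auto
      show ?thesis using pU[OF b \<gamma>(1)] \<gamma>(2) by simp
    qed
    show "\<And>\<beta>. \<beta> \<in> T0 \<Longrightarrow> p \<beta> ?x \<in> arrows \<Sigma> \<and> gsrc G (q (p \<beta> ?x)) = ?x" by (rule p)
    have inj: "inj_on (\<lambda>\<beta>. q (p \<beta> ?x)) T0"
    proof (rule inj_onI, rule ccontr)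
      fix \<beta> \<beta>' assume b: "\<beta> \<in> T0" "\<beta>' \<in> T0" "q (p \<beta> ?x) = q (p \<beta>' ?x)" "\<beta> \<noteq> \<beta>'"
      then have "D \<beta> \<beta>' \<in> \<A>" by (auto simp: \<A>_def)
      then show False using x b(3) by (auto simp: D_def)
    qed
    let ?S = "(\<lambda>\<beta>. q (p \<beta> ?x)) ` T0"
    have "fibre_support g ?x \<subseteq> ?S"
    proof
      fix \<gamma> assume \<gamma>: "\<gamma> \<in> fibre_support g ?x"
      then have "\<gamma> \<in> K" "gsrc G \<gamma> = ?x" using fibre_support_subset[OF K(2)] by auto
      moreover have "\<gamma> \<notin> K - (\<Union>\<beta>\<in>T0. U \<beta>)"
        using x imageI[of \<gamma> "K - (\<Union>\<beta>\<in>T0. U \<beta>)" "gsrc G"] \<open>gsrc G \<gamma> = ?x\<close> by (metis DiffD2)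
      ultimately obtain \<beta> where "\<beta> \<in> T0" "\<gamma> \<in> U \<beta>" by blast
      then show "\<gamma> \<in> ?S" using pU[of \<beta> \<gamma>] \<open>gsrc G \<gamma> = ?x\<close> by (intro image_eqI[of _ _ \<beta>]) auto
    qed
    then have "ev \<sigma> (section_conv E f g) = (\<Sum>\<beta>\<in>?S. ev (gmul \<Sigma> \<sigma> (ginv \<Sigma> (lift \<beta>))) f * ev (lift \<beta>) g)"
      using p T0(1) by (intro ev_conv[OF fg finite_fibre_support[OF g] s]) auto
    also have "\<dots> = (\<Sum>\<beta>\<in>T0. ev (gmul \<Sigma> \<sigma> (ginv \<Sigma> (lift (q (p \<beta> ?x))))) f * ev (lift (q (p \<beta> ?x))) g)"
      using inj by (simp add: sum.reindex)
    also have "\<dots> = (\<Sum>\<beta>\<in>T0. ev (gmul \<Sigma> \<sigma> (ginv \<Sigma> (p \<beta> ?x))) f * ev (p \<beta> ?x) g)"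
      using p s by (intro sum.cong conv_term_lift[OF fg]) (auto simp: lift)
    finally show "ev \<sigma> (section_conv E f g) =
      (\<Sum>\<beta>\<in>T0. ev (gmul \<Sigma> \<sigma> (ginv \<Sigma> (p \<beta> ?x))) f * ev (p \<beta> ?x) g)" .
  qed
  have "continuous_map (subtopology (gtop \<Sigma>) ?N) euclidean
      (\<lambda>\<sigma>. \<Sum>\<beta>\<in>T0. ev (gmul \<Sigma> \<sigma> (ginv \<Sigma> (p \<beta> (gsrc G (q \<sigma>))))) f * ev (p \<beta> (gsrc G (q \<sigma>))) g)"
  proof (intro continuous_map_sum T0 continuous_map_complex_mult)
    fix \<beta> assume b: "\<beta> \<in> T0"
    have "?O \<subseteq> gsrc G ` U \<beta>" using b by (auto simp: \<A>_def)
    then have "continuous_map (subtopology (gtop \<Sigma>) ?N) (subtopology (gtop G) (gsrc G ` U \<beta>)) (\<lambda>\<sigma>. gsrc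
        G (q \<sigma>))"
      using continuous_map_from_subtopology[OF srcq] by (auto simp: continuous_map_in_subtopology)
    from continuous_map_compose[OF this p[OF b]]
    have c: "continuous_map (subtopology (gtop \<Sigma>) ?N) (gtop \<Sigma>) (\<lambda>\<sigma>. p \<beta> (gsrc G (q \<sigma>)))" by (simp add:
        o_def)
    from continuous_map_compose[OF this Cc_continuous[OF g]]
    show "continuous_map (subtopology (gtop \<Sigma>) ?N) euclidean (\<lambda>\<sigma>. ev (p \<beta> (gsrc G (q \<sigma>))) g)" by (simp
        add: o_def)
    have "continuous_map (subtopology (gtop \<Sigma>) ?N) (gtop \<Sigma>) (\<lambda>\<sigma>. gmul \<Sigma> \<sigma> (ginv \<Sigma> (p \<beta> (gsrc G (q \<sigma>)))))"
      using p_arr[OF _ b] by (intro T.continuous_map_gmul T.continuous_map_ginv c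
          quotient_composable(1)) auto
    from continuous_map_compose[OF this Cc_continuous[OF f]]
    show "continuous_map (subtopology (gtop \<Sigma>) ?N) euclidean
        (\<lambda>\<sigma>. ev (gmul \<Sigma> \<sigma> (ginv \<Sigma> (p \<beta> (gsrc G (q \<sigma>))))) f)" by (simp add: o_def)
  qed
  then have "continuous_map (subtopology (gtop \<Sigma>) ?N) euclidean (\<lambda>\<sigma>. ev \<sigma> (section_conv E f g))"
    by (rule continuous_map_eq) (use val in auto)
  moreover have "\<sigma>0 \<in> ?N" using s0 x0 by (simp only: x0_def mem_Collect_eq)
  ultimately show "\<exists>N. openin (gtop \<Sigma>) N \<and> \<sigma>0 \<in> N \<and>
      continuous_map (subtopology (gtop \<Sigma>) N) euclidean (\<lambda>\<sigma>. ev \<sigma> (section_conv E f g))"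
    using N by (intro exI[of _ ?N]) simp
qed

lemma section_conv_in_Cc:
  assumes f: "f \<in> Cc_sections E" and g: "g \<in> Cc_sections E"
  shows "section_conv E f g \<in> Cc_sections E"
proof -
  have fg: "f \<in> sections" "g \<in> sections" by (rule Cc_in_sections[OF f], rule Cc_in_sections[OF g])
  obtain K where K: "compactin (gtop G) K" "\<And>\<sigma>. \<sigma> \<in> arrows \<Sigma> \<Longrightarrow> q \<sigma> \<notin> K \<Longrightarrow> ev \<sigma> f = 0"
    using f by (rule Cc_support) (rule that)
  obtain L where L: "compactin (gtop G) L" "\<And>\<sigma>. \<sigma> \<in> arrows \<Sigma> \<Longrightarrow> q \<sigma> \<notin> L \<Longrightarrow> ev \<sigma> g = 0"
    using g by (rule Cc_support) (rule that)
  show ?thesis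
  proof (rule CcI[OF section_conv_in_sections[OF fg finite_fibre_support[OF g]] continuous_conv[OF f g]
        B.compactin_product_set[OF K(1) L(1)]])
    fix \<sigma> assume s: "\<sigma> \<in> arrows \<Sigma>"
      and notin: "q \<sigma> \<notin> {gmul G \<alpha> \<beta> |\<alpha> \<beta>. \<alpha> \<in> K \<and> \<beta> \<in> L \<and> (\<alpha>, \<beta>) \<in> composable G}"
    have "ev (gmul \<Sigma> \<sigma> (ginv \<Sigma> (lift \<beta>))) f * ev (lift \<beta>) g = 0" if b: "\<beta> \<in> source_fibre (gsrc G (q \<sigma>))"
        for \<beta>
    proof (rule ccontr)
      assume nz: "\<not> ?thesis"
      have l: "lift \<beta> \<in> arrows \<Sigma>" "q (lift \<beta>) = \<beta>" "gsrc G (q (lift \<beta>)) = gsrc G (q \<sigma>)" using b by (auto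
          simp: lift)
      let ?\<alpha> = "gmul \<Sigma> \<sigma> (ginv \<Sigma> (lift \<beta>))"
      have "\<beta> \<in> L" "q ?\<alpha> \<in> K"
        using nz K(2)[of ?\<alpha>] L(2)[of "lift \<beta>"] l quotient_closed[OF s l(1,3)] by auto
      moreover have c: "(?\<alpha>, lift \<beta>) \<in> composable \<Sigma>" using quotient_composable(2)[OF s l(1,3)] .
      moreover have "q \<sigma> = gmul G (q ?\<alpha>) \<beta>"
        using proj_mul[OF c] quotient_mult[OF s l(1,3)] l(2) by simp
      moreover have "(q ?\<alpha>, \<beta>) \<in> composable G" using c l(2) b by (auto simp: composable_total
          B.composable_iff)
      ultimately show False using notin by blast
    qed
    then have "(\<Sum>\<beta>\<in>fibre_support g (gsrc G (q \<sigma>)). ev (gmul \<Sigma> \<sigma> (ginv \<Sigma> (lift \<beta>))) f * ev (lift \<beta>) g) = 0"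
      by (intro sum.neutral) (auto simp: fibre_support_def)
    moreover have "ev \<sigma> (section_conv E f g) =
        (\<Sum>\<beta>\<in>fibre_support g (gsrc G (q \<sigma>)). ev (gmul \<Sigma> \<sigma> (ginv \<Sigma> (lift \<beta>))) f * ev (lift \<beta>) g)"
      by (rule ev_conv[OF fg finite_fibre_support[OF g] s finite_fibre_support[OF g]]) (auto simp:
          fibre_support_def)
    ultimately show "ev \<sigma> (section_conv E f g) = 0" by simp
  qed
qed

end

section \<open>Functions on the unit space\<close>

context twist
begin

definition pointwise_mult :: "('g \<Rightarrow> complex) \<Rightarrow> ('g, 's) line_section \<Rightarrow> ('g, 's) line_section" where
  "pointwise_mult k f = section_of (\<lambda>\<sigma>. k (q \<sigma>) * ev \<sigma> f)"

lemma pointwise_mult_in_sections: "pointwise_mult k f \<in> sections"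
  by (simp only: pointwise_mult_def section_of_in_sections)

lemma ev_pointwise_mult:
  assumes "f \<in> sections" "\<sigma> \<in> arrows \<Sigma>" shows "ev \<sigma> (pointwise_mult k f) = k (q \<sigma>) * ev \<sigma> f"
  unfolding pointwise_mult_def using assms
  by (intro ev_section_of) (auto simp: equivariant_def ev_act)

lemma pointwise_mult_in_Cc:
  assumes f: "f \<in> Cc_sections E" and k: "continuous_map (gtop G) euclidean k"
  shows "pointwise_mult k f \<in> Cc_sections E"
proof -
  obtain K where K: "compactin (gtop G) K" "\<And>\<sigma>. \<sigma> \<in> arrows \<Sigma> \<Longrightarrow> q \<sigma> \<notin> K \<Longrightarrow> ev \<sigma> f = 0"
    using f by (rule Cc_support) (rule that)
  have fs: "f \<in> sections" using f by (rule Cc_in_sections)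
  show ?thesis
  proof (rule CcI[OF pointwise_mult_in_sections _ K(1)])
    have "continuous_map (gtop \<Sigma>) euclidean (\<lambda>\<sigma>. k (q \<sigma>))"
      using continuous_map_compose[OF proj_continuous k] by (simp add: o_def)
    from continuous_map_complex_mult[OF this Cc_continuous[OF f]]
    show "continuous_map (gtop \<Sigma>) euclidean (\<lambda>\<sigma>. ev \<sigma> (pointwise_mult k f))"
      by (rule continuous_map_eq_on_arrows) (simp add: ev_pointwise_mult[OF fs])
  qed (use K(2) in \<open>simp add: ev_pointwise_mult[OF fs]\<close>)
qed

abbreviation unit_arrow :: "'g \<Rightarrow> 's" where
  "unit_arrow x \<equiv> inc E (1, x)"

lemma unit_arrow:
  assumes "x \<in> units G"
  shows unit_arrow_closed: "unit_arrow x \<in> arrows \<Sigma>" and proj_unit_arrow: "q (unit_arrow x) = x"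
    and inv_unit_arrow: "ginv \<Sigma> (unit_arrow x) = unit_arrow x"
proof -
  show c: "unit_arrow x \<in> arrows \<Sigma>" using assms by simp
  show "q (unit_arrow x) = x" using assms by (intro proj_inc) simp_all
  have s: "gsrc \<Sigma> (unit_arrow x) = unit_arrow x" using assms by (intro inc_src) simp_all
  have r: "grng \<Sigma> (unit_arrow x) = unit_arrow x" using assms by (intro inc_rng) simp_all
  show "ginv \<Sigma> (unit_arrow x) = unit_arrow x"
    using T.mul_src[OF c] c by (intro T.inv_unique[symmetric]) (simp_all add: T.composable_iff s r)
qed

text \<open>The value off the units is \<open>0\<close>, so that the function is continuous on all of \<open>G\<close>.\<close>

definition unit_value :: "('g, 's) line_section \<Rightarrow> 'g \<Rightarrow> complex" where
  "unit_value f x = (if x \<in> units G then ev (unit_arrow x) f else 0)"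

lemma continuous_unit_value:
  assumes f: "f \<in> Cc_sections E" shows "continuous_map (gtop G) euclidean (unit_value f)"
proof -
  have "continuous_map (subtopology (gtop G) (units G))
      (prod_topology (top_of_set circle) (subtopology (gtop G) (units G))) (\<lambda>x. (1, x))"
    by (intro continuous_map_pairedI) (simp_all add: continuous_map_in_subtopology)
  from continuous_map_compose[OF continuous_map_compose[OF this inc_continuous] Cc_continuous[OF f]]
  have "continuous_map (subtopology (gtop G) (units G)) euclidean (\<lambda>x. ev (unit_arrow x) f)"
    by (simp add: o_def)
  from continuous_map_clopen_cases[OF B.openin_units B.closedin_units this, of "\<lambda>_. 0"]
  show ?thesis unfolding unit_value_def by simp
qed

lemma unit_Cc_iff: "h \<in> unit_Cc_sections E \<longleftrightarrow>
    h \<in> Cc_sections E \<and> (\<forall>\<sigma> \<in> arrows \<Sigma>. q \<sigma> \<notin> units G \<longrightarrow> ev \<sigma> h = 0)"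
proof -
  have "(\<forall>\<gamma> \<in> arrows G - units G. h \<gamma> = line_zero E \<gamma>) \<longleftrightarrow> (\<forall>\<sigma> \<in> arrows \<Sigma>. q \<sigma> \<notin> units G \<longrightarrow> ev \<sigma> h = 0)"
    if h: "h \<in> sections"
  proof
    assume "\<forall>\<gamma> \<in> arrows G - units G. h \<gamma> = line_zero E \<gamma>"
    then show "\<forall>\<sigma> \<in> arrows \<Sigma>. q \<sigma> \<notin> units G \<longrightarrow> ev \<sigma> h = 0"
      using section_eq_zero_iff[OF h] proj_closed by (metis DiffI)
  next
    assume z: "\<forall>\<sigma> \<in> arrows \<Sigma>. q \<sigma> \<notin> units G \<longrightarrow> ev \<sigma> h = 0"
    show "\<forall>\<gamma> \<in> arrows G - units G. h \<gamma> = line_zero E \<gamma>"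
    proof
      fix \<gamma> assume "\<gamma> \<in> arrows G - units G"
      then show "h \<gamma> = line_zero E \<gamma>"
        using section_eq_zero_iff[OF h, of "lift \<gamma>"] z by (simp add: lift)
    qed
  qed
  then show ?thesis unfolding unit_Cc_sections_def using Cc_in_sections by blast
qed

lemma unit_Cc_in_Cc: "h \<in> unit_Cc_sections E \<Longrightarrow> h \<in> Cc_sections E"
  by (simp add: unit_Cc_iff)

lemma unit_Cc_in_sections: "h \<in> unit_Cc_sections E \<Longrightarrow> h \<in> sections"
  by (intro Cc_in_sections unit_Cc_in_Cc)

lemma ev_over_unit:
  assumes "f \<in> sections" "\<sigma> \<in> arrows \<Sigma>" "q \<sigma> \<in> units G"
  obtains z where "z \<in> circle" "\<sigma> = act z (unit_arrow (q \<sigma>))"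
    "\<And>f. f \<in> sections \<Longrightarrow> ev \<sigma> f = cnj z * unit_value f (q \<sigma>)"
proof -
  obtain z where z: "z \<in> circle" "\<sigma> = act z (unit_arrow (q \<sigma>))"
    using act_transitive[OF assms(2) unit_arrow_closed[OF assms(3)]] proj_unit_arrow[OF assms(3)] by metis
  have "ev \<sigma> f = cnj z * unit_value f (q \<sigma>)" if "f \<in> sections" for f
    using ev_act[OF that unit_arrow_closed[OF assms(3)] z(1)] z(2) assms(3) by (simp add: unit_value_def)
  with z show thesis using that by blast
qed

lemma unit_section_eqI:
  assumes "f \<in> unit_Cc_sections E" "g \<in> unit_Cc_sections E"
      "\<And>x. x \<in> units G \<Longrightarrow> unit_value f x = unit_value g x"
  shows "f = g"
proof (rule section_eqI)
  show s: "f \<in> sections" "g \<in> sections"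
    by (rule unit_Cc_in_sections[OF assms(1)], rule unit_Cc_in_sections[OF assms(2)])
  fix \<sigma> assume \<sigma>: "\<sigma> \<in> arrows \<Sigma>"
  show "ev \<sigma> f = ev \<sigma> g"
  proof (cases "q \<sigma> \<in> units G")
    case True
    then show ?thesis using ev_over_unit[OF s(1) \<sigma> True] s assms(3) by metis
  next
    case False
    then show ?thesis using assms \<sigma> by (simp add: unit_Cc_iff)
  qed
qed

lemma cmod_unit_value:
  assumes "f \<in> sections" "\<sigma> \<in> arrows \<Sigma>" "q \<sigma> \<in> units G"
  shows "cmod (ev \<sigma> f) = cmod (unit_value f (q \<sigma>))"
  using cmod_ev_eq[OF assms(1,2) unit_arrow_closed[OF assms(3)]] assms(3) by (simp add: unit_value_def
      proj_unit_arrow)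

text \<open>
  The sections over the unit space form a commutative algebra under convolution, which \<open>unit_value\<close>
  identifies with an algebra of functions.
\<close>

lemma
  assumes f: "f \<in> unit_Cc_sections E" and g: "g \<in> unit_Cc_sections E"
  shows unit_add: "section_add E f g \<in> unit_Cc_sections E"
    and unit_value_add: "x \<in> units G \<Longrightarrow> unit_value (section_add E f g) x = unit_value f x + unit_value g x"
proof -
  note s = unit_Cc_in_sections[OF f] unit_Cc_in_sections[OF g]
  show "section_add E f g \<in> unit_Cc_sections E"
    using f g section_add_in_Cc[OF unit_Cc_in_Cc unit_Cc_in_Cc, OF f g] by (simp add: unit_Cc_iff
        ev_add[OF s])
  show "x \<in> units G \<Longrightarrow> unit_value (section_add E f g) x = unit_value f x + unit_value g x"
    by (simp add: unit_value_def ev_add[OF s])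
qed

lemma
  assumes f: "f \<in> unit_Cc_sections E"
  shows unit_scale: "section_scale E c f \<in> unit_Cc_sections E"
    and unit_value_scale: "x \<in> units G \<Longrightarrow> unit_value (section_scale E c f) x = c * unit_value f x"
proof -
  note s = unit_Cc_in_sections[OF f]
  show "section_scale E c f \<in> unit_Cc_sections E"
    using f section_scale_in_Cc[OF unit_Cc_in_Cc, OF f] by (simp add: unit_Cc_iff ev_scale[OF s])
  show "x \<in> units G \<Longrightarrow> unit_value (section_scale E c f) x = c * unit_value f x"
    by (simp add: unit_value_def ev_scale[OF s])
qed

lemma
  assumes f: "f \<in> unit_Cc_sections E" and k: "continuous_map (gtop G) euclidean k"
  shows unit_pointwise_mult: "pointwise_mult k f \<in> unit_Cc_sections E"
    and unit_value_pointwise_mult: "x \<in> units G \<Longrightarrow> unit_value (pointwise_mult k f) x = k x * unit_value f x"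
proof -
  note s = unit_Cc_in_sections[OF f]
  show "pointwise_mult k f \<in> unit_Cc_sections E"
    using f pointwise_mult_in_Cc[OF unit_Cc_in_Cc k, OF f] by (simp add: unit_Cc_iff
        ev_pointwise_mult[OF s])
  show "x \<in> units G \<Longrightarrow> unit_value (pointwise_mult k f) x = k x * unit_value f x"
    by (simp add: unit_value_def ev_pointwise_mult[OF s] proj_unit_arrow)
qed

lemma
  assumes f: "f \<in> unit_Cc_sections E"
  shows unit_star: "section_star E f \<in> unit_Cc_sections E"
    and unit_value_star: "x \<in> units G \<Longrightarrow> unit_value (section_star E f) x = cnj (unit_value f x)"
proof -
  note s = unit_Cc_in_sections[OF f]
  have "ev \<sigma> (section_star E f) = 0" if \<sigma>: "\<sigma> \<in> arrows \<Sigma>" "q \<sigma> \<notin> units G" for \<sigma>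
  proof -
    have "q (ginv \<Sigma> \<sigma>) \<notin> units G"
    proof
      assume u: "q (ginv \<Sigma> \<sigma>) \<in> units G"
      have "ginv G (q (ginv \<Sigma> \<sigma>)) = q \<sigma>" using \<sigma> by (simp add: proj_inv B.inv_inv)
      moreover have "ginv G (q (ginv \<Sigma> \<sigma>)) = q (ginv \<Sigma> \<sigma>)"
        using proj_inv[OF unit_arrow_closed[OF u]] u by (simp add: inv_unit_arrow proj_unit_arrow)
      ultimately show False using u \<sigma>(2) by simp
    qed
    then show ?thesis using f \<sigma>(1) by (simp add: ev_star[OF s] unit_Cc_iff T.inv_closed)
  qed
  then show "section_star E f \<in> unit_Cc_sections E"
    using section_star_in_Cc[OF unit_Cc_in_Cc, OF f] by (simp add: unit_Cc_iff)
  show "x \<in> units G \<Longrightarrow> unit_value (section_star E f) x = cnj (unit_value f x)"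
    by (simp add: unit_value_def ev_star[OF s] unit_arrow_closed inv_unit_arrow)
qed

lemma ev_conv_unit:
  assumes f: "f \<in> Cc_sections E" and h: "h \<in> unit_Cc_sections E" and \<sigma>: "\<sigma> \<in> arrows \<Sigma>"
  shows "ev \<sigma> (section_conv E f h) = ev \<sigma> f * unit_value h (gsrc G (q \<sigma>))"
proof -
  let ?x = "gsrc G (q \<sigma>)"
  note s = Cc_in_sections[OF f] unit_Cc_in_sections[OF h]
  have x: "?x \<in> units G" using \<sigma> by simp
  have srcx: "gsrc G ?x = ?x" using x by (simp add: B.units_iff)
  have "fibre_support h ?x \<subseteq> {?x}"
  proof
    fix \<beta> assume "\<beta> \<in> fibre_support h ?x"
    then have b: "\<beta> \<in> arrows G" "gsrc G \<beta> = ?x" "ev (lift \<beta>) h \<noteq> 0" by (auto simp: fibre_support_def)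
    then have "\<beta> \<in> units G" using h lift[OF b(1)] by (force simp: unit_Cc_iff)
    then show "\<beta> \<in> {?x}" using b(2) by (simp add: B.units_iff)
  qed
  then have "ev \<sigma> (section_conv E f h) = ev (gmul \<Sigma> \<sigma> (ginv \<Sigma> (lift ?x))) f * ev (lift ?x) h"
    using ev_conv[OF s finite_fibre_support[OF unit_Cc_in_Cc[OF h]] \<sigma>, of "{?x}"] x srcx by (simp add:
        B.units_arrows)
  also have "\<dots> = ev (gmul \<Sigma> \<sigma> (ginv \<Sigma> (unit_arrow ?x))) f * ev (unit_arrow ?x) h"
    using x srcx by (intro conv_term_lift[OF s \<sigma>]) (simp_all add: lift unit_arrow B.units_arrows)
  also have "gmul \<Sigma> \<sigma> (ginv \<Sigma> (unit_arrow ?x)) = \<sigma>"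
    using T.mul_src[OF \<sigma>] x \<sigma> by (simp add: inv_unit_arrow src_total)
  finally show ?thesis using x by (simp add: unit_value_def)
qed

lemma
  assumes f: "f \<in> unit_Cc_sections E" and g: "g \<in> unit_Cc_sections E"
  shows unit_conv: "section_conv E f g \<in> unit_Cc_sections E"
    and unit_value_conv: "x \<in> units G \<Longrightarrow> unit_value (section_conv E f g) x = unit_value f x * unit_value g x"
proof -
  note ev = ev_conv_unit[OF unit_Cc_in_Cc[OF f] g]
  show "section_conv E f g \<in> unit_Cc_sections E"
    using f section_conv_in_Cc[OF unit_Cc_in_Cc unit_Cc_in_Cc, OF f g] by (simp add: unit_Cc_iff ev)
  show "x \<in> units G \<Longrightarrow> unit_value (section_conv E f g) x = unit_value f x * unit_value g x"
    by (simp add: unit_value_def ev unit_arrow) (simp add: B.units_iff)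
qed

lemma section_on_units:
  assumes f: "f \<in> Cc_sections E"
  shows "section_on E (units G) f \<in> unit_Cc_sections E"
    and "x \<in> units G \<Longrightarrow> unit_value (section_on E (units G) f) x = unit_value f x"
proof -
  note s = Cc_in_sections[OF f]
  let ?k = "\<lambda>\<gamma>. if \<gamma> \<in> units G then 1 else (0::complex)"
  have k: "continuous_map (gtop G) euclidean ?k"
    by (rule continuous_map_clopen_cases[OF B.openin_units B.closedin_units]) simp_all
  have val: "f (q \<sigma>) = line_class E (ev \<sigma> f) \<sigma>" if "\<sigma> \<in> arrows \<Sigma>" "q \<sigma> \<in> units G" for \<sigma>
    by (rule section_value[OF s that(1)])
  have eq: "section_on E (units G) f = pointwise_mult ?k f"
    by (rule section_eqI[OF section_on_in_sections[OF val] pointwise_mult_in_sections])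
      (auto simp: ev_section_on[OF val] ev_pointwise_mult[OF s])
  show "section_on E (units G) f \<in> unit_Cc_sections E"
    using pointwise_mult_in_Cc[OF f k] by (simp add: eq unit_Cc_iff ev_pointwise_mult[OF s])
  show "x \<in> units G \<Longrightarrow> unit_value (section_on E (units G) f) x = unit_value f x"
    by (simp add: eq unit_value_def ev_pointwise_mult[OF s] unit_arrow)
qed

text \<open>
  Since \<open>f\<^sup>*(\<beta>\<^sup>-\<^sup>1)\<close> is the conjugate of \<open>f(\<beta>)\<close>, evaluating \<open>f\<^sup>* g\<close> at a unit \<open>x\<close> gives the inner
  product of \<open>f\<close> and \<open>g\<close> as square summable functions on the source fibre of \<open>x\<close>; in this way \<open>x\<close>
  becomes a positive functional, whose Gelfand-Naimark-Segal space is that of a regular representation.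
\<close>

lemma unit_value_star_conv:
  assumes f: "f \<in> Cc_sections E" and g: "g \<in> Cc_sections E" and x: "x \<in> units G"
    and S: "finite S" "fibre_support g x \<subseteq> S" "S \<subseteq> source_fibre x"
  shows "ev (unit_arrow x) (section_conv E (section_star E f) g) =
    (\<Sum>\<beta>\<in>S. cnj (ev (lift \<beta>) f) * ev (lift \<beta>) g)"
proof -
  note s = Cc_in_sections[OF f] Cc_in_sections[OF g]
  have x': "gsrc G (q (unit_arrow x)) = x" using x by (simp add: proj_unit_arrow) (simp add: B.units_iff)
  have "ev (gmul \<Sigma> (unit_arrow x) (ginv \<Sigma> (lift \<beta>))) (section_star E f) = cnj (ev (lift \<beta>) f)"
    if b: "\<beta> \<in> S" for \<beta>
  proof -
    have l: "lift \<beta> \<in> arrows \<Sigma>" "gsrc G (q (lift \<beta>)) = x" using b S(3) by (auto simp: lift)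
    have "grng \<Sigma> (ginv \<Sigma> (lift \<beta>)) = unit_arrow x" using l by (simp add: T.rng_inv src_total)
    then have "gmul \<Sigma> (unit_arrow x) (ginv \<Sigma> (lift \<beta>)) = ginv \<Sigma> (lift \<beta>)"
      using T.mul_rng[OF T.inv_closed[OF l(1)]] by simp
    then show ?thesis using l by (simp add: ev_star[OF s(1)] T.inv_closed T.inv_inv)
  qed
  then show ?thesis
    using ev_conv[OF section_star_in_sections[OF s(1)] s(2) finite_fibre_support[OF g]
        unit_arrow_closed[OF x] S(1)]
      S x' by simp
qed

lemma unit_value_star_conv_left:
  assumes f: "f \<in> Cc_sections E" and g: "g \<in> Cc_sections E" and x: "x \<in> units G"
    and S: "finite S" "fibre_support f x \<subseteq> S" "S \<subseteq> source_fibre x"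
  shows "ev (unit_arrow x) (section_conv E (section_star E f) g) =
    (\<Sum>\<beta>\<in>S. cnj (ev (lift \<beta>) f) * ev (lift \<beta>) g)"
proof -
  have "ev (unit_arrow x) (section_conv E (section_star E f) g) =
      (\<Sum>\<beta>\<in>S \<union> fibre_support g x. cnj (ev (lift \<beta>) f) * ev (lift \<beta>) g)"
    using S finite_fibre_support[OF g, of x] by (intro unit_value_star_conv f g x) (auto simp:
        fibre_support_def)
  also have "\<dots> = (\<Sum>\<beta>\<in>S. cnj (ev (lift \<beta>) f) * ev (lift \<beta>) g)"
    using S finite_fibre_support[OF g, of x] by (intro sum.mono_neutral_right) (auto simp:
        fibre_support_def)
  finally show ?thesis .
qed

end

section \<open>The norm of functions on the unit space\<close>

locale reduced_twist = twist E for E :: "('g, 's) twist_data" +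
  fixes j :: "('g, 's) line_section \<Rightarrow> 'a::cstar_algebra"
  assumes reduced: "reduced_completion E j"
begin

lemma j_inj: "inj_on j (Cc_sections E)"
  and j_dense: "closure (j ` Cc_sections E) = UNIV"
  and j_add: "f \<in> Cc_sections E \<Longrightarrow> g \<in> Cc_sections E \<Longrightarrow> j (section_add E f g) = j f + j g"
  and j_conv: "f \<in> Cc_sections E \<Longrightarrow> g \<in> Cc_sections E \<Longrightarrow> j (section_conv E f g) = j f * j g"
  and j_scale: "f \<in> Cc_sections E \<Longrightarrow> j (section_scale E c f) = scaleC c (j f)"
  and j_star: "f \<in> Cc_sections E \<Longrightarrow> j (section_star E f) = star (j f)"
  using reduced by (auto simp: reduced_completion_def cstar_completion_def)

lemma j_eq_zero_iff:
  assumes f: "f \<in> Cc_sections E" shows "j f = 0 \<longleftrightarrow> (\<forall>\<sigma> \<in> arrows \<Sigma>. ev \<sigma> f = 0)"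
proof -
  note s = Cc_in_sections[OF f]
  have "j f = 0 \<longleftrightarrow> j f = j (section_scale E 0 f)" using f by (simp add: j_scale)
  also have "\<dots> \<longleftrightarrow> f = section_scale E 0 f"
    using inj_on_eq_iff[OF j_inj f section_scale_in_Cc[OF f]] .
  also have "\<dots> \<longleftrightarrow> (\<forall>\<sigma> \<in> arrows \<Sigma>. ev \<sigma> f = 0)"
  proof
    assume eq: "f = section_scale E 0 f"
    show "\<forall>\<sigma> \<in> arrows \<Sigma>. ev \<sigma> f = 0"
    proof
      fix \<sigma> assume "\<sigma> \<in> arrows \<Sigma>"
      then have "ev \<sigma> (section_scale E 0 f) = 0" by (simp add: ev_scale[OF s])
      then show "ev \<sigma> f = 0" using eq by simp
    qed
  next
    assume "\<forall>\<sigma> \<in> arrows \<Sigma>. ev \<sigma> f = 0"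
    then show "f = section_scale E 0 f"
      by (intro section_eqI s section_scale_in_sections) (simp add: ev_scale[OF s])
  qed
  finally show ?thesis .
qed

definition section_diff :: "('g, 's) line_section \<Rightarrow> ('g, 's) line_section \<Rightarrow> ('g, 's) line_section" where
  "section_diff f g = section_add E f (section_scale E (-1) g)"

lemma
  assumes f: "f \<in> Cc_sections E" and g: "g \<in> Cc_sections E"
  shows section_diff_in_Cc: "section_diff f g \<in> Cc_sections E"
    and j_diff: "j (section_diff f g) = j f - j g"
    and ev_diff: "\<sigma> \<in> arrows \<Sigma> \<Longrightarrow> ev \<sigma> (section_diff f g) = ev \<sigma> f - ev \<sigma> g"
  unfolding section_diff_def
  using f g section_scale_in_Cc[OF g, of "-1"] Cc_in_sections[OF f] Cc_in_sections[OF g]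
  by (simp_all add: section_add_in_Cc j_add j_scale scaleC_minus1 ev_add ev_scale Cc_in_sections del:
      PiE_iff)

text \<open>
  For a real function \<open>h\<close> with values in \<open>[-1, 1]\<close>, the element \<open>1 + w\<close> with \<open>w = (1 - h\<^sup>2)\<^sup>1\<^sup>/\<^sup>2 -
  1\<close> and \<open>h\<close> satisfy \<open>h\<^sup>2 + (1 + w)\<^sup>2 = 1\<close>. Written as \<open>w = - h \<cdot> h / (1 + (1 - h\<^sup>2)\<^sup>1\<^sup>/\<^sup>2)\<close>, the
  function \<open>w\<close> is a multiple of \<open>h\<close>, hence it has compact support.
\<close>

lemma norm_unit_le_1_real:
  assumes h: "h \<in> unit_Cc_sections E"
    and real: "\<And>x. x \<in> units G \<Longrightarrow> unit_value h x = complex_of_real (r x)"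
    and le: "\<And>x. x \<in> units G \<Longrightarrow> \<bar>r x\<bar> \<le> 1"
  shows "norm (j h) \<le> 1"
proof -
  define \<psi> where "\<psi> = (\<lambda>t::complex. complex_of_real (- Re t / (1 + sqrt (1 - (Re t)\<^sup>2))))"
  define k where "k = (\<lambda>\<gamma>. \<psi> (unit_value h \<gamma>))"
  have pos: "1 + sqrt (1 - (Re t)\<^sup>2) > 0" if "\<bar>Re t\<bar> \<le> 1" for t
  proof -
    have "(Re t)\<^sup>2 \<le> 1" using that by (simp add: abs_square_le_1)
    then show ?thesis by (simp add: add_pos_nonneg)
  qed
  have "continuous_on {t. \<bar>Re t\<bar> \<le> 1} \<psi>"
    unfolding \<psi>_def using pos by (intro continuous_intros) force
  moreover have "unit_value h \<gamma> \<in> {t. \<bar>Re t\<bar> \<le> 1}" for \<gamma>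
  proof (cases "\<gamma> \<in> units G")
    case True
    then show ?thesis using real[OF True] le[OF True] by simp
  qed (simp add: unit_value_def)
  ultimately have k: "continuous_map (gtop G) euclidean k"
    unfolding k_def by (intro continuous_map_compose_on[OF continuous_unit_value[OF unit_Cc_in_Cc[OF h]]])
  define w where "w = pointwise_mult k h"
  have w: "w \<in> unit_Cc_sections E" unfolding w_def by (rule unit_pointwise_mult[OF h k])
  have w_val: "unit_value w x = complex_of_real (sqrt (1 - (r x)\<^sup>2) - 1)" if x: "x \<in> units G" for x
  proof -
    have "(r x)\<^sup>2 \<le> 1" using le[OF x] by (simp add: abs_square_le_1)
    then have "(sqrt (1 - (r x)\<^sup>2))\<^sup>2 = 1 - (r x)\<^sup>2" by simp
    moreover have "1 + sqrt (1 - (r x)\<^sup>2) > 0" using pos[of "of_real (r x)"] le[OF x] by simp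
    ultimately have "- r x / (1 + sqrt (1 - (r x)\<^sup>2)) * r x = sqrt (1 - (r x)\<^sup>2) - 1"
      by (simp add: field_simps power2_eq_square)
    then show ?thesis
      unfolding w_def unit_value_pointwise_mult[OF h k x]
      by (simp only: k_def \<psi>_def real[OF x] of_real_mult[symmetric] Re_complex_of_real)
  qed
  have star_h: "star (j h) = j h"
    unfolding j_star[OF unit_Cc_in_Cc[OF h], symmetric]
    by (rule arg_cong[of _ _ j]) (rule unit_section_eqI[OF unit_star[OF h] h], simp add:
        unit_value_star[OF h] real)
  have star_w: "star (j w) = j w"
    unfolding j_star[OF unit_Cc_in_Cc[OF w], symmetric]
    by (rule arg_cong[of _ _ j]) (rule unit_section_eqI[OF unit_star[OF w] w], simp add:
        unit_value_star[OF w] w_val)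
  have comm: "j h * j w = j w * j h"
    unfolding j_conv[OF unit_Cc_in_Cc unit_Cc_in_Cc, OF h w, symmetric] j_conv[OF unit_Cc_in_Cc
        unit_Cc_in_Cc, OF w h, symmetric]
    by (rule arg_cong[of _ _ j])
      (rule unit_section_eqI[OF unit_conv[OF h w] unit_conv[OF w h]], simp add: unit_value_conv[OF h w]
          unit_value_conv[OF w h])
  let ?hh = "section_conv E h h" and ?ww = "section_conv E w w" and ?w2 = "section_scale E 2 w"
  have z: "section_add E ?hh (section_add E ?ww ?w2) \<in> unit_Cc_sections E"
    by (intro unit_add unit_conv unit_scale h w)
  have "unit_value (section_add E ?hh (section_add E ?ww ?w2)) x = 0" if x: "x \<in> units G" for x
  proof -
    have "(r x)\<^sup>2 \<le> 1" using le[OF x] by (simp add: abs_square_le_1)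
    then have "(sqrt (1 - (r x)\<^sup>2))\<^sup>2 = 1 - (r x)\<^sup>2" by simp
    then have "r x * r x + ((sqrt (1 - (r x)\<^sup>2) - 1) * (sqrt (1 - (r x)\<^sup>2) - 1) + 2 * (sqrt (1 - (r
        x)\<^sup>2) - 1)) = 0"
      by (simp add: algebra_simps power2_eq_square)
    from arg_cong[OF this, of complex_of_real] show ?thesis
      by (simp only: unit_value_add[OF unit_conv[OF h h] unit_add[OF unit_conv[OF w w] unit_scale[OF w]] x]
          unit_value_add[OF unit_conv[OF w w] unit_scale[OF w] x] unit_value_conv[OF h h x]
              unit_value_conv[OF w w x]
          unit_value_scale[OF w x] real[OF x] w_val[OF x] of_real_add of_real_mult of_real_0
              of_real_numeral)
  qed
  then have "ev \<sigma> (section_add E ?hh (section_add E ?ww ?w2)) = 0" if \<sigma>: "\<sigma> \<in> arrows \<Sigma>" for \<sigma>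
    using cmod_unit_value[OF unit_Cc_in_sections[OF z] \<sigma>] z \<sigma> by (cases "q \<sigma> \<in> units G") (auto simp:
        unit_Cc_iff)
  then have "j (section_add E ?hh (section_add E ?ww ?w2)) = 0"
    using j_eq_zero_iff[OF unit_Cc_in_Cc[OF z]] by blast
  then have zero: "j h * j h + (j w * j w + 2 *\<^sub>R j w) = 0"
    using scaleC_of_real[of 2 "j w"] h w
    by (simp add: j_add j_conv j_scale section_add_in_Cc section_conv_in_Cc section_scale_in_Cc
        unit_Cc_in_Cc)
  let ?p = "left_mult (j h)" and ?q = "id_blinfun + left_mult (j w)"
  have "symmetric_op ?p" "symmetric_op ?q"
    by (intro symmetric_op_intros symmetric_op_left_mult star_h star_w)+
  moreover have "commuting ?p ?q"
    by (intro commuting_intros commutingI) (simp add: mult.assoc[symmetric] comm)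
  moreover have "?p (?p a) + ?q (?q a) = 1 *\<^sub>R a" for a
    using arg_cong[OF zero, of "\<lambda>b. b * a"] by (simp add: blinfun.bilinear_simps algebra_simps scaleR_2)
  ultimately have "norm (?p (j h)) \<le> sqrt 1 * norm (j h)"
    by (intro norm_of_sum_of_squares_le(1)) auto
  then have "(norm (j h))\<^sup>2 \<le> norm (j h)"
    using cstar_identity[of "j h"] by (simp add: star_h)
  then show ?thesis
    by (cases "norm (j h) = 0") (auto simp: power2_eq_square mult_le_cancel_right1 intro: ccontr)
qed

text \<open>The real case applied to \<open>h\<^sup>* h\<close>, after scaling.\<close>

lemma norm_unit_le:
  assumes h: "h \<in> unit_Cc_sections E" and le: "\<And>x. x \<in> units G \<Longrightarrow> cmod (unit_value h x) \<le> M" and M: "0 < M"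
  shows "norm (j h) \<le> M"
proof -
  define g where "g = section_scale E (of_real (1 / M)) h"
  have g: "g \<in> unit_Cc_sections E" unfolding g_def by (rule unit_scale[OF h])
  have sg: "section_star E g \<in> unit_Cc_sections E" by (rule unit_star[OF g])
  have "norm (j (section_conv E (section_star E g) g)) \<le> 1"
  proof (rule norm_unit_le_1_real[OF unit_conv[OF sg g]])
    fix x assume x: "x \<in> units G"
    show "unit_value (section_conv E (section_star E g) g) x = complex_of_real ((cmod (unit_value g x))\<^sup>2)"
      by (simp only: unit_value_conv[OF sg g x] unit_value_star[OF g x] complex_norm_square
          mult.commute[of "cnj _"])
    have "cmod (unit_value g x) = cmod (unit_value h x) / M"
      unfolding g_def unit_value_scale[OF h x] using M by (simp add: norm_mult norm_divide)
    then show "\<bar>(cmod (unit_value g x))\<^sup>2\<bar> \<le> 1" using le[OF x] M by (simp add: power_le_one)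
  qed
  then have "norm (star (j g) * j g) \<le> 1"
    using g sg by (simp add: j_conv j_star unit_Cc_in_Cc)
  then have "norm (j g) \<le> 1" by (simp add: cstar_identity abs_square_le_1)
  then show ?thesis
    using M h by (simp add: g_def j_scale unit_Cc_in_Cc norm_scaleC norm_divide)
qed

text \<open>
  If \<open>\<parallel>h\<^sup>* h\<parallel> < c < \<bar>h(x)\<bar>\<^sup>2\<close>, then \<open>t = \<bar>h\<bar>\<^sup>2\<close> divides the function \<open>\<theta>\<^sub>0 = max 0 (1 - c / t)\<close>
  arbitrarily often, with quotients \<open>\<theta>\<^sub>n = t\<^sup>-\<^sup>n \<theta>\<^sub>0\<close> bounded by \<open>c\<^sup>-\<^sup>n\<close>. So \<open>\<theta>\<^sub>0\<close> has norm zero,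
  although it does not vanish at \<open>x\<close>.
\<close>

lemma unit_value_le_norm:
  assumes h: "h \<in> unit_Cc_sections E" and x: "x \<in> units G"
  shows "cmod (unit_value h x) \<le> norm (j h)"
proof (rule ccontr)
  assume less: "\<not> ?thesis"
  have sh: "section_star E h \<in> unit_Cc_sections E" by (rule unit_star[OF h])
  define g where "g = section_conv E (section_star E h) h"
  have g: "g \<in> unit_Cc_sections E" unfolding g_def by (rule unit_conv[OF sh h])
  have gv: "unit_value g y = complex_of_real ((cmod (unit_value h y))\<^sup>2)" if "y \<in> units G" for y
    unfolding g_def by (simp only: unit_value_conv[OF sh h that] unit_value_star[OF h that]
        complex_norm_square mult.commute[of "cnj _"])
  define t where "t = (\<lambda>y. (cmod (unit_value h y))\<^sup>2)"
  define \<rho> where "\<rho> = norm (j g)"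
  have "\<rho> = (norm (j h))\<^sup>2"
    using h sh by (simp add: \<rho>_def g_def j_conv j_star unit_Cc_in_Cc cstar_identity)
  then have "\<rho> < t x" using less by (simp add: t_def power_strict_mono)
  then obtain c where c: "\<rho> < c" "c < t x" using dense by blast
  have c0: "c > 0" using c(1) norm_ge_zero[of "j g"] unfolding \<rho>_def by linarith
  define \<psi> where "\<psi> = (\<lambda>n (s::complex). complex_of_real ((1 - c / max (Re s) c) / max (Re s) c ^ Suc n))"
  have k: "continuous_map (gtop G) euclidean (\<lambda>\<gamma>. \<psi> n (unit_value g \<gamma>))" for n
  proof (rule continuous_map_compose_on[OF continuous_unit_value[OF unit_Cc_in_Cc[OF g]], of UNIV])
    have "max s c \<noteq> 0" for s using c0 by (simp add: max_def)
    then show "continuous_on UNIV (\<psi> n)"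
      unfolding \<psi>_def by (intro continuous_intros) auto
  qed simp
  define \<theta> where "\<theta> = (\<lambda>n. pointwise_mult (\<lambda>\<gamma>. \<psi> n (unit_value g \<gamma>)) g)"
  have \<theta>: "\<theta> n \<in> unit_Cc_sections E" for n
    unfolding \<theta>_def by (rule unit_pointwise_mult[OF g k])
  have \<theta>_val: "unit_value (\<theta> n) y = complex_of_real (if t y \<le> c then 0 else (1 - c / t y) / t y ^ n)"
    if y: "y \<in> units G" for n y
  proof -
    have "unit_value (\<theta> n) y = complex_of_real ((1 - c / max (t y) c) / max (t y) c ^ Suc n * t y)"
      unfolding \<theta>_def unit_value_pointwise_mult[OF g k y] by (simp add: gv[OF y] \<psi>_def t_def)
    also have "(1 - c / max (t y) c) / max (t y) c ^ Suc n * t y = (if t y \<le> c then 0 else (1 - c / t y)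
        / t y ^ n)"
      using c0 by (simp add: max_def)
    finally show ?thesis .
  qed
  have \<theta>_norm: "norm (j (\<theta> n)) \<le> (1 / c) ^ n" for n
  proof (rule norm_unit_le[OF \<theta>])
    fix y assume y: "y \<in> units G"
    show "cmod (unit_value (\<theta> n) y) \<le> (1 / c) ^ n"
    proof (cases "t y \<le> c")
      case False
      then have "0 \<le> 1 - c / t y" "1 - c / t y \<le> 1" "c ^ n \<le> t y ^ n" "0 < c ^ n" "0 < t y ^ n"
        using c0 by (auto intro: power_mono)
      then have "(1 - c / t y) / t y ^ n \<le> 1 / c ^ n" "0 \<le> (1 - c / t y) / t y ^ n"
        by (auto intro!: frac_le)
      moreover from this(2) have "cmod (unit_value (\<theta> n) y) = (1 - c / t y) / t y ^ n"
        unfolding \<theta>_val[OF y] norm_of_real if_not_P[OF False] by (rule abs_of_nonneg)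
      ultimately show ?thesis by (simp add: power_one_over)
    qed (use c0 in \<open>simp add: \<theta>_val[OF y]\<close>)
  qed (use c0 in simp)
  have step: "j g * j (\<theta> (Suc n)) = j (\<theta> n)" for n
  proof -
    have "section_conv E g (\<theta> (Suc n)) = \<theta> n"
    proof (rule unit_section_eqI[OF unit_conv[OF g \<theta>] \<theta>])
      fix y assume y: "y \<in> units G"
      have "t y * (if t y \<le> c then 0 else (1 - c / t y) / t y ^ Suc n) =
          (if t y \<le> c then 0 else (1 - c / t y) / t y ^ n)"
        using c0 by auto
      moreover have "unit_value g y = complex_of_real (t y)" unfolding t_def by (rule gv[OF y])
      ultimately show "unit_value (section_conv E g (\<theta> (Suc n))) y = unit_value (\<theta> n) y"
        unfolding unit_value_conv[OF g \<theta> y] \<theta>_val[OF y] by (simp only: of_real_mult[symmetric])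
    qed
    then show ?thesis using j_conv[OF unit_Cc_in_Cc[OF g] unit_Cc_in_Cc[OF \<theta>]] by metis
  qed
  have "norm (j (\<theta> 0)) \<le> \<rho> ^ n * norm (j (\<theta> n))" for n
  proof (induction n)
    case (Suc n)
    have "norm (j (\<theta> n)) \<le> \<rho> * norm (j (\<theta> (Suc n)))"
      using norm_mult_ineq[of "j g" "j (\<theta> (Suc n))"] by (simp add: step \<rho>_def)
    then have "\<rho> ^ n * norm (j (\<theta> n)) \<le> \<rho> ^ n * (\<rho> * norm (j (\<theta> (Suc n))))"
      by (rule mult_left_mono) (simp add: \<rho>_def)
    then show ?case using Suc by (simp add: mult_ac)
  qed simp
  then have "norm (j (\<theta> 0)) \<le> (\<rho> / c) ^ n" for n
    using order_trans[OF _ mult_left_mono[OF \<theta>_norm, of "\<rho> ^ n"]]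
    by (metis (no_types, opaque_lifting) \<rho>_def norm_ge_zero power_mult_distrib times_divide_eq_right
        mult.right_neutral zero_le_power)
  moreover have "(\<lambda>n. (\<rho> / c) ^ n) \<longlonglongrightarrow> 0"
    using c c0 by (intro LIMSEQ_power_zero) (simp add: \<rho>_def)
  ultimately have "norm (j (\<theta> 0)) \<le> 0" by (intro LIMSEQ_le_const) auto
  then have "unit_value (\<theta> 0) x = 0"
    using j_eq_zero_iff[OF unit_Cc_in_Cc[OF \<theta>, of 0]] x by (simp add: unit_value_def unit_arrow_closed)
  then show False using c c0 unfolding \<theta>_val[OF x] of_real_eq_0_iff by (auto simp: field_simps split:
      if_splits)
qed

end

section \<open>Elements of the reduced algebra as functions\<close>

context reduced_twist
begin

text \<open>
  The number \<open>\<bar>f(\<sigma>)\<bar>\<^sup>2\<close> is one of the summands of the value of \<open>f\<^sup>* f\<close> at the source of \<open>\<sigma>\<close>, which is a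
  value of the expectation of \<open>f\<^sup>* f\<close>.
\<close>

lemma cmod_ev_le_norm:
  assumes f: "f \<in> Cc_sections E" and \<sigma>: "\<sigma> \<in> arrows \<Sigma>"
  shows "cmod (ev \<sigma> f) \<le> norm (j f)"
proof -
  obtain P where P: "conditional_expectation (closure (j ` unit_Cc_sections E)) P"
    "\<And>f. f \<in> Cc_sections E \<Longrightarrow> P (j f) = j (section_on E (units G) f)"
    using reduced unfolding reduced_completion_def by blast
  let ?x = "gsrc G (q \<sigma>)"
  have x: "?x \<in> units G" using \<sigma> by simp
  have sf: "section_star E f \<in> Cc_sections E" by (rule section_star_in_Cc[OF f])
  define ff where "ff = section_conv E (section_star E f) f"
  have ff: "ff \<in> Cc_sections E" unfolding ff_def by (rule section_conv_in_Cc[OF sf f])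
  let ?S = "insert (q \<sigma>) (fibre_support f ?x)"
  have "ev (unit_arrow ?x) ff = (\<Sum>\<beta>\<in>?S. cnj (ev (lift \<beta>) f) * ev (lift \<beta>) f)"
    unfolding ff_def using finite_fibre_support[OF f] \<sigma>
    by (intro unit_value_star_conv f x) (auto simp: fibre_support_def)
  also have "\<dots> = complex_of_real (\<Sum>\<beta>\<in>?S. (cmod (ev (lift \<beta>) f))\<^sup>2)"
    by (simp only: of_real_sum complex_norm_square mult.commute[of "cnj _"])
  finally have val: "cmod (unit_value ff ?x) = (\<Sum>\<beta>\<in>?S. (cmod (ev (lift \<beta>) f))\<^sup>2)"
    using x by (simp only: unit_value_def if_True norm_of_real) (simp add: sum_nonneg)
  have "(cmod (ev \<sigma> f))\<^sup>2 = (cmod (ev (lift (q \<sigma>)) f))\<^sup>2"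
    using cmod_ev_eq[OF Cc_in_sections[OF f] \<sigma>, of "lift (q \<sigma>)"] \<sigma> by (simp add: lift)
  also have "\<dots> \<le> (\<Sum>\<beta>\<in>?S. (cmod (ev (lift \<beta>) f))\<^sup>2)"
    by (rule member_le_sum) (use finite_fibre_support[OF f] in auto)
  also have "\<dots> = cmod (unit_value (section_on E (units G) ff) ?x)"
    unfolding section_on_units(2)[OF ff x] val ..
  also have "\<dots> \<le> norm (j (section_on E (units G) ff))"
    by (rule unit_value_le_norm[OF section_on_units(1)[OF ff] x])
  also have "\<dots> = norm (P (j ff))" using P(2)[OF ff] by simp
  also have "\<dots> \<le> norm (j ff)" using P(1) by (simp add: conditional_expectation_def)
  also have "\<dots> = (norm (j f))\<^sup>2"
    unfolding ff_def j_conv[OF sf f] j_star[OF f] cstar_identity ..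
  finally show ?thesis by (rule power2_le_imp_le) simp
qed

definition approximants :: "'a \<Rightarrow> nat \<Rightarrow> ('g, 's) line_section" where
  "approximants a = (SOME u. (\<forall>n. u n \<in> Cc_sections E) \<and> (\<lambda>n. j (u n)) \<longlonglongrightarrow> a)"

lemma approximants: "approximants a n \<in> Cc_sections E" "(\<lambda>n. j (approximants a n)) \<longlonglongrightarrow> a"
proof -
  have "a \<in> closure (j ` Cc_sections E)" by (simp add: j_dense)
  then obtain v where v: "\<And>n. v n \<in> j ` Cc_sections E" "v \<longlonglongrightarrow> a" by (meson closure_sequential)
  then have "\<forall>n. \<exists>f. f \<in> Cc_sections E \<and> v n = j f" by blast
  then obtain u where u: "\<And>n. u n \<in> Cc_sections E \<and> v n = j (u n)" by metis
  then have "v = (\<lambda>n. j (u n))" by auto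
  then have "\<exists>u. (\<forall>n. u n \<in> Cc_sections E) \<and> (\<lambda>n. j (u n)) \<longlonglongrightarrow> a" using u v(2) by blast
  from someI_ex[OF this] show "approximants a n \<in> Cc_sections E" "(\<lambda>n. j (approximants a n)) \<longlonglongrightarrow> a"
    unfolding approximants_def by auto
qed

lemma ex_approximant: "0 < \<epsilon> \<Longrightarrow> \<exists>f \<in> Cc_sections E. norm (j f - a) < \<epsilon>"
  using LIMSEQ_D[OF approximants(2)[of a], of \<epsilon>] approximants(1)[of a] by blast

text \<open>The extension of the evaluation at \<open>\<sigma>\<close> by continuity.\<close>

definition Ev :: "'s \<Rightarrow> 'a \<Rightarrow> complex" where
  "Ev \<sigma> a = lim (\<lambda>n. ev \<sigma> (approximants a n))"

lemma Ev_close: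
  assumes f: "f \<in> Cc_sections E" and \<sigma>: "\<sigma> \<in> arrows \<Sigma>"
  shows "cmod (ev \<sigma> f - Ev \<sigma> a) \<le> norm (j f - a)"
proof -
  let ?u = "approximants a"
  have le: "cmod (ev \<sigma> g - ev \<sigma> h) \<le> norm (j g - j h)" if "g \<in> Cc_sections E" "h \<in> Cc_sections E" for g h
    using cmod_ev_le_norm[OF section_diff_in_Cc[OF that] \<sigma>] by (simp add: j_diff[OF that] ev_diff[OF
        that \<sigma>])
  have "Cauchy (\<lambda>n. ev \<sigma> (?u n))"
  proof (rule metric_CauchyI)
    fix e :: real assume "e > 0"
    then obtain M where M: "\<forall>m\<ge>M. \<forall>n\<ge>M. dist (j (?u m)) (j (?u n)) < e"
      using metric_CauchyD[OF LIMSEQ_imp_Cauchy[OF approximants(2)[of a]]] by blast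
    have "dist (ev \<sigma> (?u m)) (ev \<sigma> (?u n)) < e" if "m \<ge> M" "n \<ge> M" for m n
    proof -
      have "dist (ev \<sigma> (?u m)) (ev \<sigma> (?u n)) \<le> dist (j (?u m)) (j (?u n))"
        unfolding dist_norm by (rule le[OF approximants(1) approximants(1)])
      also have "\<dots> < e" using M that by blast
      finally show ?thesis .
    qed
    then show "\<exists>M. \<forall>m\<ge>M. \<forall>n\<ge>M. dist (ev \<sigma> (?u m)) (ev \<sigma> (?u n)) < e" by blast
  qed
  then have lim: "(\<lambda>n. ev \<sigma> (?u n)) \<longlonglongrightarrow> Ev \<sigma> a"
    unfolding Ev_def using Cauchy_convergent convergent_LIMSEQ_iff by blast
  have "(\<lambda>n. cmod (ev \<sigma> f - ev \<sigma> (?u n))) \<longlonglongrightarrow> cmod (ev \<sigma> f - Ev \<sigma> a)"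
    by (intro tendsto_intros lim)
  moreover have "(\<lambda>n. norm (j f - j (?u n))) \<longlonglongrightarrow> norm (j f - a)"
    by (intro tendsto_intros approximants)
  ultimately show ?thesis
    by (rule LIMSEQ_le) (use le[OF f approximants(1)] in auto)
qed

lemma Ev_j: "f \<in> Cc_sections E \<Longrightarrow> \<sigma> \<in> arrows \<Sigma> \<Longrightarrow> Ev \<sigma> (j f) = ev \<sigma> f"
  using Ev_close[of f \<sigma> "j f"] by simp

lemma Ev_tendsto:
  assumes "\<And>n. u n \<in> Cc_sections E" "(\<lambda>n. j (u n)) \<longlonglongrightarrow> a" "\<sigma> \<in> arrows \<Sigma>"
  shows "(\<lambda>n. ev \<sigma> (u n)) \<longlonglongrightarrow> Ev \<sigma> a"
proof (rule LIM_zero_cancel, rule Lim_null_comparison)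
  show "\<forall>\<^sub>F n in sequentially. norm (ev \<sigma> (u n) - Ev \<sigma> a) \<le> norm (j (u n) - a)"
    using Ev_close assms by simp
  show "(\<lambda>n. norm (j (u n) - a)) \<longlonglongrightarrow> 0" using assms(2) by (intro tendsto_norm_zero LIM_zero)
qed

lemma Ev_add: assumes \<sigma>: "\<sigma> \<in> arrows \<Sigma>" shows "Ev \<sigma> (a + b) = Ev \<sigma> a + Ev \<sigma> b"
proof (rule LIMSEQ_unique)
  let ?u = "approximants a" and ?v = "approximants b"
  have "(\<lambda>n. j (section_add E (?u n) (?v n))) \<longlonglongrightarrow> a + b"
    using tendsto_add[OF approximants(2)[of a] approximants(2)[of b]] by (simp add: j_add approximants)
  then show "(\<lambda>n. ev \<sigma> (section_add E (?u n) (?v n))) \<longlonglongrightarrow> Ev \<sigma> (a + b)"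
    by (intro Ev_tendsto section_add_in_Cc approximants \<sigma>)
  show "(\<lambda>n. ev \<sigma> (section_add E (?u n) (?v n))) \<longlonglongrightarrow> Ev \<sigma> a + Ev \<sigma> b"
    unfolding ev_add[OF Cc_in_sections[OF approximants(1)] Cc_in_sections[OF approximants(1)] \<sigma>]
    by (intro tendsto_add Ev_tendsto approximants \<sigma>)
qed

lemma Ev_scale: assumes \<sigma>: "\<sigma> \<in> arrows \<Sigma>" shows "Ev \<sigma> (scaleC c a) = c * Ev \<sigma> a"
proof (rule LIMSEQ_unique)
  let ?u = "approximants a"
  have "(\<lambda>n. j (section_scale E c (?u n))) \<longlonglongrightarrow> scaleC c a"
    using tendsto_scaleC[OF approximants(2)[of a]] by (simp add: j_scale approximants)
  then show "(\<lambda>n. ev \<sigma> (section_scale E c (?u n))) \<longlonglongrightarrow> Ev \<sigma> (scaleC c a)"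
    by (intro Ev_tendsto section_scale_in_Cc approximants \<sigma>)
  show "(\<lambda>n. ev \<sigma> (section_scale E c (?u n))) \<longlonglongrightarrow> c * Ev \<sigma> a"
    unfolding ev_scale[OF Cc_in_sections[OF approximants(1)] \<sigma>]
    by (intro tendsto_mult tendsto_const Ev_tendsto approximants \<sigma>)
qed

lemma Ev_diff: "\<sigma> \<in> arrows \<Sigma> \<Longrightarrow> Ev \<sigma> (a - b) = Ev \<sigma> a - Ev \<sigma> b"
  using Ev_add[of \<sigma> a "scaleC (-1) b"] Ev_scale[of \<sigma> "-1" b] by (simp add: scaleC_minus1)

lemma cmod_Ev_le: assumes \<sigma>: "\<sigma> \<in> arrows \<Sigma>" shows "cmod (Ev \<sigma> a) \<le> norm a"
proof (rule LIMSEQ_le)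
  show "(\<lambda>n. cmod (ev \<sigma> (approximants a n))) \<longlonglongrightarrow> cmod (Ev \<sigma> a)"
    by (intro tendsto_norm Ev_tendsto approximants \<sigma>)
  show "(\<lambda>n. norm (j (approximants a n))) \<longlonglongrightarrow> norm a"
    by (intro tendsto_norm approximants)
qed (use cmod_ev_le_norm[OF approximants(1) \<sigma>] in auto)

lemma Ev_tendsto_norm:
  assumes \<sigma>: "\<sigma> \<in> arrows \<Sigma>" and lim: "c \<longlonglongrightarrow> a"
  shows "(\<lambda>n. Ev \<sigma> (c n)) \<longlonglongrightarrow> Ev \<sigma> a"
proof (rule LIM_zero_cancel, rule Lim_null_comparison)
  show "\<forall>\<^sub>F n in sequentially. norm (Ev \<sigma> (c n) - Ev \<sigma> a) \<le> norm (c n - a)"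
    using cmod_Ev_le[OF \<sigma>] by (simp add: Ev_diff[OF \<sigma>, symmetric])
  show "(\<lambda>n. norm (c n - a)) \<longlonglongrightarrow> 0" using lim by (intro tendsto_norm_zero LIM_zero)
qed

lemma equivariant_Ev: "equivariant (\<lambda>\<sigma>. Ev \<sigma> a)"
  unfolding equivariant_def
proof (intro ballI)
  fix \<sigma> \<mu> assume \<sigma>: "\<sigma> \<in> arrows \<Sigma>" and \<mu>: "\<mu> \<in> circle"
  show "Ev (act \<mu> \<sigma>) a = cnj \<mu> * Ev \<sigma> a"
  proof (rule LIMSEQ_unique)
    show "(\<lambda>n. ev (act \<mu> \<sigma>) (approximants a n)) \<longlonglongrightarrow> Ev (act \<mu> \<sigma>) a"
      by (intro Ev_tendsto approximants act_closed \<sigma> \<mu>)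
    show "(\<lambda>n. ev (act \<mu> \<sigma>) (approximants a n)) \<longlonglongrightarrow> cnj \<mu> * Ev \<sigma> a"
      unfolding ev_act[OF Cc_in_sections[OF approximants(1)] \<sigma> \<mu>]
      by (intro tendsto_mult tendsto_const Ev_tendsto approximants \<sigma>)
  qed
qed

lemma continuous_Ev: "continuous_map (gtop \<Sigma>) euclidean (\<lambda>\<sigma>. Ev \<sigma> a)"
proof -
  have "continuous_map (gtop \<Sigma>) Met_TC.mtopology (\<lambda>\<sigma>. Ev \<sigma> a)"
  proof (rule Met_TC.continuous_map_uniform_limit)
    show "\<forall>\<^sub>F n in sequentially. continuous_map (gtop \<Sigma>) Met_TC.mtopology (\<lambda>\<sigma>. ev \<sigma> (approximants a n))"
      using Cc_continuous[OF approximants(1)] by simp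
    fix \<epsilon> :: real assume "0 < \<epsilon>"
    then obtain N where N: "\<And>n. n \<ge> N \<Longrightarrow> norm (j (approximants a n) - a) < \<epsilon>"
      using LIMSEQ_D[OF approximants(2)[of a]] by blast
    have "dist (ev \<sigma> (approximants a n)) (Ev \<sigma> a) < \<epsilon>" if "n \<ge> N" "\<sigma> \<in> arrows \<Sigma>" for n \<sigma>
      using order_le_less_trans[OF Ev_close[OF approximants(1) that(2)] N[OF that(1)]] by (simp add:
          dist_norm)
    then show "\<forall>\<^sub>F n in sequentially. \<forall>\<sigma>\<in>topspace (gtop \<Sigma>). Ev \<sigma> a \<in> UNIV \<and> dist (ev \<sigma> (approximants a
        n)) (Ev \<sigma> a) < \<epsilon>"
      unfolding eventually_sequentially by auto
  qed simp
  then show ?thesis by simp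
qed

lemma section_of_Ev_in_C0: "section_of (\<lambda>\<sigma>. Ev \<sigma> a) \<in> C0_sections E"
proof -
  let ?F = "section_of (\<lambda>\<sigma>. Ev \<sigma> a)"
  note ev_F = ev_section_of[OF equivariant_Ev, of _ a]
  have cont: "continuous_map (gtop \<Sigma>) euclidean (\<lambda>\<sigma>. ev \<sigma> ?F)"
    by (rule continuous_map_eq_on_arrows[OF continuous_Ev[of a]]) (simp add: ev_F)
  have norm_F: "line_norm E (?F (q \<sigma>)) = cmod (Ev \<sigma> a)" if "\<sigma> \<in> arrows \<Sigma>" for \<sigma>
    using line_norm_section[OF section_of_in_sections that] ev_F[OF that] by metis
  have norm_cont: "continuous_map (gtop G) euclideanreal (\<lambda>\<gamma>. line_norm E (?F \<gamma>))"
    by (rule continuous_map_on_base[OF continuous_map_norm[OF continuous_Ev[of a]]]) (simp only: norm_F)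
  have "compactin (gtop G) {\<gamma> \<in> arrows G. \<epsilon> \<le> line_norm E (?F \<gamma>)}" if \<epsilon>: "\<epsilon> > 0" for \<epsilon>
  proof -
    obtain f where f: "f \<in> Cc_sections E" "norm (j f - a) < \<epsilon>" using ex_approximant[OF \<epsilon>] by blast
    obtain K where K: "compactin (gtop G) K" "\<And>\<sigma>. \<sigma> \<in> arrows \<Sigma> \<Longrightarrow> q \<sigma> \<notin> K \<Longrightarrow> ev \<sigma> f = 0"
      using f(1) by (rule Cc_support) (rule that)
    have "{\<gamma> \<in> arrows G. \<epsilon> \<le> line_norm E (?F \<gamma>)} \<subseteq> K"
    proof (clarify, rule ccontr)
      fix \<gamma> assume g: "\<gamma> \<in> arrows G" "\<epsilon> \<le> line_norm E (?F \<gamma>)" "\<gamma> \<notin> K"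
      have l: "lift \<gamma> \<in> arrows \<Sigma>" "q (lift \<gamma>) = \<gamma>" using lift[OF g(1)] by auto
      have "\<epsilon> \<le> cmod (Ev (lift \<gamma>) a)" using norm_F[OF l(1)] g(2) l(2) by simp
      moreover have "cmod (Ev (lift \<gamma>) a) < \<epsilon>"
        using Ev_close[OF f(1) l(1), of a] K(2)[OF l(1)] l(2) g(3) f(2) by simp
      ultimately show False by simp
    qed
    moreover have "closedin (gtop G) {\<gamma> \<in> topspace (gtop G). line_norm E (?F \<gamma>) \<in> {\<epsilon>..}}"
      by (rule closedin_continuous_map_preimage[OF norm_cont]) simp
    ultimately show ?thesis by (intro closed_compactin[OF K(1)]) auto
  qed
  then show ?thesis
    using cont section_of_in_sections by (auto simp: C0_sections_def continuous_sections_iff)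
qed

lemma completion_section_eq: "completion_section E j a = section_of (\<lambda>\<sigma>. Ev \<sigma> a)"
  unfolding completion_section_def
proof (rule the_equality)
  let ?F = "section_of (\<lambda>\<sigma>. Ev \<sigma> a)"
  note ev_F = ev_section_of[OF equivariant_Ev, of _ a]
  have "uniform_limit (arrows \<Sigma>) (\<lambda>n \<sigma>. ev \<sigma> (u n)) (\<lambda>\<sigma>. ev \<sigma> ?F) sequentially"
    if u: "\<forall>n. u n \<in> Cc_sections E" "(\<lambda>n. j (u n)) \<longlonglongrightarrow> a" for u
  proof (rule uniform_limitI)
    fix e :: real assume "0 < e"
    then obtain N where N: "\<And>n. n \<ge> N \<Longrightarrow> norm (j (u n) - a) < e"
      using LIMSEQ_D[OF u(2)] by blast
    have "dist (ev \<sigma> (u n)) (ev \<sigma> ?F) < e" if "n \<ge> N" "\<sigma> \<in> arrows \<Sigma>" for n \<sigma>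
      using order_le_less_trans[OF Ev_close[OF _ that(2)] N[OF that(1)]] u(1) by (simp add: dist_norm
          ev_F[OF that(2)])
    then show "\<forall>\<^sub>F n in sequentially. \<forall>\<sigma>\<in>arrows \<Sigma>. dist (ev \<sigma> (u n)) (ev \<sigma> ?F) < e"
      unfolding eventually_sequentially by blast
  qed
  then show "?F \<in> C0_sections E \<and> (\<forall>u. (\<forall>n. u n \<in> Cc_sections E) \<and> (\<lambda>n. j (u n)) \<longlonglongrightarrow> a \<longrightarrow>
      uniform_limit (arrows \<Sigma>) (\<lambda>n \<sigma>. ev \<sigma> (u n)) (\<lambda>\<sigma>. ev \<sigma> ?F) sequentially)"
    using section_of_Ev_in_C0 by blast
  fix F assume F: "F \<in> C0_sections E \<and> (\<forall>u. (\<forall>n. u n \<in> Cc_sections E) \<and> (\<lambda>n. j (u n)) \<longlonglongrightarrow> a \<longrightarrow>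
      uniform_limit (arrows \<Sigma>) (\<lambda>n \<sigma>. ev \<sigma> (u n)) (\<lambda>\<sigma>. ev \<sigma> F) sequentially)"
  then have lim: "uniform_limit (arrows \<Sigma>) (\<lambda>n \<sigma>. ev \<sigma> (approximants a n)) (\<lambda>\<sigma>. ev \<sigma> F) sequentially"
    using approximants by blast
  have Fs: "F \<in> sections" using F unfolding C0_sections_def continuous_sections_def by blast
  show "F = ?F"
  proof (rule section_eqI[OF Fs section_of_in_sections])
    fix \<sigma> assume \<sigma>: "\<sigma> \<in> arrows \<Sigma>"
    have "ev \<sigma> F = Ev \<sigma> a"
      by (rule LIMSEQ_unique[OF tendsto_uniform_limitI[OF lim \<sigma>] Ev_tendsto[OF approximants \<sigma>]])
    then show "ev \<sigma> F = ev \<sigma> ?F" by (simp add: ev_F[OF \<sigma>])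
  qed
qed

lemma completion_eval_eq: "\<sigma> \<in> arrows \<Sigma> \<Longrightarrow> completion_eval E j \<sigma> a = Ev \<sigma> a"
  unfolding completion_eval_def completion_section_eq by (rule ev_section_of[OF equivariant_Ev])

subsection \<open>Evaluation at the units\<close>

abbreviation unit_functional :: "'g \<Rightarrow> 'a \<Rightarrow> complex" where
  "unit_functional x \<equiv> Ev (unit_arrow x)"

lemma unit_functional_star_mult:
  assumes f: "f \<in> Cc_sections E" and g: "g \<in> Cc_sections E" and x: "x \<in> units G"
    and S: "finite S" "fibre_support f x \<subseteq> S" "S \<subseteq> source_fibre x"
  shows "unit_functional x (star (j f) * j g) = (\<Sum>\<beta>\<in>S. cnj (ev (lift \<beta>) f) * ev (lift \<beta>) g)"
proof -
  have "star (j f) * j g = j (section_conv E (section_star E f) g)"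
    using f g by (simp add: j_conv j_star section_star_in_Cc)
  then show ?thesis
    using unit_value_star_conv_left[OF f g x S] Ev_j[OF section_conv_in_Cc[OF section_star_in_Cc[OF f]
        g] unit_arrow_closed[OF x]]
    by simp
qed

lemma unit_functional_square:
  assumes f: "f \<in> Cc_sections E" and x: "x \<in> units G"
    and S: "finite S" "fibre_support f x \<subseteq> S" "S \<subseteq> source_fibre x"
  shows "unit_functional x (star (j f) * j f) = complex_of_real (\<Sum>\<beta>\<in>S. (cmod (ev (lift \<beta>) f))\<^sup>2)"
  unfolding unit_functional_star_mult[OF f f x S]
  by (simp only: of_real_sum complex_norm_square mult.commute[of "cnj _"])

lemma unit_functional_positive:
  assumes x: "x \<in> units G" shows "unit_functional x (star a * a) \<in> \<real>\<^sub>\<ge>\<^sub>0"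
proof (rule closed_sequentially[OF closed_nonneg_Reals_complex])
  show "(\<lambda>n. unit_functional x (star (j (approximants a n)) * j (approximants a n))) \<longlonglongrightarrow> unit_functional x
      (star a * a)"
    by (intro Ev_tendsto_norm unit_arrow_closed x tendsto_mult tendsto_star approximants)
  fix n
  let ?S = "fibre_support (approximants a n) x"
  have "unit_functional x (star (j (approximants a n)) * j (approximants a n)) =
      complex_of_real (\<Sum>\<beta>\<in>?S. (cmod (ev (lift \<beta>) (approximants a n)))\<^sup>2)"
    by (rule unit_functional_square[OF approximants(1) x finite_fibre_support[OF approximants(1)]])
        (auto simp: fibre_support_def)
  then show "unit_functional x (star (j (approximants a n)) * j (approximants a n)) \<in> \<real>\<^sub>\<ge>\<^sub>0"
    by (simp only: nonneg_Reals_of_real_iff sum_nonneg zero_le_power2)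
qed

lemma positive_functionals:
  assumes "cstar_subalgebra D" "Y \<subseteq> units G"
  shows "positive_functionals D Y unit_functional"
proof
  fix x assume "x \<in> Y"
  then have x: "x \<in> units G" and \<sigma>: "unit_arrow x \<in> arrows \<Sigma>" using assms(2) unit_arrow_closed by auto
  show "unit_functional x (a + b) = unit_functional x a + unit_functional x b" for a b by (rule
      Ev_add[OF \<sigma>])
  show "unit_functional x (scaleC c a) = c * unit_functional x a" for c a by (rule Ev_scale[OF \<sigma>])
  show "cmod (unit_functional x a) \<le> norm a" for a by (rule cmod_Ev_le[OF \<sigma>])
  show "unit_functional x (star a * a) \<in> \<real>\<^sub>\<ge>\<^sub>0" for a by (rule unit_functional_positive[OF x])
qed (fact assms)

text \<open>
  The functionals are the values of the expectation, whose range carries the supremum norm; so they all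
  vanish at \<open>a\<^sup>* a\<close> only if the expectation does.
\<close>

lemma unit_functionals_faithful:
  assumes zero: "\<And>x. x \<in> units G \<Longrightarrow> unit_functional x (star a * a) = 0"
  shows "a = 0"
proof -
  obtain P where P: "conditional_expectation (closure (j ` unit_Cc_sections E)) P" "faithful P"
    "\<And>f. f \<in> Cc_sections E \<Longrightarrow> P (j f) = j (section_on E (units G) f)"
    using reduced unfolding reduced_completion_def by blast
  define b where "b = star a * a"
  let ?u = "approximants b"
  have P_diff: "P (c - d) = P c - P d" for c d
  proof -
    have "P (c + scaleC (-1) d) = P c + scaleC (-1) (P d)"
      using P(1) by (simp only: conditional_expectation_def)
    then show ?thesis by (simp add: scaleC_minus1)
  qed
  have P_le: "norm (P c) \<le> norm c" for c using P(1) by (simp add: conditional_expectation_def)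
  have le: "norm (P b) \<le> 2 * norm (j (?u n) - b) + \<epsilon>" if \<epsilon>: "0 < \<epsilon>" for n \<epsilon>
  proof -
    let ?r = "section_on E (units G) (?u n)"
    have "norm (j ?r) \<le> norm (j (?u n) - b) + \<epsilon>"
    proof (rule norm_unit_le[OF section_on_units(1)[OF approximants(1)]])
      fix x assume x: "x \<in> units G"
      have "unit_value ?r x = unit_value (?u n) x" by (rule section_on_units(2)[OF approximants(1) x])
      then have "cmod (unit_value ?r x) = cmod (ev (unit_arrow x) (?u n) - unit_functional x b)"
        using zero[OF x] x by (simp add: unit_value_def b_def)
      also have "\<dots> \<le> norm (j (?u n) - b)" by (rule Ev_close[OF approximants(1) unit_arrow_closed[OF x]])
      finally show "cmod (unit_value ?r x) \<le> norm (j (?u n) - b) + \<epsilon>" using \<epsilon> by simp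
    qed (use \<epsilon> in \<open>simp add: add_nonneg_pos\<close>)
    moreover have "norm (P b) \<le> norm (P (j (?u n))) + norm (P (j (?u n) - b))"
      unfolding P_diff using norm_triangle_ineq4[of "P (j (?u n))" "P (j (?u n)) - P b"] by simp
    ultimately show ?thesis
      using P_le[of "j (?u n) - b"] P(3)[OF approximants(1), of b n] by simp
  qed
  have "norm (P b) \<le> \<epsilon>" if \<epsilon>: "0 < \<epsilon>" for \<epsilon>
  proof -
    obtain n where "norm (j (?u n) - b) < \<epsilon> / 4"
      using LIMSEQ_D[OF approximants(2)[of b], of "\<epsilon> / 4"] \<epsilon> by auto
    then show ?thesis using le[of "\<epsilon> / 2" n] \<epsilon> by simp
  qed
  then have "norm (P b) \<le> 0" by (rule field_le_epsilon) simp
  then have "P (star a * a) = 0" unfolding b_def by (simp only: norm_le_zero_iff)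
  then show "a = 0" using P(2) unfolding faithful_def by blast
qed

end

section \<open>Multiplication by positive type functions\<close>

text \<open>
  The Cholesky decomposition of a positive matrix. Removing one index \<open>t\<close> subtracts the rank one matrix
  \<open>H \<eta> t * H t \<gamma> / H t t\<close>; if the diagonal entry vanishes, then so do the row and the column of \<open>t\<close>.
\<close>

lemma positive_matrix_decomposition:
  fixes H :: "'i \<Rightarrow> 'i \<Rightarrow> complex"
  assumes "finite T"
    and "\<And>c. (\<Sum>\<eta>\<in>T. \<Sum>\<gamma>\<in>T. cnj (c \<eta>) * H \<eta> \<gamma> * c \<gamma>) \<in> \<real>\<^sub>\<ge>\<^sub>0"
  shows "\<exists>(n::nat) v. \<forall>\<eta>\<in>T. \<forall>\<gamma>\<in>T. H \<eta> \<gamma> = (\<Sum>i<n. cnj (v i \<eta>) * v i \<gamma>)"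
  using assms
proof (induction T arbitrary: H rule: finite_induct)
  case empty
  then show ?case by simp
next
  case (insert t T)
  define S1 where "S1 c = (\<Sum>\<gamma>\<in>T. H t \<gamma> * c \<gamma>)" for c
  define S2 where "S2 c = (\<Sum>\<eta>\<in>T. cnj (c \<eta>) * H \<eta> t)" for c
  define Q where "Q c = (\<Sum>\<eta>\<in>T. \<Sum>\<gamma>\<in>T. cnj (c \<eta>) * H \<eta> \<gamma> * c \<gamma>)" for c
  have form: "cnj s * H t t * s + cnj s * S1 c + S2 c * s + Q c \<in> \<real>\<^sub>\<ge>\<^sub>0" for s c
  proof -
    define c' where "c' = c(t := s)"
    have c': "c' t = s" "\<And>\<gamma>. \<gamma> \<in> T \<Longrightarrow> c' \<gamma> = c \<gamma>" using insert.hyps(2) by (auto simp: c'_def)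
    have "(\<Sum>\<eta>\<in>insert t T. \<Sum>\<gamma>\<in>insert t T. cnj (c' \<eta>) * H \<eta> \<gamma> * c' \<gamma>) =
        cnj s * H t t * s + (\<Sum>\<gamma>\<in>T. cnj s * H t \<gamma> * c \<gamma>) + (\<Sum>\<eta>\<in>T. cnj (c \<eta>) * H \<eta> t * s) + Q c"
      using insert.hyps c' by (simp add: sum.distrib Q_def cong: sum.cong)
    also have "(\<Sum>\<gamma>\<in>T. cnj s * H t \<gamma> * c \<gamma>) = cnj s * S1 c"
      by (simp add: S1_def sum_distrib_left mult.assoc)
    also have "(\<Sum>\<eta>\<in>T. cnj (c \<eta>) * H \<eta> t * s) = S2 c * s"
      by (simp add: S2_def sum_distrib_right)
    finally show ?thesis using insert.prems[of c'] by (simp only:)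
  qed
  have nonneg: "Im z = 0 \<and> 0 \<le> Re z" if "z \<in> \<real>\<^sub>\<ge>\<^sub>0" for z :: complex
    using that by (simp add: complex_nonneg_Reals_iff)
  have zero: "S1 (\<lambda>_. 0) = 0" "S2 (\<lambda>_. 0) = 0" "Q (\<lambda>_. 0) = 0" by (simp_all add: S1_def S2_def Q_def)
  define d where "d = Re (H t t)"
  have d: "H t t = of_real d" "0 \<le> d"
    using nonneg[OF form[of 1 "\<lambda>_. 0"]] by (auto simp: zero d_def complex_eq_iff)
  have herm: "S2 c = cnj (S1 c)" for c
  proof -
    have "Im (Q c) = 0" using nonneg[OF form[of 0 c]] by simp
    then show ?thesis
      using nonneg[OF form[of 1 c]] nonneg[OF form[of \<i> c]] d by (simp add: complex_eq_iff)
  qed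
  have S1_delta: "S1 (\<lambda>\<beta>. if \<beta> = \<gamma> then 1 else 0) = H t \<gamma>" "S2 (\<lambda>\<beta>. if \<beta> = \<gamma> then 1 else 0) = H \<gamma> t"
    if "\<gamma> \<in> T" for \<gamma>
    using that insert.hyps(1) by (simp_all add: S1_def S2_def if_distrib[of cnj] if_distrib[of "\<lambda>z. z * _"]
        if_distrib[of "\<lambda>z. _ * z"] sum.delta cong: if_cong)
  have col: "H \<gamma> t = cnj (H t \<gamma>)" if "\<gamma> \<in> T" for \<gamma>
    using herm[of "\<lambda>\<beta>. if \<beta> = \<gamma> then 1 else 0"] S1_delta[OF that] by simp
  have S1_zero: "S1 c = 0" if d0: "d = 0" for c
  proof (rule ccontr)
    assume nz: "S1 c \<noteq> 0"
    define r where "r = (Re (Q c) + 1) / (2 * (cmod (S1 c))\<^sup>2)"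
    have "cnj (- of_real r * S1 c) * S1 c + S2 c * (- of_real r * S1 c) = - of_real (2 * r * (cmod (S1
        c))\<^sup>2)"
      unfolding herm by (simp only: of_real_mult complex_norm_square) (simp add: algebra_simps)
    also have "2 * r * (cmod (S1 c))\<^sup>2 = Re (Q c) + 1" using nz by (simp add: r_def)
    finally have "0 \<le> Re (- of_real (Re (Q c) + 1) + Q c)"
      using nonneg[OF form[of "- of_real r * S1 c" c]] d d0 by (simp add: add.assoc)
    then show False by simp
  qed
  define H' where "H' \<eta> \<gamma> = H \<eta> \<gamma> - H \<eta> t * H t \<gamma> / of_real d" for \<eta> \<gamma>
  have "(\<Sum>\<eta>\<in>T. \<Sum>\<gamma>\<in>T. cnj (c \<eta>) * H' \<eta> \<gamma> * c \<gamma>) \<in> \<real>\<^sub>\<ge>\<^sub>0" for c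
  proof -
    let ?s = "- S1 c / of_real d"
    have "(\<Sum>\<eta>\<in>T. \<Sum>\<gamma>\<in>T. cnj (c \<eta>) * H' \<eta> \<gamma> * c \<gamma>) =
        Q c - (\<Sum>\<eta>\<in>T. \<Sum>\<gamma>\<in>T. (cnj (c \<eta>) * H \<eta> t) * (H t \<gamma> * c \<gamma>)) / of_real d"
      by (simp add: H'_def Q_def algebra_simps sum_subtractf sum_divide_distrib)
    also have "(\<Sum>\<eta>\<in>T. \<Sum>\<gamma>\<in>T. (cnj (c \<eta>) * H \<eta> t) * (H t \<gamma> * c \<gamma>)) = S2 c * S1 c"
      by (simp add: S1_def S2_def sum_product)
    also have "Q c - S2 c * S1 c / of_real d = cnj ?s * H t t * ?s + cnj ?s * S1 c + S2 c * ?s + Q c"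
      using S1_zero[of c] herm[of c] d by (cases "d = 0") (simp_all add: field_simps)
    finally show ?thesis using form[of ?s c] by (simp only:)
  qed
  from insert.IH[OF this] obtain n :: nat and v
    where v: "\<And>\<eta> \<gamma>. \<eta> \<in> T \<Longrightarrow> \<gamma> \<in> T \<Longrightarrow> H' \<eta> \<gamma> = (\<Sum>i<n. cnj (v i \<eta>) * v i \<gamma>)" by blast
  define w where "w i \<gamma> = (if i = n then H t \<gamma> / of_real (sqrt d) else if \<gamma> = t then 0 else v i \<gamma>)" for i \<gamma>
  have sqrt_d: "complex_of_real (sqrt d) * complex_of_real (sqrt d) = of_real d"
    using d(2) by (simp add: of_real_mult[symmetric])
  have row0: "H t \<gamma> = 0" if "d = 0" "\<gamma> \<in> T" for \<gamma>
    using S1_zero[OF that(1), of "\<lambda>\<beta>. if \<beta> = \<gamma> then 1 else 0"] S1_delta[OF that(2)] by simp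
  have last: "cnj (w n \<eta>) * w n \<gamma> = cnj (H t \<eta>) * H t \<gamma> / of_real d" for \<eta> \<gamma>
    using sqrt_d by (simp add: w_def)
  have "H \<eta> \<gamma> = (\<Sum>i<Suc n. cnj (w i \<eta>) * w i \<gamma>)" if "\<eta> \<in> insert t T" "\<gamma> \<in> insert t T" for \<eta> \<gamma>
  proof -
    have split: "(\<Sum>i<Suc n. cnj (w i \<eta>) * w i \<gamma>) =
        (\<Sum>i<n. cnj (if \<eta> = t then 0 else v i \<eta>) * (if \<gamma> = t then 0 else v i \<gamma>)) + cnj (H t \<eta>) * H t \<gamma> /
            of_real d"
      by (simp add: last) (simp add: w_def)
    show ?thesis
    proof (cases "\<eta> = t \<or> \<gamma> = t")
      case True
      then have "(\<Sum>i<n. cnj (if \<eta> = t then 0 else v i \<eta>) * (if \<gamma> = t then 0 else v i \<gamma>)) = 0" by auto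
      moreover have "H \<eta> \<gamma> = cnj (H t \<eta>) * H t \<gamma> / of_real d"
      proof -
        have row: "H t \<beta> = H t t * H t \<beta> / of_real d" if "\<beta> \<in> insert t T" for \<beta>
          using that row0 d(1) by (cases "d = 0") auto
        show ?thesis
        proof (cases "\<eta> = t")
          case True
          then show ?thesis using row[OF that(2)] d(1) by simp
        next
          case False
          then have "\<eta> \<in> T" "\<gamma> = t" using that True by auto
          then show ?thesis
            using col[of \<eta>] row0[of \<eta>] d(1) by simp
        qed
      qed
      ultimately show ?thesis unfolding split by simp
    next
      case False
      then have T: "\<eta> \<in> T" "\<gamma> \<in> T" using that by auto
      have "H \<eta> \<gamma> = H' \<eta> \<gamma> + cnj (H t \<eta>) * H t \<gamma> / of_real d"
        using col[OF T(1)] by (simp add: H'_def)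
      then show ?thesis unfolding split using False v[OF T] by simp
    qed
  qed
  then show ?case by blast
qed

context lch_etale_groupoid
begin

lemma continuous_interpolation:
  fixes c :: "'a \<Rightarrow> complex"
  assumes S: "finite S" "S \<subseteq> arrows G"
  shows "\<exists>\<kappa>. continuous_map (gtop G) euclidean \<kappa> \<and> (\<forall>\<beta> \<in> S. \<kappa> \<beta> = c \<beta>)"
proof -
  have "completely_regular_space (gtop G)"
    using locally_compact_regular_imp_completely_regular_space locally_compact Hausdorff by blast
  then have "\<exists>f. continuous_map (gtop G) (top_of_set {0..1::real}) f \<and> f \<beta> = 0 \<and> f ` (S - {\<beta>}) \<subseteq> {1}"
    if b: "\<beta> \<in> S" for \<beta>
  proof -
    have "closedin (gtop G) (S - {\<beta>})" using S by (intro closedin_Hausdorff_finite Hausdorff) auto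
    moreover have "\<beta> \<in> topspace (gtop G) - (S - {\<beta>})" using b S by auto
    ultimately show ?thesis using \<open>completely_regular_space (gtop G)\<close>
      unfolding completely_regular_space_def by blast
  qed
  then obtain f where f: "\<And>\<beta>. \<beta> \<in> S \<Longrightarrow> continuous_map (gtop G) (top_of_set {0..1::real}) (f \<beta>) \<and>
      f \<beta> \<beta> = 0 \<and> f \<beta> ` (S - {\<beta>}) \<subseteq> {1}" by metis
  let ?\<kappa> = "\<lambda>\<gamma>. \<Sum>\<beta>\<in>S. c \<beta> * complex_of_real (1 - f \<beta> \<gamma>)"
  have "continuous_map (gtop G) euclidean ?\<kappa>"
  proof (intro continuous_map_sum S continuous_map_complex_mult)
    fix \<beta> assume b: "\<beta> \<in> S"
    have "continuous_map (gtop G) euclidean (f \<beta>)" using f[OF b] by (auto simp: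
        continuous_map_in_subtopology)
    then show "continuous_map (gtop G) euclidean (\<lambda>\<gamma>. complex_of_real (1 - f \<beta> \<gamma>))"
      by (rule continuous_map_compose_on[where S=UNIV and h="\<lambda>t. complex_of_real (1 - t)"]) (auto
          intro!: continuous_intros)
  qed simp
  moreover have "?\<kappa> \<gamma> = c \<gamma>" if g: "\<gamma> \<in> S" for \<gamma>
  proof -
    have "c \<beta> * complex_of_real (1 - f \<beta> \<gamma>) = (if \<beta> = \<gamma> then c \<gamma> else 0)" if b: "\<beta> \<in> S" for \<beta>
      using f[OF b] g by (cases "\<beta> = \<gamma>") auto
    then have "?\<kappa> \<gamma> = (\<Sum>\<beta>\<in>S. if \<beta> = \<gamma> then c \<gamma> else 0)" by (intro sum.cong) auto
    then show ?thesis using g S by simp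
  qed
  ultimately show ?thesis by blast
qed

end

context reduced_twist
begin

sublocale PF: positive_functionals UNIV "units G" unit_functional
  by (rule positive_functionals) (simp_all add: cstar_subalgebra_def)

lemma seminorm_at_j:
  assumes "f \<in> Cc_sections E" "x \<in> units G"
    "finite S" "fibre_support f x \<subseteq> S" "S \<subseteq> source_fibre x"
  shows "PF.seminorm_at x (j f) = L2_set (\<lambda>\<beta>. cmod (ev (lift \<beta>) f)) S"
  unfolding PF.seminorm_at_def unit_functional_square[OF assms] by (simp add: L2_set_def)

text \<open>
  The entries of the matrix by which \<open>f\<close> acts on the square summable functions on a source fibre, in the
  coordinates given by the chosen lifts.
\<close>

definition matrix_entry :: "('g, 's) line_section \<Rightarrow> 'g \<Rightarrow> 'g \<Rightarrow> complex" where
  "matrix_entry f \<gamma> \<beta> = ev (gmul \<Sigma> (lift \<gamma>) (ginv \<Sigma> (lift \<beta>))) f"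

lemma unit_functional_matrix:
  assumes f: "f \<in> Cc_sections E" and k: "k \<in> Cc_sections E" and g: "g \<in> Cc_sections E" and x: "x \<in> units G"
    and S: "finite S" "fibre_support k x \<subseteq> S" "fibre_support g x \<subseteq> S" "S \<subseteq> source_fibre x"
  shows "unit_functional x (star (j k) * (j f * j g)) =
    (\<Sum>\<gamma>\<in>S. \<Sum>\<beta>\<in>S. cnj (ev (lift \<gamma>) k) * (matrix_entry f \<gamma> \<beta> * ev (lift \<beta>) g))"
proof -
  have fg: "section_conv E f g \<in> Cc_sections E" by (rule section_conv_in_Cc[OF f g])
  have "ev (lift \<gamma>) (section_conv E f g) = (\<Sum>\<beta>\<in>S. matrix_entry f \<gamma> \<beta> * ev (lift \<beta>) g)" if "\<gamma> \<in> S" for \<gamma>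
  proof -
    have "\<gamma> \<in> arrows G" "gsrc G \<gamma> = x" using that S by auto
    then show ?thesis unfolding matrix_entry_def
      using S by (intro ev_conv[OF Cc_in_sections[OF f] Cc_in_sections[OF g] finite_fibre_support[OF
          g]]) (auto simp: lift)
  qed
  then show ?thesis
    unfolding j_conv[OF f g, symmetric] unit_functional_star_mult[OF k fg x S(1,2,4)]
    by (simp add: sum_distrib_left)
qed

text \<open>
  The values of the functionals on products \<open>k\<^sup>* f g\<close> are the forms of these matrices, so that bounds
  for the matrices are bounds for the norm.
\<close>

lemma norm_le_matrix_bound:
  assumes f: "f \<in> Cc_sections E" and M: "0 \<le> M"
    and bound: "\<And>x k g S. x \<in> units G \<Longrightarrow> k \<in> Cc_sections E \<Longrightarrow> g \<in> Cc_sections E \<Longrightarrow> finite S \<Longrightarrow>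
      S \<subseteq> source_fibre x \<Longrightarrow> fibre_support k x \<subseteq> S \<Longrightarrow> fibre_support g x \<subseteq> S \<Longrightarrow>
      cmod (\<Sum>\<gamma>\<in>S. \<Sum>\<beta>\<in>S. cnj (ev (lift \<gamma>) k) * (matrix_entry f \<gamma> \<beta> * ev (lift \<beta>) g)) \<le>
      M * L2_set (\<lambda>\<beta>. cmod (ev (lift \<beta>) k)) S * L2_set (\<lambda>\<beta>. cmod (ev (lift \<beta>) g)) S"
  shows "norm (j f) \<le> M"
proof (rule PF.norm_le_gns_bound)
  show "e = 0" if "\<And>x. x \<in> units G \<Longrightarrow> unit_functional x (star e * e) = 0" for e
    using that by (rule unit_functionals_faithful)
  show "PF.gns_bound (j f) M"
  proof (rule PF.gns_bound_on_dense[of "j ` Cc_sections E"])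
    fix x k' g' assume x: "x \<in> units G" and "k' \<in> j ` Cc_sections E" "g' \<in> j ` Cc_sections E"
    then obtain k g where kg: "k \<in> Cc_sections E" "k' = j k" "g \<in> Cc_sections E" "g' = j g" by blast
    let ?S = "fibre_support k x \<union> fibre_support g x"
    have S: "finite ?S" "fibre_support k x \<subseteq> ?S" "fibre_support g x \<subseteq> ?S" "?S \<subseteq> source_fibre x"
      using finite_fibre_support[OF kg(1), of x] finite_fibre_support[OF kg(3), of x] by (auto simp:
          fibre_support_def)
    show "cmod (unit_functional x (star k' * (j f * g'))) \<le> M * PF.seminorm_at x k' * PF.seminorm_at x g'"
      unfolding kg(2,4) unit_functional_matrix[OF f kg(1,3) x S]
        seminorm_at_j[OF kg(1) x S(1,2,4)] seminorm_at_j[OF kg(3) x S(1,3,4)]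
      by (rule bound[OF x kg(1,3) S(1,4,2,3)])
  qed (simp_all add: j_dense)
qed (simp_all add: M)

text \<open>
  A row or a column of the matrix of a section with support in a compact set \<open>K\<close> has at most \<open>m\<close>
  nonzero entries, where \<open>m\<close> bounds the number of elements of \<open>K\<close> with a given source or range;
  hence its norm is at most \<open>m\<close> times the largest entry.
\<close>

lemma norm_le_sup_on_compact:
  assumes K: "compactin (gtop G) K"
  shows "\<exists>m\<ge>0. \<forall>\<epsilon>\<ge>0. \<forall>f \<in> Cc_sections E. (\<forall>\<sigma> \<in> arrows \<Sigma>. cmod (ev \<sigma> f) \<le> \<epsilon>) \<longrightarrow>
    (\<forall>\<sigma> \<in> arrows \<Sigma>. q \<sigma> \<notin> K \<longrightarrow> ev \<sigma> f = 0) \<longrightarrow> norm (j f) \<le> m * \<epsilon>"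
proof -
  obtain m1 where m1: "\<And>x. finite {\<gamma> \<in> K. gsrc G \<gamma> = x} \<and> card {\<gamma> \<in> K. gsrc G \<gamma> = x} \<le> m1"
    using B.local_homeomorphism_finite_fibres[OF B.etale_src K] by blast
  obtain m2 where m2: "\<And>x. finite {\<gamma> \<in> K. grng G \<gamma> = x} \<and> card {\<gamma> \<in> K. grng G \<gamma> = x} \<le> m2"
    using B.local_homeomorphism_finite_fibres[OF B.etale_rng K] by blast
  define m where "m = max m1 m2"
  have m12: "m1 \<le> m" "m2 \<le> m" by (simp_all add: m_def)
  have "norm (j f) \<le> real m * \<epsilon>" if \<epsilon>: "0 \<le> \<epsilon>" and f: "f \<in> Cc_sections E"
    and sup: "\<forall>\<sigma> \<in> arrows \<Sigma>. cmod (ev \<sigma> f) \<le> \<epsilon>"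
    and supp: "\<forall>\<sigma> \<in> arrows \<Sigma>. q \<sigma> \<notin> K \<longrightarrow> ev \<sigma> f = 0" for \<epsilon> f
  proof (rule norm_le_matrix_bound[OF f])
    show "0 \<le> real m * \<epsilon>" using \<epsilon> by simp
    fix x k g S assume x: "x \<in> units G" and S: "finite S" "S \<subseteq> source_fibre x"
    let ?k = "\<lambda>\<gamma>. cmod (ev (lift \<gamma>) k)" and ?g = "\<lambda>\<beta>. cmod (ev (lift \<beta>) g)"
    define R where "R = (\<lambda>\<gamma> \<beta>. gmul G \<gamma> (ginv G \<beta>) \<in> K)"
    have quot: "gmul \<Sigma> (lift \<gamma>) (ginv \<Sigma> (lift \<beta>)) \<in> arrows \<Sigma>"
        "q (gmul \<Sigma> (lift \<gamma>) (ginv \<Sigma> (lift \<beta>))) = gmul G \<gamma> (ginv G \<beta>)"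
        "(\<gamma>, ginv G \<beta>) \<in> composable G"
      if "\<gamma> \<in> S" "\<beta> \<in> S" for \<gamma> \<beta>
      using that S(2) quotient_closed[of "lift \<gamma>" "lift \<beta>"] proj_quotient[of "lift \<gamma>" "lift \<beta>"]
      by (auto simp: lift subset_iff B.composable_iff B.inv_closed B.rng_inv)
    have entry: "cmod (matrix_entry f \<gamma> \<beta>) \<le> (if R \<gamma> \<beta> then \<epsilon> else 0)" if "\<gamma> \<in> S" "\<beta> \<in> S" for \<gamma> \<beta>
      using sup supp quot(1,2)[OF that] by (auto simp: matrix_entry_def R_def)
    have row: "card {\<beta> \<in> S. R \<gamma> \<beta>} \<le> m" if g: "\<gamma> \<in> S" for \<gamma>
    proof -
      have "inj_on (\<lambda>\<beta>. gmul G \<gamma> (ginv G \<beta>)) {\<beta> \<in> S. R \<gamma> \<beta>}"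
      proof (rule inj_on_inverseI[of _ "\<lambda>\<alpha>. gmul G (ginv G \<alpha>) \<gamma>"])
        fix \<beta> assume b: "\<beta> \<in> {\<beta> \<in> S. R \<gamma> \<beta>}"
        let ?\<alpha> = "gmul G \<gamma> (ginv G \<beta>)"
        have c: "(\<gamma>, ginv G \<beta>) \<in> composable G" using quot(3)[OF g] b by simp
        have "gmul G ?\<alpha> \<beta> = \<gamma>" using b g S(2) by (intro B.mul_inv_mul) auto
        moreover have "(?\<alpha>, \<beta>) \<in> composable G"
          using b S(2) B.mul_closed[OF c] B.src_mul[OF c] by (auto simp: B.composable_iff B.src_inv)
        ultimately show "gmul G (ginv G ?\<alpha>) \<gamma> = \<beta>" using B.inv_mul_cancel by metis
      qed
      moreover have "(\<lambda>\<beta>. gmul G \<gamma> (ginv G \<beta>)) ` {\<beta> \<in> S. R \<gamma> \<beta>} \<subseteq> {\<alpha> \<in> K. grng G \<alpha> = grng G \<gamma>}"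
        using quot(3)[OF g] B.rng_mul by (auto simp: R_def)
      ultimately have "card {\<beta> \<in> S. R \<gamma> \<beta>} \<le> card {\<alpha> \<in> K. grng G \<alpha> = grng G \<gamma>}"
        using m2 by (intro card_inj_on_le) auto
      then show ?thesis using m2[of "grng G \<gamma>"] m12 by linarith
    qed
    have col: "card {\<gamma> \<in> S. R \<gamma> \<beta>} \<le> m" if b: "\<beta> \<in> S" for \<beta>
    proof -
      have "inj_on (\<lambda>\<gamma>. gmul G \<gamma> (ginv G \<beta>)) {\<gamma> \<in> S. R \<gamma> \<beta>}"
      proof (rule inj_on_inverseI[of _ "\<lambda>\<alpha>. gmul G \<alpha> \<beta>"])
        fix \<gamma> assume "\<gamma> \<in> {\<gamma> \<in> S. R \<gamma> \<beta>}"
        then show "gmul G (gmul G \<gamma> (ginv G \<beta>)) \<beta> = \<gamma>" using b S(2) by (intro B.mul_inv_mul) auto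
      qed
      moreover have "(\<lambda>\<gamma>. gmul G \<gamma> (ginv G \<beta>)) ` {\<gamma> \<in> S. R \<gamma> \<beta>} \<subseteq> {\<alpha> \<in> K. gsrc G \<alpha> = grng G \<beta>}"
        using quot(3)[OF _ b] B.src_mul b S(2) by (auto simp: R_def B.src_inv subset_iff)
      ultimately have "card {\<gamma> \<in> S. R \<gamma> \<beta>} \<le> card {\<alpha> \<in> K. gsrc G \<alpha> = grng G \<beta>}"
        using m1 by (intro card_inj_on_le) auto
      then show ?thesis using m1[of "grng G \<beta>"] m12 by linarith
    qed
    let ?R = "{p \<in> S \<times> S. R (fst p) (snd p)}"
    have sum_R: "(\<Sum>p\<in>?R. h (fst p) (snd p)) = (\<Sum>\<gamma>\<in>S. \<Sum>\<beta>\<in>S. if R \<gamma> \<beta> then h \<gamma> \<beta> else 0)" for h ::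
        "'g \<Rightarrow> 'g \<Rightarrow> real"
    proof -
      have "(\<Sum>p\<in>?R. h (fst p) (snd p)) = (\<Sum>p\<in>S \<times> S. if R (fst p) (snd p) then h (fst p) (snd p) else 0)"
        using S(1) by (simp add: sum.inter_filter)
      then show ?thesis by (simp add: sum.cartesian_product case_prod_unfold)
    qed
    have "(\<Sum>p\<in>?R. (?k (fst p))\<^sup>2) = (\<Sum>\<gamma>\<in>S. real (card {\<beta> \<in> S. R \<gamma> \<beta>}) * (?k \<gamma>)\<^sup>2)"
      unfolding sum_R[of "\<lambda>\<gamma> \<beta>. (?k \<gamma>)\<^sup>2"] using S(1) by (simp add: sum.inter_filter[symmetric])
    also have "\<dots> \<le> (\<Sum>\<gamma>\<in>S. real m * (?k \<gamma>)\<^sup>2)"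
      by (intro sum_mono mult_right_mono) (use row in auto)
    finally have k_le: "L2_set (\<lambda>p. ?k (fst p)) ?R \<le> sqrt m * L2_set ?k S"
      by (simp add: L2_set_def sum_distrib_left[symmetric] real_sqrt_mult[symmetric])
    have "(\<Sum>p\<in>?R. (?g (snd p))\<^sup>2) = (\<Sum>\<beta>\<in>S. real (card {\<gamma> \<in> S. R \<gamma> \<beta>}) * (?g \<beta>)\<^sup>2)"
      unfolding sum_R[of "\<lambda>\<gamma> \<beta>. (?g \<beta>)\<^sup>2"] using S(1)
      by (subst sum.swap) (simp add: sum.inter_filter[symmetric])
    also have "\<dots> \<le> (\<Sum>\<beta>\<in>S. real m * (?g \<beta>)\<^sup>2)"
      by (intro sum_mono mult_right_mono) (use col in auto)
    finally have g_le: "L2_set (\<lambda>p. ?g (snd p)) ?R \<le> sqrt m * L2_set ?g S"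
      by (simp add: L2_set_def sum_distrib_left[symmetric] real_sqrt_mult[symmetric])
    have "cmod (\<Sum>\<gamma>\<in>S. \<Sum>\<beta>\<in>S. cnj (ev (lift \<gamma>) k) * (matrix_entry f \<gamma> \<beta> * ev (lift \<beta>) g)) \<le>
        (\<Sum>\<gamma>\<in>S. \<Sum>\<beta>\<in>S. if R \<gamma> \<beta> then \<epsilon> * (?k \<gamma> * ?g \<beta>) else 0)"
    proof (intro sum_norm_le)
      fix \<gamma> \<beta> assume gb: "\<gamma> \<in> S" "\<beta> \<in> S"
      have "cmod (cnj (ev (lift \<gamma>) k) * (matrix_entry f \<gamma> \<beta> * ev (lift \<beta>) g)) =
          cmod (matrix_entry f \<gamma> \<beta>) * (?k \<gamma> * ?g \<beta>)" by (simp add: norm_mult)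
      also have "\<dots> \<le> (if R \<gamma> \<beta> then \<epsilon> else 0) * (?k \<gamma> * ?g \<beta>)"
        by (intro mult_right_mono entry gb) simp
      finally show "cmod (cnj (ev (lift \<gamma>) k) * (matrix_entry f \<gamma> \<beta> * ev (lift \<beta>) g)) \<le>
          (if R \<gamma> \<beta> then \<epsilon> * (?k \<gamma> * ?g \<beta>) else 0)" by (simp split: if_splits)
    qed
    also have "\<dots> = \<epsilon> * (\<Sum>p\<in>?R. \<bar>?k (fst p)\<bar> * \<bar>?g (snd p)\<bar>)"
      unfolding sum_R[of "\<lambda>\<gamma> \<beta>. \<epsilon> * (?k \<gamma> * ?g \<beta>)", symmetric] by (simp add: sum_distrib_left)
    also have "\<dots> \<le> \<epsilon> * (L2_set (\<lambda>p. ?k (fst p)) ?R * L2_set (\<lambda>p. ?g (snd p)) ?R)"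
      by (intro mult_left_mono L2_set_mult_ineq \<epsilon>)
    also have "\<dots> \<le> \<epsilon> * ((sqrt m * L2_set ?k S) * (sqrt m * L2_set ?g S))"
      by (intro mult_left_mono mult_mono k_le g_le \<epsilon>) (simp_all add: L2_set_nonneg)
    also have "\<dots> = \<epsilon> * (sqrt m * sqrt m) * (L2_set ?k S * L2_set ?g S)" by (simp only: mult_ac)
    also have "sqrt m * sqrt m = real m" by simp
    finally show "cmod (\<Sum>\<gamma>\<in>S. \<Sum>\<beta>\<in>S. cnj (ev (lift \<gamma>) k) * (matrix_entry f \<gamma> \<beta> * ev (lift \<beta>) g)) \<le>
        real m * \<epsilon> * L2_set ?k S * L2_set ?g S" by (simp add: mult_ac)
  qed
  then show ?thesis by (intro exI[of _ "real m"]) simp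
qed

text \<open>
  Multiplication by a function of positive type is a Schur multiplier: decomposing the positive matrix
  \<open>h(\<gamma> \<beta>\<^sup>-\<^sup>1)\<close> on a finite set as \<open>\<Sum>i. cnj (v\<^sub>i \<gamma>) v\<^sub>i \<beta>\<close>, the form of \<open>h f\<close> is a sum of forms of \<open>f\<close>
  at the vectors multiplied by \<open>v\<^sub>i\<close>, and \<open>\<Sum>i. \<bar>v\<^sub>i \<gamma>\<bar>\<^sup>2 = h(\<gamma> \<gamma>\<^sup>-\<^sup>1)\<close> is bounded by \<open>C\<close>.
\<close>

lemma norm_positive_type_mult:
  assumes f: "f \<in> Cc_sections E" and h: "continuous_map (gtop G) euclidean h" "positive_type G h"
    and C: "\<And>\<gamma>. \<gamma> \<in> arrows G \<Longrightarrow> cmod (h \<gamma>) \<le> C" "0 \<le> C"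
  shows "norm (j (pointwise_mult h f)) \<le> C * norm (j f)"
proof (rule norm_le_matrix_bound[OF pointwise_mult_in_Cc[OF f h(1)]])
  show "0 \<le> C * norm (j f)" using C(2) by simp
  fix x k g S
  assume x: "x \<in> units G" and k: "k \<in> Cc_sections E" and g: "g \<in> Cc_sections E"
    and S: "finite S" "S \<subseteq> source_fibre x" "fibre_support k x \<subseteq> S" "fibre_support g x \<subseteq> S"
  have fs: "f \<in> sections" by (rule Cc_in_sections[OF f])
  define H where "H \<gamma> \<beta> = h (gmul G \<gamma> (ginv G \<beta>))" for \<gamma> \<beta>
  have "(\<Sum>\<eta>\<in>S. \<Sum>\<gamma>\<in>S. cnj (c \<eta>) * H \<eta> \<gamma> * c \<gamma>) \<in> \<real>\<^sub>\<ge>\<^sub>0" for c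
    using h(2) x S(1,2) unfolding positive_type_def H_def by blast
  from positive_matrix_decomposition[OF S(1) this]
  obtain n :: nat and v where v: "\<And>\<gamma> \<beta>. \<gamma> \<in> S \<Longrightarrow> \<beta> \<in> S \<Longrightarrow> H \<gamma> \<beta> = (\<Sum>i<n. cnj (v i \<gamma>) * v i \<beta>)" by blast
  have SG: "S \<subseteq> arrows G" using S(2) by auto
  have "\<exists>\<kappa>. continuous_map (gtop G) euclidean \<kappa> \<and> (\<forall>\<beta> \<in> S. \<kappa> \<beta> = v i \<beta>)" for i
    by (rule B.continuous_interpolation[OF S(1) SG])
  then obtain \<kappa> where \<kappa>: "\<And>i. continuous_map (gtop G) euclidean (\<kappa> i)" "\<And>i \<beta>. \<beta> \<in> S \<Longrightarrow> \<kappa> i \<beta> = v i \<beta>" by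
      metis
  \<comment> \<open>Multiplication by \<open>\<kappa> i\<close> realises multiplication by \<open>v i\<close> on the source fibre within the algebra.\<close>
  have cut: "pointwise_mult (\<kappa> i) b \<in> Cc_sections E" "fibre_support (pointwise_mult (\<kappa> i) b) x \<subseteq> S"
      "\<And>\<beta>. \<beta> \<in> S \<Longrightarrow> ev (lift \<beta>) (pointwise_mult (\<kappa> i) b) = v i \<beta> * ev (lift \<beta>) b"
    if b: "b \<in> Cc_sections E" "fibre_support b x \<subseteq> S" for i b
  proof -
    note bs = Cc_in_sections[OF b(1)]
    show "pointwise_mult (\<kappa> i) b \<in> Cc_sections E" by (rule pointwise_mult_in_Cc[OF b(1) \<kappa>(1)])
    show "fibre_support (pointwise_mult (\<kappa> i) b) x \<subseteq> S"
      using b(2) by (auto simp: fibre_support_def lift ev_pointwise_mult[OF bs])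
    show "ev (lift \<beta>) (pointwise_mult (\<kappa> i) b) = v i \<beta> * ev (lift \<beta>) b" if "\<beta> \<in> S" for \<beta>
      using that SG \<kappa>(2)[OF that] by (auto simp: lift ev_pointwise_mult[OF bs])
  qed
  let ?N = "\<lambda>b. L2_set (\<lambda>\<beta>. cmod (ev (lift \<beta>) b)) S"
  have entry: "matrix_entry (pointwise_mult h f) \<gamma> \<beta> = H \<gamma> \<beta> * matrix_entry f \<gamma> \<beta>" if "\<gamma> \<in> S" "\<beta> \<in> S"
      for \<gamma> \<beta>
    using that S(2) quotient_closed[of "lift \<gamma>" "lift \<beta>"] proj_quotient[of "lift \<gamma>" "lift \<beta>"]
    by (auto simp: lift subset_iff matrix_entry_def H_def ev_pointwise_mult[OF fs])
  have "(\<Sum>\<gamma>\<in>S. \<Sum>\<beta>\<in>S. cnj (ev (lift \<gamma>) k) * (matrix_entry (pointwise_mult h f) \<gamma> \<beta> * ev (lift \<beta>) g)) =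
      (\<Sum>\<gamma>\<in>S. \<Sum>\<beta>\<in>S. \<Sum>i<n. cnj (v i \<gamma> * ev (lift \<gamma>) k) * (matrix_entry f \<gamma> \<beta> * (v i \<beta> * ev (lift \<beta>) g)))"
    by (intro sum.cong refl) (simp add: entry v sum_distrib_left sum_distrib_right mult_ac)
  also have "\<dots> = (\<Sum>\<gamma>\<in>S. \<Sum>i<n. \<Sum>\<beta>\<in>S. cnj (v i \<gamma> * ev (lift \<gamma>) k) * (matrix_entry f \<gamma> \<beta> * (v i \<beta> * ev
      (lift \<beta>) g)))"
    by (intro sum.cong refl sum.swap)
  also have "\<dots> = (\<Sum>i<n. \<Sum>\<gamma>\<in>S. \<Sum>\<beta>\<in>S. cnj (v i \<gamma> * ev (lift \<gamma>) k) * (matrix_entry f \<gamma> \<beta> * (v i \<beta> * ev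
      (lift \<beta>) g)))"
    by (rule sum.swap)
  also have "\<dots> = (\<Sum>i<n. unit_functional x (star (j (pointwise_mult (\<kappa> i) k)) * (j f * j (pointwise_mult
      (\<kappa> i) g))))"
    by (intro sum.cong refl)
      (simp add: unit_functional_matrix[OF f cut(1)[OF k S(3)] cut(1)[OF g S(4)] x S(1) cut(2)[OF k
          S(3)] cut(2)[OF g S(4)] S(2)]
        cut(3)[OF k S(3)] cut(3)[OF g S(4)] cong: sum.cong)
  also have "cmod \<dots> \<le> (\<Sum>i<n. norm (j f) * ?N (pointwise_mult (\<kappa> i) k) * ?N (pointwise_mult (\<kappa> i) g))"
  proof (rule sum_norm_le)
    fix i
    have "cmod (unit_functional x (star (j (pointwise_mult (\<kappa> i) k)) * (j f * j (pointwise_mult (\<kappa> i)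
        g)))) \<le>
        norm (j f) * PF.seminorm_at x (j (pointwise_mult (\<kappa> i) k)) * PF.seminorm_at x (j (pointwise_mult
            (\<kappa> i) g))"
      using PF.gns_bound_norm[of "j f"] x by (simp add: PF.gns_bound_def)
    then show "cmod (unit_functional x (star (j (pointwise_mult (\<kappa> i) k)) * (j f * j (pointwise_mult (\<kappa>
        i) g)))) \<le>
        norm (j f) * ?N (pointwise_mult (\<kappa> i) k) * ?N (pointwise_mult (\<kappa> i) g)"
      by (simp only: seminorm_at_j[OF cut(1)[OF k S(3)] x S(1) cut(2)[OF k S(3)] S(2)]
        seminorm_at_j[OF cut(1)[OF g S(4)] x S(1) cut(2)[OF g S(4)] S(2)])
  qed
  also have "\<dots> = norm (j f) * (\<Sum>i<n. \<bar>?N (pointwise_mult (\<kappa> i) k)\<bar> * \<bar>?N (pointwise_mult (\<kappa> i) g)\<bar>)"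
    by (simp add: sum_distrib_left mult.assoc L2_set_nonneg)
  also have "\<dots> \<le> norm (j f) * (L2_set (\<lambda>i. ?N (pointwise_mult (\<kappa> i) k)) {..<n} * L2_set (\<lambda>i. ?N
      (pointwise_mult (\<kappa> i) g)) {..<n})"
    by (intro mult_left_mono L2_set_mult_ineq) simp
  also have "\<dots> \<le> norm (j f) * ((sqrt C * ?N k) * (sqrt C * ?N g))"
  proof -
    have "L2_set (\<lambda>i. ?N (pointwise_mult (\<kappa> i) b)) {..<n} \<le> sqrt C * ?N b"
      if b: "b \<in> Cc_sections E" "fibre_support b x \<subseteq> S" for b
    proof -
      have diag: "(\<Sum>i<n. (cmod (v i \<beta>))\<^sup>2) \<le> C" if "\<beta> \<in> S" for \<beta>
      proof -
        have "complex_of_real (\<Sum>i<n. (cmod (v i \<beta>))\<^sup>2) = H \<beta> \<beta>"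
          unfolding v[OF that that] by (simp only: of_real_sum complex_norm_square mult.commute[of "cnj _"])
        then have "(\<Sum>i<n. (cmod (v i \<beta>))\<^sup>2) \<le> cmod (H \<beta> \<beta>)"
          by (metis norm_of_real abs_ge_self)
        also have "\<dots> \<le> C" using that SG by (auto simp: H_def B.mul_inv B.rng_closed intro!: C(1))
        finally show ?thesis .
      qed
      have "(\<Sum>i<n. (?N (pointwise_mult (\<kappa> i) b))\<^sup>2) = (\<Sum>i<n. \<Sum>\<beta>\<in>S. (cmod (v i \<beta>))\<^sup>2 * (cmod (ev (lift \<beta>)
          b))\<^sup>2)"
        by (simp add: L2_set_def sum_nonneg cut(3)[OF b] norm_mult power_mult_distrib cong: sum.cong)
      also have "\<dots> = (\<Sum>\<beta>\<in>S. (\<Sum>i<n. (cmod (v i \<beta>))\<^sup>2) * (cmod (ev (lift \<beta>) b))\<^sup>2)"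
        unfolding sum_distrib_right by (rule sum.swap)
      also have "\<dots> \<le> (\<Sum>\<beta>\<in>S. C * (cmod (ev (lift \<beta>) b))\<^sup>2)"
        by (intro sum_mono mult_right_mono diag) simp_all
      finally show ?thesis
        by (simp add: L2_set_def[of _ "{..<n}"] L2_set_def[of _ S] sum_distrib_left[symmetric]
            real_sqrt_mult[symmetric])
    qed
    from this[OF k S(3)] this[OF g S(4)] show ?thesis
      by (intro mult_left_mono mult_mono) (simp_all add: L2_set_nonneg C(2))
  qed
  also have "\<dots> = norm (j f) * (sqrt C * sqrt C) * (?N k * ?N g)" by (simp only: mult_ac)
  also have "sqrt C * sqrt C = C" using C(2) by simp
  finally show "cmod (\<Sum>\<gamma>\<in>S. \<Sum>\<beta>\<in>S. cnj (ev (lift \<gamma>) k) * (matrix_entry (pointwise_mult h f) \<gamma> \<beta> * ev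
      (lift \<beta>) g)) \<le>
      C * norm (j f) * ?N k * ?N g" by (simp add: mult_ac)
qed

end

section \<open>Twists over open subgroupoids\<close>

lemma subtopology_Int: "subtopology (subtopology X A) B = subtopology X (A \<inter> B)"
  by (simp add: subtopology_subtopology)

lemma restrict_grpd_simps [simp]:
  "gtop (restrict_grpd G X) = subtopology (gtop G) X" "gsrc (restrict_grpd G X) = gsrc G"
  "grng (restrict_grpd G X) = grng G" "gmul (restrict_grpd G X) = gmul G"
      "ginv (restrict_grpd G X) = ginv G"
  by (simp_all add: restrict_grpd_def)

lemma subtwist_simps [simp]:
  "base_grpd (subtwist E H) = restrict_grpd (base_grpd E) H"
  "total_grpd (subtwist E H) = restrict_grpd (total_grpd E) (preimage_arrows E H)"
  "inc (subtwist E H) = inc E" "proj (subtwist E H) = proj E"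
  by (simp_all add: subtwist_def)

lemma local_homeomorphism_restrict:
  assumes lh: "local_homeomorphism X Y f" and A: "openin X A" and fA: "f ` A \<subseteq> B"
  shows "local_homeomorphism (subtopology X A) (subtopology Y B) f"
  unfolding local_homeomorphism_def
proof
  fix x assume "x \<in> topspace (subtopology X A)"
  then have x: "x \<in> topspace X" "x \<in> A" by auto
  obtain U where U: "openin X U" "x \<in> U" "openin Y (f ` U)"
    and hom: "homeomorphic_map (subtopology X U) (subtopology Y (f ` U)) f"
    using lh x(1) unfolding local_homeomorphism_def by blast
  have UA: "openin X (U \<inter> A)" using U(1) A by blast
  have "openin (subtopology X U) (U \<inter> A)" by (rule openin_subtopology_Int2[OF A])
  then have "openin (subtopology Y (f ` U)) (f ` (U \<inter> A))"
    using homeomorphic_imp_open_map[OF hom] unfolding open_map_def by blast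
  then have fUA: "openin Y (f ` (U \<inter> A))" using U(3) by (rule openin_trans_full)
  have "f ` (topspace (subtopology X U) \<inter> (U \<inter> A)) = topspace (subtopology Y (f ` U)) \<inter> f ` (U \<inter> A)"
    using openin_subset[OF U(1)] openin_subset[OF fUA] by auto
  from homeomorphic_map_subtopologies[OF hom this]
  have hom': "homeomorphic_map (subtopology X (U \<inter> (U \<inter> A))) (subtopology Y (f ` U \<inter> f ` (U \<inter> A))) f"
    by (simp only: subtopology_Int)
  have e1: "U \<inter> (U \<inter> A) = A \<inter> (U \<inter> A)" by blast
  have e2: "f ` U \<inter> f ` (U \<inter> A) = B \<inter> f ` (U \<inter> A)" using fA by blast
  have hom'': "homeomorphic_map (subtopology (subtopology X A) (U \<inter> A)) (subtopology (subtopology Y B)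
      (f ` (U \<inter> A))) f"
    using hom' by (simp only: subtopology_Int e1 e2)
  have "openin (subtopology X A) (U \<inter> A)" using U(1) by (auto simp: openin_subtopology)
  moreover have "openin (subtopology Y B) (f ` (U \<inter> A))"
    using fUA fA by (auto simp: openin_subtopology)
  ultimately show "\<exists>U. openin (subtopology X A) U \<and> x \<in> U \<and> openin (subtopology Y B) (f ` U) \<and>
      homeomorphic_map (subtopology (subtopology X A) U) (subtopology (subtopology Y B) (f ` U)) f"
    using x U(2) hom'' by blast
qed

context topological_groupoid
begin

context
  fixes H assumes H: "open_subgroupoid G H"
begin

lemma subgroupoid_open: "openin (gtop G) H" using H by (simp add: open_subgroupoid_def)

lemma subgroupoid_subset: "H \<subseteq> arrows G" using openin_subset[OF subgroupoid_open] by simp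

lemma subgroupoid_inv: "\<gamma> \<in> H \<Longrightarrow> ginv G \<gamma> \<in> H" using H by (simp add: open_subgroupoid_def)

lemma subgroupoid_mul: "\<gamma> \<in> H \<Longrightarrow> \<eta> \<in> H \<Longrightarrow> gsrc G \<gamma> = grng G \<eta> \<Longrightarrow> gmul G \<gamma> \<eta> \<in> H"
  using H subgroupoid_subset unfolding open_subgroupoid_def composable_iff by blast

lemma subgroupoid_src: "\<gamma> \<in> H \<Longrightarrow> gsrc G \<gamma> \<in> H"
  using subgroupoid_mul[of "ginv G \<gamma>" \<gamma>] subgroupoid_inv[of \<gamma>] subgroupoid_subset
  by (auto simp: src_inv inv_mul subset_iff)

lemma subgroupoid_rng: "\<gamma> \<in> H \<Longrightarrow> grng G \<gamma> \<in> H"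
  using subgroupoid_src[OF subgroupoid_inv, of \<gamma>] subgroupoid_subset by (auto simp: src_inv)

lemma arrows_restrict: "arrows (restrict_grpd G H) = H"
  using subgroupoid_subset by (simp add: arrows_def[of "restrict_grpd G H"] Int_absorb1)

lemma units_restrict: "units (restrict_grpd G H) = units G \<inter> H"
proof (intro equalityI subsetI)
  fix x assume "x \<in> units G \<inter> H"
  then show "x \<in> units (restrict_grpd G H)"
    unfolding units_def[of "restrict_grpd G H"] arrows_restrict
    by (intro image_eqI[of _ _ x]) (auto simp: units_iff)
next
  fix x assume "x \<in> units (restrict_grpd G H)"
  then obtain \<gamma> where "\<gamma> \<in> H" "x = gsrc G \<gamma>"
    unfolding units_def[of "restrict_grpd G H"] arrows_restrict by auto
  then show "x \<in> units G \<inter> H" using subgroupoid_src subgroupoid_subset by auto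
qed

lemma composable_restrict: "composable (restrict_grpd G H) = composable G \<inter> (H \<times> H)"
  unfolding composable_def arrows_restrict using subgroupoid_subset by auto

lemma topological_groupoid_restrict: "topological_groupoid (restrict_grpd G H)"
proof
  have HG: "\<gamma> \<in> arrows G" if "\<gamma> \<in> H" for \<gamma> using that subgroupoid_subset by blast
  have cont: "continuous_map (subtopology (gtop G) H) (subtopology (gtop G) H) f"
    if "continuous_map (gtop G) (gtop G) f" "\<And>\<gamma>. \<gamma> \<in> H \<Longrightarrow> f \<gamma> \<in> H" for f
    using that by (auto simp: continuous_map_in_subtopology continuous_map_from_subtopology)
  show "continuous_map (gtop (restrict_grpd G H)) (gtop (restrict_grpd G H)) (gsrc (restrict_grpd G H))"
    by (simp add: cont continuous_src subgroupoid_src)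
  show "continuous_map (gtop (restrict_grpd G H)) (gtop (restrict_grpd G H)) (grng (restrict_grpd G H))"
    by (simp add: cont continuous_rng subgroupoid_rng)
  show "continuous_map (gtop (restrict_grpd G H)) (gtop (restrict_grpd G H)) (ginv (restrict_grpd G H))"
    by (simp add: cont continuous_inv subgroupoid_inv)
  have "subtopology (prod_topology (subtopology (gtop G) H) (subtopology (gtop G) H)) (composable G \<inter> (H
      \<times> H)) =
      subtopology (prod_topology (gtop G) (gtop G)) (composable G \<inter> (H \<times> H))"
    unfolding subtopology_Times[symmetric] subtopology_Int by (rule arg_cong[of _ _ "subtopology _"]) blast
  moreover have "continuous_map (subtopology (prod_topology (gtop G) (gtop G)) (composable G \<inter> (H \<times> H)))
      (gtop G)
      (\<lambda>(\<gamma>, \<eta>). gmul G \<gamma> \<eta>)"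
    by (rule continuous_map_from_subtopology_mono[OF continuous_mul]) blast
  ultimately show "continuous_map (subtopology (prod_topology (gtop (restrict_grpd G H)) (gtop
      (restrict_grpd G H)))
      (composable (restrict_grpd G H))) (gtop (restrict_grpd G H)) (\<lambda>(\<gamma>, \<eta>). gmul (restrict_grpd G H) \<gamma> \<eta>)"
    using subgroupoid_mul
    by (auto simp: composable_restrict continuous_map_in_subtopology composable_iff)
qed (use subgroupoid_subset in \<open>auto simp: arrows_restrict composable_restrict subgroupoid_src
    subgroupoid_rng subgroupoid_inv
    subgroupoid_mul composable_iff src_src rng_src src_rng rng_rng src_mul rng_mul mul_assoc mul_src mul_rng
    src_inv rng_inv inv_mul mul_inv subset_iff\<close>)

end

end

lemma (in lch_etale_groupoid) lch_etale_groupoid_restrict: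
  assumes H: "open_subgroupoid G H" shows "lch_etale_groupoid (restrict_grpd G H)"
proof -
  interpret R: topological_groupoid "restrict_grpd G H" by (rule topological_groupoid_restrict[OF H])
  have top: "subtopology (gtop (restrict_grpd G H)) (units (restrict_grpd G H)) =
      subtopology (subtopology (gtop G) (units G)) H"
    by (simp add: units_restrict[OF H] subtopology_Int Int_commute Int_left_commute)
  show ?thesis
  proof
    show "locally_compact_space (gtop (restrict_grpd G H))"
      using locally_compact_space_open_subset locally_compact Hausdorff subgroupoid_open[OF H] by auto
    show "Hausdorff_space (gtop (restrict_grpd G H))"
      using Hausdorff by (simp add: Hausdorff_space_subtopology)
    show "local_homeomorphism (gtop (restrict_grpd G H))
        (subtopology (gtop (restrict_grpd G H)) (units (restrict_grpd G H))) (gsrc (restrict_grpd G H))"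
      unfolding top using local_homeomorphism_restrict[OF etale_src subgroupoid_open[OF H], of H]
          subgroupoid_src[OF H] by auto
    show "local_homeomorphism (gtop (restrict_grpd G H))
        (subtopology (gtop (restrict_grpd G H)) (units (restrict_grpd G H))) (grng (restrict_grpd G H))"
      unfolding top using local_homeomorphism_restrict[OF etale_rng subgroupoid_open[OF H], of H]
          subgroupoid_rng[OF H] by auto
  qed
qed

context twist
begin

context
  fixes H assumes H: "open_subgroupoid G H"
begin

lemma preimage_subgroupoid: "open_subgroupoid \<Sigma> (preimage_arrows E H)"
  unfolding open_subgroupoid_def
proof (intro conjI ballI impI)
  show "openin (gtop \<Sigma>) (preimage_arrows E H)"
    unfolding preimage_arrows_def by (rule openin_preimage[OF B.subgroupoid_open[OF H]])
  show "ginv \<Sigma> \<sigma> \<in> preimage_arrows E H" if "\<sigma> \<in> preimage_arrows E H" for \<sigma>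
    using that B.subgroupoid_inv[OF H] by (simp add: preimage_arrows_def T.inv_closed proj_inv)
  show "gmul \<Sigma> \<sigma> \<tau> \<in> preimage_arrows E H"
    if "\<sigma> \<in> preimage_arrows E H" "\<tau> \<in> preimage_arrows E H" "(\<sigma>, \<tau>) \<in> composable \<Sigma>" for \<sigma> \<tau>
    using that B.subgroupoid_mul[OF H] proj_mul[OF that(3)]
    by (simp add: preimage_arrows_def T.mul_closed composable_total)
qed

lemma arrows_subtwist: "arrows (total_grpd (subtwist E H)) = {\<sigma> \<in> arrows \<Sigma>. q \<sigma> \<in> H}"
  using T.arrows_restrict[OF preimage_subgroupoid] by (simp add: preimage_arrows_def)

lemma twist_subtwist: "twist (subtwist E H)"
proof (rule twist.intro)
  note HG = B.subgroupoid_subset[OF H]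
  note units = B.units_restrict[OF H]
  note arr = arrows_subtwist[simplified]
  show "lch_etale_groupoid (base_grpd (subtwist E H))"
    using B.lch_etale_groupoid_restrict[OF H] by simp
  show "topological_groupoid (total_grpd (subtwist E H))"
    using T.topological_groupoid_restrict[OF preimage_subgroupoid] by simp
  have "continuous_map (subtopology (prod_topology (top_of_set circle) (subtopology (gtop G) (units G)))
      (UNIV \<times> H))
      (gtop \<Sigma>) (inc E)"
    by (rule continuous_map_from_subtopology[OF inc_continuous])
  moreover have "subtopology (prod_topology (top_of_set circle) (subtopology (gtop G) (units G))) (UNIV
      \<times> H) =
      prod_topology (top_of_set circle) (subtopology (gtop G) (units G \<inter> H))"
    by (simp add: subtopology_Times subtopology_Int)
  moreover have "subtopology (gtop G) (units G \<inter> H) = subtopology (subtopology (gtop G) H) (units G \<inter> H)"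
    by (simp add: subtopology_Int Int_left_commute Int_commute)
  ultimately show "continuous_map (prod_topology (top_of_set circle)
      (subtopology (gtop (base_grpd (subtwist E H))) (units (base_grpd (subtwist E H)))))
      (gtop (total_grpd (subtwist E H))) (inc (subtwist E H))"
    using proj_inc by (auto simp: units continuous_map_in_subtopology preimage_arrows_def)
  show "inj_on (inc (subtwist E H)) (circle \<times> units (base_grpd (subtwist E H)))"
    unfolding subtwist_simps by (rule inj_on_subset[OF inc_inj]) (auto simp: units)
  show "continuous_map (gtop (total_grpd (subtwist E H))) (gtop (base_grpd (subtwist E H))) (proj
      (subtwist E H))"
    using proj_continuous by (auto simp: continuous_map_in_subtopology continuous_map_from_subtopology
        preimage_arrows_def)
  show "proj (subtwist E H) ` arrows (total_grpd (subtwist E H)) = arrows (base_grpd (subtwist E H))"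
  proof -
    have "q ` {\<sigma> \<in> arrows \<Sigma>. q \<sigma> \<in> H} = H"
    proof (intro equalityI subsetI)
      fix \<gamma> assume g: "\<gamma> \<in> H"
      then have "\<gamma> \<in> arrows G" using HG by blast
      then show "\<gamma> \<in> q ` {\<sigma> \<in> arrows \<Sigma>. q \<sigma> \<in> H}"
        using g by (intro image_eqI[of _ _ "lift \<gamma>"]) (auto simp: lift)
    qed auto
    then show ?thesis by (simp add: arr B.arrows_restrict[OF H])
  qed
  show "inc (subtwist E H) ` (circle \<times> units (base_grpd (subtwist E H))) =
      {\<sigma> \<in> arrows (total_grpd (subtwist E H)). proj (subtwist E H) \<sigma> \<in> units (base_grpd (subtwist E H))}"
  proof (intro equalityI subsetI)
    fix \<sigma> assume "\<sigma> \<in> {\<sigma> \<in> arrows (total_grpd (subtwist E H)). proj (subtwist E H) \<sigma> \<in> units (base_grpd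
        (subtwist E H))}"
    then have s: "\<sigma> \<in> arrows \<Sigma>" "q \<sigma> \<in> units G" "q \<sigma> \<in> H" by (auto simp: arr units)
    obtain z where "z \<in> circle" "\<sigma> = inc E (z, q \<sigma>)" using unit_fibre[OF s(1,2)] .
    then show "\<sigma> \<in> inc (subtwist E H) ` (circle \<times> units (base_grpd (subtwist E H)))"
      using s by (intro image_eqI[of _ _ "(z, q \<sigma>)"]) (auto simp: units)
  qed (auto simp: arr units proj_inc)
  show "gmul (total_grpd (subtwist E H)) (inc (subtwist E H) (z, grng (base_grpd (subtwist E H)) (proj
      (subtwist E H) \<sigma>))) \<sigma> =
      gmul (total_grpd (subtwist E H)) \<sigma> (inc (subtwist E H) (z, gsrc (base_grpd (subtwist E H)) (proj
          (subtwist E H) \<sigma>)))"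
    if "z \<in> circle" "\<sigma> \<in> arrows (total_grpd (subtwist E H))" for z \<sigma>
    using central[OF that(1)] that(2) by (simp add: arr)
  fix \<alpha> assume a: "\<alpha> \<in> arrows (base_grpd (subtwist E H))"
  then have \<alpha>: "\<alpha> \<in> H" "\<alpha> \<in> arrows G" using HG by (auto simp: B.arrows_restrict[OF H])
  obtain U \<phi> where U: "openin (gtop G) U" "\<alpha> \<in> U"
    and \<phi>: "continuous_map (subtopology (gtop G) U) (gtop \<Sigma>) \<phi>" "\<forall>\<beta> \<in> U. q (\<phi> \<beta>) = \<beta>"
    and hom: "homeomorphic_map (prod_topology (top_of_set circle) (subtopology (gtop G) U))
        (subtopology (gtop \<Sigma>) {\<sigma> \<in> arrows \<Sigma>. q \<sigma> \<in> U}) (\<lambda>(z, \<beta>). gmul \<Sigma> (inc E (z, grng G \<beta>)) (\<phi> \<beta>))"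
    using locally_trivial[OF \<alpha>(2)] by blast
  let ?\<Theta> = "\<lambda>(z, \<beta>). gmul \<Sigma> (inc E (z, grng G \<beta>)) (\<phi> \<beta>)"
  have \<phi>': "\<phi> \<beta> \<in> arrows \<Sigma>" if "\<beta> \<in> U" for \<beta>
    using funcset_mem[OF continuous_map_funspace[OF \<phi>(1)], of \<beta>] that openin_subset[OF U(1)] by auto
  have q\<Theta>: "q (?\<Theta> (z, \<beta>)) = \<beta>" if "z \<in> circle" "\<beta> \<in> U" for z \<beta>
    using proj_act[OF that(1) \<phi>'[OF that(2)]] \<phi>(2) that(2) by (simp add: circle_act_def)
  have "homeomorphic_map (subtopology (prod_topology (top_of_set circle) (subtopology (gtop G) U)) (UNIV
      \<times> H))
      (subtopology (subtopology (gtop \<Sigma>) {\<sigma> \<in> arrows \<Sigma>. q \<sigma> \<in> U}) {\<sigma> \<in> arrows \<Sigma>. q \<sigma> \<in> H}) ?\<Theta>"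
    by (rule homeomorphic_map_subtopologies_alt[OF hom]) (use q\<Theta> in auto)
  moreover have "subtopology (prod_topology (top_of_set circle) (subtopology (gtop G) U)) (UNIV \<times> H) =
      prod_topology (top_of_set circle) (subtopology (subtopology (gtop G) H) (U \<inter> H))"
    by (simp add: subtopology_Times subtopology_Int Int_left_commute Int_commute)
  moreover have "subtopology (subtopology (gtop \<Sigma>) {\<sigma> \<in> arrows \<Sigma>. q \<sigma> \<in> U}) {\<sigma> \<in> arrows \<Sigma>. q \<sigma> \<in> H} =
      subtopology (subtopology (gtop \<Sigma>) {\<sigma> \<in> arrows \<Sigma>. q \<sigma> \<in> H}) {\<sigma> \<in> {\<sigma> \<in> arrows \<Sigma>. q \<sigma> \<in> H}. q \<sigma> \<in> U \<inter> H}"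
    unfolding subtopology_Int by (rule arg_cong[of _ _ "subtopology _"]) blast
  ultimately have hom': "homeomorphic_map (prod_topology (top_of_set circle) (subtopology (subtopology
      (gtop G) H) (U \<inter> H)))
      (subtopology (subtopology (gtop \<Sigma>) {\<sigma> \<in> arrows \<Sigma>. q \<sigma> \<in> H}) {\<sigma> \<in> {\<sigma> \<in> arrows \<Sigma>. q \<sigma> \<in> H}. q \<sigma> \<in> U
          \<inter> H}) ?\<Theta>"
    by simp
  have "continuous_map (subtopology (subtopology (gtop G) H) (U \<inter> H)) (subtopology (gtop \<Sigma>) {\<sigma> \<in> arrows
      \<Sigma>. q \<sigma> \<in> H}) \<phi>"
  proof -
    have "subtopology (subtopology (gtop G) H) (U \<inter> H) = subtopology (gtop G) (U \<inter> H)"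
      unfolding subtopology_Int by (rule arg_cong[of _ _ "subtopology _"]) blast
    moreover have "continuous_map (subtopology (gtop G) (U \<inter> H)) (gtop \<Sigma>) \<phi>"
      by (rule continuous_map_from_subtopology_mono[OF \<phi>(1)]) blast
    ultimately show ?thesis using \<phi>' \<phi>(2) by (auto simp: continuous_map_in_subtopology)
  qed
  moreover have "openin (subtopology (gtop G) H) (U \<inter> H)" using U(1) by (auto simp: openin_subtopology)
  ultimately show "\<exists>U \<phi>. openin (gtop (base_grpd (subtwist E H))) U \<and> \<alpha> \<in> U \<and>
      continuous_map (subtopology (gtop (base_grpd (subtwist E H))) U) (gtop (total_grpd (subtwist E
          H))) \<phi> \<and>
      (\<forall>\<beta> \<in> U. proj (subtwist E H) (\<phi> \<beta>) = \<beta>) \<and>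
      homeomorphic_map
        (prod_topology (top_of_set circle) (subtopology (gtop (base_grpd (subtwist E H))) U))
        (subtopology (gtop (total_grpd (subtwist E H))) {\<sigma> \<in> arrows (total_grpd (subtwist E H)). proj
            (subtwist E H) \<sigma> \<in> U})
        (\<lambda>(z, \<beta>). gmul (total_grpd (subtwist E H)) (inc (subtwist E H) (z, grng (base_grpd (subtwist E
            H)) \<beta>)) (\<phi> \<beta>))"
    using hom' U(2) \<alpha>(1) \<phi>(2)
    by (intro exI[of _ "U \<inter> H"] exI[of _ \<phi>]) (simp add: arr[unfolded preimage_arrows_def]
        preimage_arrows_def)
qed (use B.subgroupoid_subset[OF H] in \<open>auto simp: arrows_subtwist[simplified] B.units_restrict[OF H]
    inc_src inc_rng inc_mul proj_src proj_rng proj_inc proj_mul T.composable_restrict[OF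
        preimage_subgroupoid]\<close>)

end

end

section \<open>The copy of the algebra of an open subgroupoid\<close>

locale reduced_subtwist = reduced_twist E j
  for E :: "('g, 's) twist_data" and j :: "('g, 's) line_section \<Rightarrow> 'a::cstar_algebra" +
  fixes H :: "'g set" and jH :: "('g, 's) line_section \<Rightarrow> 'b::cstar_algebra"
  assumes H: "open_subgroupoid (base_grpd E) H"
    and reduced_H: "reduced_completion (subtwist E H) jH"
begin

sublocale Sub: reduced_twist "subtwist E H" jH
  using twist_subtwist[OF H] reduced_H
  by (simp add: reduced_twist_def reduced_twist_axioms_def)

abbreviation "Cc_H \<equiv> Cc_sections (subtwist E H)"
abbreviation "evH \<equiv> section_eval (subtwist E H)"
abbreviation "ext \<equiv> section_on E H"
abbreviation "\<Sigma>H \<equiv> {\<sigma> \<in> arrows \<Sigma>. q \<sigma> \<in> H}"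

lemma arrows_H [simp]: "arrows (restrict_grpd G H) = H" by (rule B.arrows_restrict[OF H])

lemma arrows_\<Sigma>H [simp]: "arrows (restrict_grpd \<Sigma> (preimage_arrows E H)) = \<Sigma>H"
  using arrows_subtwist[OF H] by simp

lemma units_H: "units (restrict_grpd G H) = units G \<inter> H" by (rule B.units_restrict[OF H])

lemma act_H: "circle_act (subtwist E H) = act"
  by (intro ext) (simp add: circle_act_def)

lemma line_class_H: assumes "\<sigma> \<in> \<Sigma>H" shows "line_class (subtwist E H) z \<sigma> = line_class E z \<sigma>"
proof -
  have "((z, \<sigma>), (w, \<tau>)) \<in> line_rel (subtwist E H) \<longleftrightarrow> ((z, \<sigma>), (w, \<tau>)) \<in> line_rel E" for w \<tau>
    using assms by (auto simp: line_rel_def act_H)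
  then show ?thesis by (auto simp: line_class_def)
qed

lemma lift_H: "\<gamma> \<in> H \<Longrightarrow> Sub.lift \<gamma> = lift \<gamma>"
  unfolding Sub.lift_def lift_def by (rule arg_cong[of _ _ Eps]) auto

lemma section_value_H:
  assumes "f \<in> Cc_H" "\<sigma> \<in> arrows \<Sigma>" "q \<sigma> \<in> H" shows "f (q \<sigma>) = line_class E (evH \<sigma> f) \<sigma>"
  using Sub.section_value[OF Sub.Cc_in_sections[OF assms(1)], of \<sigma>] assms line_class_H by simp

lemma
  assumes f: "f \<in> Cc_H"
  shows ext_in_sections: "ext f \<in> sections"
    and ev_ext: "\<sigma> \<in> arrows \<Sigma> \<Longrightarrow> ev \<sigma> (ext f) = (if q \<sigma> \<in> H then evH \<sigma> f else 0)"
  by (rule section_on_in_sections[OF section_value_H[OF f]], assumption+)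
    (rule ev_section_on[OF section_value_H[OF f]], assumption+)

text \<open>
  The extension is continuous on the open set above \<open>H\<close>, and zero on the open set above the
  complement of its support, which is compact and therefore closed in \<open>G\<close>.
\<close>

lemma ext_in_Cc: assumes f: "f \<in> Cc_H" shows "ext f \<in> Cc_sections E"
proof -
  obtain K where "compactin (gtop (base_grpd (subtwist E H))) K"
    and zero: "\<And>\<sigma>. \<sigma> \<in> arrows (total_grpd (subtwist E H)) \<Longrightarrow> proj (subtwist E H) \<sigma> \<notin> K \<Longrightarrow> evH \<sigma> f = 0"
    using f by (rule Sub.Cc_support) (rule that)
  then have K: "compactin (gtop G) K" "K \<subseteq> H" by (auto simp: compactin_subtopology)
  have zero': "ev \<sigma> (ext f) = 0" if "\<sigma> \<in> arrows \<Sigma>" "q \<sigma> \<notin> K" for \<sigma>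
    using zero[of \<sigma>] that by (simp add: ev_ext[OF f])
  have \<Sigma>H_open: "openin (gtop \<Sigma>) \<Sigma>H" by (rule openin_preimage[OF B.subgroupoid_open[OF H]])
  have "continuous_map (gtop \<Sigma>) euclidean (\<lambda>\<sigma>. ev \<sigma> (ext f))"
  proof (rule continuous_map_locally)
    fix \<sigma> assume "\<sigma> \<in> topspace (gtop \<Sigma>)"
    then have \<sigma>: "\<sigma> \<in> arrows \<Sigma>" by simp
    show "\<exists>N. openin (gtop \<Sigma>) N \<and> \<sigma> \<in> N \<and> continuous_map (subtopology (gtop \<Sigma>) N) euclidean (\<lambda>\<sigma>. ev \<sigma>
        (ext f))"
    proof (cases "q \<sigma> \<in> H")
      case True
      have "continuous_map (subtopology (gtop \<Sigma>) \<Sigma>H) euclidean (\<lambda>\<sigma>. evH \<sigma> f)"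
        using Sub.Cc_continuous[OF f] by (simp add: preimage_arrows_def)
      then have "continuous_map (subtopology (gtop \<Sigma>) \<Sigma>H) euclidean (\<lambda>\<sigma>. ev \<sigma> (ext f))"
        by (rule continuous_map_eq) (simp add: ev_ext[OF f])
      then show ?thesis using \<Sigma>H_open \<sigma> True by blast
    next
      case False
      let ?N = "{\<sigma> \<in> arrows \<Sigma>. q \<sigma> \<in> arrows G - K}"
      have "openin (gtop G) (topspace (gtop G) - K)"
        by (rule openin_diff[OF openin_topspace B.compactin_imp_closed[OF K(1)]])
      then have "openin (gtop \<Sigma>) ?N" by (intro openin_preimage) simp
      moreover have "continuous_map (subtopology (gtop \<Sigma>) ?N) euclidean (\<lambda>\<sigma>. ev \<sigma> (ext f))"
        by (rule continuous_map_eq[of _ _ "\<lambda>_. 0"]) (auto simp: zero')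
      moreover have "\<sigma> \<in> ?N" using \<sigma> False K(2) by auto
      ultimately show ?thesis by blast
    qed
  qed
  from CcI[OF ext_in_sections[OF f] this K(1)] show ?thesis using zero' by blast
qed

lemma ext_add: assumes f: "f \<in> Cc_H" and g: "g \<in> Cc_H"
  shows "ext (section_add (subtwist E H) f g) = section_add E (ext f) (ext g)"
proof (rule section_eqI)
  note fg = Sub.section_add_in_Cc[OF f g]
  show "ext (section_add (subtwist E H) f g) \<in> sections" by (rule ext_in_sections[OF fg])
  show "section_add E (ext f) (ext g) \<in> sections" by (rule section_add_in_sections[OF ext_in_sections[OF
      f] ext_in_sections[OF g]])
  fix \<sigma> assume \<sigma>: "\<sigma> \<in> arrows \<Sigma>"
  show "ev \<sigma> (ext (section_add (subtwist E H) f g)) = ev \<sigma> (section_add E (ext f) (ext g))"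
    unfolding ev_add[OF ext_in_sections[OF f] ext_in_sections[OF g] \<sigma>] ev_ext[OF fg \<sigma>] ev_ext[OF f \<sigma>]
        ev_ext[OF g \<sigma>]
    using Sub.ev_add[OF Sub.Cc_in_sections[OF f] Sub.Cc_in_sections[OF g], of \<sigma>] \<sigma> by simp
qed

lemma ext_scale: assumes f: "f \<in> Cc_H"
  shows "ext (section_scale (subtwist E H) c f) = section_scale E c (ext f)"
proof (rule section_eqI)
  note cf = Sub.section_scale_in_Cc[OF f]
  show "ext (section_scale (subtwist E H) c f) \<in> sections" by (rule ext_in_sections[OF cf])
  show "section_scale E c (ext f) \<in> sections" by (rule section_scale_in_sections[OF ext_in_sections[OF f]])
  fix \<sigma> assume \<sigma>: "\<sigma> \<in> arrows \<Sigma>"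
  show "ev \<sigma> (ext (section_scale (subtwist E H) c f)) = ev \<sigma> (section_scale E c (ext f))"
    unfolding ev_scale[OF ext_in_sections[OF f] \<sigma>] ev_ext[OF cf \<sigma>] ev_ext[OF f \<sigma>]
    using Sub.ev_scale[OF Sub.Cc_in_sections[OF f], of \<sigma>] \<sigma> by simp
qed

lemma inv_in_H_iff: "\<sigma> \<in> arrows \<Sigma> \<Longrightarrow> q (ginv \<Sigma> \<sigma>) \<in> H \<longleftrightarrow> q \<sigma> \<in> H"
  using B.subgroupoid_inv[OF H, of "q \<sigma>"] B.subgroupoid_inv[OF H, of "ginv G (q \<sigma>)"]
  by (auto simp: proj_inv B.inv_inv)

lemma ext_star: assumes f: "f \<in> Cc_H"
  shows "ext (section_star (subtwist E H) f) = section_star E (ext f)"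
proof (rule section_eqI)
  note sf = Sub.section_star_in_Cc[OF f]
  show "ext (section_star (subtwist E H) f) \<in> sections" by (rule ext_in_sections[OF sf])
  show "section_star E (ext f) \<in> sections" by (rule section_star_in_sections[OF ext_in_sections[OF f]])
  fix \<sigma> assume \<sigma>: "\<sigma> \<in> arrows \<Sigma>"
  show "ev \<sigma> (ext (section_star (subtwist E H) f)) = ev \<sigma> (section_star E (ext f))"
    unfolding ev_star[OF ext_in_sections[OF f] \<sigma>] ev_ext[OF sf \<sigma>] ev_ext[OF f T.inv_closed[OF \<sigma>]]
    using Sub.ev_star[OF Sub.Cc_in_sections[OF f], of \<sigma>] \<sigma> by (simp add: inv_in_H_iff)
qed

lemma ext_conv: assumes f: "f \<in> Cc_H" and g: "g \<in> Cc_H"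
  shows "ext (section_conv (subtwist E H) f g) = section_conv E (ext f) (ext g)"
proof (rule section_eqI)
  note fg = Sub.section_conv_in_Cc[OF f g]
  note fin = finite_fibre_support[OF ext_in_Cc[OF g]]
  show "ext (section_conv (subtwist E H) f g) \<in> sections" by (rule ext_in_sections[OF fg])
  show "section_conv E (ext f) (ext g) \<in> sections"
    by (rule section_conv_in_sections[OF ext_in_sections[OF f] ext_in_sections[OF g] fin])
  fix \<sigma> assume \<sigma>: "\<sigma> \<in> arrows \<Sigma>"
  let ?x = "gsrc G (q \<sigma>)"
  let ?S = "fibre_support (ext g) ?x"
  have S: "\<beta> \<in> H" "\<beta> \<in> arrows G" "gsrc G \<beta> = ?x" "lift \<beta> \<in> arrows \<Sigma>" "q (lift \<beta>) = \<beta>" if "\<beta> \<in> ?S" for \<beta>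
    using that by (auto simp: fibre_support_def lift ev_ext[OF g] split: if_splits)
  have val: "ev \<sigma> (section_conv E (ext f) (ext g)) =
      (\<Sum>\<beta>\<in>?S. ev (gmul \<Sigma> \<sigma> (ginv \<Sigma> (lift \<beta>))) (ext f) * ev (lift \<beta>) (ext g))"
    by (rule ev_conv[OF ext_in_sections[OF f] ext_in_sections[OF g] fin \<sigma> fin]) (auto simp:
        fibre_support_def)
  have quot: "gmul \<Sigma> \<sigma> (ginv \<Sigma> (lift \<beta>)) \<in> arrows \<Sigma>"
      "q (gmul \<Sigma> \<sigma> (ginv \<Sigma> (lift \<beta>))) \<in> H \<longleftrightarrow> q \<sigma> \<in> H" if b: "\<beta> \<in> ?S" for \<beta>
  proof -
    let ?\<alpha> = "gmul \<Sigma> \<sigma> (ginv \<Sigma> (lift \<beta>))"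
    have src: "gsrc G (q (lift \<beta>)) = gsrc G (q \<sigma>)" using S[OF b] by simp
    show a: "?\<alpha> \<in> arrows \<Sigma>" by (rule quotient_closed[OF \<sigma> S(4)[OF b] src])
    have c: "(\<sigma>, ginv \<Sigma> (lift \<beta>)) \<in> composable \<Sigma>" by (rule quotient_composable(1)[OF \<sigma> S(4)[OF b] src])
    have c': "(?\<alpha>, lift \<beta>) \<in> composable \<Sigma>" by (rule quotient_composable(2)[OF \<sigma> S(4)[OF b] src])
    have "q \<sigma> \<in> H \<Longrightarrow> q ?\<alpha> \<in> H"
      using proj_mul[OF c] c S[OF b] B.subgroupoid_mul[OF H, of "q \<sigma>" "ginv G \<beta>"] B.subgroupoid_inv[OF
          H, of \<beta>]
      by (simp add: composable_total proj_inv)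
    moreover have "q ?\<alpha> \<in> H \<Longrightarrow> q \<sigma> \<in> H"
      using proj_mul[OF c'] c' S[OF b] quotient_mult[OF \<sigma> S(4)[OF b] src] B.subgroupoid_mul[OF H, of
          "q ?\<alpha>" \<beta>]
      by (simp add: composable_total)
    ultimately show "q ?\<alpha> \<in> H \<longleftrightarrow> q \<sigma> \<in> H" by blast
  qed
  show "ev \<sigma> (ext (section_conv (subtwist E H) f g)) = ev \<sigma> (section_conv E (ext f) (ext g))"
  proof (cases "q \<sigma> \<in> H")
    case True
    have "evH \<sigma> (section_conv (subtwist E H) f g) =
        (\<Sum>\<beta>\<in>?S. evH (gmul (total_grpd (subtwist E H)) \<sigma> (ginv (total_grpd (subtwist E H)) (Sub.lift \<beta>)))
            f * evH (Sub.lift \<beta>) g)"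
    proof (rule Sub.ev_conv[OF Sub.Cc_in_sections[OF f] Sub.Cc_in_sections[OF g]
        Sub.finite_fibre_support[OF g]])
      show "\<sigma> \<in> arrows (total_grpd (subtwist E H))" using \<sigma> True by simp
      show "finite ?S" by (rule fin)
      show "Sub.fibre_support g (gsrc (base_grpd (subtwist E H)) (proj (subtwist E H) \<sigma>)) \<subseteq> ?S"
        using B.subgroupoid_subset[OF H] by (auto simp: Sub.fibre_support_def fibre_support_def lift_H
            lift ev_ext[OF g] subset_iff)
      show "?S \<subseteq> Sub.source_fibre (gsrc (base_grpd (subtwist E H)) (proj (subtwist E H) \<sigma>))"
        using S by auto
    qed
    also have "\<dots> = (\<Sum>\<beta>\<in>?S. ev (gmul \<Sigma> \<sigma> (ginv \<Sigma> (lift \<beta>))) (ext f) * ev (lift \<beta>) (ext g))"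
      using quot True S by (intro sum.cong) (simp_all add: ev_ext[OF f] ev_ext[OF g] lift_H)
    finally show ?thesis using val True by (simp add: ev_ext[OF fg \<sigma>])
  next
    case False
    have "(\<Sum>\<beta>\<in>?S. ev (gmul \<Sigma> \<sigma> (ginv \<Sigma> (lift \<beta>))) (ext f) * ev (lift \<beta>) (ext g)) = 0"
      using quot False by (intro sum.neutral) (simp add: ev_ext[OF f])
    then show ?thesis using val False by (simp add: ev_ext[OF fg \<sigma>])
  qed
qed

definition J :: "('g, 's) line_section \<Rightarrow> 'a" where
  "J f = j (ext f)"

lemma J_add: "f \<in> Cc_H \<Longrightarrow> g \<in> Cc_H \<Longrightarrow> J f + J g = J (section_add (subtwist E H) f g)"
  and J_scale: "f \<in> Cc_H \<Longrightarrow> scaleC c (J f) = J (section_scale (subtwist E H) c f)"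
  and J_star: "f \<in> Cc_H \<Longrightarrow> star (J f) = J (section_star (subtwist E H) f)"
  and J_conv: "f \<in> Cc_H \<Longrightarrow> g \<in> Cc_H \<Longrightarrow> J f * J g = J (section_conv (subtwist E H) f g)"
  by (simp_all only: J_def ext_add ext_scale ext_star ext_conv j_add j_scale j_star j_conv ext_in_Cc)

definition subalgebra_H :: "'a set" where
  "subalgebra_H = closure (J ` Cc_H)"

lemma subalgebra_H_sequence:
  assumes "a \<in> subalgebra_H"
  obtains u where "\<And>n. u n \<in> Cc_H" "(\<lambda>n. J (u n)) \<longlonglongrightarrow> a"
proof -
  obtain v where v: "\<And>n. v n \<in> J ` Cc_H" "v \<longlonglongrightarrow> a"
    using assms unfolding subalgebra_H_def by (meson closure_sequential)
  then have "\<forall>n. \<exists>f. f \<in> Cc_H \<and> v n = J f" by blast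
  then obtain u where u: "\<And>n. u n \<in> Cc_H \<and> v n = J (u n)" by metis
  then have "v = (\<lambda>n. J (u n))" by auto
  then show thesis using that[of u] u v(2) by blast
qed

lemma subalgebra_H_limit: "(\<And>n. u n \<in> Cc_H) \<Longrightarrow> (\<lambda>n. J (u n)) \<longlonglongrightarrow> a \<Longrightarrow> a \<in> subalgebra_H"
  unfolding subalgebra_H_def closure_sequential by (intro exI[of _ "\<lambda>n. J (u n)"]) auto

lemma cstar_subalgebra_H: "cstar_subalgebra subalgebra_H"
  unfolding cstar_subalgebra_def
proof (intro conjI ballI allI)
  show "closed subalgebra_H" by (simp add: subalgebra_H_def)
  show sc: "scaleC c a \<in> subalgebra_H" if a: "a \<in> subalgebra_H" for c a
  proof -
    obtain u where u: "\<And>n. u n \<in> Cc_H" "(\<lambda>n. J (u n)) \<longlonglongrightarrow> a" using subalgebra_H_sequence[OF a] by blast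
    show ?thesis using tendsto_scaleC[OF u(2), of c]
      by (intro subalgebra_H_limit[of "\<lambda>n. section_scale (subtwist E H) c (u n)"])
        (simp_all add: u(1) Sub.section_scale_in_Cc J_scale)
  qed
  show "star a \<in> subalgebra_H" if a: "a \<in> subalgebra_H" for a
  proof -
    obtain u where u: "\<And>n. u n \<in> Cc_H" "(\<lambda>n. J (u n)) \<longlonglongrightarrow> a" using subalgebra_H_sequence[OF a] by blast
    show ?thesis using tendsto_star[OF u(2)]
      by (intro subalgebra_H_limit[of "\<lambda>n. section_star (subtwist E H) (u n)"])
        (simp_all add: u(1) Sub.section_star_in_Cc J_star)
  qed
  fix a b assume a: "a \<in> subalgebra_H" and b: "b \<in> subalgebra_H"
  obtain u where u: "\<And>n. u n \<in> Cc_H" "(\<lambda>n. J (u n)) \<longlonglongrightarrow> a" using subalgebra_H_sequence[OF a] by blast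
  obtain v where v: "\<And>n. v n \<in> Cc_H" "(\<lambda>n. J (v n)) \<longlonglongrightarrow> b" using subalgebra_H_sequence[OF b] by blast
  show "a + b \<in> subalgebra_H" using tendsto_add[OF u(2) v(2)]
    by (intro subalgebra_H_limit[of "\<lambda>n. section_add (subtwist E H) (u n) (v n)"])
      (simp_all add: u(1) v(1) Sub.section_add_in_Cc J_add)
  show "a * b \<in> subalgebra_H" using tendsto_mult[OF u(2) v(2)]
    by (intro subalgebra_H_limit[of "\<lambda>n. section_conv (subtwist E H) (u n) (v n)"])
      (simp_all add: u(1) v(1) Sub.section_conv_in_Cc J_conv)
next
  define z where "z = section_scale (subtwist E H) 0 (Sub.approximants 0 0)"
  have "z \<in> Cc_H" unfolding z_def by (intro Sub.section_scale_in_Cc Sub.approximants)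
  moreover have "J z = 0" unfolding z_def J_scale[OF Sub.approximants(1), symmetric] by simp
  ultimately show "0 \<in> subalgebra_H" using subalgebra_H_limit[of "\<lambda>_. z" 0] by simp
qed

lemma Ev_subalgebra_H:
  assumes a: "a \<in> subalgebra_H" and \<sigma>: "\<sigma> \<in> arrows \<Sigma>" "q \<sigma> \<notin> H"
  shows "Ev \<sigma> a = 0"
proof -
  obtain u where u: "\<And>n. u n \<in> Cc_H" "(\<lambda>n. J (u n)) \<longlonglongrightarrow> a" using subalgebra_H_sequence[OF a] by blast
  have "(\<lambda>n. ev \<sigma> (ext (u n))) \<longlonglongrightarrow> Ev \<sigma> a"
    using u by (intro Ev_tendsto \<sigma> ext_in_Cc) (simp_all add: J_def)
  then show ?thesis using LIMSEQ_unique[OF tendsto_const[of 0]] \<sigma> u(1) by (simp add: ev_ext)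
qed

lemma unit_functional_J:
  assumes f: "f \<in> Cc_H" and x: "x \<in> units G \<inter> H"
  shows "unit_functional x (J f) = Sub.unit_functional x (jH f)"
proof -
  have \<sigma>: "unit_arrow x \<in> arrows \<Sigma>" "q (unit_arrow x) \<in> H" using x by (auto simp: unit_arrow)
  show ?thesis
    unfolding J_def Ev_j[OF ext_in_Cc[OF f] \<sigma>(1)] ev_ext[OF f \<sigma>(1)]
    using Sub.Ev_j[OF f, of "unit_arrow x"] \<sigma> by simp
qed

lemma unit_functional_J_matrix:
  assumes k: "k \<in> Cc_H" and f: "f \<in> Cc_H" and g: "g \<in> Cc_H" and x: "x \<in> units G \<inter> H"
  shows "unit_functional x (star (J k) * (J f * J g)) = Sub.unit_functional x (star (jH k) * (jH f * jH g))"
    and "unit_functional x (star (J f) * J f) = Sub.unit_functional x (star (jH f) * jH f)"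
  using k f g x
  by (simp_all add: J_star J_conv unit_functional_J Sub.j_conv Sub.j_star Sub.section_conv_in_Cc
      Sub.section_star_in_Cc)

text \<open>
  Both norms are determined by the forms \<open>f \<mapsto> \<phi>\<^sub>x(k\<^sup>* f g)\<close> with \<open>k\<close>
  and \<open>g\<close> in the respective dense subalgebra, where \<open>x\<close> may be restricted to the units of \<open>H\<close>: at the
  other units the functionals vanish on the image.
\<close>

lemma norm_J: assumes f: "f \<in> Cc_H" shows "norm (J f) = norm (jH f)"
proof (rule antisym)
  have uH: "units (base_grpd (subtwist E H)) = units G \<inter> H" by (simp add: units_H)
  interpret PD: positive_functionals subalgebra_H "units G \<inter> H" unit_functional
    by (rule positive_functionals[OF cstar_subalgebra_H]) simp
  have in_D: "J g \<in> subalgebra_H" if "g \<in> Cc_H" for g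
    unfolding subalgebra_H_def by (rule subsetD[OF closure_subset imageI[OF that]])
  have semi: "PD.seminorm_at x (J g) = Sub.PF.seminorm_at x (jH g)" if "g \<in> Cc_H" "x \<in> units G \<inter> H" for g x
    unfolding PD.seminorm_at_def Sub.PF.seminorm_at_def
    using unit_functional_J_matrix(2)[OF that(1) that(1) that(1) that(2)] by simp
  show "norm (J f) \<le> norm (jH f)"
  proof (rule PD.norm_le_gns_bound)
    fix e assume e: "e \<in> subalgebra_H" and zero: "\<And>x. x \<in> units G \<inter> H \<Longrightarrow> unit_functional x (star e * e) = 0"
    have "star e * e \<in> subalgebra_H" using e by (intro PD.in_D)
    then have "unit_functional x (star e * e) = 0" if "x \<in> units G" for x
      using zero Ev_subalgebra_H[of _ "unit_arrow x"] that unit_arrow_closed[OF that] proj_unit_arrow[OF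
          that]
      by (cases "x \<in> H") auto
    then show "e = 0" by (rule unit_functionals_faithful)
  next
    show "PD.gns_bound (J f) (norm (jH f))"
    proof (rule PD.gns_bound_on_dense[of "J ` Cc_H"])
      show "J ` Cc_H \<subseteq> subalgebra_H" "subalgebra_H \<subseteq> closure (J ` Cc_H)"
        unfolding subalgebra_H_def by (auto intro: closure_subset[THEN subsetD])
      fix x k' g' assume x: "x \<in> units G \<inter> H" and "k' \<in> J ` Cc_H" "g' \<in> J ` Cc_H"
      then obtain k g where k: "k \<in> Cc_H" "k' = J k" and g: "g \<in> Cc_H" "g' = J g" by blast
      have x': "x \<in> units (base_grpd (subtwist E H))" using x unfolding uH .
      show "cmod (unit_functional x (star k' * (J f * g'))) \<le> norm (jH f) * PD.seminorm_at x k' *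
          PD.seminorm_at x g'"
        unfolding k(2) g(2) unit_functional_J_matrix(1)[OF k(1) f g(1) x] semi[OF k(1) x] semi[OF g(1) x]
        using Sub.PF.gns_bound_norm[OF UNIV_I, of "jH f"] x' unfolding Sub.PF.gns_bound_def by blast
    qed (rule in_D[OF f])
  qed (use in_D[OF f] in auto)
  show "norm (jH f) \<le> norm (J f)"
  proof (rule Sub.PF.norm_le_gns_bound)
    show "e = 0" if "\<And>x. x \<in> units (base_grpd (subtwist E H)) \<Longrightarrow> Sub.unit_functional x (star e * e) = 0"
        for e
      using that by (rule Sub.unit_functionals_faithful)
    show "Sub.PF.gns_bound (jH f) (norm (J f))"
    proof (rule Sub.PF.gns_bound_on_dense[of "jH ` Cc_H"])
      fix x k' g' assume "x \<in> units (base_grpd (subtwist E H))" and "k' \<in> jH ` Cc_H" "g' \<in> jH ` Cc_H"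
      then obtain k g where x: "x \<in> units G \<inter> H" and k: "k \<in> Cc_H" "k' = jH k" and g: "g \<in> Cc_H" "g' = jH g"
        unfolding uH by blast
      show "cmod (Sub.unit_functional x (star k' * (jH f * g'))) \<le> norm (J f) * Sub.PF.seminorm_at x k'
          * Sub.PF.seminorm_at x g'"
        unfolding k(2) g(2) unit_functional_J_matrix(1)[OF k(1) f g(1) x, symmetric] semi[OF k(1) x,
            symmetric] semi[OF g(1) x, symmetric]
        using PD.gns_bound_norm[OF in_D[OF f]] x in_D[OF k(1)] in_D[OF g(1)] unfolding PD.gns_bound_def
            by blast
    qed (simp_all add: Sub.j_dense)
  qed simp_all
qed

lemma dist_J: assumes f: "f \<in> Cc_H" and g: "g \<in> Cc_H" shows "dist (J f) (J g) = dist (jH f) (jH g)"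
proof -
  have "J (Sub.section_diff f g) = J f - J g"
    unfolding Sub.section_diff_def J_add[OF f Sub.section_scale_in_Cc[OF g], symmetric] J_scale[OF g,
        symmetric]
    by (simp add: scaleC_minus1)
  then show ?thesis
    using norm_J[OF Sub.section_diff_in_Cc[OF f g]] Sub.j_diff[OF f g] by (simp add: dist_norm)
qed

text \<open>Extension by zero is isometric, so the limit does not depend on the approximating sequence.\<close>

lemma canonical_embedding_eq:
  assumes u: "\<And>n. u n \<in> Cc_H" and b: "(\<lambda>n. jH (u n)) \<longlonglongrightarrow> b" and a: "(\<lambda>n. J (u n)) \<longlonglongrightarrow> a"
  shows "canonical_embedding E H j jH b = a"
  unfolding canonical_embedding_def
proof (rule the_equality)
  show "\<forall>v. (\<forall>n. v n \<in> Cc_H) \<and> (\<lambda>n. jH (v n)) \<longlonglongrightarrow> b \<longrightarrow> (\<lambda>n. j (ext (v n))) \<longlonglongrightarrow> a"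
  proof (intro allI impI, elim conjE)
    fix v assume v: "\<forall>n. v n \<in> Cc_H" "(\<lambda>n. jH (v n)) \<longlonglongrightarrow> b"
    have "(\<lambda>n. dist (jH (v n)) (jH (u n))) \<longlonglongrightarrow> dist b b" by (intro tendsto_dist v b)
    moreover have "dist (jH (v n)) (jH (u n)) = norm (J (v n) - J (u n))" for n
      using dist_J[of "v n" "u n"] v(1) u by (simp add: dist_norm)
    ultimately have "(\<lambda>n. norm (J (v n) - J (u n))) \<longlonglongrightarrow> 0" by simp
    then have "(\<lambda>n. J (v n) - J (u n)) \<longlonglongrightarrow> 0" by (rule tendsto_norm_zero_cancel)
    from tendsto_add[OF this a] show "(\<lambda>n. j (ext (v n))) \<longlonglongrightarrow> a" by (simp add: J_def)
  qed
  fix a' assume "\<forall>v. (\<forall>n. v n \<in> Cc_H) \<and> (\<lambda>n. jH (v n)) \<longlonglongrightarrow> b \<longrightarrow> (\<lambda>n. j (ext (v n))) \<longlonglongrightarrow> a'"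
  then have "(\<lambda>n. J (u n)) \<longlonglongrightarrow> a'" using u b unfolding J_def by blast
  then show "a' = a" using a by (rule LIMSEQ_unique)
qed

lemma Cauchy_transfer:
  assumes u: "\<And>n. u n \<in> Cc_H" shows "Cauchy (\<lambda>n. J (u n)) \<longleftrightarrow> Cauchy (\<lambda>n. jH (u n))"
  by (simp add: Cauchy_def dist_J u)

lemma range_canonical_embedding: "range (canonical_embedding E H j jH) = subalgebra_H"
proof (intro equalityI subsetI)
  fix a assume "a \<in> range (canonical_embedding E H j jH)"
  then obtain b where b: "a = canonical_embedding E H j jH b" by blast
  let ?u = "Sub.approximants b"
  have "Cauchy (\<lambda>n. J (?u n))"
    unfolding Cauchy_transfer[OF Sub.approximants(1)] by (rule LIMSEQ_imp_Cauchy[OF Sub.approximants(2)])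
  then obtain a' where a': "(\<lambda>n. J (?u n)) \<longlonglongrightarrow> a'" using Cauchy_convergent convergent_def by blast
  have "a = a'" unfolding b by (rule canonical_embedding_eq[OF Sub.approximants a'])
  then show "a \<in> subalgebra_H" using subalgebra_H_limit[OF Sub.approximants(1) a'] by simp
next
  fix a assume "a \<in> subalgebra_H"
  then obtain u where u: "\<And>n. u n \<in> Cc_H" "(\<lambda>n. J (u n)) \<longlonglongrightarrow> a" using subalgebra_H_sequence by blast
  have "Cauchy (\<lambda>n. jH (u n))"
    unfolding Cauchy_transfer[OF u(1), symmetric] by (rule LIMSEQ_imp_Cauchy[OF u(2)])
  then obtain b where "(\<lambda>n. jH (u n)) \<longlonglongrightarrow> b" using Cauchy_convergent convergent_def by blast
  from canonical_embedding_eq[OF u(1) this u(2)] show "a \<in> range (canonical_embedding E H j jH)" by blast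
qed

section \<open>Sections vanishing off an open subgroupoid\<close>

text \<open>
  A section \<open>F\<close> with compact support that vanishes off \<open>H\<close> need not have compact support in \<open>H\<close>. The
  cut-off factor \<open>1 - \<delta> / max \<bar>F\<bar> \<delta>\<close> changes \<open>F\<close> by at most \<open>\<delta>\<close> and leaves a section with support in
  the compact set \<open>{\<bar>F\<bar> \<ge> \<delta>}\<close>, which is contained in \<open>H\<close>.
\<close>

lemma Cc_vanishing_in_subalgebra_H:
  assumes F: "F \<in> Cc_sections E" and zero: "\<And>\<sigma>. \<sigma> \<in> arrows \<Sigma> \<Longrightarrow> q \<sigma> \<notin> H \<Longrightarrow> ev \<sigma> F = 0"
  shows "j F \<in> subalgebra_H"
proof -
  note Fs = Cc_in_sections[OF F]
  obtain K where K: "compactin (gtop G) K" "\<And>\<sigma>. \<sigma> \<in> arrows \<Sigma> \<Longrightarrow> q \<sigma> \<notin> K \<Longrightarrow> ev \<sigma> F = 0"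
    using F by (rule Cc_support) (rule that)
  obtain m where m: "0 \<le> m" "\<And>\<epsilon> f. 0 \<le> \<epsilon> \<Longrightarrow> f \<in> Cc_sections E \<Longrightarrow> \<forall>\<sigma> \<in> arrows \<Sigma>. cmod (ev \<sigma> f) \<le> \<epsilon> \<Longrightarrow>
      \<forall>\<sigma> \<in> arrows \<Sigma>. q \<sigma> \<notin> K \<longrightarrow> ev \<sigma> f = 0 \<Longrightarrow> norm (j f) \<le> m * \<epsilon>"
    using norm_le_sup_on_compact[OF K(1)] by blast
  define N where "N = (\<lambda>\<gamma>. line_norm E (F \<gamma>))"
  have N: "N (q \<sigma>) = cmod (ev \<sigma> F)" if "\<sigma> \<in> arrows \<Sigma>" for \<sigma>
    unfolding N_def by (rule line_norm_section[OF Fs that])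
  have N_cont: "continuous_map (gtop G) euclideanreal N"
    by (rule continuous_map_on_base[OF continuous_map_norm[OF Cc_continuous[OF F]]]) (simp add: N)
  have approx: "\<exists>f \<in> Cc_H. norm (J f - j F) \<le> m * \<delta>" if \<delta>: "0 < \<delta>" for \<delta>
  proof -
    define k where "k = (\<lambda>\<gamma>. complex_of_real (1 - \<delta> / max (N \<gamma>) \<delta>))"
    have "max t \<delta> \<noteq> 0" for t using \<delta> by (simp add: max_def)
    then have k_cont: "continuous_map (gtop G) euclidean k"
      unfolding k_def by (intro continuous_map_compose_on[OF N_cont, of UNIV]) (auto intro!:
          continuous_intros)
    define F' where "F' = pointwise_mult k F"
    have F': "F' \<in> Cc_sections E" unfolding F'_def by (rule pointwise_mult_in_Cc[OF F k_cont])
    have ev_F': "ev \<sigma> F' = k (q \<sigma>) * ev \<sigma> F" if "\<sigma> \<in> arrows \<Sigma>" for \<sigma>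
      unfolding F'_def by (rule ev_pointwise_mult[OF Fs that])
    have close: "cmod (ev \<sigma> F' - ev \<sigma> F) \<le> \<delta>" if \<sigma>: "\<sigma> \<in> arrows \<Sigma>" for \<sigma>
    proof -
      have "ev \<sigma> F' - ev \<sigma> F = - complex_of_real (\<delta> / max (N (q \<sigma>)) \<delta>) * ev \<sigma> F"
        by (simp add: ev_F'[OF \<sigma>] k_def algebra_simps)
      then have "cmod (ev \<sigma> F' - ev \<sigma> F) = \<delta> / max (N (q \<sigma>)) \<delta> * N (q \<sigma>)"
        using \<delta> by (simp add: norm_mult norm_divide N[OF \<sigma>] max_def)
      also have "\<dots> \<le> \<delta>"
        using \<delta> N[OF \<sigma>] by (simp add: max_def field_simps)
      finally show ?thesis .
    qed
    define L where "L = {\<gamma> \<in> topspace (gtop G). N \<gamma> \<in> {\<delta>..}}"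
    have "L \<subseteq> K \<inter> H"
    proof
      fix \<gamma> assume "\<gamma> \<in> L"
      then have g: "\<gamma> \<in> arrows G" "\<delta> \<le> N \<gamma>" by (auto simp: L_def)
      then have "ev (lift \<gamma>) F \<noteq> 0" using N[of "lift \<gamma>"] \<delta> by (auto simp: lift)
      then show "\<gamma> \<in> K \<inter> H" using K(2)[of "lift \<gamma>"] zero[of "lift \<gamma>"] g by (auto simp: lift)
    qed
    moreover have "closedin (gtop G) L"
      unfolding L_def by (rule closedin_continuous_map_preimage[OF N_cont]) simp
    ultimately have L: "compactin (gtop G) L" "L \<subseteq> H" by (auto intro: closed_compactin[OF K(1)])
    have F'_zero: "ev \<sigma> F' = 0" if "\<sigma> \<in> arrows \<Sigma>" "q \<sigma> \<notin> L" for \<sigma>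
      using that \<delta> by (auto simp: L_def ev_F' k_def max_def)
    define f where "f = Sub.section_of (\<lambda>\<sigma>. ev \<sigma> F')"
    have equi: "Sub.equivariant (\<lambda>\<sigma>. ev \<sigma> F')"
      unfolding Sub.equivariant_def act_H using ev_act[OF Cc_in_sections[OF F']] by simp
    have f: "f \<in> Cc_H"
      unfolding f_def
    proof (rule Sub.section_of_in_Cc[OF equi])
      show "continuous_map (gtop (total_grpd (subtwist E H))) euclidean (\<lambda>\<sigma>. ev \<sigma> F')"
        using Cc_continuous[OF F'] by (simp add: continuous_map_from_subtopology)
      show "compactin (gtop (base_grpd (subtwist E H))) L" using L by (simp add: compactin_subtopology)
    qed (use F'_zero in simp)
    have "ext f = F'"
    proof (rule section_eqI[OF ext_in_sections[OF f] Cc_in_sections[OF F']])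
      fix \<sigma> assume \<sigma>: "\<sigma> \<in> arrows \<Sigma>"
      show "ev \<sigma> (ext f) = ev \<sigma> F'"
        unfolding ev_ext[OF f \<sigma>] using \<sigma> F'_zero[OF \<sigma>] L(2) Sub.ev_section_of[OF equi, of \<sigma>]
        by (cases "q \<sigma> \<in> H") (auto simp: f_def)
    qed
    then have "J f - j F = j (section_diff F' F)" by (simp add: J_def j_diff[OF F' F])
    also have "norm \<dots> \<le> m * \<delta>"
      using close K(2) \<delta> by (intro m(2) section_diff_in_Cc F' F) (auto simp: ev_diff[OF F' F] ev_F')
    finally show ?thesis using f by blast
  qed
  show ?thesis
    unfolding subalgebra_H_def
  proof (rule closure_approachable[THEN iffD2], intro allI impI)
    fix e :: real assume e: "0 < e"
    have "0 < e / (m + 1)" using e m(1) by simp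
    then obtain f where f: "f \<in> Cc_H" "norm (J f - j F) \<le> m * (e / (m + 1))" using approx by blast
    have "m * (e / (m + 1)) < e" using e m(1) by (simp add: field_simps)
    then show "\<exists>y\<in>J ` Cc_H. dist y (j F) < e" using f by (auto simp: dist_norm intro!: bexI[of _ f])
  qed
qed

text \<open>
  The bound \<open>C\<close> for multiplication by \<open>h\<close> does not depend on the support of \<open>h\<close>, and it passes to the
  limit along approximants of \<open>a\<close>; the limit \<open>h a\<close> is a section with the compact support of \<open>h\<close>.
\<close>

lemma positive_type_mult_extends:
  assumes h: "h \<in> compactly_supported_functions G" "positive_type G h"
    and C: "\<And>\<gamma>. \<gamma> \<in> arrows G \<Longrightarrow> cmod (h \<gamma>) \<le> C" "0 \<le> C"
  obtains F where "F \<in> Cc_sections E" "\<And>\<sigma>. \<sigma> \<in> arrows \<Sigma> \<Longrightarrow> ev \<sigma> F = h (q \<sigma>) * Ev \<sigma> a"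
    "\<And>f. f \<in> Cc_sections E \<Longrightarrow> norm (j F - j (pointwise_mult h f)) \<le> C * norm (a - j f)"
proof -
  define K where "K = gtop G closure_of {\<gamma> \<in> arrows G. h \<gamma> \<noteq> 0}"
  have h_cont: "continuous_map (gtop G) euclidean h" and K: "compactin (gtop G) K"
    using h(1) by (auto simp: compactly_supported_functions_def K_def)
  have h0: "h (q \<sigma>) = 0" if "\<sigma> \<in> arrows \<Sigma>" "q \<sigma> \<notin> K" for \<sigma>
  proof (rule ccontr)
    assume "h (q \<sigma>) \<noteq> 0"
    then have "q \<sigma> \<in> {\<gamma> \<in> arrows G. h \<gamma> \<noteq> 0}" using proj_closed[OF that(1)] by blast
    moreover have "{\<gamma> \<in> arrows G. h \<gamma> \<noteq> 0} \<subseteq> K" unfolding K_def by (rule closure_of_subset) auto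
    ultimately show False using that(2) by blast
  qed
  obtain m where m: "0 \<le> m" "\<And>\<epsilon> f. 0 \<le> \<epsilon> \<Longrightarrow> f \<in> Cc_sections E \<Longrightarrow> \<forall>\<sigma> \<in> arrows \<Sigma>. cmod (ev \<sigma> f) \<le> \<epsilon> \<Longrightarrow>
      \<forall>\<sigma> \<in> arrows \<Sigma>. q \<sigma> \<notin> K \<longrightarrow> ev \<sigma> f = 0 \<Longrightarrow> norm (j f) \<le> m * \<epsilon>"
    using norm_le_sup_on_compact[OF K] by blast
  have equi: "equivariant (\<lambda>\<sigma>. h (q \<sigma>) * Ev \<sigma> a)"
    using equivariant_Ev[of a] by (simp add: equivariant_def)
  define F where "F = section_of (\<lambda>\<sigma>. h (q \<sigma>) * Ev \<sigma> a)"
  have F: "F \<in> Cc_sections E"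
    unfolding F_def
  proof (rule section_of_in_Cc[OF equi _ K])
    have "continuous_map (gtop \<Sigma>) euclidean (\<lambda>\<sigma>. h (q \<sigma>))"
      using continuous_map_compose[OF proj_continuous h_cont] by (simp add: o_def)
    then show "continuous_map (gtop \<Sigma>) euclidean (\<lambda>\<sigma>. h (q \<sigma>) * Ev \<sigma> a)"
      by (rule continuous_map_complex_mult[OF _ continuous_Ev])
  qed (simp add: h0)
  have ev_F: "ev \<sigma> F = h (q \<sigma>) * Ev \<sigma> a" if "\<sigma> \<in> arrows \<Sigma>" for \<sigma>
    unfolding F_def by (rule ev_section_of[OF equi that])
  have hf: "pointwise_mult h f \<in> Cc_sections E" "\<And>\<sigma>. \<sigma> \<in> arrows \<Sigma> \<Longrightarrow> ev \<sigma> (pointwise_mult h f) = h (q \<sigma>)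
      * ev \<sigma> f"
    if "f \<in> Cc_sections E" for f
    using pointwise_mult_in_Cc[OF that h_cont] ev_pointwise_mult[OF Cc_in_sections[OF that]] by auto
  \<comment> \<open>A first estimate with a factor \<open>m\<close> that depends on the support of \<open>h\<close>. It shows that \<open>j F\<close> is the\<close>
  \<comment> \<open>limit of \<open>j (h u)\<close> along approximants \<open>u\<close> of \<open>a\<close>, which removes the factor in the limit.\<close>
  have lim: "norm (j F - j (pointwise_mult h f)) \<le> m * (C * norm (j f - a))" if f: "f \<in> Cc_sections E" for f
    unfolding j_diff[OF F hf(1)[OF f], symmetric]
  proof (rule m(2)[OF _ section_diff_in_Cc[OF F hf(1)[OF f]]])
    show "0 \<le> C * norm (j f - a)" using C(2) by simp
    show "\<forall>\<sigma>\<in>arrows \<Sigma>. cmod (ev \<sigma> (section_diff F (pointwise_mult h f))) \<le> C * norm (j f - a)"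
    proof
      fix \<sigma> assume \<sigma>: "\<sigma> \<in> arrows \<Sigma>"
      have "ev \<sigma> (section_diff F (pointwise_mult h f)) = h (q \<sigma>) * (Ev \<sigma> a - ev \<sigma> f)"
        by (simp add: ev_diff[OF F hf(1)[OF f] \<sigma>] ev_F[OF \<sigma>] hf(2)[OF f \<sigma>] algebra_simps)
      also have "cmod \<dots> \<le> C * norm (j f - a)"
        unfolding norm_mult norm_minus_commute[of "Ev \<sigma> a"]
        by (intro mult_mono C Ev_close f \<sigma>) (simp_all add: \<sigma> C)
      finally show "cmod (ev \<sigma> (section_diff F (pointwise_mult h f))) \<le> C * norm (j f - a)" .
    qed
    show "\<forall>\<sigma>\<in>arrows \<Sigma>. q \<sigma> \<notin> K \<longrightarrow> ev \<sigma> (section_diff F (pointwise_mult h f)) = 0"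
      by (simp add: ev_diff[OF F hf(1)[OF f]] ev_F hf(2)[OF f] h0)
  qed
  have "norm (j F - j (pointwise_mult h f)) \<le> C * norm (a - j f)" if f: "f \<in> Cc_sections E" for f
  proof (rule LIMSEQ_le_const)
    let ?u = "approximants a"
    show "(\<lambda>n. m * (C * norm (j (?u n) - a)) + C * norm (j (?u n) - j f)) \<longlonglongrightarrow> C * norm (a - j f)"
    proof -
      have "(\<lambda>n. m * (C * norm (j (?u n) - a)) + C * norm (j (?u n) - j f)) \<longlonglongrightarrow> m * (C * norm (a - a)) + C
          * norm (a - j f)"
        by (intro tendsto_intros approximants)
      then show ?thesis by simp
    qed
    have "norm (j F - j (pointwise_mult h f)) \<le> m * (C * norm (j (?u n) - a)) + C * norm (j (?u n) - j
        f)" for n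
    proof -
      have d: "section_diff (?u n) f \<in> Cc_sections E" by (rule section_diff_in_Cc[OF approximants(1) f])
      have "section_diff (pointwise_mult h (?u n)) (pointwise_mult h f) = pointwise_mult h (section_diff
          (?u n) f)"
        by (rule section_eqI[OF Cc_in_sections[OF section_diff_in_Cc[OF hf(1)[OF approximants(1)]
            hf(1)[OF f]]]
              Cc_in_sections[OF hf(1)[OF d]]])
          (simp add: ev_diff[OF hf(1)[OF approximants(1)] hf(1)[OF f]] hf(2)[OF approximants(1)]
              hf(2)[OF f] hf(2)[OF d]
            ev_diff[OF approximants(1) f] algebra_simps)
      then have "j (pointwise_mult h (?u n)) - j (pointwise_mult h f) = j (pointwise_mult h
          (section_diff (?u n) f))"
        using j_diff[OF hf(1)[OF approximants(1)] hf(1)[OF f], of a n] by simp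
      also have "norm \<dots> \<le> C * norm (j (section_diff (?u n) f))"
        by (rule norm_positive_type_mult[OF d h_cont h(2) C])
      finally have "norm (j (pointwise_mult h (?u n)) - j (pointwise_mult h f)) \<le> C * norm (j (?u n) - j f)"
        by (simp add: j_diff[OF approximants(1) f])
      moreover have "norm (j F - j (pointwise_mult h f)) \<le>
          norm (j F - j (pointwise_mult h (?u n))) + norm (j (pointwise_mult h (?u n)) - j
              (pointwise_mult h f))"
        using norm_triangle_ineq[of "j F - j (pointwise_mult h (?u n))"
            "j (pointwise_mult h (?u n)) - j (pointwise_mult h f)"] by simp
      ultimately show ?thesis using lim[OF approximants(1), of a n] by linarith
    qed
    then show "\<exists>N. \<forall>n\<ge>N. norm (j F - j (pointwise_mult h f)) \<le> m * (C * norm (j (?u n) - a)) + C * norm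
        (j (?u n) - j f)"
      by blast
  qed
  then show thesis using that F ev_F by blast
qed

text \<open>
  With functions of positive type that converge to \<open>1\<close> uniformly on the compact support of an
  approximant \<open>f\<close> of \<open>a\<close>, the products \<open>h a\<close> are compactly supported sections that vanish wherever
  \<open>a\<close> does, and they are close to \<open>h f\<close>, to \<open>f\<close> and to \<open>a\<close>.
\<close>

lemma vanishing_in_subalgebra_H:
  assumes "amenable G" and a: "\<And>\<sigma>. \<sigma> \<in> arrows \<Sigma> \<Longrightarrow> q \<sigma> \<notin> H \<Longrightarrow> Ev \<sigma> a = 0"
  shows "a \<in> subalgebra_H"
proof -
  obtain \<F> :: "('g \<Rightarrow> complex) filter" and C where \<F>: "\<F> \<noteq> bot"
      "\<forall>\<^sub>F h in \<F>. h \<in> compactly_supported_functions G \<and> positive_type G h \<and> (\<forall>\<gamma> \<in> arrows G. cmod (h \<gamma>)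
          \<le> C)"
    and unif: "\<And>K. compactin (gtop G) K \<Longrightarrow> uniform_limit K (\<lambda>h. h) (\<lambda>_. 1) \<F>"
    using assms(1) unfolding amenable_def by blast
  have approx: "\<exists>b \<in> subalgebra_H. dist b a < e" if e: "0 < e" for e
  proof -
    define C' where "C' = max C 0"
    define \<eta> where "\<eta> = e / (2 * (C' + 2))"
    have C': "0 \<le> C'" "C \<le> C'" by (auto simp: C'_def)
    have \<eta>: "0 < \<eta>" using e C' by (simp add: \<eta>_def)
    obtain f where f: "f \<in> Cc_sections E" "norm (j f - a) < \<eta>" using ex_approximant[OF \<eta>] by blast
    note fs = Cc_in_sections[OF f(1)]
    obtain K where K: "compactin (gtop G) K" "\<And>\<sigma>. \<sigma> \<in> arrows \<Sigma> \<Longrightarrow> q \<sigma> \<notin> K \<Longrightarrow> ev \<sigma> f = 0"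
      using f(1) by (rule Cc_support) (rule that)
    obtain m where m: "0 \<le> m" "\<And>\<epsilon> f. 0 \<le> \<epsilon> \<Longrightarrow> f \<in> Cc_sections E \<Longrightarrow> \<forall>\<sigma> \<in> arrows \<Sigma>. cmod (ev \<sigma> f) \<le> \<epsilon> \<Longrightarrow>
        \<forall>\<sigma> \<in> arrows \<Sigma>. q \<sigma> \<notin> K \<longrightarrow> ev \<sigma> f = 0 \<Longrightarrow> norm (j f) \<le> m * \<epsilon>"
      using norm_le_sup_on_compact[OF K(1)] by blast
    \<comment> \<open>The closeness of \<open>h\<close> to \<open>1\<close> on \<open>K\<close> that makes \<open>h f\<close> closer to \<open>f\<close> than \<open>\<eta>\<close>.\<close>
    define \<delta> where "\<delta> = \<eta> / ((m + 1) * (norm (j f) + 1))"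
    have pos: "0 < (m + 1) * (norm (j f) + 1)" using m(1) by (intro mult_pos_pos add_nonneg_pos) auto
    have \<delta>: "0 < \<delta>" unfolding \<delta>_def by (rule divide_pos_pos[OF \<eta> pos])
    have "\<forall>\<^sub>F h in \<F>. \<forall>\<gamma> \<in> K. dist (h \<gamma>) 1 < \<delta>" using uniform_limitD[OF unif[OF K(1)] \<delta>] .
    with \<F>(2) have "\<forall>\<^sub>F h in \<F>. (h \<in> compactly_supported_functions G \<and> positive_type G h \<and> (\<forall>\<gamma> \<in> arrows
        G. cmod (h \<gamma>) \<le> C)) \<and>
        (\<forall>\<gamma> \<in> K. dist (h \<gamma>) 1 < \<delta>)" by (rule eventually_conj)
    then obtain h where h: "h \<in> compactly_supported_functions G" "positive_type G h"
        "\<And>\<gamma>. \<gamma> \<in> arrows G \<Longrightarrow> cmod (h \<gamma>) \<le> C" and h1: "\<And>\<gamma>. \<gamma> \<in> K \<Longrightarrow> dist (h \<gamma>) 1 < \<delta>"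
      using eventually_happens'[OF \<F>(1)] by blast
    have h_le: "\<And>\<gamma>. \<gamma> \<in> arrows G \<Longrightarrow> cmod (h \<gamma>) \<le> C'" using h(3) C'(2) by (rule order_trans)
    have h_cont: "continuous_map (gtop G) euclidean h" using h(1) by (simp add:
        compactly_supported_functions_def)
    obtain F where F: "F \<in> Cc_sections E" "\<And>\<sigma>. \<sigma> \<in> arrows \<Sigma> \<Longrightarrow> ev \<sigma> F = h (q \<sigma>) * Ev \<sigma> a"
      "\<And>f. f \<in> Cc_sections E \<Longrightarrow> norm (j F - j (pointwise_mult h f)) \<le> C' * norm (a - j f)"
      using positive_type_mult_extends[OF h(1,2) h_le C'(1)] by blast
    have "j F \<in> subalgebra_H" by (rule Cc_vanishing_in_subalgebra_H[OF F(1)]) (simp add: F(2) a)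
    moreover have "dist (j F) a < e"
    proof -
      have hf: "pointwise_mult h f \<in> Cc_sections E" by (rule pointwise_mult_in_Cc[OF f(1) h_cont])
      have "norm (j (pointwise_mult h f) - j f) \<le> m * (\<delta> * norm (j f))"
        unfolding j_diff[OF hf f(1), symmetric]
      proof (rule m(2)[OF _ section_diff_in_Cc[OF hf f(1)]])
        show "0 \<le> \<delta> * norm (j f)" using \<delta> by simp
        have ev_d: "ev \<sigma> (section_diff (pointwise_mult h f) f) = (h (q \<sigma>) - 1) * ev \<sigma> f" if
            "\<sigma> \<in> arrows \<Sigma>" for \<sigma>
          by (simp add: ev_diff[OF hf f(1) that] ev_pointwise_mult[OF fs that] algebra_simps)
        show "\<forall>\<sigma>\<in>arrows \<Sigma>. cmod (ev \<sigma> (section_diff (pointwise_mult h f) f)) \<le> \<delta> * norm (j f)"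
        proof
          fix \<sigma> assume \<sigma>: "\<sigma> \<in> arrows \<Sigma>"
          show "cmod (ev \<sigma> (section_diff (pointwise_mult h f) f)) \<le> \<delta> * norm (j f)"
          proof (cases "q \<sigma> \<in> K")
            case True
            show ?thesis unfolding ev_d[OF \<sigma>] norm_mult
              using h1[OF True] \<delta> by (intro mult_mono cmod_ev_le_norm f(1) \<sigma>) (simp_all add: dist_norm)
          next
            case False
            then show ?thesis using K(2)[OF \<sigma>] \<delta> by (simp add: ev_d[OF \<sigma>])
          qed
        qed
        show "\<forall>\<sigma>\<in>arrows \<Sigma>. q \<sigma> \<notin> K \<longrightarrow> ev \<sigma> (section_diff (pointwise_mult h f) f) = 0"
          using K(2) by (simp add: ev_d)
      qed
      also have "m * (\<delta> * norm (j f)) \<le> (m + 1) * (\<delta> * (norm (j f) + 1))"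
        using m(1) \<delta> by (intro mult_mono) auto
      also have "\<dots> = \<eta>" using pos by (simp add: \<delta>_def field_simps)
      finally have 1: "norm (j (pointwise_mult h f) - j f) \<le> \<eta>" .
      have "C' * norm (a - j f) \<le> C' * \<eta>"
        using f(2) C'(1) by (intro mult_left_mono) (simp_all add: norm_minus_commute)
      then have 2: "norm (j F - j (pointwise_mult h f)) \<le> C' * \<eta>" using F(3)[OF f(1)] by linarith
      have "dist (j F) a \<le> dist (j F) (j (pointwise_mult h f)) + dist (j (pointwise_mult h f)) (j f) +
          dist (j f) a"
        using dist_triangle[of "j F" a "j f"] dist_triangle[of "j F" "j f" "j (pointwise_mult h f)"] by
            linarith
      also have "\<dots> \<le> C' * \<eta> + \<eta> + \<eta>"
        using 1 2 f(2) by (simp add: dist_norm)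
      also have "\<dots> = (C' + 2) * \<eta>" by (simp add: algebra_simps)
      also have "\<dots> = e / 2" using C'(1) by (simp add: \<eta>_def field_simps)
      finally show ?thesis using e by simp
    qed
    ultimately show ?thesis by blast
  qed
  then have "a \<in> closure subalgebra_H" by (simp add: closure_approachable)
  then show ?thesis by (simp add: subalgebra_H_def)
qed

end

theorem theorem4p2:
  fixes E :: "('g, 's) twist_data"
    and H :: "'g set"
    and j :: "('g, 's) line_section \<Rightarrow> 'a::cstar_algebra"
    and jH :: "('g, 's) line_section \<Rightarrow> 'b::cstar_algebra"
  assumes "twist E"
    and "amenable (base_grpd E)"
    and "open_subgroupoid (base_grpd E) H"
    and "reduced_completion E j"
    and "reduced_completion (subtwist E H) jH"
  shows "{f :: 'a. \<forall>\<sigma> \<in> arrows (total_grpd E) - preimage_arrows E H. completion_eval E j \<sigma> f = 0}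
       = range (canonical_embedding E H j jH)"
proof -
  interpret reduced_subtwist E j H jH
    using assms by (simp add: reduced_subtwist_def reduced_subtwist_axioms_def reduced_twist_def
        reduced_twist_axioms_def)
  show ?thesis
    unfolding range_canonical_embedding
  proof (intro equalityI subsetI)
    fix a :: 'a
    assume "a \<in> {f. \<forall>\<sigma> \<in> arrows (total_grpd E) - preimage_arrows E H. completion_eval E j \<sigma> f = 0}"
    then show "a \<in> subalgebra_H"
      by (intro vanishing_in_subalgebra_H[OF assms(2)]) (auto simp: preimage_arrows_def completion_eval_eq)
  next
    fix a :: 'a assume "a \<in> subalgebra_H"
    then show "a \<in> {f. \<forall>\<sigma> \<in> arrows (total_grpd E) - preimage_arrows E H. completion_eval E j \<sigma> f = 0}"
      by (auto simp: preimage_arrows_def completion_eval_eq Ev_subalgebra_H)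
  qed
qed

end
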